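(* Let $N>2$ and let $\Omega$ be a bounded domain in $\mathbb{R}^N$ with $C^{2,\gamma}$ boundary for some $\gamma\in(0,1)$. Let $\alpha\in\left(1,\frac{N}{N-2}\right)$ and $2^*=\frac{2N}{N-2}$. For $k=0,1,2,\dots$ define $$a_k=\frac{2N}{N-2}-2\left(\frac{N}{N-2}-\alpha\right)\left(\frac N2\right)^k,\qquad b_k=\frac{1-\left(\frac2N\right)^k}{1-\frac2N}.$$ Then $$\int_\Omega|\nabla u|^{2\alpha}\,dx\le\left(\left((2\alpha-2)c+1\right)c_\Omega\right)^{b_k}\left(\|\Delta u\|_{2^*}\right)^{b_k}\left(\|\nabla u\|_2\right)^{b_k}\left(\int_\Omega|\nabla u|^{a_k}\,dx\right)^{\left(\frac2N\right)^k}$$ for every $k\in\{0,1,2,\dots\}$ with $a_k\ge0$ and every $u\in W^{2,2^*}(\Omega)$ with $\nabla u\cdot\nu=0$ on $\partial\Omega$, where $\nu$ is the unit outward normal to $\partial\Omega$, $c$ is the constant in the Calderón–Zygmund inequality stated in the context, and $c_\Omega$ is the constant in the Sobolev inequality stated in the context.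
   Context: $\|\cdot\|_p$ denotes the norm in $L^p(\Omega)$, and $u_\Omega=\frac{1}{|\Omega|}\int_\Omega u\,dx$, where $|\Omega|$ is the Lebesgue measure of $\Omega$. The constant $c_\Omega$ is that of the Sobolev inequality $\|u-u_\Omega\|_{2^*}\le c_\Omega\|\nabla u\|_2$ for all $u\in W^{1,2}(\Omega)$. The constant $c$ is that of the Calderón–Zygmund inequality, which the paper states as follows: if $u$ is a weak solution of the Neumann boundary value problem $-\Delta u=g$ in $\Omega$, $\nabla u\cdot\nu=0$ on $\partial\Omega$, then for each $p>1$ there is a positive constant $c$ depending only on $N$, $p$, $\Omega$ and the smoothness of the boundary such that $\|u\|_{W^{2,p}(\Omega)}\equiv\|\nabla^2u\|_p+\|\nabla u\|_p+\|u\|_p\le c\|g\|_p=c\|\Delta u\|_p$. In the proposition this constant is taken with $p=2^*$.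
   Formalization: The Calderón–Zygmund inequality defining c is required only for weak solutions u with mean value zero, since as printed it fails for nonzero constant u (with g = 0); the estimate itself is proved for all u as stated. *)

theory Defs
  imports "HOL-Analysis.Analysis"
begin

text \<open>Real powers with the convention \<open>0\<^sup>0 = 1\<close>; the library has \<open>0 powr 0 = 0\<close>.\<close>

definition rpow :: "real \<Rightarrow> real \<Rightarrow> real" where
  "rpow x a = (if a = 0 then 1 else x powr a)"


section \<open>Smooth functions on the whole space\<close>

definition pd :: "'n \<Rightarrow> (real^'n \<Rightarrow> real) \<Rightarrow> real^'n \<Rightarrow> real" where
  "pd i f x = frechet_derivative f (at x) (axis i 1)"

primrec Ck :: "nat \<Rightarrow> (real^'n \<Rightarrow> real) \<Rightarrow> bool" where
  "Ck 0 f \<longleftrightarrow> continuous_on UNIV f"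
| "Ck (Suc k) f \<longleftrightarrow> (\<forall>x. f differentiable at x) \<and> (\<forall>i. Ck k (pd i f))"

definition smooth :: "(real^'n \<Rightarrow> real) \<Rightarrow> bool" where
  "smooth f \<longleftrightarrow> (\<forall>k. Ck k f)"

definition test_function :: "(real^'n) set \<Rightarrow> (real^'n \<Rightarrow> real) \<Rightarrow> bool" where
  "test_function \<Omega> \<phi> \<longleftrightarrow> smooth \<phi> \<and> (\<exists>K. compact K \<and> K \<subseteq> \<Omega> \<and> (\<forall>x. x \<notin> K \<longrightarrow> \<phi> x = 0))"

definition C2_holder :: "real \<Rightarrow> (real^'n \<Rightarrow> real) \<Rightarrow> bool" where
  "C2_holder \<gamma> h \<longleftrightarrow> Ck 2 h \<and>
     (\<forall>i j. \<exists>L. \<forall>x y. \<bar>pd j (pd i h) x - pd j (pd i h) y\<bar> \<le> L * dist x y powr \<gamma>)"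


section \<open>Lebesgue and Sobolev spaces\<close>

definition Lp :: "'a measure \<Rightarrow> real \<Rightarrow> ('a \<Rightarrow> 'b::euclidean_space) set" where
  "Lp M p = {f. f \<in> borel_measurable M \<and> integrable M (\<lambda>x. norm (f x) powr p)}"

definition Lp_norm :: "'a measure \<Rightarrow> real \<Rightarrow> ('a \<Rightarrow> 'b::euclidean_space) \<Rightarrow> real" where
  "Lp_norm M p f = (\<integral>x. norm (f x) powr p \<partial>M) powr (1 / p)"

definition weak_partial :: "(real^'n) set \<Rightarrow> 'n \<Rightarrow> (real^'n \<Rightarrow> real) \<Rightarrow> (real^'n \<Rightarrow> real) \<Rightarrow> bool" where
  "weak_partial \<Omega> i f g \<longleftrightarrow>
     (\<forall>K. compact K \<and> K \<subseteq> \<Omega> \<longrightarrow> f absolutely_integrable_on K \<and> g absolutely_integrable_on K) \<and>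
     (\<forall>\<phi>. test_function \<Omega> \<phi> \<longrightarrow>
        (\<integral>x. f x * pd i \<phi> x \<partial>lebesgue_on \<Omega>) = - (\<integral>x. g x * \<phi> x \<partial>lebesgue_on \<Omega>))"

fun sobolev :: "nat \<Rightarrow> real \<Rightarrow> (real^'n) set \<Rightarrow> (real^'n \<Rightarrow> real) set" where
  "sobolev 0 p \<Omega> = Lp (lebesgue_on \<Omega>) p"
| "sobolev (Suc k) p \<Omega> =
     {u \<in> Lp (lebesgue_on \<Omega>) p. \<forall>i. \<exists>g \<in> sobolev k p \<Omega>. weak_partial \<Omega> i u g}"

text \<open>A weak derivative is determined only up to a null set; the operators below choose one
  representative. Everything that follows depends on them only through integrals.\<close>

definition wpd :: "(real^'n) set \<Rightarrow> 'n \<Rightarrow> (real^'n \<Rightarrow> real) \<Rightarrow> real^'n \<Rightarrow> real" where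
  "wpd \<Omega> i u = (SOME g. weak_partial \<Omega> i u g)"

definition wgrad :: "(real^'n) set \<Rightarrow> (real^'n \<Rightarrow> real) \<Rightarrow> real^'n \<Rightarrow> real^'n" where
  "wgrad \<Omega> u x = (\<chi> i. wpd \<Omega> i u x)"

definition whess :: "(real^'n) set \<Rightarrow> (real^'n \<Rightarrow> real) \<Rightarrow> real^'n \<Rightarrow> real^'n^'n" where
  "whess \<Omega> u x = (\<chi> i j. wpd \<Omega> j (wpd \<Omega> i u) x)"

definition wlap :: "(real^'n) set \<Rightarrow> (real^'n \<Rightarrow> real) \<Rightarrow> real^'n \<Rightarrow> real" where
  "wlap \<Omega> u x = (\<Sum>i\<in>UNIV. wpd \<Omega> i (wpd \<Omega> i u) x)"

definition W1_norm :: "(real^'n) set \<Rightarrow> real \<Rightarrow> (real^'n \<Rightarrow> real) \<Rightarrow> real" where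
  "W1_norm \<Omega> p u = Lp_norm (lebesgue_on \<Omega>) p (wgrad \<Omega> u) + Lp_norm (lebesgue_on \<Omega>) p u"

text \<open>The norm on \<open>real^'n^'n\<close> is the Frobenius norm.\<close>

definition W2_norm :: "(real^'n) set \<Rightarrow> real \<Rightarrow> (real^'n \<Rightarrow> real) \<Rightarrow> real" where
  "W2_norm \<Omega> p u = Lp_norm (lebesgue_on \<Omega>) p (whess \<Omega> u)
     + Lp_norm (lebesgue_on \<Omega>) p (wgrad \<Omega> u) + Lp_norm (lebesgue_on \<Omega>) p u"

definition average :: "(real^'n) set \<Rightarrow> (real^'n \<Rightarrow> real) \<Rightarrow> real" where
  "average \<Omega> u = (\<integral>x. u x \<partial>lebesgue_on \<Omega>) / measure lebesgue \<Omega>"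


section \<open>Boundary regularity, normal and surface measure\<close>

text \<open>Near each boundary point, \<open>\<Omega>\<close> is the part above the graph of a \<open>C\<^bsup>2,\<gamma>\<^esup>\<close> function over
  the hyperplane orthogonal to some unit vector \<open>e\<close>. A function on that hyperplane is represented
  by a function on the whole space which is only evaluated at \<open>x - (x \<bullet> e) e\<close>.\<close>

definition C2_holder_boundary :: "real \<Rightarrow> (real^'n) set \<Rightarrow> bool" where
  "C2_holder_boundary \<gamma> \<Omega> \<longleftrightarrow>
     (\<forall>x0 \<in> frontier \<Omega>. \<exists>r>0. \<exists>e h. norm e = 1 \<and> C2_holder \<gamma> h \<and>
        \<Omega> \<inter> ball x0 r = {x \<in> ball x0 r. h (x - (x \<bullet> e) *\<^sub>R e) < x \<bullet> e})"

text \<open>The unit vector \<open>n\<close> at a boundary point such that directions with negative \<open>n\<close>-component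
  enter \<open>\<Omega>\<close> and directions with positive \<open>n\<close>-component leave its closure. It is unique when it
  exists, and it exists at every boundary point of a \<open>C\<^sup>1\<close> domain.\<close>

definition is_outer_normal :: "(real^'n) set \<Rightarrow> real^'n \<Rightarrow> real^'n \<Rightarrow> bool" where
  "is_outer_normal \<Omega> x n \<longleftrightarrow> norm n = 1 \<and>
     (\<forall>v. v \<bullet> n < 0 \<longrightarrow> (\<forall>\<^sub>F t in at_right 0. x + t *\<^sub>R v \<in> \<Omega>)) \<and>
     (\<forall>v. v \<bullet> n > 0 \<longrightarrow> (\<forall>\<^sub>F t in at_right 0. x + t *\<^sub>R v \<notin> closure \<Omega>))"

definition outer_normal :: "(real^'n) set \<Rightarrow> real^'n \<Rightarrow> real^'n" where
  "outer_normal \<Omega> x = (THE n. is_outer_normal \<Omega> x n)"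

text \<open>The \<open>s\<close>-dimensional Hausdorff measure, for \<open>s > 0\<close>, normalised to agree with Lebesgue
  measure for integer \<open>s\<close>, on its Caratheodory measurable sets (which include the Borel sets).
  Boundedness of the covering sets is required because \<^const>\<open>diameter\<close> is meaningful only for
  bounded sets.\<close>

definition hausdorff_outer :: "real \<Rightarrow> 'a::euclidean_space set \<Rightarrow> ennreal" where
  "hausdorff_outer s A = (SUP \<delta>\<in>{0<..}.
     INF C\<in>{C :: nat \<Rightarrow> 'a set. A \<subseteq> (\<Union>n. C n) \<and> (\<forall>n. bounded (C n) \<and> diameter (C n) \<le> \<delta>)}.
       (\<Sum>n. ennreal (unit_ball_vol s * (diameter (C n) / 2) powr s)))"

definition hausdorff_measure :: "real \<Rightarrow> 'a::euclidean_space measure" where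
  "hausdorff_measure s =
     measure_of UNIV (lambda_system UNIV UNIV (hausdorff_outer s)) (hausdorff_outer s)"

definition surface_measure :: "(real^'n) set \<Rightarrow> (real^'n) measure" where
  "surface_measure \<Omega> = restrict_space (hausdorff_measure (real CARD('n) - 1)) (frontier \<Omega>)"


section \<open>Traces and the Neumann condition\<close>

text \<open>\<open>g\<close> is the trace on the boundary of \<open>f \<in> W\<^bsup>1,p\<^esup>(\<Omega>)\<close>: the trace operator is the continuous
  extension to \<open>W\<^bsup>1,p\<^esup>(\<Omega>)\<close> of the restriction of functions smooth up to the boundary.\<close>

definition has_trace :: "(real^'n) set \<Rightarrow> real \<Rightarrow> (real^'n \<Rightarrow> real) \<Rightarrow> (real^'n \<Rightarrow> real) \<Rightarrow> bool" where
  "has_trace \<Omega> p f g \<longleftrightarrow> f \<in> sobolev 1 p \<Omega> \<and> g \<in> Lp (surface_measure \<Omega>) p \<and>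
     (\<exists>\<phi>. (\<forall>n. smooth (\<phi> n)) \<and>
        (\<lambda>n::nat. W1_norm \<Omega> p (\<lambda>x. \<phi> n x - f x)) \<longlonglongrightarrow> 0 \<and>
        (\<lambda>n::nat. Lp_norm (surface_measure \<Omega>) p (\<lambda>x. \<phi> n x - g x)) \<longlonglongrightarrow> 0)"

definition neumann_condition :: "(real^'n) set \<Rightarrow> real \<Rightarrow> (real^'n \<Rightarrow> real) \<Rightarrow> bool" where
  "neumann_condition \<Omega> p u \<longleftrightarrow>
     (\<exists>T :: real^'n \<Rightarrow> real^'n. (\<forall>i. has_trace \<Omega> p (wpd \<Omega> i u) (\<lambda>x. T x $ i)) \<and>
        (AE x in surface_measure \<Omega>. T x \<bullet> outer_normal \<Omega> x = 0))"

text \<open>Weak solutions of \<open>-\<Delta>u = g\<close> in \<open>\<Omega>\<close>, \<open>\<nabla>u \<cdot> \<nu> = 0\<close> on the boundary.\<close>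

definition weak_neumann_solution :: "(real^'n) set \<Rightarrow> (real^'n \<Rightarrow> real) \<Rightarrow> (real^'n \<Rightarrow> real) \<Rightarrow> bool" where
  "weak_neumann_solution \<Omega> g u \<longleftrightarrow> u \<in> sobolev 1 2 \<Omega> \<and>
     (\<forall>\<phi> \<in> sobolev 1 2 \<Omega>.
        (\<integral>x. wgrad \<Omega> u x \<bullet> wgrad \<Omega> \<phi> x \<partial>lebesgue_on \<Omega>) = (\<integral>x. g x * \<phi> x \<partial>lebesgue_on \<Omega>))"


section \<open>The two constants\<close>

definition sobolev_constant :: "(real^'n) set \<Rightarrow> real \<Rightarrow> real \<Rightarrow> bool" where
  "sobolev_constant \<Omega> q C \<longleftrightarrow>
     (\<forall>u \<in> sobolev 1 2 \<Omega>. u \<in> Lp (lebesgue_on \<Omega>) q \<and>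
        Lp_norm (lebesgue_on \<Omega>) q (\<lambda>x. u x - average \<Omega> u) \<le> C * Lp_norm (lebesgue_on \<Omega>) 2 (wgrad \<Omega> u))"

text \<open>Solutions of the Neumann problem are unique only up to additive constants, and for a nonzero
  constant \<open>u\<close> (with \<open>g = 0\<close>) the estimate fails. It is therefore required of the solutions with
  mean value zero only. Used for \<open>p \<ge> 2\<close>, so that the right-hand side \<open>g\<close> is square integrable.\<close>

definition calderon_zygmund_constant :: "(real^'n) set \<Rightarrow> real \<Rightarrow> real \<Rightarrow> bool" where
  "calderon_zygmund_constant \<Omega> p c \<longleftrightarrow> 0 < c \<and>
     (\<forall>g u. g \<in> Lp (lebesgue_on \<Omega>) p \<and> weak_neumann_solution \<Omega> g u \<and> average \<Omega> u = 0 \<longrightarrow>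
        u \<in> sobolev 2 p \<Omega> \<and> W2_norm \<Omega> p u \<le> c * Lp_norm (lebesgue_on \<Omega>) p g)"

end

theory Submission
  imports Defs
begin

text \<open>
  Write \<open>p = 2N/(N-2)\<close>, \<open>G = \<nabla>u\<close>, \<open>v\<close> for \<open>u\<close> minus its mean value and \<open>I(s)\<close> for the integral of
  \<open>|G|^s\<close>. Everything follows from one inequality, for \<open>2 \<le> s \<le> 2\<alpha>\<close>:

  \<open>I(s) \<le> ((s-2) c + 1) c_\<Omega> \<parallel>\<Delta>u\<parallel>_p \<parallel>\<nabla>u\<parallel>_2 I((s-2)N/2)^(2/N)\<close>.

  It holds because \<open>v\<close> has gradient \<open>G\<close> and the field \<open>|G|^(s-2) G\<close> has no normal component on the
  boundary, so that integration by parts bounds \<open>I(s)\<close> by the integral of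
  \<open>|v| |G|^(s-2) ((s-2)|D\<^sup>2u| + |\<Delta>u|)\<close>; Hoelder's inequality with exponents \<open>p\<close>, \<open>p\<close> and \<open>N/2\<close>
  separates the factors, the Sobolev inequality bounds \<open>v\<close> and the Calderon-Zygmund inequality
  bounds \<open>D\<^sup>2u\<close>. Since \<open>(a\<^sub>k - 2)N/2 = a\<close> at \<open>k+1\<close> and \<open>b\<close> at \<open>k+1\<close> is \<open>b\<^sub>k + (2/N)^k\<close>, iterating the
  inequality from \<open>s = a\<^sub>0 = 2\<alpha>\<close> gives the claim; that \<open>a\<close> is nonnegative at the next index says
  exactly that \<open>s = a\<^sub>k\<close> is at least 2. The one-step inequality is \<open>gradient_power_bound\<close>
  combined with \<open>calderon_zygmund_hessian_bound\<close>.

  The analytic core is the integration by parts, \<open>flux_div_integral_zero\<close>. It is needed twice: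
  with a power weight, as above, and with weight 1 against arbitrary test functions in \<open>W^(1,2)\<close>,
  where it says that \<open>v\<close> solves the weak Neumann problem with right-hand side \<open>-\<Delta>u\<close>, so that the
  Calderon-Zygmund inequality applies. No surface integral and no trace of \<open>v\<close> enter. Multiplying
  by a cutoff that vanishes near the boundary turns the claim into the definition of the weak
  derivative of \<open>v\<close> (\<open>interior_identity\<close>). When the cutoff layer has width \<open>\<epsilon>\<close>, the error is at most
  a multiple of the integral of \<open>|v| |G \<cdot> \<nabla>H| / \<epsilon>\<close> over the layer, where \<open>H\<close> is a local defining
  function of the domain. The normal component \<open>G \<cdot> \<nabla>H\<close> has trace zero, and a Hardy-type
  estimate (\<open>strip_estimate\<close>) bounds the integral of \<open>(G \<cdot> \<nabla>H)\<^sup>2 / \<epsilon>\<^sup>2\<close> over the layer by that of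
  \<open>|D\<^sup>2u|\<^sup>2\<close> over a comparable layer, which tends to 0.

  The Hardy estimate is proved for the smooth fields that define the trace, by integrating along
  the lines transversal to the boundary, and it survives the limit because the boundary values
  converge in the surface measure. What this requires of the Hausdorff measure are two one-sided
  bounds with unspecified constants: a layer over a boundary set has Lebesgue measure at most a
  multiple of the Hausdorff measure of the set (\<open>content_le_hausdorff_outer\<close>), and the boundary has
  finite measure (\<open>hausdorff_frontier_finite\<close>); and that Borel sets are measurable
  (\<open>borel_subset_hausdorff\<close>). Finiteness and measurability matter because the norms in the
  definition of a trace are integrals, which have the value 0 when the integrand is not integrable.

  Weak derivatives are defined by smooth test functions, while the cutoffs above are only of
  class \<open>C\<^sup>1\<close>; mollification (\<open>weak_partial_C1\<close>) closes this gap, and also shows that weak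
  derivatives are unique almost everywhere (\<open>weak_partial_AE_unique\<close>).
\<close>

section \<open>Continuously differentiable functions and smooth functions\<close>

text \<open>A function together with its gradient: in this relational form the calculus rules compute the
  gradient of a compound expression by resolution.\<close>

definition has_C1_gradient :: "(real^'n \<Rightarrow> real) \<Rightarrow> (real^'n \<Rightarrow> real^'n) \<Rightarrow> bool" where
  "has_C1_gradient f g \<longleftrightarrow> (\<forall>x. GDERIV f x :> g x) \<and> continuous_on UNIV g"

lemma pd_eq_gradient: "GDERIV f x :> D \<Longrightarrow> pd i f x = D $ i"
  unfolding pd_def gderiv_def
  by (metis frechet_derivative_at inner_commute inner_axis inner_real_def mult.right_neutral)

lemma gderiv_pd:
  fixes f :: "real^'n \<Rightarrow> real"
  assumes "f differentiable at x"
  shows "GDERIV f x :> (\<chi> i. pd i f x)"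
proof -
  let ?f' = "frechet_derivative f (at x)"
  have d: "(f has_derivative ?f') (at x)" using assms frechet_derivative_works by blast
  then interpret bounded_linear ?f' by (rule has_derivative_bounded_linear)
  have "?f' h = h \<bullet> (\<chi> i. pd i f x)" for h
  proof -
    have "?f' h = ?f' (\<Sum>i\<in>UNIV. h $ i *\<^sub>R axis i 1)"
      using basis_expansion[of h] by (simp add: scalar_mult_eq_scaleR)
    also have "\<dots> = (\<Sum>i\<in>UNIV. h $ i * pd i f x)" by (simp add: sum scaleR pd_def)
    finally show ?thesis by (simp add: inner_vec_def)
  qed
  then have "?f' = (\<lambda>h. h \<bullet> (\<chi> i. pd i f x))" by auto
  then show ?thesis using d unfolding gderiv_def by metis
qed

lemma has_C1_gradient_pd: "has_C1_gradient f g \<Longrightarrow> pd i f = (\<lambda>x. g x $ i)"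
  unfolding has_C1_gradient_def using pd_eq_gradient by blast

lemma has_C1_gradient_continuous: "has_C1_gradient f g \<Longrightarrow> continuous_on UNIV f"
  unfolding has_C1_gradient_def gderiv_def
  by (meson continuous_at_imp_continuous_on has_derivative_continuous)

lemma has_C1_gradient_const: "has_C1_gradient (\<lambda>x. c) (\<lambda>x. 0)"
  by (simp add: has_C1_gradient_def GDERIV_const)

lemma has_C1_gradient_add:
  "has_C1_gradient f g \<Longrightarrow> has_C1_gradient f' g' \<Longrightarrow> has_C1_gradient (\<lambda>x. f x + f' x) (\<lambda>x. g x + g' x)"
  by (simp add: has_C1_gradient_def GDERIV_add continuous_on_add)

lemma has_C1_gradient_diff:
  "has_C1_gradient f g \<Longrightarrow> has_C1_gradient f' g' \<Longrightarrow> has_C1_gradient (\<lambda>x. f x - f' x) (\<lambda>x. g x - g' x)"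
  by (simp add: has_C1_gradient_def GDERIV_diff continuous_on_diff)

lemma has_C1_gradient_mult:
  assumes "has_C1_gradient f g" "has_C1_gradient f' g'"
  shows "has_C1_gradient (\<lambda>x. f x * f' x) (\<lambda>x. f x *\<^sub>R g' x + f' x *\<^sub>R g x)"
  using assms has_C1_gradient_continuous[OF assms(1)] has_C1_gradient_continuous[OF assms(2)]
  by (auto simp: has_C1_gradient_def intro!: GDERIV_mult continuous_intros)

lemma has_C1_gradient_compose:
  assumes "has_C1_gradient f g" "\<And>t. (q has_real_derivative q' t) (at t)" "continuous_on UNIV q'"
  shows "has_C1_gradient (\<lambda>x. q (f x)) (\<lambda>x. q' (f x) *\<^sub>R g x)"
proof -
  have "GDERIV (\<lambda>x. q (f x)) x :> q' (f x) *\<^sub>R g x" for x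
    using assms by (intro GDERIV_DERIV_compose) (auto simp: has_C1_gradient_def)
  moreover have "continuous_on UNIV (\<lambda>x. q' (f x))"
    by (rule continuous_on_compose2[OF assms(3) has_C1_gradient_continuous[OF assms(1)]]) simp
  ultimately show ?thesis using assms(1) by (auto simp: has_C1_gradient_def intro!: continuous_intros)
qed

lemma has_C1_gradient_component: "has_C1_gradient (\<lambda>x::real^'n. x $ i) (\<lambda>x. axis i 1)"
  by (auto simp: has_C1_gradient_def gderiv_def inner_axis intro!: derivative_eq_intros
      bounded_linear_imp_has_derivative bounded_linear_vec_nth)

lemma has_C1_gradient_inner_self: "has_C1_gradient (\<lambda>x::real^'n. x \<bullet> x) (\<lambda>x. 2 *\<^sub>R x)"
  by (auto simp: has_C1_gradient_def gderiv_def inner_commute intro!: derivative_eq_intros continuous_intros)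

lemma has_C1_gradient_norm_shift:
  "has_C1_gradient (\<lambda>x::real^'n. (norm (x - c))\<^sup>2) (\<lambda>x. 2 *\<^sub>R (x - c))"
  unfolding power2_norm_eq_inner
  by (auto simp: has_C1_gradient_def gderiv_def inner_commute intro!: derivative_eq_intros continuous_intros)

lemma has_C1_gradient_imp_Ck_Suc:
  "has_C1_gradient f g \<Longrightarrow> (\<And>i. Ck k (\<lambda>x. g x $ i)) \<Longrightarrow> Ck (Suc k) f"
  using has_C1_gradient_pd[of f g]
  by (auto simp: has_C1_gradient_def gderiv_def differentiable_def)

lemma Ck_Suc_has_C1_gradient:
  fixes f :: "real^'n \<Rightarrow> real"
  assumes "Ck (Suc k) f"
  shows "has_C1_gradient f (\<lambda>x. \<chi> i. pd i f x)"
proof -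
  have *: "Ck k h \<Longrightarrow> continuous_on UNIV h" for k and h :: "real^'n \<Rightarrow> real"
    by (cases k) (auto intro!: continuous_at_imp_continuous_on differentiable_imp_continuous_within)
  have "continuous_on UNIV (pd i f)" for i using assms * by auto
  then have "continuous_on UNIV (\<lambda>x. \<chi> i. pd i f x)" by (intro continuous_on_vec_lambda) auto
  then show ?thesis using assms gderiv_pd by (auto simp: has_C1_gradient_def)
qed

lemma Ck_continuous: "Ck k f \<Longrightarrow> continuous_on UNIV f"
  by (cases k) (auto intro!: continuous_at_imp_continuous_on differentiable_imp_continuous_within)

lemma Ck_Suc_iff:
  "Ck (Suc k) f \<longleftrightarrow> (\<exists>g. has_C1_gradient f g \<and> (\<forall>i. Ck k (\<lambda>x. g x $ i)))"
proof
  assume f: "Ck (Suc k) f"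
  show "\<exists>g. has_C1_gradient f g \<and> (\<forall>i. Ck k (\<lambda>x. g x $ i))"
    using Ck_Suc_has_C1_gradient[OF f] f by (intro exI[of _ "\<lambda>x. \<chi> i. pd i f x"]) auto
qed (metis has_C1_gradient_imp_Ck_Suc)

lemma Ck_SucD: "Ck (Suc k) f \<Longrightarrow> Ck k f"
proof (induction k arbitrary: f)
  case 0 then show ?case using Ck_continuous[of "Suc 0" f] by simp
next
  case (Suc k)
  then show ?case by (subst (asm) Ck_Suc_iff, subst Ck_Suc_iff) blast
qed

lemma Ck_const: "Ck k (\<lambda>x. c)"
proof (induction k arbitrary: c)
  case (Suc k) then show ?case
    by (intro has_C1_gradient_imp_Ck_Suc[OF has_C1_gradient_const]) simp
qed simp

lemma Ck_add: "Ck k f \<Longrightarrow> Ck k g \<Longrightarrow> Ck k (\<lambda>x. f x + g x)"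
proof (induction k arbitrary: f g)
  case (Suc k)
  then obtain f' g' where "has_C1_gradient f f'" "\<forall>i. Ck k (\<lambda>x. f' x $ i)"
    "has_C1_gradient g g'" "\<forall>i. Ck k (\<lambda>x. g' x $ i)" unfolding Ck_Suc_iff by blast
  then show ?case using Suc.IH
    by (intro has_C1_gradient_imp_Ck_Suc[OF has_C1_gradient_add]) auto
qed (simp add: continuous_on_add)

lemma Ck_mult: "Ck k f \<Longrightarrow> Ck k g \<Longrightarrow> Ck k (\<lambda>x. f x * g x)"
proof (induction k arbitrary: f g)
  case (Suc k)
  then obtain f' g' where *: "has_C1_gradient f f'" "\<forall>i. Ck k (\<lambda>x. f' x $ i)"
    "has_C1_gradient g g'" "\<forall>i. Ck k (\<lambda>x. g' x $ i)" unfolding Ck_Suc_iff by blast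
  have "Ck k f" "Ck k g" using Suc.prems Ck_SucD by auto
  with * show ?case using Suc.IH
    by (intro has_C1_gradient_imp_Ck_Suc[OF has_C1_gradient_mult[OF *(1,3)]]) (auto intro!: Ck_add)
qed (simp add: continuous_on_mult)

lemma Ck_component: "Ck k (\<lambda>x::real^'n. x $ i)"
proof (cases k)
  case (Suc m)
  show ?thesis unfolding Suc
    by (rule has_C1_gradient_imp_Ck_Suc[OF has_C1_gradient_component Ck_const])
qed (auto intro: continuous_on_component continuous_on_id)

lemma smooth_const: "smooth (\<lambda>x. c)" by (simp add: smooth_def Ck_const)

lemma smooth_mult: "smooth f \<Longrightarrow> smooth g \<Longrightarrow> smooth (\<lambda>x. f x * g x)"
  by (simp add: smooth_def Ck_mult)

lemma smooth_has_C1_gradient: "smooth f \<Longrightarrow> has_C1_gradient f (\<lambda>x. \<chi> i. pd i f x)"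
  unfolding smooth_def using Ck_Suc_has_C1_gradient by blast

subsection \<open>A smooth bump\<close>

text \<open>The functions \<open>P(1/t) e^(-1/t)\<close>, extended by 0 to \<open>t \<le> 0\<close>. With an arbitrary polynomial \<open>P\<close> the
  family is closed under differentiation, which is what makes each member smooth.\<close>

definition flat_exp :: "real poly \<Rightarrow> real \<Rightarrow> real" where
  "flat_exp p t = (if t \<le> 0 then 0 else poly p (1/t) * exp (- (1/t)))"

lemma poly_times_exp_minus_tendsto_0: "((\<lambda>s::real. poly p s * exp (- s)) \<longlongrightarrow> 0) at_top"
proof -
  have "((\<lambda>s::real. \<Sum>i\<le>degree p. coeff p i * (s ^ i / exp s)) \<longlongrightarrow> (\<Sum>i\<le>degree p. coeff p i * 0)) at_top"
    by (intro tendsto_intros tendsto_power_div_exp_0)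
  then show ?thesis by (simp add: poly_altdef exp_minus divide_inverse sum_distrib_right mult.assoc)
qed

lemma flat_exp_at_right_0: "((\<lambda>t. flat_exp p t / t) \<longlongrightarrow> 0) (at_right 0)"
proof -
  have "((\<lambda>t. poly (pCons 0 p) (inverse t) * exp (- inverse t)) \<longlongrightarrow> 0) (at_right (0::real))"
    by (rule filterlim_compose[OF poly_times_exp_minus_tendsto_0 filterlim_inverse_at_top_right])
  then show ?thesis
    by (rule Lim_transform_eventually)
      (auto simp: flat_exp_def eventually_at_filter field_simps)
qed

text \<open>For \<open>s = 1/t\<close> the derivative of \<open>P(s) e^(-s)\<close> in \<open>t\<close> is \<open>s\<^sup>2 (P(s) - P'(s)) e^(-s)\<close>. At \<open>t = 0\<close> the
  difference quotient vanishes from the left, and from the right because the exponential beats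
  every polynomial.\<close>

lemma flat_exp_deriv:
  "(flat_exp p has_real_derivative flat_exp ([:0,0,1:] * (p - pderiv p)) t) (at t)"
proof -
  consider "t < 0" | "t = 0" | "t > 0" by linarith
  then show ?thesis
  proof cases
    case 1
    then have "((\<lambda>_. 0) has_real_derivative 0) (at t)" by simp
    then have "(flat_exp p has_real_derivative 0) (at t)"
      by (rule has_field_derivative_transform_within_open[of _ _ _ "{..<0}"])
        (use 1 in \<open>auto simp: flat_exp_def\<close>)
    with 1 show ?thesis by (simp add: flat_exp_def)
  next
    case 2
    have "((\<lambda>t. flat_exp p t / t) \<longlongrightarrow> 0) (at_left 0)"
      by (rule Lim_transform_eventually[OF tendsto_const])
        (auto simp: flat_exp_def eventually_at_filter)
    with flat_exp_at_right_0[of p] have "((\<lambda>t. flat_exp p t / t) \<longlongrightarrow> 0) (at 0)"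
      by (simp add: filterlim_split_at)
    then show ?thesis using 2 by (simp add: has_field_derivative_iff flat_exp_def)
  next
    case 3
    have "((\<lambda>t. poly p (1/t) * exp (- (1/t))) has_real_derivative
        flat_exp ([:0,0,1:] * (p - pderiv p)) t) (at t)"
      using 3 by (auto intro!: derivative_eq_intros poly_DERIV[THEN DERIV_chain2]
          simp: flat_exp_def field_simps power2_eq_square)
    then show ?thesis
      by (rule has_field_derivative_transform_within_open[of _ _ _ "{0<..}"])
        (use 3 in \<open>auto simp: flat_exp_def\<close>)
  qed
qed

lemma Ck_flat_exp_bump: "Ck k (\<lambda>x::real^'n. flat_exp p (r - x \<bullet> x))"
proof (induction k arbitrary: p)
  case 0
  have "continuous_on UNIV (flat_exp p)"
    using flat_exp_deriv by (meson DERIV_isCont continuous_at_imp_continuous_on)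
  then show ?case by (auto intro!: continuous_on_compose2[of UNIV "flat_exp p"] continuous_intros)
next
  case (Suc k)
  have *: "has_C1_gradient (\<lambda>x::real^'n. r - x \<bullet> x) (\<lambda>x. 0 - 2 *\<^sub>R x)"
    by (rule has_C1_gradient_diff[OF has_C1_gradient_const has_C1_gradient_inner_self])
  let ?q = "[:0,0,1:] * (p - pderiv p)"
  have c: "continuous_on UNIV (flat_exp ?q)"
    using flat_exp_deriv by (meson DERIV_isCont continuous_at_imp_continuous_on)
  have "Ck k (\<lambda>x::real^'n. (flat_exp ?q (r - x \<bullet> x) *\<^sub>R (0 - 2 *\<^sub>R x)) $ i)" for i
  proof -
    have "Ck k (\<lambda>x::real^'n. flat_exp ?q (r - x \<bullet> x) * (- 2 * x $ i))"
      by (intro Ck_mult Suc.IH Ck_const Ck_component)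
    then show ?thesis by (simp add: mult.assoc)
  qed
  then show ?case
    by (intro has_C1_gradient_imp_Ck_Suc[OF has_C1_gradient_compose[OF * flat_exp_deriv c]])
qed

definition mollifier :: "real \<Rightarrow> real^'n \<Rightarrow> real" where
  "mollifier d x = flat_exp 1 (d\<^sup>2 - x \<bullet> x) / (\<integral>y. flat_exp 1 (d\<^sup>2 - y \<bullet> y) \<partial>(lborel::(real^'n) measure))"

lemma continuous_compact_support_integrable:
  fixes f :: "'a::euclidean_space \<Rightarrow> real"
  assumes "continuous_on UNIV f" "compact K" "\<And>x. x \<notin> K \<Longrightarrow> f x = 0"
  shows "integrable lborel f"
proof -
  have "integrable lborel (\<lambda>x. indicator K x *\<^sub>R f x)"
    using borel_integrable_compact[OF assms(2)] assms(1) continuous_on_subset by blast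
  moreover have "(\<lambda>x. indicator K x *\<^sub>R f x) = f" using assms(3) by (auto simp: indicator_def fun_eq_iff)
  ultimately show ?thesis by simp
qed

lemma flat_exp_bump_eq_0: "d > 0 \<Longrightarrow> x \<notin> cball 0 d \<Longrightarrow> flat_exp p (d\<^sup>2 - x \<bullet> x) = 0"
  by (simp add: flat_exp_def dot_square_norm dist_norm abs_le_square_iff[symmetric])

text \<open>The normalising integral is not zero because the bump is positive on an open ball.\<close>

lemma mollifier_facts:
  fixes d :: real
  assumes d: "d > 0"
  shows "smooth (mollifier d :: real^'n \<Rightarrow> real)" "mollifier d (x::real^'n) \<ge> 0"
    "norm (x::real^'n) > d \<Longrightarrow> mollifier d x = 0"
    "integrable lborel (mollifier d :: real^'n \<Rightarrow> real)"
    "(\<integral>y. mollifier d (y::real^'n) \<partial>lborel) = 1"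
proof -
  let ?b = "\<lambda>x::real^'n. flat_exp 1 (d\<^sup>2 - x \<bullet> x)"
  let ?I = "\<integral>y. ?b y \<partial>lborel"
  have nn: "?b x \<ge> 0" for x by (simp add: flat_exp_def)
  have cont: "continuous_on UNIV ?b" using Ck_flat_exp_bump[of 0] by simp
  have int: "integrable lborel ?b"
    by (rule continuous_compact_support_integrable[OF cont, of "cball 0 d"])
      (auto intro!: flat_exp_bump_eq_0 d)
  have "?I \<noteq> 0"
  proof
    assume "?I = 0"
    then have "AE x in lborel. ?b x = 0" using integral_nonneg_eq_0_iff_AE[OF int] nn by auto
    then have "AE x in lborel. x \<notin> ball (0::real^'n) d"
    proof (rule AE_mp, intro AE_I2 impI)
      fix x :: "real^'n" assume "?b x = 0"
      then have "d\<^sup>2 \<le> (norm x)\<^sup>2" by (auto simp: flat_exp_def dot_square_norm split: if_splits)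
      then show "x \<notin> ball 0 d" using d abs_le_square_iff[of d "norm x"] by simp
    qed
    then have "emeasure lborel (ball (0::real^'n) d) = 0"
      by (subst (asm) AE_iff_measurable[OF _ refl]) (auto simp: ball_def dist_norm)
    then show False using open_not_negligible[of "ball (0::real^'n) d"] d
      by (simp add: negligible_iff_emeasure0)
  qed
  then have I: "?I > 0" using nn by (simp add: less_le Bochner_Integration.integral_nonneg)
  have eq: "mollifier d = (\<lambda>x::real^'n. (1/?I) * ?b x)" by (auto simp: mollifier_def)
  show "smooth (mollifier d :: real^'n \<Rightarrow> real)"
    unfolding eq by (intro smooth_mult smooth_const) (simp add: smooth_def Ck_flat_exp_bump)
  show "mollifier d x \<ge> 0" unfolding eq using I nn by simp
  show "norm x > d \<Longrightarrow> mollifier d x = 0" unfolding eq using flat_exp_bump_eq_0[OF d, of x] by simp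
  show "integrable lborel (mollifier d :: real^'n \<Rightarrow> real)" unfolding eq using int by simp
  show "(\<integral>y. mollifier d (y::real^'n) \<partial>lborel) = 1" unfolding eq using I int by simp
qed

subsection \<open>Convolution\<close>

definition convol :: "(real^'n \<Rightarrow> real) \<Rightarrow> (real^'n \<Rightarrow> real) \<Rightarrow> real^'n \<Rightarrow> real" where
  "convol k f x = (\<integral>y. k (x - y) * f y \<partial>lborel)"


lemma lborel_distr_reflect: "distr lborel borel (\<lambda>x::'a::euclidean_space. t - x) = lborel"
  using lborel_affine[of "-1" t] by (simp add: density_1)

lemma lborel_distr_shift: "distr lborel borel (\<lambda>x::'a::euclidean_space. t + x) = lborel"
  using lborel_affine[of 1 t] by (simp add: density_1)

lemma lborel_integral_reflect:
  fixes f :: "'a::euclidean_space \<Rightarrow> real"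
  assumes "f \<in> borel_measurable borel"
  shows "(\<integral>x. f (t - x) \<partial>lborel) = (\<integral>x. f x \<partial>lborel)"
  using integral_distr[of "\<lambda>x. t - x" lborel borel f] assms by (simp add: lborel_distr_reflect)

lemma lborel_integral_shift:
  fixes f :: "'a::euclidean_space \<Rightarrow> real"
  assumes "f \<in> borel_measurable borel"
  shows "(\<integral>x. f (t + x) \<partial>lborel) = (\<integral>x. f x \<partial>lborel)"
  using integral_distr[of "\<lambda>x. t + x" lborel borel f] assms by (simp add: lborel_distr_shift)

text \<open>Hence a convolution may be differentiated on either factor: smoothness comes from the kernel,
  while the gradient of a \<open>C\<^sup>1\<close> function passes to its mollification.\<close>

lemma convol_commute:
  fixes k f :: "real^'n \<Rightarrow> real"
  assumes "continuous_on UNIV k" "continuous_on UNIV f"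
  shows "convol k f = convol f k"
proof
  fix x :: "real^'n"
  have "(\<lambda>y. k (x - y) * f y) \<in> borel_measurable borel"
    by (intro borel_measurable_continuous_onI continuous_intros continuous_on_compose2[OF assms(1)] assms(2)) auto
  from lborel_integral_reflect[OF this, of x]
  show "convol k f x = convol f k x" unfolding convol_def by (simp add: mult.commute)
qed

lemma lborel_integral_eq_cbox:
  fixes f :: "'a::euclidean_space \<Rightarrow> real"
  assumes "continuous_on UNIV f" "\<And>x. x \<notin> cbox a b \<Longrightarrow> f x = 0"
  shows "(\<integral>x. f x \<partial>lborel) = integral (cbox a b) f"
proof -
  have "integrable lborel f"
    by (rule continuous_compact_support_integrable[OF assms(1) compact_cbox assms(2)])
  then have "(\<integral>x. f x \<partial>lborel) = integral UNIV f" by (simp add: integral_lborel)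
  also have "f = (\<lambda>x. if x \<in> cbox a b then f x else 0)" using assms(2) by auto
  then have "integral UNIV f = integral UNIV (\<lambda>x. if x \<in> cbox a b then f x else 0)" by simp
  finally show ?thesis by (simp add: integral_restrict_UNIV)
qed

lemma convol_eq_cbox:
  assumes "continuous_on UNIV k" "continuous_on UNIV f" "\<And>x. x \<notin> cbox a b \<Longrightarrow> f x = 0"
  shows "convol k f x = integral (cbox a b) (\<lambda>y. k (x - y) * f y)"
  unfolding convol_def
  by (rule lborel_integral_eq_cbox)
    (auto intro!: continuous_intros continuous_on_compose2[OF assms(1)] assms)

lemma continuous_on_convol:
  fixes f :: "real^'n \<Rightarrow> real"
  assumes "continuous_on UNIV k" "continuous_on UNIV f" "compact K" "\<And>x. x \<notin> K \<Longrightarrow> f x = 0"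
  shows "continuous_on UNIV (convol k f)"
proof -
  obtain a b where ab: "K \<subseteq> cbox a b"
    using bounded_subset_cbox_symmetric[OF compact_imp_bounded[OF assms(3)]] by blast
  have "convol k f x = integral (cbox a b) (\<lambda>y. k (x - y) * f y)" for x
    using ab assms by (intro convol_eq_cbox) auto
  moreover have "continuous_on UNIV (\<lambda>x. integral (cbox a b) (\<lambda>y. k (x - y) * f y))"
    by (intro integral_continuous_on_param)
      (auto simp: split_beta intro!: continuous_intros continuous_on_compose2[OF assms(1)]
        continuous_on_compose2[OF assms(2)])
  ultimately show ?thesis by simp
qed

text \<open>Differentiation under the integral sign; the compact support of \<open>f\<close> turns the integral into one
  over a fixed box.\<close>

lemma has_C1_gradient_convol:
  fixes f :: "real^'n \<Rightarrow> real"
  assumes k: "has_C1_gradient k kg"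
    and f: "continuous_on UNIV f" "compact K" "\<And>x. x \<notin> K \<Longrightarrow> f x = 0"
  shows "has_C1_gradient (convol k f) (\<lambda>x. \<chi> i. convol (\<lambda>z. kg z $ i) f x)"
proof -
  obtain a b where ab: "K \<subseteq> cbox a b"
    using bounded_subset_cbox_symmetric[OF compact_imp_bounded[OF f(2)]] by blast
  have f0: "x \<notin> cbox a b \<Longrightarrow> f x = 0" for x using ab f(3) by auto
  have kc: "continuous_on UNIV k" using k by (rule has_C1_gradient_continuous)
  have kgc: "continuous_on UNIV kg" using k by (simp add: has_C1_gradient_def)
  then have kgic: "continuous_on UNIV (\<lambda>z. kg z $ i)" for i by (intro continuous_intros)
  let ?fx = "\<lambda>x t. blinfun_inner_left (f t *\<^sub>R kg (x - t))"
  have D: "((\<lambda>x. k (x - t) * f t) has_derivative blinfun_apply (?fx x t)) (at x within UNIV)" for x t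
  proof -
    have d1: "((\<lambda>x. x - t) has_derivative (\<lambda>h. h)) (at x)"
      by (auto intro!: derivative_eq_intros)
    have d2: "(k has_derivative (\<lambda>h. h \<bullet> kg (x - t))) (at (x - t))"
      using k by (simp add: has_C1_gradient_def gderiv_def)
    have "((\<lambda>x. k (x - t)) has_derivative (\<lambda>h. h \<bullet> kg (x - t))) (at x)"
      by (rule has_derivative_compose[OF d1 d2])
    then have "((\<lambda>x. k (x - t) * f t) has_derivative (\<lambda>h. (h \<bullet> kg (x - t)) * f t)) (at x)"
      by (rule has_derivative_mult_left)
    then show ?thesis by (simp add: mult.commute)
  qed
  have cfx: "continuous_on (UNIV \<times> cbox a b) (\<lambda>(x, t). ?fx x t)"
    unfolding split_beta
    by (intro bounded_linear.continuous_on[OF bounded_linear_blinfun_inner_left] continuous_intros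
        continuous_on_compose2[OF f(1)] continuous_on_compose2[OF kgc]) auto
  have "GDERIV (convol k f) x :> (\<chi> i. convol (\<lambda>z. kg z $ i) f x)" for x
  proof -
    have "((\<lambda>x. integral (cbox a b) (\<lambda>t. k (x - t) * f t)) has_derivative
        integral (cbox a b) (?fx x)) (at x within UNIV)"
      by (rule leibniz_rule[OF D _ cfx])
        (auto intro!: integrable_continuous continuous_intros continuous_on_compose2[OF kc]
          continuous_on_compose2[OF f(1)])
    moreover have "blinfun_apply (integral (cbox a b) (?fx x)) = (\<lambda>h. h \<bullet> (\<chi> i. convol (\<lambda>z. kg z $ i) f x))"
    proof
      fix h
      have int: "?fx x integrable_on cbox a b"
        by (intro integrable_continuous bounded_linear.continuous_on[OF bounded_linear_blinfun_inner_left]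
            continuous_intros continuous_on_compose2[OF f(1)] continuous_on_compose2[OF kgc]) auto
      have "blinfun_apply (integral (cbox a b) (?fx x)) h
          = integral (cbox a b) (\<lambda>t. \<Sum>i\<in>UNIV. h $ i * (kg (x - t) $ i * f t))"
        by (subst blinfun_apply_integral[OF int]) (simp add: inner_vec_def sum_distrib_left mult_ac)
      also have "\<dots> = (\<Sum>i\<in>UNIV. h $ i * integral (cbox a b) (\<lambda>t. kg (x - t) $ i * f t))"
        by (subst integral_sum)
          (auto intro!: integrable_continuous continuous_intros continuous_on_compose2[OF f(1)]
            continuous_on_compose2[OF kgc])
      also have "\<dots> = h \<bullet> (\<chi> i. convol (\<lambda>z. kg z $ i) f x)"
        by (simp add: inner_vec_def convol_eq_cbox[OF kgic f(1) f0])
      finally show "blinfun_apply (integral (cbox a b) (?fx x)) h = h \<bullet> (\<chi> i. convol (\<lambda>z. kg z $ i) f x)" .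
    qed
    moreover have "convol k f = (\<lambda>x. integral (cbox a b) (\<lambda>t. k (x - t) * f t))"
      by (intro ext convol_eq_cbox[OF kc f(1) f0])
    ultimately show ?thesis unfolding gderiv_def by simp
  qed
  moreover have "continuous_on UNIV (\<lambda>x. \<chi> i. convol (\<lambda>z. kg z $ i) f x)"
    by (intro continuous_on_vec_lambda continuous_on_convol[OF kgic f])
  ultimately show ?thesis by (simp add: has_C1_gradient_def)
qed

lemma Ck_convol:
  fixes f :: "real^'n \<Rightarrow> real"
  assumes "Ck m k" and f: "continuous_on UNIV f" "compact K" "\<And>x. x \<notin> K \<Longrightarrow> f x = 0"
  shows "Ck m (convol k f)"
  using assms(1)
proof (induction m arbitrary: k)
  case 0
  then show ?case using continuous_on_convol[OF _ f] by simp
next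
  case (Suc m)
  then obtain kg where "has_C1_gradient k kg" "\<And>i. Ck m (\<lambda>x. kg x $ i)"
    unfolding Ck_Suc_iff by blast
  then show ?case using Suc.IH by (intro has_C1_gradient_imp_Ck_Suc[OF has_C1_gradient_convol[OF _ f]]) auto
qed

lemma continuous_on_mollifier: "d > 0 \<Longrightarrow> continuous_on UNIV (mollifier d :: real^'n \<Rightarrow> real)"
  using mollifier_facts(1)[of d] unfolding smooth_def by (meson Ck_continuous)

definition mollify :: "real \<Rightarrow> (real^'n \<Rightarrow> real) \<Rightarrow> real^'n \<Rightarrow> real" where
  "mollify d f = convol (mollifier d) f"

context
  fixes f :: "real^'n \<Rightarrow> real" and K and d :: real
  assumes f: "continuous_on UNIV f" "compact K" "\<And>x. x \<notin> K \<Longrightarrow> f x = 0" and d: "d > 0"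
begin

lemma smooth_mollify: "smooth (mollify d f)"
  unfolding smooth_def mollify_def
proof
  show "Ck m (convol (mollifier d) f)" for m
    using mollifier_facts(1)[OF d] by (intro Ck_convol[OF _ f]) (auto simp: smooth_def)
qed

lemma mollify_eq: "mollify d f x = (\<integral>y. f (x - y) * mollifier d y \<partial>lborel)"
proof -
  have "continuous_on UNIV (mollifier d :: real^'n \<Rightarrow> real)"
    by (rule continuous_on_mollifier[OF d])
  from convol_commute[OF this f(1)] show ?thesis by (simp add: mollify_def convol_def)
qed

lemma mollify_integrable: "integrable lborel (\<lambda>y. f (x - y) * mollifier d y)"
proof (rule continuous_compact_support_integrable[of _ "cball 0 d"])
  show "continuous_on UNIV (\<lambda>y. f (x - y) * mollifier d y)"
    by (intro continuous_intros continuous_on_compose2[OF f(1)] continuous_on_mollifier[OF d]) auto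
qed (use mollifier_facts(3)[OF d] in \<open>auto simp: not_le\<close>)

lemma mollify_eq_0: "(\<And>y. y \<in> K \<Longrightarrow> dist x y > d) \<Longrightarrow> mollify d f x = 0"
proof -
  assume *: "\<And>y. y \<in> K \<Longrightarrow> dist x y > d"
  have "f (x - y) * mollifier d y = 0" for y
  proof (cases "x - y \<in> K")
    case True
    then have "norm y > d" using *[of "x - y"] by (simp add: dist_norm)
    then show ?thesis by (simp add: mollifier_facts(3)[OF d])
  qed (simp add: f(3))
  then have "(\<lambda>y. f (x - y) * mollifier d y) = (\<lambda>_. 0)" by blast
  then show ?thesis by (simp add: mollify_eq)
qed

lemma mollify_close:
  assumes "\<And>y. dist x y \<le> d \<Longrightarrow> \<bar>f y - c\<bar> \<le> e" "e \<ge> 0"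
  shows "\<bar>mollify d f x - c\<bar> \<le> e"
proof -
  note [simp] = mollify_integrable mollifier_facts(4,5)[OF d]
  have "mollify d f x - c = (\<integral>y. f (x - y) * mollifier d y - c * mollifier d y \<partial>lborel)"
    by (simp add: mollify_eq)
  also have "\<bar>\<dots>\<bar> \<le> (\<integral>y. \<bar>f (x - y) * mollifier d y - c * mollifier d y\<bar> \<partial>lborel)"
    by (rule integral_abs_bound)
  also have "\<dots> \<le> (\<integral>y. e * mollifier d (y::real^'n) \<partial>lborel)"
  proof (intro Bochner_Integration.integral_mono)
    fix y :: "real^'n"
    show "\<bar>f (x - y) * mollifier d y - c * mollifier d y\<bar> \<le> e * mollifier d y"
    proof (cases "norm y \<le> d")
      case True
      then have "\<bar>f (x - y) - c\<bar> \<le> e" using assms(1)[of "x - y"] by (simp add: dist_norm)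
      then show ?thesis using mollifier_facts(2)[OF d, of y]
        by (simp add: left_diff_distrib[symmetric] abs_mult mult_right_mono)
    qed (simp add: mollifier_facts(3)[OF d])
  qed auto
  finally show ?thesis by simp
qed

end

lemma mollify_tendsto:
  fixes f :: "real^'n \<Rightarrow> real"
  assumes f: "continuous_on UNIV f" "compact K" "\<And>x. x \<notin> K \<Longrightarrow> f x = 0"
    and d: "\<And>n. d n > 0" "d \<longlonglongrightarrow> 0"
  shows "(\<lambda>n. mollify (d n) f x) \<longlonglongrightarrow> f x"
proof (rule LIMSEQ_I)
  fix e :: real assume e: "e > 0"
  obtain r where r: "r > 0" "\<And>y. dist y x < r \<Longrightarrow> dist (f y) (f x) < e/2"
    using f(1) e half_gt_zero[OF e] unfolding continuous_on_iff by (metis UNIV_I)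
  obtain n0 where n0: "\<And>n. n \<ge> n0 \<Longrightarrow> norm (d n - 0) < r" using LIMSEQ_D[OF d(2) r(1)] by blast
  show "\<exists>no. \<forall>n\<ge>no. norm (mollify (d n) f x - f x) < e"
  proof (intro exI[of _ n0] allI impI)
    fix n assume "n \<ge> n0"
    then have "\<bar>mollify (d n) f x - f x\<bar> \<le> e/2"
      using n0[of n] d(1)[of n] r(2) e
      by (intro mollify_close[OF f d(1)]) (force simp: dist_commute dist_real_def less_imp_le)+
    then show "norm (mollify (d n) f x - f x) < e" using e by simp
  qed
qed

lemma mollify_gradient:
  assumes f: "has_C1_gradient f g" "compact K" "\<And>x. x \<notin> K \<Longrightarrow> f x = 0" and d: "d > 0"
  shows "pd i (mollify d f) = mollify d (\<lambda>x. g x $ i)"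
proof -
  have mc: "continuous_on UNIV (mollifier d :: real^'n \<Rightarrow> real)" by (rule continuous_on_mollifier[OF d])
  have fc: "continuous_on UNIV f" by (rule has_C1_gradient_continuous[OF f(1)])
  have gc: "continuous_on UNIV (\<lambda>x. g x $ i)"
    using f(1) by (auto simp: has_C1_gradient_def intro!: continuous_intros)
  have "has_C1_gradient (convol f (mollifier d)) (\<lambda>x. \<chi> i. convol (\<lambda>z. g z $ i) (mollifier d) x)"
    by (rule has_C1_gradient_convol[OF f(1) mc, of "cball 0 d"]) (use mollifier_facts(3)[OF d] in \<open>auto simp: not_le\<close>)
  from has_C1_gradient_pd[OF this, of i]
  show ?thesis by (simp add: mollify_def convol_commute[OF mc fc] convol_commute[OF mc gc])
qed

lemma has_C1_gradient_eq_0_outside: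
  assumes "has_C1_gradient f g" "closed K" "\<And>x. x \<notin> K \<Longrightarrow> f x = 0" "x \<notin> K"
  shows "g x = 0"
proof -
  have d: "(f has_derivative (\<lambda>h. h \<bullet> g x)) (at x)" using assms(1) by (simp add: has_C1_gradient_def gderiv_def)
  have "((\<lambda>_. 0) has_derivative (\<lambda>h. h \<bullet> g x)) (at x)"
    by (rule has_derivative_transform_within_open[OF d, of "- K"]) (use assms in auto)
  then have "(\<lambda>h. h \<bullet> g x) = (\<lambda>_. 0)"
    using has_derivative_unique has_derivative_const by blast
  then have "g x \<bullet> g x = 0" by meson
  then show ?thesis by simp
qed

section \<open>Weak derivatives\<close>

text \<open>All mollifications with small radius, of \<open>f\<close> and of its derivatives, vanish outside one compact
  subset \<open>K'\<close> of \<open>\<Omega>\<close>. This is what allows passing to the limit against functions that are only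
  locally integrable.\<close>

lemma mollifications_are_test_functions:
  fixes \<Omega> :: "(real^'n) set"
  assumes f: "continuous_on UNIV f" "compact K" "\<And>x. x \<notin> K \<Longrightarrow> f x = 0"
    and K: "K \<subseteq> \<Omega>" and "open \<Omega>"
  obtains d K' where "\<And>n::nat. d n > 0" "d \<longlonglongrightarrow> 0" "compact K'" "K' \<subseteq> \<Omega>" "K \<subseteq> K'"
    "\<And>n. test_function \<Omega> (mollify (d n) f)"
    "\<And>h n x. \<lbrakk>continuous_on UNIV h; \<And>x. x \<notin> K \<Longrightarrow> h x = 0; x \<notin> K'\<rbrakk> \<Longrightarrow> mollify (d n) h x = 0"
proof -
  obtain e where e: "e > 0" "(\<Union>x\<in>K. cball x e) \<subseteq> \<Omega>"
    using compact_subset_open_imp_cball_epsilon_subset[OF f(2) \<open>open \<Omega>\<close> K] by blast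
  define d where "d n = e / real (Suc n)" for n
  define K' where "K' = (\<Union>x\<in>K. cball x e)"
  have K'eq: "K' = {x + y | x y. x \<in> K \<and> y \<in> cball 0 e}"
    unfolding K'_def by (force simp: dist_norm norm_minus_commute)
  have d: "d n > 0" "d n \<le> e" for n using e(1) by (auto simp: d_def field_simps)
  have 0: "mollify (d n) h x = 0"
    if "continuous_on UNIV h" "\<And>x. x \<notin> K \<Longrightarrow> h x = 0" "x \<notin> K'" for h n x
    using that d[of n]
    by (intro mollify_eq_0[OF that(1) f(2) that(2) d(1)]) (force simp: K'_def dist_commute not_le)+
  show thesis
  proof (rule that[of d K'])
    show "d n > 0" for n by (rule d)
    show "d \<longlonglongrightarrow> 0" unfolding d_def[abs_def] by (intro tendsto_divide_0[OF tendsto_const] filterlim_at_top_imp_at_infinity filterlim_compose[OF filterlim_real_sequentially filterlim_Suc])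
    show "compact K'" unfolding K'eq by (intro compact_sums f(2) compact_cball)
    show "K' \<subseteq> \<Omega>" using e by (simp add: K'_def)
    show "K \<subseteq> K'" using e(1) by (force simp: K'_def)
    show "test_function \<Omega> (mollify (d n) f)" for n
      using \<open>compact K'\<close> \<open>K' \<subseteq> \<Omega>\<close> smooth_mollify[OF f d(1)] 0[OF f(1,3)] by (auto simp: test_function_def)
  qed (use 0 in auto)
qed

lemma continuous_imp_measurable_lebesgue_on:
  fixes h :: "'a::euclidean_space \<Rightarrow> 'b::euclidean_space"
  shows "continuous_on UNIV h \<Longrightarrow> h \<in> borel_measurable (lebesgue_on \<Omega>)"
  by (intro measurable_restrict_space1 measurable_completion) (simp add: borel_measurable_continuous_onI)

lemma continuous_compact_support_bounded:
  fixes f :: "'a::euclidean_space \<Rightarrow> real"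
  assumes "continuous_on UNIV f" "compact K" "\<And>x. x \<notin> K \<Longrightarrow> f x = 0"
  obtains B where "B \<ge> 0" "\<And>x. \<bar>f x\<bar> \<le> B"
proof -
  have "bounded (f ` K)"
    by (intro compact_imp_bounded compact_continuous_image[OF continuous_on_subset[OF assms(1)]] assms) auto
  then obtain B where "\<And>x. x \<in> K \<Longrightarrow> \<bar>f x\<bar> \<le> B" unfolding bounded_iff by auto
  then have "\<bar>f x\<bar> \<le> max B 0" for x using assms(3)[of x] by (cases "x \<in> K") force+
  then show thesis by (intro that[of "max B 0"]) auto
qed

text \<open>Dominated convergence: the mollifications obey the bound of \<open>f\<close> and live on \<open>K'\<close>.\<close>

lemma mollify_integral_tendsto:
  fixes \<Omega> :: "(real^'n) set"
  assumes f: "continuous_on UNIV f" "compact K" "\<And>x. x \<notin> K \<Longrightarrow> f x = 0"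
    and d: "\<And>n::nat. d n > 0" "d \<longlonglongrightarrow> 0"
    and K': "compact K'" "K' \<subseteq> \<Omega>" "K \<subseteq> K'" "\<And>n x. x \<notin> K' \<Longrightarrow> mollify (d n) f x = 0"
    and w: "w absolutely_integrable_on K'" and "open \<Omega>"
  shows "(\<lambda>n. \<integral>x. w x * mollify (d n) f x \<partial>lebesgue_on \<Omega>) \<longlonglongrightarrow> (\<integral>x. w x * f x \<partial>lebesgue_on \<Omega>)"
proof -
  obtain B where B: "B \<ge> 0" "\<And>x. \<bar>f x\<bar> \<le> B"
    using continuous_compact_support_bounded[OF f] by blast
  have mB: "\<bar>mollify (d n) f x\<bar> \<le> B" for n x
    using mollify_close[OF f d(1), where c=0 and e=B and x=x] B by simp
  let ?w = "\<lambda>x. indicator K' x * w x"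
  have wi: "integrable lebesgue ?w" using w by (simp add: set_integrable_def)
  have [measurable]: "\<Omega> \<in> sets lebesgue" using \<open>open \<Omega>\<close> by simp
  have wi': "integrable (lebesgue_on \<Omega>) ?w"
    using integrable_mult_indicator[OF _ wi, of \<Omega>] by (subst integrable_restrict_space) auto
  note cm = continuous_imp_measurable_lebesgue_on
  have "(\<lambda>n. \<integral>x. ?w x * mollify (d n) f x \<partial>lebesgue_on \<Omega>) \<longlonglongrightarrow> (\<integral>x. ?w x * f x \<partial>lebesgue_on \<Omega>)"
  proof (rule integral_dominated_convergence)
    show "integrable (lebesgue_on \<Omega>) (\<lambda>x. \<bar>?w x\<bar> * B)"
      using wi' by (intro integrable_mult_left integrable_abs)
    show "AE x in lebesgue_on \<Omega>. (\<lambda>n. ?w x * mollify (d n) f x) \<longlonglongrightarrow> ?w x * f x"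
      by (intro AE_I2 tendsto_intros mollify_tendsto[OF f d])
    show "AE x in lebesgue_on \<Omega>. norm (?w x * mollify (d n) f x) \<le> \<bar>?w x\<bar> * B" for n
      using mult_left_mono[OF mB, of "\<bar>?w x\<bar>" for x] by (intro AE_I2) (simp add: abs_mult)
    show "(\<lambda>x. ?w x * f x) \<in> borel_measurable (lebesgue_on \<Omega>)"
      by (intro borel_measurable_times borel_measurable_integrable[OF wi'] cm f(1))
    show "(\<lambda>x. ?w x * mollify (d n) f x) \<in> borel_measurable (lebesgue_on \<Omega>)" for n
      using smooth_mollify[OF f d(1), of n] unfolding smooth_def
      by (intro borel_measurable_times borel_measurable_integrable[OF wi'] cm) (meson Ck_continuous)
  qed
  moreover have "(\<lambda>x. ?w x * mollify (d n) f x) = (\<lambda>x. w x * mollify (d n) f x)" for n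
    using K'(4) by (auto simp: indicator_def fun_eq_iff)
  moreover have "(\<lambda>x. ?w x * f x) = (\<lambda>x. w x * f x)"
    using K'(3) f(3) by (auto simp: indicator_def fun_eq_iff)
  ultimately show ?thesis by simp
qed

text \<open>A test function of class \<open>C\<^sup>1\<close> is the limit of its mollifications together with the first
  derivatives, boundedly and with supports in one compact set.\<close>

lemma weak_partial_C1:
  fixes \<Omega> :: "(real^'n) set"
  assumes w: "weak_partial \<Omega> i f w" and \<phi>: "has_C1_gradient \<phi> g" "compact K" "\<And>x. x \<notin> K \<Longrightarrow> \<phi> x = 0"
    and "K \<subseteq> \<Omega>" "open \<Omega>"
  shows "(\<integral>x. f x * g x $ i \<partial>lebesgue_on \<Omega>) = - (\<integral>x. w x * \<phi> x \<partial>lebesgue_on \<Omega>)"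
proof -
  have c: "continuous_on UNIV \<phi>" by (rule has_C1_gradient_continuous[OF \<phi>(1)])
  have gc: "continuous_on UNIV (\<lambda>x. g x $ i)" using \<phi>(1) by (auto simp: has_C1_gradient_def intro!: continuous_intros)
  have g0: "x \<notin> K \<Longrightarrow> g x $ i = 0" for x
    using has_C1_gradient_eq_0_outside[OF \<phi>(1) compact_imp_closed[OF \<phi>(2)] \<phi>(3)] by auto
  obtain d K' where d: "\<And>n::nat. d n > 0" "d \<longlonglongrightarrow> 0" "compact K'" "K' \<subseteq> \<Omega>" "K \<subseteq> K'"
    "\<And>n. test_function \<Omega> (mollify (d n) \<phi>)"
    "\<And>h n x. \<lbrakk>continuous_on UNIV h; \<And>x. x \<notin> K \<Longrightarrow> h x = 0; x \<notin> K'\<rbrakk> \<Longrightarrow> mollify (d n) h x = 0"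
    using mollifications_are_test_functions[OF c \<phi>(2,3) \<open>K \<subseteq> \<Omega>\<close> \<open>open \<Omega>\<close>] by metis
  have fw: "f absolutely_integrable_on K'" "w absolutely_integrable_on K'"
    using w d(3,4) by (auto simp: weak_partial_def)
  have "(\<integral>x. f x * mollify (d n) (\<lambda>x. g x $ i) x \<partial>lebesgue_on \<Omega>)
      = - (\<integral>x. w x * mollify (d n) \<phi> x \<partial>lebesgue_on \<Omega>)" for n
    using w d(6)[of n] mollify_gradient[OF \<phi> d(1)] by (auto simp: weak_partial_def)
  moreover have "(\<lambda>n. \<integral>x. f x * mollify (d n) (\<lambda>x. g x $ i) x \<partial>lebesgue_on \<Omega>) \<longlonglongrightarrow> (\<integral>x. f x * g x $ i \<partial>lebesgue_on \<Omega>)"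
    by (rule mollify_integral_tendsto[OF gc \<phi>(2) g0 d(1-5) d(7)[OF gc g0] fw(1) \<open>open \<Omega>\<close>]) auto
  moreover have "(\<lambda>n. - (\<integral>x. w x * mollify (d n) \<phi> x \<partial>lebesgue_on \<Omega>)) \<longlonglongrightarrow> - (\<integral>x. w x * \<phi> x \<partial>lebesgue_on \<Omega>)"
    by (intro tendsto_minus mollify_integral_tendsto[OF c \<phi>(2,3) d(1-5) d(7)[OF c \<phi>(3)] fw(2) \<open>open \<Omega>\<close>]) auto
  ultimately show ?thesis by (simp add: LIMSEQ_unique)
qed

text \<open>An open set is a countable union of compact sets. Being a weak derivative requires no more than
  local integrability, so measurability on \<open>\<Omega>\<close> has to be recovered this way.\<close>

lemma measurable_if_absolutely_integrable_on_compacts: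
  fixes f :: "'a::euclidean_space \<Rightarrow> real"
  assumes "open \<Omega>" "\<And>K. compact K \<Longrightarrow> K \<subseteq> \<Omega> \<Longrightarrow> f absolutely_integrable_on K"
  shows "f \<in> borel_measurable (lebesgue_on \<Omega>)"
proof -
  obtain C where C: "\<And>n. compact (C n)" "\<And>n::nat. C n \<subseteq> \<Omega>" "\<And>n. C n \<subseteq> interior (C (Suc n))" "\<Union>(range C) = \<Omega>"
    using open_Union_compact_subsets[OF assms(1)] by metis
  have mono: "C m \<subseteq> C n" if "m \<le> n" for m n
    using that by (rule lift_Suc_mono_le[of C, rotated]) (use C(3) interior_subset in fast)
  show ?thesis
  proof (rule borel_measurable_LIMSEQ_metric)
    fix n
    have "integrable lebesgue (\<lambda>x. indicator (C n) x *\<^sub>R f x)"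
      using assms(2)[OF C(1,2)] by (simp add: set_integrable_def)
    then show "(\<lambda>x. indicator (C n) x *\<^sub>R f x) \<in> borel_measurable (lebesgue_on \<Omega>)"
      by (intro measurable_restrict_space1 borel_measurable_integrable)
  next
    fix x assume "x \<in> space (lebesgue_on \<Omega>)"
    then obtain m where "x \<in> C m" using C(4) by (auto simp: space_restrict_space)
    then have "\<forall>\<^sub>F n in sequentially. indicator (C n) x *\<^sub>R f x = f x"
      using mono by (intro eventually_sequentiallyI[of m]) (auto simp: indicator_def)
    then show "(\<lambda>n. indicator (C n) x *\<^sub>R f x) \<longlonglongrightarrow> f x" by (rule tendsto_eventually)
  qed
qed

lemma weak_partial_measurable:
  assumes "weak_partial \<Omega> i f w" "open \<Omega>"
  shows "f \<in> borel_measurable (lebesgue_on \<Omega>)" "w \<in> borel_measurable (lebesgue_on \<Omega>)"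
  by (rule measurable_if_absolutely_integrable_on_compacts; use assms in \<open>simp add: weak_partial_def\<close>)+

text \<open>The indicator of \<open>K\<close> is the decreasing limit of the continuous functions
  \<open>max 0 (1 - (n+1) dist(x, K))\<close>, and each of these is a limit of test functions.\<close>

lemma integral_compact_zero_if_test_zero:
  fixes \<Omega> :: "(real^'n) set" and w :: "real^'n \<Rightarrow> real"
  assumes "open \<Omega>" and w: "\<And>K. compact K \<Longrightarrow> K \<subseteq> \<Omega> \<Longrightarrow> w absolutely_integrable_on K"
    and t: "\<And>\<phi>. test_function \<Omega> \<phi> \<Longrightarrow> (\<integral>x. w x * \<phi> x \<partial>lebesgue_on \<Omega>) = 0"
    and K: "compact K" "K \<subseteq> \<Omega>"
  shows "(\<integral>x. w x * indicator K x \<partial>lebesgue_on \<Omega>) = 0"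
proof (cases "K = {}")
  case False
  obtain e where e: "e > 0" "(\<Union>x\<in>K. cball x e) \<subseteq> \<Omega>"
    using compact_subset_open_imp_cball_epsilon_subset[OF K(1) \<open>open \<Omega>\<close> K(2)] by blast
  define K' where "K' = (\<Union>x\<in>K. cball x e)"
  have "K' = {x + y | x y. x \<in> K \<and> y \<in> cball 0 e}"
    unfolding K'_def by (force simp: dist_norm norm_minus_commute)
  then have "compact K'" using compact_sums[OF K(1) compact_cball[of 0 e]] by simp
  moreover have "K' \<subseteq> \<Omega>" using e by (simp add: K'_def)
  ultimately have K': "compact K'" "K' \<subseteq> \<Omega>" by auto
  define h where "h n x = max 0 (1 - real (Suc n) * infdist x K)" for n and x :: "real^'n"
  have hc: "continuous_on UNIV (h n)" for n
    unfolding h_def[abs_def] by (intro continuous_intros)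
  have h_off: "h n x = 0" if "x \<notin> K'" "1 / real (Suc n) < e" for n x
  proof -
    obtain y where y: "y \<in> K" "infdist x K = dist x y"
      using infdist_attains_inf[OF compact_imp_closed[OF K(1)] False] by blast
    then have "e \<le> infdist x K" using that(1) by (auto simp: K'_def dist_commute not_le)
    then have "1 / real (Suc n) \<le> infdist x K" using that(2) by linarith
    then have "1 \<le> real (Suc n) * infdist x K" by (simp add: divide_le_eq mult.commute)
    then show ?thesis by (simp add: h_def)
  qed
  have "(\<integral>x. w x * h n x \<partial>lebesgue_on \<Omega>) = 0" if n: "1 / real (Suc n) < e" for n
  proof -
    note h0 = h_off[OF _ n]
    obtain d K'' where d: "\<And>n::nat. d n > 0" "d \<longlonglongrightarrow> 0" "compact K''" "K'' \<subseteq> \<Omega>" "K' \<subseteq> K''"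
      "\<And>m. test_function \<Omega> (mollify (d m) (h n))"
      "\<And>h n x. \<lbrakk>continuous_on UNIV h; \<And>x. x \<notin> K' \<Longrightarrow> h x = 0; x \<notin> K''\<rbrakk> \<Longrightarrow> mollify (d n) h x = 0"
      using mollifications_are_test_functions[OF hc K'(1) h0 K'(2) \<open>open \<Omega>\<close>] by metis
    have "(\<lambda>m. \<integral>x. w x * mollify (d m) (h n) x \<partial>lebesgue_on \<Omega>) \<longlonglongrightarrow> (\<integral>x. w x * h n x \<partial>lebesgue_on \<Omega>)"
      by (rule mollify_integral_tendsto[OF hc K'(1) h0 d(1-5) d(7)[OF hc h0] w[OF d(3,4)] \<open>open \<Omega>\<close>]) auto
    then show ?thesis using t[OF d(6)] by (simp add: LIMSEQ_const_iff)
  qed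
  moreover have "\<forall>\<^sub>F n in sequentially. 1 / real (Suc n) < e"
    using order_tendstoD(2)[OF LIMSEQ_inverse_real_of_nat e(1)] by (simp add: divide_inverse)
  ultimately have ev: "\<forall>\<^sub>F n in sequentially. (\<integral>x. w x * h n x \<partial>lebesgue_on \<Omega>) = 0"
    by (auto elim: eventually_mono)
  have [measurable]: "\<Omega> \<in> sets lebesgue" using \<open>open \<Omega>\<close> by simp
  obtain n0 where n0: "1 / real (Suc n0) < e" using \<open>e > 0\<close> nat_approx_posE by blast
  have h_le: "0 \<le> h n x" "h n x \<le> 1" for n x by (auto simp: h_def infdist_nonneg)
  have n0': "1 / real (Suc (n + n0)) < e" for n
    by (rule le_less_trans[OF _ n0]) (simp add: frac_le)
  have wi: "integrable lebesgue (\<lambda>x. indicator K' x * w x)"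
    using w[OF K'] by (simp add: set_integrable_def)
  have wi': "integrable (lebesgue_on \<Omega>) (\<lambda>x. indicator K' x * w x)"
    using integrable_mult_indicator[OF _ wi, of \<Omega>] by (subst integrable_restrict_space) auto
  have wm: "w \<in> borel_measurable (lebesgue_on \<Omega>)"
    by (rule measurable_if_absolutely_integrable_on_compacts[OF \<open>open \<Omega>\<close> w])
  have cm: "h n \<in> borel_measurable (lebesgue_on \<Omega>)" for n
    using hc by (rule continuous_imp_measurable_lebesgue_on)
  have "(\<lambda>n. \<integral>x. w x * h (n + n0) x \<partial>lebesgue_on \<Omega>) \<longlonglongrightarrow> (\<integral>x. w x * indicator K x \<partial>lebesgue_on \<Omega>)"
  proof (rule integral_dominated_convergence)
    show "integrable (lebesgue_on \<Omega>) (\<lambda>x. \<bar>indicator K' x * w x\<bar>)" using wi' by (rule integrable_abs)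
    show "(\<lambda>x. w x * indicator K x) \<in> borel_measurable (lebesgue_on \<Omega>)"
      using wm K(1) by (intro borel_measurable_times borel_measurable_indicator)
        (use K(2) in \<open>auto intro!: sets_restrict_space_iff[THEN iffD2] simp: borel_compact\<close>)
    show "(\<lambda>x. w x * h (n + n0) x) \<in> borel_measurable (lebesgue_on \<Omega>)" for n
      by (intro borel_measurable_times wm cm)
    show "AE x in lebesgue_on \<Omega>. (\<lambda>n. w x * h (n + n0) x) \<longlonglongrightarrow> w x * indicator K x"
    proof (intro AE_I2 tendsto_intros)
      fix x
      have "(\<lambda>n. h n x) \<longlonglongrightarrow> indicator K x"
      proof (cases "x \<in> K")
        case True then show ?thesis by (simp add: h_def)
      next
        case False
        then have "infdist x K > 0"
          using compact_imp_closed[OF K(1)] \<open>K \<noteq> {}\<close> in_closed_iff_infdist_zero infdist_nonneg by (metis less_eq_real_def)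
        then obtain N where N: "1 / real (Suc N) < infdist x K" using nat_approx_posE by blast
        have "h n x = 0" if "n \<ge> N" for n
        proof -
          have "1 < real (Suc N) * infdist x K" using N by (simp add: divide_less_eq mult.commute)
          also have "\<dots> \<le> real (Suc n) * infdist x K" using that by (intro mult_right_mono infdist_nonneg) auto
          finally show ?thesis by (simp add: h_def)
        qed
        then have "\<forall>\<^sub>F n in sequentially. h n x = 0" by (rule eventually_sequentiallyI)
        then show ?thesis using False by (simp add: tendsto_eventually)
      qed
      then show "(\<lambda>n. h (n + n0) x) \<longlonglongrightarrow> indicator K x" by (rule LIMSEQ_ignore_initial_segment)
    qed
    show "AE x in lebesgue_on \<Omega>. norm (w x * h (n + n0) x) \<le> \<bar>indicator K' x * w x\<bar>" for n
    proof (intro AE_I2)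
      fix x show "norm (w x * h (n + n0) x) \<le> \<bar>indicator K' x * w x\<bar>"
        using h_le[of "n+n0" x] h_off[OF _ n0', of x n]
        by (cases "x \<in> K'") (auto simp: abs_mult mult_left_le)
    qed
  qed
  moreover have "(\<lambda>n. \<integral>x. w x * h (n + n0) x \<partial>lebesgue_on \<Omega>) \<longlonglongrightarrow> 0"
    by (rule LIMSEQ_ignore_initial_segment[OF tendsto_eventually[OF ev]])
  ultimately show ?thesis using LIMSEQ_unique by blast
qed simp

text \<open>The lemma of du Bois-Reymond. If \<open>w\<close> were positive on a set of positive measure, inner regularity
  would give a compact such set, over which the integral of \<open>w\<close> could not vanish.\<close>

lemma AE_zero_if_test_zero:
  fixes \<Omega> :: "(real^'n) set" and w :: "real^'n \<Rightarrow> real"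
  assumes "open \<Omega>" and w: "\<And>K. compact K \<Longrightarrow> K \<subseteq> \<Omega> \<Longrightarrow> w absolutely_integrable_on K"
    and t: "\<And>\<phi>. test_function \<Omega> \<phi> \<Longrightarrow> (\<integral>x. w x * \<phi> x \<partial>lebesgue_on \<Omega>) = 0"
  shows "AE x in lebesgue_on \<Omega>. w x = 0"
proof -
  have pos: "AE x in lebesgue_on \<Omega>. v x \<le> 0"
    if v: "\<And>K. compact K \<Longrightarrow> K \<subseteq> \<Omega> \<Longrightarrow> v absolutely_integrable_on K"
      and t: "\<And>\<phi>. test_function \<Omega> \<phi> \<Longrightarrow> (\<integral>x. v x * \<phi> x \<partial>lebesgue_on \<Omega>) = 0" for v :: "real^'n \<Rightarrow> real"
  proof -
    have [measurable]: "\<Omega> \<in> sets lebesgue" using \<open>open \<Omega>\<close> by simp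
    have vm: "v \<in> borel_measurable (lebesgue_on \<Omega>)"
      by (rule measurable_if_absolutely_integrable_on_compacts[OF \<open>open \<Omega>\<close> v])
    define E where "E = {x \<in> \<Omega>. v x > 0}"
    have "{x \<in> space (lebesgue_on \<Omega>). 0 < v x} \<in> sets (lebesgue_on \<Omega>)"
      using borel_measurable_iff_greater[THEN iffD1, OF vm] by blast
    then have "E \<in> sets (lebesgue_on \<Omega>)" by (simp add: E_def space_restrict_space)
    then have E: "E \<in> sets lebesgue" by (simp add: sets_restrict_space_iff)
    have "negligible E"
    proof -
      have *: "negligible K" if K: "compact K" "K \<subseteq> E" for K
      proof -
        have KO: "K \<subseteq> \<Omega>" using K by (auto simp: E_def)
        have Km: "K \<in> sets (lebesgue_on \<Omega>)" "K \<in> sets lebesgue"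
          using K(1) KO by (auto simp: sets_restrict_space_iff borel_compact)
        have i: "integrable (lebesgue_on \<Omega>) (\<lambda>x. v x * indicator K x)"
        proof -
          have "integrable lebesgue (\<lambda>x. indicator K x * v x)"
            using v[OF K(1) KO] by (simp add: set_integrable_def)
          then have "integrable (lebesgue_on \<Omega>) (\<lambda>x. indicator K x * v x)"
            using integrable_mult_indicator[of \<Omega> lebesgue "\<lambda>x. indicator K x * v x"]
            by (subst integrable_restrict_space) auto
          then show ?thesis by (simp add: mult.commute)
        qed
        have i0: "(\<integral>x. v x * indicator K x \<partial>lebesgue_on \<Omega>) = 0"
          by (rule integral_compact_zero_if_test_zero[OF \<open>open \<Omega>\<close> _ _ K(1) KO]) (rule v t; assumption)+
        have nn: "AE x in lebesgue_on \<Omega>. 0 \<le> v x * indicator K x"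
          using K(2) by (intro AE_I2) (auto simp: indicator_def E_def)
        have "AE x in lebesgue_on \<Omega>. v x * indicator K x = 0"
          using integral_nonneg_eq_0_iff_AE[OF i nn] i0 by blast
        then have "AE x in lebesgue_on \<Omega>. x \<notin> K"
        proof eventually_elim
          case (elim x)
          then show ?case using K(2) by (cases "x \<in> K") (auto simp: E_def)
        qed
        then have "AE x in lebesgue. x \<in> \<Omega> \<longrightarrow> x \<notin> K" by (simp add: AE_restrict_space_iff)
        then have "AE x in lebesgue. x \<notin> K" by eventually_elim (use KO in blast)
        then show ?thesis using AE_iff_null_sets[OF Km(2)] negligible_iff_null_sets by blast
      qed
      have "emeasure lebesgue (E \<inter> cball 0 (real n)) = 0" for n
      proof (rule ccontr)
        let ?F = "E \<inter> cball 0 (real n)"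
        assume "emeasure lebesgue ?F \<noteq> 0"
        have F: "?F \<in> sets lebesgue" using E by auto
        have "bounded ?F" by auto
        then have Fm: "?F \<in> lmeasurable" using F bounded_set_imp_lmeasurable by blast
        then have "emeasure lebesgue ?F = ennreal (measure lebesgue ?F)" by (rule emeasure_eq_measure2)
        then have "measure lebesgue ?F > 0"
          using \<open>emeasure lebesgue ?F \<noteq> 0\<close> by (metis ennreal_0 less_le measure_nonneg)
        then obtain T where T: "closed T" "T \<subseteq> ?F" "?F - T \<in> lmeasurable" "emeasure lebesgue (?F - T) < ennreal (measure lebesgue ?F)"
          using sets_lebesgue_inner_closed[OF F] by metis
        have "compact T" using T \<open>bounded ?F\<close> bounded_subset compact_eq_bounded_closed by blast
        then have "negligible T" using * T(2) by blast
        then have "measure lebesgue (?F - T) = measure lebesgue ?F"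
          by (simp add: measure_Diff_null_set Fm fmeasurableD F negligible_iff_null_sets)
        then show False using T(3,4) by (simp add: emeasure_eq_measure2)
      qed
      then have "negligible (E \<inter> cball 0 (real n))" for n using E by (subst negligible_iff_emeasure0) auto
      then have "negligible (\<Union>n. E \<inter> cball 0 (real n))" by (intro negligible_countable_Union) auto
      moreover have "(\<Union>n. E \<inter> cball 0 (real n)) = E"
      proof (intro equalityI subsetI)
        fix x assume x: "x \<in> E"
        obtain n where "norm x \<le> real n" using real_arch_simple by blast
        then show "x \<in> (\<Union>n. E \<inter> cball 0 (real n))" using x by auto
      qed auto
      ultimately show ?thesis by simp
    qed
    then have "AE x in lebesgue. x \<notin> E" by (simp add: negligible_iff_null_sets AE_not_in)
    then have "AE x in lebesgue. x \<in> \<Omega> \<longrightarrow> v x \<le> 0"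
      by eventually_elim (auto simp: E_def not_less)
    then show ?thesis by (simp add: AE_restrict_space_iff)
  qed
  have "AE x in lebesgue_on \<Omega>. w x \<le> 0" by (rule pos[OF w t])
  moreover have "AE x in lebesgue_on \<Omega>. - w x \<le> 0"
  proof (rule pos)
    show "(\<lambda>x. - w x) absolutely_integrable_on K" if "compact K" "K \<subseteq> \<Omega>" for K
      using w[OF that] by (simp add: set_integrable_def)
    show "(\<integral>x. - w x * \<phi> x \<partial>lebesgue_on \<Omega>) = 0" if "test_function \<Omega> \<phi>" for \<phi>
      using t[OF that] by simp
  qed
  ultimately show ?thesis by eventually_elim auto
qed

lemma lebesgue_on_integral_eq_lborel:
  fixes f :: "'a::euclidean_space \<Rightarrow> real"
  assumes "f \<in> borel_measurable borel" "\<And>x. x \<notin> \<Omega> \<Longrightarrow> f x = 0" "\<Omega> \<in> sets lebesgue"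
  shows "(\<integral>x. f x \<partial>lebesgue_on \<Omega>) = (\<integral>x. f x \<partial>lborel)"
proof -
  have "(\<integral>x. f x \<partial>lebesgue_on \<Omega>) = (\<integral>x. indicator \<Omega> x *\<^sub>R f x \<partial>lebesgue)"
    using assms(3) by (subst integral_restrict_space) auto
  also have "(\<lambda>x. indicator \<Omega> x *\<^sub>R f x) = f" using assms(2) by (auto simp: fun_eq_iff indicator_def)
  finally show ?thesis using assms(1) by (simp add: integral_completion)
qed

lemma has_C1_gradient_along_line:
  assumes "has_C1_gradient f g"
  shows "((\<lambda>t. f (x + t *\<^sub>R v)) has_real_derivative (v \<bullet> g (x + t *\<^sub>R v))) (at t)"
proof -
  have d1: "((\<lambda>t. x + t *\<^sub>R v) has_derivative (\<lambda>h. h *\<^sub>R v)) (at t)"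
    by (auto intro!: derivative_eq_intros)
  have d2: "(f has_derivative (\<lambda>h. h \<bullet> g (x + t *\<^sub>R v))) (at (x + t *\<^sub>R v))"
    using assms by (simp add: has_C1_gradient_def gderiv_def)
  have "((\<lambda>t. f (x + t *\<^sub>R v)) has_derivative (\<lambda>h. (h *\<^sub>R v) \<bullet> g (x + t *\<^sub>R v))) (at t)"
    by (rule has_derivative_compose[OF d1 d2])
  then show ?thesis by (simp add: has_field_derivative_def mult_commute_abs)
qed

text \<open>The difference quotients in direction \<open>i\<close> have integral 0 by translation invariance, and they
  converge boundedly to the partial derivative.\<close>

lemma integral_gradient_zero:
  fixes f :: "real^'n \<Rightarrow> real"
  assumes f: "has_C1_gradient f g" and K: "compact K" "\<And>x. x \<notin> K \<Longrightarrow> f x = 0"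
  shows "(\<integral>x. g x $ i \<partial>lborel) = 0"
proof -
  let ?e = "axis i 1 :: real^'n"
  define q where "q n x = real (Suc n) * (f (x + (1 / real (Suc n)) *\<^sub>R ?e) - f x)" for n x
  have fc: "continuous_on UNIV f" by (rule has_C1_gradient_continuous[OF f])
  have gc: "continuous_on UNIV (\<lambda>x. g x $ i)" using f by (auto simp: has_C1_gradient_def intro!: continuous_intros)
  have g0: "x \<notin> K \<Longrightarrow> g x $ i = 0" for x
    using has_C1_gradient_eq_0_outside[OF f compact_imp_closed[OF K(1)] K(2)] by auto
  obtain B where B: "B \<ge> 0" "\<And>x. \<bar>g x $ i\<bar> \<le> B"
    using continuous_compact_support_bounded[OF gc K(1) g0] by blast
  define K' where "K' = {x + y | x y. x \<in> K \<and> y \<in> cball (0::real^'n) 1}"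
  have K': "compact K'" unfolding K'_def by (intro compact_sums K compact_cball)
  have radial_coefficient: "\<bar>q n x\<bar> \<le> B * indicator K' x" for n x
  proof (cases "x \<in> K'")
    case True
    let ?t = "1 / real (Suc n)"
    have "\<exists>z. 0 < z \<and> z < ?t \<and> f (x + ?t *\<^sub>R ?e) - f (x + 0 *\<^sub>R ?e) = (?t - 0) * (?e \<bullet> g (x + z *\<^sub>R ?e))"
      by (rule MVT2) (auto intro: has_C1_gradient_along_line[OF f])
    then obtain z where "f (x + ?t *\<^sub>R ?e) - f x = ?t * (g (x + z *\<^sub>R ?e) $ i)"
      by (auto simp: inner_axis' )
    then have "q n x = g (x + z *\<^sub>R ?e) $ i" by (simp add: q_def)
    then show ?thesis using B(2) True by simp
  next
    case False
    have "x \<notin> K" using False unfolding K'_def by force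
    moreover have "x + (1 / real (Suc n)) *\<^sub>R ?e \<notin> K"
    proof
      assume *: "x + (1 / real (Suc n)) *\<^sub>R ?e \<in> K"
      have "x = (x + (1 / real (Suc n)) *\<^sub>R ?e) + (- (1 / real (Suc n)) *\<^sub>R ?e)" by simp
      moreover have "- (1 / real (Suc n)) *\<^sub>R ?e \<in> cball 0 1" by (simp add: norm_axis_1)
      ultimately have "x \<in> K'" unfolding K'_def using * by blast
      then show False using False by blast
    qed
    ultimately show ?thesis using False K(2) by (simp add: q_def)
  qed
  have fi: "integrable lborel f" by (rule continuous_compact_support_integrable[OF fc K])
  have fm: "f \<in> borel_measurable borel" using fc by (rule borel_measurable_continuous_onI)
  have fs: "integrable lborel (\<lambda>x. f (x + v))" for v
  proof (rule continuous_compact_support_integrable[of _ "(\<lambda>x. x - v) ` K"])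
    show "continuous_on UNIV (\<lambda>x. f (x + v))" by (intro continuous_on_compose2[OF fc] continuous_intros) auto
    show "compact ((\<lambda>x. x - v) ` K)" by (intro compact_continuous_image continuous_intros K(1))
    fix x assume "x \<notin> (\<lambda>x. x - v) ` K"
    then have "x + v \<notin> K" by (metis add_diff_cancel image_eqI)
    then show "f (x + v) = 0" by (rule K(2))
  qed
  have q0: "(\<integral>x. q n x \<partial>lborel) = 0" for n
  proof -
    have "(\<integral>x. f (x + v) \<partial>lborel) = (\<integral>x. f x \<partial>lborel)" for v
      using lborel_integral_shift[OF fm, of v] by (simp only: add.commute)
    then show ?thesis unfolding q_def using fi fs by simp
  qed
  have "(\<lambda>n. \<integral>x. q n x \<partial>lborel) \<longlonglongrightarrow> (\<integral>x. g x $ i \<partial>lborel)"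
  proof (rule integral_dominated_convergence)
    show "integrable lborel (\<lambda>x. B * indicator K' x)"
      using K' emeasure_compact_finite[OF K'] by (intro integrable_mult_right integrable_real_indicator) (simp_all add: borel_compact)
    show "AE x in lborel. (\<lambda>n. q n x) \<longlonglongrightarrow> g x $ i"
    proof (rule AE_I2)
      fix x
      have "((\<lambda>t. (f (x + t *\<^sub>R ?e) - f (x + 0 *\<^sub>R ?e)) / (t - 0)) \<longlongrightarrow> ?e \<bullet> g (x + 0 *\<^sub>R ?e)) (at 0)"
        using has_C1_gradient_along_line[OF f, of x ?e 0] by (simp add: has_field_derivative_iff)
      then have "((\<lambda>t. (f (x + t *\<^sub>R ?e) - f x) / t) \<longlongrightarrow> g x $ i) (at 0)" by (simp add: inner_axis')
      moreover have "filterlim (\<lambda>n. 1 / real (Suc n)) (at 0) sequentially"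
        using LIMSEQ_inverse_real_of_nat by (auto simp: filterlim_at divide_inverse)
      ultimately have "(\<lambda>n. (f (x + (1 / real (Suc n)) *\<^sub>R ?e) - f x) / (1 / real (Suc n))) \<longlonglongrightarrow> g x $ i"
        by (rule filterlim_compose)
      then show "(\<lambda>n. q n x) \<longlonglongrightarrow> g x $ i" by (simp add: q_def mult.commute)
    qed
    show "AE x in lborel. norm (q n x) \<le> B * indicator K' x" for n using radial_coefficient by simp
    show "(\<lambda>x. g x $ i) \<in> borel_measurable lborel" using gc by (simp add: borel_measurable_continuous_onI)
    show "q n \<in> borel_measurable lborel" for n
      unfolding q_def[abs_def] using fi fs by (intro borel_measurable_times borel_measurable_diff borel_measurable_const borel_measurable_integrable)
  qed
  then show ?thesis using q0 by (simp add: LIMSEQ_const_iff)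
qed

lemma continuous_absolutely_integrable_on_compact:
  fixes f :: "'a::euclidean_space \<Rightarrow> real"
  assumes "continuous_on UNIV f" "compact K"
  shows "f absolutely_integrable_on K"
proof -
  have "integrable lborel (\<lambda>x. indicator K x *\<^sub>R f x)"
    using borel_integrable_compact[OF assms(2)] assms(1) continuous_on_subset by blast
  then show ?thesis unfolding set_integrable_def by (simp add: integrable_completion)
qed

lemma test_functionE:
  assumes "test_function \<Omega> (\<phi> :: real^'n \<Rightarrow> real)"
  obtains K where "compact K" "K \<subseteq> \<Omega>" "\<And>x. x \<notin> K \<Longrightarrow> \<phi> x = 0" "has_C1_gradient \<phi> (\<lambda>x. \<chi> i. pd i \<phi> x)"
    "continuous_on UNIV \<phi>" "\<And>i. continuous_on UNIV (pd i \<phi>)" "\<And>i x. x \<notin> K \<Longrightarrow> pd i \<phi> x = 0"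
proof -
  obtain K where K: "compact K" "K \<subseteq> \<Omega>" "\<And>x. x \<notin> K \<Longrightarrow> \<phi> x = 0" using assms by (auto simp: test_function_def)
  have \<phi>: "has_C1_gradient \<phi> (\<lambda>x. \<chi> i. pd i \<phi> x)" using assms smooth_has_C1_gradient by (auto simp: test_function_def)
  show thesis
  proof (rule that[OF K \<phi>])
    show "continuous_on UNIV \<phi>" by (rule has_C1_gradient_continuous[OF \<phi>])
    show "continuous_on UNIV (pd i \<phi>)" for i
      using assms by (auto simp: test_function_def smooth_def dest!: spec[of _ "Suc 0"])
    show "x \<notin> K \<Longrightarrow> pd i \<phi> x = 0" for i x
      using has_C1_gradient_eq_0_outside[OF \<phi> compact_imp_closed[OF K(1)] K(3), of x] by (metis vec_lambda_beta zero_index)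
  qed
qed

text \<open>The product \<open>f \<phi>\<close> is of class \<open>C\<^sup>1\<close> with compact support, hence its derivative has integral 0.\<close>

lemma weak_partial_of_C1:
  fixes \<Omega> :: "(real^'n) set"
  assumes f: "has_C1_gradient f g" and "open \<Omega>"
  shows "weak_partial \<Omega> i f (\<lambda>x. g x $ i)"
  unfolding weak_partial_def
proof (intro conjI allI impI)
  have fc: "continuous_on UNIV f" by (rule has_C1_gradient_continuous[OF f])
  have gc: "continuous_on UNIV (\<lambda>x. g x $ i)" using f by (auto simp: has_C1_gradient_def intro!: continuous_intros)
  show "f absolutely_integrable_on K" "(\<lambda>x. g x $ i) absolutely_integrable_on K" if "compact K \<and> K \<subseteq> \<Omega>" for K
    using that fc gc by (auto intro: continuous_absolutely_integrable_on_compact)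
  fix \<phi> assume t: "test_function \<Omega> \<phi>"
  then obtain K where K: "compact K" "K \<subseteq> \<Omega>" "\<And>x. x \<notin> K \<Longrightarrow> \<phi> x = 0"
    and \<phi>: "has_C1_gradient \<phi> (\<lambda>x. \<chi> i. pd i \<phi> x)" and \<phi>c: "continuous_on UNIV \<phi>"
    and pc: "\<And>i. continuous_on UNIV (pd i \<phi>)" and p0: "\<And>i x. x \<notin> K \<Longrightarrow> pd i \<phi> x = 0"
    by (rule test_functionE) (rule that; simp)
  have "(\<integral>x. (f x *\<^sub>R (\<chi> i. pd i \<phi> x) + \<phi> x *\<^sub>R g x) $ i \<partial>lborel) = 0"
    by (rule integral_gradient_zero[OF has_C1_gradient_mult[OF f \<phi>] K(1)]) (simp add: K(3))
  then have eq: "(\<integral>x. f x * pd i \<phi> x + g x $ i * \<phi> x \<partial>lborel) = 0" by (simp add: mult.commute)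
  have i1: "integrable lborel (\<lambda>x. f x * pd i \<phi> x)"
    by (rule continuous_compact_support_integrable[OF _ K(1)]) (auto intro!: continuous_intros fc pc simp: p0)
  have i2: "integrable lborel (\<lambda>x. g x $ i * \<phi> x)"
    by (rule continuous_compact_support_integrable[OF _ K(1)]) (auto intro!: continuous_on_mult gc \<phi>c simp: K)
  have "(\<integral>x. f x * pd i \<phi> x \<partial>lebesgue_on \<Omega>) = (\<integral>x. f x * pd i \<phi> x \<partial>lborel)"
    using K(2) p0 \<open>open \<Omega>\<close> borel_measurable_integrable[OF i1]
    by (intro lebesgue_on_integral_eq_lborel) auto
  moreover have "(\<integral>x. g x $ i * \<phi> x \<partial>lebesgue_on \<Omega>) = (\<integral>x. g x $ i * \<phi> x \<partial>lborel)"
    using K(2,3) \<open>open \<Omega>\<close> borel_measurable_integrable[OF i2]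
    by (intro lebesgue_on_integral_eq_lborel) auto
  ultimately show "(\<integral>x. f x * pd i \<phi> x \<partial>lebesgue_on \<Omega>) = - (\<integral>x. g x $ i * \<phi> x \<partial>lebesgue_on \<Omega>)"
    using eq i1 i2 by simp
qed

lemma integrable_times_test:
  fixes \<Omega> :: "(real^'n) set" and w \<phi> :: "real^'n \<Rightarrow> real"
  assumes "\<And>K. compact K \<Longrightarrow> K \<subseteq> \<Omega> \<Longrightarrow> w absolutely_integrable_on K" "open \<Omega>"
    and "continuous_on UNIV \<phi>" "compact K" "K \<subseteq> \<Omega>" "\<And>x. x \<notin> K \<Longrightarrow> \<phi> x = 0"
  shows "integrable (lebesgue_on \<Omega>) (\<lambda>x. w x * \<phi> x)"
proof -
  obtain B where B: "\<And>x. \<bar>\<phi> x\<bar> \<le> B" using continuous_compact_support_bounded[OF assms(3,4,6)] by blast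
  have wi: "integrable lebesgue (\<lambda>x. indicator K x * w x)"
    using assms(1)[OF assms(4,5)] by (simp add: set_integrable_def)
  then have wi': "integrable (lebesgue_on \<Omega>) (\<lambda>x. indicator K x * w x)"
    using integrable_mult_indicator[OF _ wi, of \<Omega>] assms(2) by (subst integrable_restrict_space) auto
  have "integrable (lebesgue_on \<Omega>) (\<lambda>x. (indicator K x * w x) * \<phi> x)"
  proof (rule Bochner_Integration.integrable_bound)
    show "integrable (lebesgue_on \<Omega>) (\<lambda>x. \<bar>indicator K x * w x\<bar> * B)"
      using wi' by (intro integrable_mult_left integrable_abs)
    show "(\<lambda>x. indicator K x * w x * \<phi> x) \<in> borel_measurable (lebesgue_on \<Omega>)"
      by (intro borel_measurable_times[OF borel_measurable_integrable[OF wi']]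
          continuous_imp_measurable_lebesgue_on assms(3))
    show "AE x in lebesgue_on \<Omega>. norm (indicator K x * w x * \<phi> x) \<le> norm (\<bar>indicator K x * w x\<bar> * B)"
    proof (rule AE_I2)
      fix x
      have "\<bar>indicator K x * w x * \<phi> x\<bar> \<le> \<bar>indicator K x * w x\<bar> * B"
        unfolding abs_mult[of "indicator K x * w x"] by (intro mult_left_mono B) simp
      then show "norm (indicator K x * w x * \<phi> x) \<le> norm (\<bar>indicator K x * w x\<bar> * B)" by simp
    qed
  qed
  moreover have "(\<lambda>x. (indicator K x * w x) * \<phi> x) = (\<lambda>x. w x * \<phi> x)"
    using assms(6) by (auto simp: fun_eq_iff indicator_def)
  ultimately show ?thesis by simp
qed

lemma weak_partial_diff:
  fixes \<Omega> :: "(real^'n) set"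
  assumes f: "weak_partial \<Omega> i f w" and f': "weak_partial \<Omega> i f' w'" and "open \<Omega>"
  shows "weak_partial \<Omega> i (\<lambda>x. f x - f' x) (\<lambda>x. w x - w' x)"
  unfolding weak_partial_def
proof (intro conjI allI impI)
  note d = f[unfolded weak_partial_def] f'[unfolded weak_partial_def]
  show "(\<lambda>x. f x - f' x) absolutely_integrable_on K" "(\<lambda>x. w x - w' x) absolutely_integrable_on K"
    if "compact K \<and> K \<subseteq> \<Omega>" for K
    using that d by (auto intro!: set_integral_diff)
  fix \<phi> assume t: "test_function \<Omega> \<phi>"
  then obtain K where K: "compact K" "K \<subseteq> \<Omega>" "\<And>x. x \<notin> K \<Longrightarrow> \<phi> x = 0"
    and "has_C1_gradient \<phi> (\<lambda>x. \<chi> i. pd i \<phi> x)" and c: "continuous_on UNIV \<phi>" and pc: "\<And>i. continuous_on UNIV (pd i \<phi>)" and p0: "\<And>i x. x \<notin> K \<Longrightarrow> pd i \<phi> x = 0"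
    by (rule test_functionE) (rule that; simp)
  have i: "integrable (lebesgue_on \<Omega>) (\<lambda>x. f x * pd i \<phi> x)" "integrable (lebesgue_on \<Omega>) (\<lambda>x. f' x * pd i \<phi> x)"
    "integrable (lebesgue_on \<Omega>) (\<lambda>x. w x * \<phi> x)" "integrable (lebesgue_on \<Omega>) (\<lambda>x. w' x * \<phi> x)"
    using d K p0 c pc \<open>open \<Omega>\<close> by (auto intro!: integrable_times_test)
  show "(\<integral>x. (f x - f' x) * pd i \<phi> x \<partial>lebesgue_on \<Omega>) = - (\<integral>x. (w x - w' x) * \<phi> x \<partial>lebesgue_on \<Omega>)"
    using d t i by (simp add: left_diff_distrib)
qed

text \<open>An equality of predicates, so that the weak derivatives chosen for \<open>u\<close> and for \<open>u\<close> minus its mean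
  value are the same functions and not just equal almost everywhere.\<close>

lemma weak_partial_shift_iff:
  fixes \<Omega> :: "(real^'n) set"
  assumes "open \<Omega>"
  shows "weak_partial \<Omega> i (\<lambda>x. f x - c) = weak_partial \<Omega> i f"
proof
  fix w
  have c: "weak_partial \<Omega> i (\<lambda>x. c) (\<lambda>x. 0)" for c
    using weak_partial_of_C1[OF has_C1_gradient_const assms] by simp
  show "weak_partial \<Omega> i (\<lambda>x. f x - c) w = weak_partial \<Omega> i f w"
    using weak_partial_diff[OF _ c[of c] assms, where f=f and w=w]
      weak_partial_diff[OF _ c[of "-c"] assms, where f="\<lambda>x. f x - c" and w=w] by auto
qed

lemma weak_partial_AE_unique:
  fixes \<Omega> :: "(real^'n) set"
  assumes w: "weak_partial \<Omega> i f w" and w': "weak_partial \<Omega> i f w'" and "open \<Omega>"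
  shows "AE x in lebesgue_on \<Omega>. w x = w' x"
proof -
  have z: "weak_partial \<Omega> i (\<lambda>x. 0) (\<lambda>x. w x - w' x)"
    using weak_partial_diff[OF w w' \<open>open \<Omega>\<close>] by simp
  have "AE x in lebesgue_on \<Omega>. w x - w' x = 0"
    by (rule AE_zero_if_test_zero[OF \<open>open \<Omega>\<close>]) (use z in \<open>simp_all add: weak_partial_def\<close>)
  then show ?thesis by eventually_elim simp
qed

lemma weak_partial_wpd: "weak_partial \<Omega> i f w \<Longrightarrow> weak_partial \<Omega> i f (wpd \<Omega> i f)"
  unfolding wpd_def by (rule someI[of "weak_partial \<Omega> i f"])

section \<open>Hausdorff measure\<close>

definition gauge_weight :: "real \<Rightarrow> 'a::euclidean_space set \<Rightarrow> ennreal" where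
  "gauge_weight s X = ennreal (unit_ball_vol s * (diameter X / 2) powr s)"

definition fine_covers :: "real \<Rightarrow> 'a::euclidean_space set \<Rightarrow> (nat \<Rightarrow> 'a set) set" where
  "fine_covers \<delta> A = {C. A \<subseteq> (\<Union>n. C n) \<and> (\<forall>n. bounded (C n) \<and> diameter (C n) \<le> \<delta>)}"

definition hausdorff_pre :: "real \<Rightarrow> real \<Rightarrow> 'a::euclidean_space set \<Rightarrow> ennreal" where
  "hausdorff_pre s \<delta> A = (INF C\<in>fine_covers \<delta> A. \<Sum>n. gauge_weight s (C n))"

lemma hausdorff_outer_eq: "hausdorff_outer s A = (SUP \<delta>\<in>{0<..}. hausdorff_pre s \<delta> A)"
  by (simp add: hausdorff_outer_def hausdorff_pre_def fine_covers_def gauge_weight_def)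

lemma gauge_weight_empty [simp]: "gauge_weight s {} = 0"
  by (simp add: gauge_weight_def diameter_def)

lemma hausdorff_pre_le: "C \<in> fine_covers \<delta> A \<Longrightarrow> hausdorff_pre s \<delta> A \<le> (\<Sum>n. gauge_weight s (C n))"
  unfolding hausdorff_pre_def by (rule INF_lower)

lemma hausdorff_pre_mono: "A \<subseteq> B \<Longrightarrow> hausdorff_pre s \<delta> A \<le> hausdorff_pre s \<delta> B"
  unfolding hausdorff_pre_def by (rule INF_superset_mono) (auto simp: fine_covers_def)

lemma hausdorff_pre_antimono: "\<delta> \<le> \<delta>' \<Longrightarrow> hausdorff_pre s \<delta>' A \<le> hausdorff_pre s \<delta> A"
  unfolding hausdorff_pre_def by (rule INF_superset_mono) (auto simp: fine_covers_def intro: order_trans)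

lemma hausdorff_pre_le_outer: "\<delta> > 0 \<Longrightarrow> hausdorff_pre s \<delta> A \<le> hausdorff_outer s A"
  unfolding hausdorff_outer_eq by (rule SUP_upper) simp

lemma hausdorff_outer_mono: "A \<subseteq> B \<Longrightarrow> hausdorff_outer s A \<le> hausdorff_outer s B"
  unfolding hausdorff_outer_eq by (intro SUP_mono) (auto intro: hausdorff_pre_mono)

lemma hausdorff_pre_empty: "\<delta> > 0 \<Longrightarrow> hausdorff_pre s \<delta> {} = 0"
  using hausdorff_pre_le[of "\<lambda>_. {}" \<delta> "{}" s] by (simp add: fine_covers_def diameter_def)

lemma hausdorff_outer_empty [simp]: "hausdorff_outer s {} = 0"
  by (simp add: hausdorff_outer_eq hausdorff_pre_empty cong: SUP_cong_simp)

text \<open>Near-optimal covers of the \<open>A i\<close>, with errors \<open>e/2, e/4, \<dots>\<close>, are merged into one by an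
  enumeration of pairs.\<close>

lemma hausdorff_pre_countably_subadditive:
  fixes A :: "nat \<Rightarrow> 'a::euclidean_space set"
  shows "hausdorff_pre s \<delta> (\<Union>i. A i) \<le> (\<Sum>i. hausdorff_pre s \<delta> (A i))"
proof (rule ennreal_le_epsilon)
  fix e :: real assume e: "0 < e" and fin: "(\<Sum>i. hausdorff_pre s \<delta> (A i)) < top"
  have "\<exists>C. C \<in> fine_covers \<delta> (A i) \<and>
      (\<Sum>n. gauge_weight s (C n)) \<le> hausdorff_pre s \<delta> (A i) + ennreal (e * (1/2) ^ Suc i)" for i
  proof -
    have "hausdorff_pre s \<delta> (A i) < top"
      using fin by (metis ennreal_suminf_lessD)
    then have "hausdorff_pre s \<delta> (A i) < hausdorff_pre s \<delta> (A i) + ennreal (e * (1/2) ^ Suc i)"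
      using e by (simp add: ennreal_add_left_cancel_less[of _ 0, simplified] less_top)
    then have "\<exists>C\<in>fine_covers \<delta> (A i). (\<Sum>n. gauge_weight s (C n)) < hausdorff_pre s \<delta> (A i) + ennreal (e * (1/2) ^ Suc i)"
      by (subst (asm) (1) hausdorff_pre_def) (simp only: INF_less_iff)
    then show ?thesis by (auto intro: less_imp_le)
  qed
  then obtain C where C: "\<And>i. C i \<in> fine_covers \<delta> (A i)"
    "\<And>i. (\<Sum>n. gauge_weight s (C i n)) \<le> hausdorff_pre s \<delta> (A i) + ennreal (e * (1/2) ^ Suc i)"
    by metis
  define D where "D k = C (fst (prod_decode k)) (snd (prod_decode k))" for k
  have "D \<in> fine_covers \<delta> (\<Union>i. A i)"
  proof -
    have "(\<Union>i. A i) \<subseteq> (\<Union>k. D k)"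
    proof
      fix x assume "x \<in> (\<Union>i. A i)"
      then obtain i n where "x \<in> C i n" using C(1) by (force simp: fine_covers_def)
      then have "x \<in> D (prod_encode (i, n))" by (simp add: D_def)
      then show "x \<in> (\<Union>k. D k)" by blast
    qed
    then show ?thesis using C(1) by (auto simp: fine_covers_def D_def)
  qed
  then have "hausdorff_pre s \<delta> (\<Union>i. A i) \<le> (\<Sum>k. gauge_weight s (D k))" by (rule hausdorff_pre_le)
  also have "\<dots> = (\<Sum>i. \<Sum>n. gauge_weight s (C i n))"
    using suminf_ennreal_2dimen[where f="\<lambda>(i, n). gauge_weight s (C i n)" and g="\<lambda>i. \<Sum>n. gauge_weight s (C i n)"]
    by (simp add: D_def comp_def split_beta)
  also have "\<dots> \<le> (\<Sum>i. hausdorff_pre s \<delta> (A i) + ennreal (e * (1/2) ^ Suc i))"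
    by (intro suminf_le C(2)) auto
  also have "\<dots> = (\<Sum>i. hausdorff_pre s \<delta> (A i)) + (\<Sum>i. ennreal (e * (1/2) ^ Suc i))"
    by (rule suminf_add[symmetric]) auto
  also have "(\<Sum>i. ennreal (e * (1/2) ^ Suc i)) = ennreal e"
    using sums_mult[OF power_half_series, of e] e by (intro suminf_ennreal_eq) auto
  finally show "hausdorff_pre s \<delta> (\<Union>i. A i) \<le> (\<Sum>i. hausdorff_pre s \<delta> (A i)) + ennreal e" .
qed

lemma hausdorff_outer_countably_subadditive:
  "hausdorff_outer s (\<Union>i. A i) \<le> (\<Sum>i. hausdorff_outer s (A i))"
  unfolding hausdorff_outer_eq[of s "\<Union>i. A i"]
proof (rule SUP_least)
  fix \<delta> :: real assume "\<delta> \<in> {0<..}"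
  have "hausdorff_pre s \<delta> (\<Union>i. A i) \<le> (\<Sum>i. hausdorff_pre s \<delta> (A i))"
    by (rule hausdorff_pre_countably_subadditive)
  also have "\<dots> \<le> (\<Sum>i. hausdorff_outer s (A i))"
    using \<open>\<delta> \<in> {0<..}\<close> by (intro suminf_le hausdorff_pre_le_outer) auto
  finally show "hausdorff_pre s \<delta> (\<Union>i. A i) \<le> (\<Sum>i. hausdorff_outer s (A i))" .
qed

lemma hausdorff_outer_Un_le: "hausdorff_outer s (A \<union> B) \<le> hausdorff_outer s A + hausdorff_outer s B"
proof -
  have "hausdorff_outer s (A \<union> B) \<le> (\<Sum>i. hausdorff_outer s ((\<lambda>i::nat. if i = 0 then A else if i = 1 then B else {}) i))"
    using hausdorff_outer_countably_subadditive[of s "\<lambda>i::nat. if i = 0 then A else if i = 1 then B else {}"]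
    by (rule order_trans[rotated]) (auto intro!: hausdorff_outer_mono split: if_splits)
  also have "\<dots> = (\<Sum>i<2. hausdorff_outer s ((\<lambda>i::nat. if i = 0 then A else if i = 1 then B else {}) i))"
    by (rule suminf_finite) auto
  finally show ?thesis by (simp add: lessThan_nat_numeral lessThan_Suc numeral_2_eq_2 add.commute)
qed

lemma outer_measure_space_hausdorff_outer:
  "outer_measure_space UNIV (hausdorff_outer s :: 'a::euclidean_space set \<Rightarrow> ennreal)"
  unfolding outer_measure_space_def
  by (auto simp: positive_def increasing_def countably_subadditive_def
      intro: hausdorff_outer_mono hausdorff_outer_countably_subadditive)

text \<open>A set of diameter less than the distance of \<open>A\<close> and \<open>B\<close> meets at most one of them, so every fine
  cover of the union splits into a cover of \<open>A\<close> and one of \<open>B\<close>.\<close>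

lemma hausdorff_outer_separated:
  fixes A B :: "'a::euclidean_space set"
  assumes r: "r > 0" "\<And>a b. a \<in> A \<Longrightarrow> b \<in> B \<Longrightarrow> r \<le> dist a b"
  shows "hausdorff_outer s A + hausdorff_outer s B \<le> hausdorff_outer s (A \<union> B)"
proof -
  have *: "hausdorff_pre s \<delta> A + hausdorff_pre s \<delta> B \<le> hausdorff_pre s \<delta> (A \<union> B)"
    if "\<delta> < r" for \<delta>
    unfolding hausdorff_pre_def[of _ _ "A \<union> B"]
  proof (rule INF_greatest)
    fix C assume C: "C \<in> fine_covers \<delta> (A \<union> B)"
    let ?A = "\<lambda>n. if C n \<inter> A \<noteq> {} then C n else {}" and ?B = "\<lambda>n. if C n \<inter> A = {} then C n else {}"
    have "bounded (C 0)" "diameter (C 0) \<le> \<delta>" using C by (auto simp: fine_covers_def)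
    then have d0: "0 \<le> \<delta>" using diameter_ge_0 by (metis order_trans)
    have de: "diameter ({}::'a set) = 0" by (simp add: diameter_def)
    have "A \<subseteq> (\<Union>n. ?A n)"
    proof
      fix x assume x: "x \<in> A"
      then obtain n where "x \<in> C n" using C by (auto simp: fine_covers_def)
      then have "x \<in> ?A n" using x by auto
      then show "x \<in> (\<Union>n. ?A n)" by blast
    qed
    then have "?A \<in> fine_covers \<delta> A" using C d0 by (auto simp: fine_covers_def de)
    moreover have "C n \<inter> A = {}" if n: "b \<in> C n" "b \<in> B" for b n
    proof (rule ccontr)
      assume "C n \<inter> A \<noteq> {}"
      then obtain a where a: "a \<in> C n" "a \<in> A" by blast
      then have "dist a b \<le> \<delta>" using C n diameter_bounded_bound[of "C n" a b] by (auto simp: fine_covers_def intro: order_trans)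
      then show False using r(2)[OF a(2) n(2)] that(1) \<open>\<delta> < r\<close> by linarith
    qed
    note CA = this
    have "B \<subseteq> (\<Union>n. ?B n)"
    proof
      fix x assume x: "x \<in> B"
      then obtain n where n: "x \<in> C n" using C by (auto simp: fine_covers_def)
      then have "x \<in> ?B n" using CA[OF n x] by simp
      then show "x \<in> (\<Union>n. ?B n)" by blast
    qed
    then have "?B \<in> fine_covers \<delta> B" using C d0 by (auto simp: fine_covers_def de)
    ultimately have "hausdorff_pre s \<delta> A + hausdorff_pre s \<delta> B
        \<le> (\<Sum>n. gauge_weight s (?A n)) + (\<Sum>n. gauge_weight s (?B n))"
      by (intro add_mono hausdorff_pre_le)
    also have "\<dots> = (\<Sum>n. gauge_weight s (?A n) + gauge_weight s (?B n))"
      by (rule suminf_add) auto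
    also have "\<dots> = (\<Sum>n. gauge_weight s (C n))" by (intro suminf_cong) auto
    finally show "hausdorff_pre s \<delta> A + hausdorff_pre s \<delta> B \<le> (\<Sum>n. gauge_weight s (C n))" .
  qed
  have le: "hausdorff_pre s \<delta> A + hausdorff_pre s \<delta>' B \<le> hausdorff_outer s (A \<union> B)" if "\<delta> > 0" "\<delta>' > 0" for \<delta> \<delta>'
  proof -
    define d where "d = min (min \<delta> \<delta>') (r/2)"
    have d: "d > 0" "d < r" "d \<le> \<delta>" "d \<le> \<delta>'" using that r(1) by (auto simp: d_def)
    have "hausdorff_pre s \<delta> A + hausdorff_pre s \<delta>' B \<le> hausdorff_pre s d A + hausdorff_pre s d B"
      by (intro add_mono hausdorff_pre_antimono d)
    also have "\<dots> \<le> hausdorff_pre s d (A \<union> B)" by (rule *[OF d(2)])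
    also have "\<dots> \<le> hausdorff_outer s (A \<union> B)" by (rule hausdorff_pre_le_outer[OF d(1)])
    finally show ?thesis .
  qed
  have "hausdorff_outer s A + hausdorff_pre s \<delta>' B \<le> hausdorff_outer s (A \<union> B)" if "\<delta>' > 0" for \<delta>'
  proof -
    have "hausdorff_outer s A + hausdorff_pre s \<delta>' B = (SUP \<delta>\<in>{0<..}. hausdorff_pre s \<delta> A + hausdorff_pre s \<delta>' B)"
      unfolding hausdorff_outer_eq by (rule ennreal_SUP_add_left[symmetric]) auto
    also have "\<dots> \<le> hausdorff_outer s (A \<union> B)" using le that by (intro SUP_least) auto
    finally show ?thesis .
  qed
  then have "(SUP \<delta>\<in>{0<..}. hausdorff_outer s A + hausdorff_pre s \<delta> B) \<le> hausdorff_outer s (A \<union> B)"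
    by (intro SUP_least) auto
  also have "(SUP \<delta>\<in>{0<..}. hausdorff_outer s A + hausdorff_pre s \<delta> B) = hausdorff_outer s A + hausdorff_outer s B"
    unfolding hausdorff_outer_eq[of s B]
    using ennreal_SUP_add_left[of "{0<..}" "\<lambda>\<delta>. hausdorff_pre s \<delta> B" "hausdorff_outer s A"]
    by (auto simp: add.commute)
  finally show ?thesis .
qed

text \<open>Caratheodory's criterion. With \<open>B n\<close> the part of \<open>A\<close> at distance at least \<open>1/(n+1)\<close> from \<open>F\<close>,
  additivity on separated sets gives the claim for \<open>B n\<close> in place of \<open>A - F\<close>. The remainder lies in
  the shells \<open>R k\<close> with \<open>k \<ge> n\<close>; shells whose indices differ by at least 2 are separated, so the even
  ones and the odd ones each have total measure at most that of \<open>A\<close>, and the tail of this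
  convergent series tends to 0.\<close>

lemma closed_in_lambda_system_hausdorff:
  fixes F :: "'a::euclidean_space set"
  assumes "closed F"
  shows "F \<in> lambda_system UNIV UNIV (hausdorff_outer s)"
proof (cases "F = {}")
  case False
  let ?H = "hausdorff_outer s"
  have "?H (A \<inter> F) + ?H (A - F) \<le> ?H A" for A
  proof (cases "?H A = top")
    case False
    then have fin: "?H A < top" by (simp add: less_top)
    define r where "r n = 1 / real (Suc n)" for n
    define B where "B n = {x \<in> A. r n \<le> infdist x F}" for n
    define R where "R n = {x \<in> A. r (Suc n) \<le> infdist x F \<and> infdist x F < r n}" for n
    have rpos: "r n > 0" for n by (simp add: r_def)
    have rdec: "r n \<le> r m" if "m \<le> n" for m n using that by (simp add: r_def frac_le)
    have rdec': "r (Suc n) < r n" for n by (simp add: r_def frac_less2)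
    have lip: "infdist x F - infdist y F \<le> dist x y" for x y using infdist_triangle[of x F y] by simp
    have step: "?H (A \<inter> F) + ?H (B n) \<le> ?H A" for n
    proof -
      have "?H (A \<inter> F) + ?H (B n) \<le> ?H ((A \<inter> F) \<union> B n)"
      proof (rule hausdorff_outer_separated[OF rpos[of n]])
        show "r n \<le> dist a b" if "a \<in> A \<inter> F" "b \<in> B n" for a b
          using that infdist_le[of a F b] by (simp add: B_def dist_commute)
      qed
      also have "\<dots> \<le> ?H A" by (rule hausdorff_outer_mono) (auto simp: B_def)
      finally show ?thesis .
    qed
    have odd: "(\<Sum>k<m. ?H (R (2*k + j))) \<le> ?H (\<Union>k<m. R (2*k + j))" for m j
    proof (induction m)
      case (Suc m)
      have "(\<Sum>k<Suc m. ?H (R (2*k + j))) \<le> ?H (\<Union>k<m. R (2*k + j)) + ?H (R (2*m + j))"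
        using Suc.IH by (simp add: add_right_mono)
      also have "\<dots> \<le> ?H ((\<Union>k<m. R (2*k + j)) \<union> R (2*m + j))"
      proof (cases "m = 0")
        case False
        show ?thesis
        proof (rule hausdorff_outer_separated[of "r (2*m+j-1) - r (2*m+j)"])
        show "r (2*m+j-1) - r (2*m+j) \<le> dist a b" if ab: "a \<in> (\<Union>k<m. R (2*k + j))" "b \<in> R (2*m + j)" for a b
        proof -
          obtain k where k: "k < m" "a \<in> R (2*k+j)" using ab by blast
          then have "r (2*m+j-1) \<le> r (Suc (2*k+j))" by (intro rdec) auto
          also have "\<dots> \<le> infdist a F" using k by (simp add: R_def)
          finally show ?thesis using ab(2) lip[of a b] by (simp add: R_def)
        qed
        show "r (2*m+j-1) - r (2*m+j) > 0"
          using rdec'[of "2*m+j-1"] False by (cases "2*m+j") auto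
        qed
      qed simp
      also have "(\<Union>k<m. R (2*k + j)) \<union> R (2*m + j) = (\<Union>k<Suc m. R (2*k + j))" by (auto simp: less_Suc_eq)
      finally show ?case .
    qed simp
    have evenodd: "(\<Sum>k<n. ?H (R k)) \<le> 2 * ?H A" for n
    proof -
      have "(\<Sum>k<n. ?H (R k)) \<le> (\<Sum>k<2*n. ?H (R k))" by (rule sum_mono2) auto
      also have "\<dots> = (\<Sum>k<n. ?H (R (2*k + 0))) + (\<Sum>k<n. ?H (R (2*k + 1)))"
        by (induction n) (auto simp: algebra_simps)
      also have "\<dots> \<le> ?H (\<Union>k<n. R (2*k + 0)) + ?H (\<Union>k<n. R (2*k + 1))" by (intro add_mono odd)
      also have "\<dots> \<le> ?H A + ?H A" by (intro add_mono hausdorff_outer_mono) (auto simp: R_def)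
      finally show ?thesis by (simp add: mult_2)
    qed
    define f where "f n = enn2real (?H (R n))" for n
    have Rfin: "?H (R n) < top" for n
      using fin hausdorff_outer_mono[of "R n" A s] by (auto simp: R_def intro: le_less_trans)
    then have f: "?H (R n) = ennreal (f n)" for n by (simp add: f_def less_top)
    have f0: "f n \<ge> 0" for n by (simp add: f_def)
    have "summable f"
    proof (rule summableI_nonneg_bounded[OF f0])
      fix n
      have "ennreal (\<Sum>k<n. f k) \<le> 2 * ?H A" using evenodd[of n] by (simp add: f sum_ennreal f0)
      moreover have "2 * ?H A < top" using fin by (simp add: ennreal_mult_less_top)
      ultimately have "enn2real (ennreal (\<Sum>k<n. f k)) \<le> enn2real (2 * ?H A)" by (rule enn2real_mono)
      then show "(\<Sum>k<n. f k) \<le> enn2real (2 * ?H A)" by (simp add: sum_nonneg f0)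
    qed
    have cover: "A - F \<subseteq> B n \<union> (\<Union>k. R (k + n))" for n
    proof
      fix x assume x: "x \<in> A - F"
      then have pos: "infdist x F > 0"
        using \<open>closed F\<close> \<open>F \<noteq> {}\<close> in_closed_iff_infdist_zero infdist_nonneg by (metis DiffD2 less_eq_real_def)
      show "x \<in> B n \<union> (\<Union>k. R (k + n))"
      proof (cases "r n \<le> infdist x F")
        case False
        obtain m where m: "r m < infdist x F" using reals_Archimedean[OF pos] by (auto simp: r_def inverse_eq_divide)
        define k where "k = (LEAST k. r k \<le> infdist x F)"
        have k: "r k \<le> infdist x F" unfolding k_def by (rule LeastI[of "\<lambda>k. r k \<le> infdist x F" m]) (use m in simp)
        have "k > n" using False k rdec[of k n] by (metis not_le order_trans)
        then obtain l where l: "k = Suc (l + n)" by (metis add.commute less_iff_Suc_add)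
        have "\<not> r (l + n) \<le> infdist x F" using not_less_Least[of "l+n" "\<lambda>k. r k \<le> infdist x F"] l by (simp add: k_def)
        then have "x \<in> R (l + n)" using k l x by (simp add: R_def)
        then show ?thesis by blast
      qed (use x in \<open>simp add: B_def\<close>)
    qed
    show ?thesis
    proof (rule ennreal_le_epsilon)
      fix e :: real assume e: "0 < e"
      obtain n where n: "norm (\<Sum>i. f (i + n)) < e" using suminf_exist_split[OF e \<open>summable f\<close>] by blast
      have "?H (A - F) \<le> ?H (B n) + ?H (\<Union>k. R (k + n))"
        using hausdorff_outer_mono[OF cover[of n], of s] hausdorff_outer_Un_le by (rule order_trans)
      also have "?H (\<Union>k. R (k + n)) \<le> (\<Sum>k. ?H (R (k + n)))" by (rule hausdorff_outer_countably_subadditive)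
      also have "\<dots> = ennreal (\<Sum>k. f (k + n))"
        unfolding f using \<open>summable f\<close> f0 by (intro suminf_ennreal2) (auto simp: summable_iff_shift)
      also have "\<dots> \<le> ennreal e" using n by (intro ennreal_leI) simp
      finally have "?H (A - F) \<le> ?H (B n) + ennreal e" by (simp add: add_left_mono)
      then have "?H (A \<inter> F) + ?H (A - F) \<le> ?H (A \<inter> F) + ?H (B n) + ennreal e" by (simp add: add_left_mono add.assoc)
      also have "\<dots> \<le> ?H A + ennreal e" by (intro add_right_mono step)
      finally show "?H (A \<inter> F) + ?H (A - F) \<le> ?H A + ennreal e" .
    qed
  qed simp
  moreover have "?H A \<le> ?H (A \<inter> F) + ?H (A - F)" for A
    using hausdorff_outer_Un_le[of s "A \<inter> F" "A - F"] by (simp add: Int_Diff_Un)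
  ultimately have "?H (F \<inter> A) + ?H ((UNIV - F) \<inter> A) = ?H A" for A
    by (metis Compl_eq_Diff_UNIV Diff_eq Int_commute antisym)
  then show ?thesis by (simp add: lambda_system_def)
qed (simp add: lambda_system_def)

lemma measure_space_hausdorff:
  "measure_space UNIV (lambda_system UNIV UNIV (hausdorff_outer s)) (hausdorff_outer s :: 'a::euclidean_space set \<Rightarrow> ennreal)"
  using sigma_algebra.caratheodory_lemma[OF sigma_algebra_Pow, of UNIV "hausdorff_outer s :: 'a set \<Rightarrow> ennreal"]
    outer_measure_space_hausdorff_outer[of s, where 'a='a] by simp

lemma sets_hausdorff_measure:
  "sets (hausdorff_measure s :: 'a::euclidean_space measure) = lambda_system UNIV UNIV (hausdorff_outer s)"
  using measure_space_hausdorff[of s, where 'a='a]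
  by (simp add: hausdorff_measure_def sigma_algebra.sigma_sets_eq measure_space_def)

lemma space_hausdorff_measure [simp]: "space (hausdorff_measure s) = UNIV"
  by (simp add: hausdorff_measure_def space_measure_of_conv)

lemma borel_subset_hausdorff:
  fixes A :: "'a::euclidean_space set"
  shows "A \<in> sets borel \<Longrightarrow> A \<in> sets (hausdorff_measure s)"
proof -
  assume A: "A \<in> sets borel"
  have "sigma_algebra UNIV (lambda_system UNIV UNIV (hausdorff_outer s :: 'a set \<Rightarrow> ennreal))"
    using measure_space_hausdorff[of s, where 'a='a] by (simp add: measure_space_def)
  then have "sigma_sets UNIV (Collect closed :: 'a set set) \<subseteq> lambda_system UNIV UNIV (hausdorff_outer s)"
    by (rule sigma_algebra.sigma_sets_subset) (auto intro: closed_in_lambda_system_hausdorff)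
  then show ?thesis using A by (auto simp: sets_hausdorff_measure borel_eq_closed)
qed

lemma emeasure_hausdorff_measure:
  fixes A :: "'a::euclidean_space set"
  shows "A \<in> sets (hausdorff_measure s) \<Longrightarrow> emeasure (hausdorff_measure s) A = hausdorff_outer s A"
  unfolding sets_hausdorff_measure hausdorff_measure_def
  using measure_space_hausdorff[of s, where 'a='a]
  by (intro emeasure_measure_of_sigma) (auto simp: measure_space_def sigma_algebra.sigma_sets_eq)

text \<open>The cylinder of height \<open>L\<close> over a set of diameter at most \<open>d\<close> is covered by about \<open>L/d + 1\<close> balls of
  radius \<open>2d\<close>, centred at distance \<open>d\<close> from each other along the axis. Because \<open>d \<le> 1\<close> their total
  volume is of the order of \<open>d^(n-1)\<close>. Covering by balls makes the direction of the axis
  irrelevant.\<close>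

lemma cylinder_content_le:
  fixes X :: "'a::euclidean_space set"
  assumes X: "bounded X" "diameter X \<le> d" and d: "0 < d" "d \<le> 1" and "norm e = 1" "L \<ge> 0"
  shows "emeasure lborel {x + t *\<^sub>R e | x t. x \<in> closure X \<and> t \<in> {0..L}}
    \<le> ennreal ((L + 1) * unit_ball_vol DIM('a) * 2 ^ DIM('a) * d ^ (DIM('a) - 1))"
proof (cases "X = {}")
  case False
  then obtain p where p: "p \<in> X" by blast
  define m where "m = nat \<lfloor>L / d\<rfloor>"
  let ?N = "DIM('a)"
  have N: "?N \<ge> 1" using DIM_positive by (simp add: Suc_leI)
  let ?B = "{x + t *\<^sub>R e | x t. x \<in> closure X \<and> t \<in> {0..L}}"
  let ?C = "\<lambda>j. cball (p + (real j * d) *\<^sub>R e) (2 * d)"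
  have sub: "?B \<subseteq> (\<Union>j\<le>m. ?C j)"
  proof
    fix y assume "y \<in> ?B"
    then obtain x t where y: "y = x + t *\<^sub>R e" "x \<in> closure X" "0 \<le> t" "t \<le> L" by auto
    have xp: "dist x p \<le> d"
      using diameter_bounded_bound[of "closure X" x p] X y(2) p closure_subset diameter_closure[OF X(1)]
      by (metis bounded_closure order_trans subsetD)
    define j where "j = nat \<lfloor>t / d\<rfloor>"
    have "\<lfloor>t/d\<rfloor> \<ge> 0" using y d by simp
    then have j: "real j \<le> t / d" "t / d < real j + 1" unfolding j_def by linarith+
    have "j \<le> m" unfolding j_def m_def using y d by (intro nat_mono floor_mono divide_right_mono) auto
    have "y - (p + (real j * d) *\<^sub>R e) = (x - p) + (t - real j * d) *\<^sub>R e" by (simp add: y algebra_simps)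
    then have "norm (y - (p + (real j * d) *\<^sub>R e)) \<le> norm (x - p) + norm ((t - real j * d) *\<^sub>R e)"
      by (metis norm_triangle_ineq)
    also have "\<dots> \<le> d + \<bar>t - real j * d\<bar>" using xp assms by (simp add: dist_norm)
    also have "\<bar>t - real j * d\<bar> \<le> d" using j d by (simp add: field_simps)
    finally have "y \<in> ?C j" by (simp add: dist_norm norm_minus_commute)
    then show "y \<in> (\<Union>j\<le>m. ?C j)" using \<open>j \<le> m\<close> by blast
  qed
  have "emeasure lborel ?B \<le> emeasure lborel (\<Union>j\<le>m. ?C j)"
    by (rule emeasure_mono[OF sub]) auto
  also have "\<dots> \<le> (\<Sum>j\<le>m. emeasure lborel (?C j))"
    by (rule emeasure_subadditive_finite) auto
  also have "\<dots> = (\<Sum>j\<le>m. ennreal (unit_ball_vol ?N * (2 * d) ^ ?N))"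
    using d by (simp add: emeasure_cball)
  also have "\<dots> = ennreal ((real m + 1) * (unit_ball_vol ?N * (2 * d) ^ ?N))"
    using d by (simp add: ennreal_mult'' ennreal_of_nat_eq_real_of_nat[symmetric] ennreal_mult ennreal_plus[symmetric] del: ennreal_plus)
       (simp add: ennreal_mult' ennreal_of_nat_eq_real_of_nat add.commute)
  also have "\<dots> \<le> ennreal ((L + 1) * unit_ball_vol ?N * 2 ^ ?N * d ^ (?N - 1))"
  proof (rule ennreal_leI)
    have "real m \<le> L / d" using d \<open>L \<ge> 0\<close> by (simp add: m_def)
    then have "(real m + 1) * d \<le> L + 1" using d by (simp add: field_simps)
    moreover have "d ^ ?N = d * d ^ (?N - 1)" using N by (metis power_eq_if not_one_le_zero)
    ultimately have "(real m + 1) * d ^ ?N \<le> (L + 1) * d ^ (?N - 1)"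
      using d by (simp add: mult.assoc[symmetric] mult_right_mono)
    then have "(real m + 1) * d ^ ?N * (unit_ball_vol ?N * 2 ^ ?N) \<le> (L + 1) * d ^ (?N - 1) * (unit_ball_vol ?N * 2 ^ ?N)"
      by (rule mult_right_mono) simp
    then show "(real m + 1) * (unit_ball_vol ?N * (2 * d) ^ ?N) \<le> (L + 1) * unit_ball_vol ?N * 2 ^ ?N * d ^ (?N - 1)"
      by (simp add: power_mult_distrib mult_ac)
  qed
  finally show ?thesis .
qed simp

lemma cylinder_compact:
  fixes X :: "'a::euclidean_space set"
  assumes "bounded X"
  shows "compact {x + t *\<^sub>R e | x t. x \<in> closure X \<and> t \<in> {0..L::real}}"
proof -
  have "{x + t *\<^sub>R e | x t. x \<in> closure X \<and> t \<in> {0..L}} = {x + y | x y. x \<in> closure X \<and> y \<in> (\<lambda>t. t *\<^sub>R e) ` {0..L}}"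
    by blast
  also have "compact \<dots>"
    using assms by (intro compact_sums compact_continuous_image continuous_intros) (auto simp: compact_closure)
  finally show ?thesis .
qed

text \<open>If the diameter is 0, the preceding bound holds for every \<open>d\<close> in \<open>(0,1]\<close>, and \<open>d\<close> tends to 0.\<close>

lemma cylinder_content_le_diameter:
  fixes X :: "'a::euclidean_space set"
  assumes X: "bounded X" "diameter X \<le> 1" and e: "norm e = 1" "L \<ge> 0" and N: "DIM('a) \<ge> 2"
  shows "emeasure lborel {x + t *\<^sub>R e | x t. x \<in> closure X \<and> t \<in> {0..L}}
    \<le> ennreal ((L + 1) * unit_ball_vol DIM('a) * 2 ^ DIM('a) * diameter X ^ (DIM('a) - 1))"
proof (cases "diameter X = 0")
  case False
  then have "0 < diameter X" using diameter_ge_0[OF X(1)] by simp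
  then show ?thesis using cylinder_content_le[OF X(1) order_refl _ X(2) e] by simp
next
  case True
  let ?B = "{x + t *\<^sub>R e | x t. x \<in> closure X \<and> t \<in> {0..L}}"
  let ?c = "(L + 1) * unit_ball_vol DIM('a) * 2 ^ DIM('a)"
  have "(\<lambda>n. ?c * (1 / real (Suc n)) ^ (DIM('a) - 1)) \<longlonglongrightarrow> ?c * 0 ^ (DIM('a) - 1)"
    using LIMSEQ_inverse_real_of_nat by (intro tendsto_intros) (simp add: divide_inverse)
  then have "(\<lambda>n. ennreal (?c * (1 / real (Suc n)) ^ (DIM('a) - 1))) \<longlonglongrightarrow> ennreal (?c * 0 ^ (DIM('a) - 1))"
    by (rule tendsto_ennrealI)
  then have "emeasure lborel ?B \<le> ennreal (?c * 0 ^ (DIM('a) - 1))"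
  proof (rule LIMSEQ_le_const, intro exI[of _ 0] allI impI)
    fix n
    show "emeasure lborel ?B \<le> ennreal (?c * (1 / real (Suc n)) ^ (DIM('a) - 1))"
      by (rule cylinder_content_le[OF X(1) _ _ _ e]) (use True in auto)
  qed
  then show ?thesis using True by simp
qed

text \<open>Every cover of \<open>A\<close> by sets of diameter at most 1 induces a cover of the cylinder over \<open>A\<close>, whose
  content is at most a constant times the sum of the weights of the cover.\<close>

lemma content_le_hausdorff_outer:
  fixes e :: "'a::euclidean_space"
  assumes e: "norm e = 1" "L \<ge> 0" and N: "DIM('a) \<ge> 2"
  obtains c where "c \<ge> 0" "\<And>S A. S \<in> sets borel \<Longrightarrow> S \<subseteq> {x + t *\<^sub>R e | x t. x \<in> A \<and> t \<in> {0..L}} \<Longrightarrow>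
    emeasure lborel S \<le> ennreal c * hausdorff_outer (real DIM('a) - 1) A"
proof -
  let ?N = "DIM('a)"
  define s where "s = real ?N - 1"
  have s: "s > 0" "s = real (?N - 1)" using N by (auto simp: s_def)
  have us: "unit_ball_vol s > 0" using s by (simp add: unit_ball_vol_pos)
  define k where "k = (L + 1) * unit_ball_vol ?N * 2 ^ ?N"
  have k0: "k > 0" using e by (simp add: k_def unit_ball_vol_pos)
  define c where "c = k * 2 powr s / unit_ball_vol s"
  have c0: "c > 0" using k0 us by (simp add: c_def)
  have cyl: "emeasure lborel {x + t *\<^sub>R e | x t. x \<in> closure X \<and> t \<in> {0..L}} \<le> ennreal c * gauge_weight s X"
    if X: "bounded X" "diameter X \<le> 1" for X :: "'a set"
  proof -
    have d0: "diameter X \<ge> 0" by (rule diameter_ge_0[OF X(1)])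
    have "diameter X ^ (?N - 1) = diameter X powr s"
    proof (cases "diameter X = 0")
      case True then show ?thesis using s N by simp
    next
      case False
      then show ?thesis unfolding s(2) using powr_realpow[of "diameter X" "?N - 1"] d0 by (metis less_le)
    qed
    then have "k * diameter X ^ (?N - 1) = c * (unit_ball_vol s * (diameter X / 2) powr s)"
      using us d0 by (simp add: c_def powr_divide)
    then show ?thesis using cylinder_content_le_diameter[OF X e N] c0
      by (simp add: gauge_weight_def k_def ennreal_mult'[symmetric] us less_imp_le)
  qed
  show thesis
  proof (rule that[of c])
    show "c \<ge> 0" using c0 by simp
    fix S A assume S: "S \<in> sets borel" "S \<subseteq> {x + t *\<^sub>R e | x t. x \<in> A \<and> t \<in> {0..L}}"
    have "ennreal (1/c) * emeasure lborel S \<le> hausdorff_pre s 1 A"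
      unfolding hausdorff_pre_def
    proof (rule INF_greatest)
      fix C assume C: "C \<in> fine_covers 1 A"
      let ?B = "\<lambda>n. {x + t *\<^sub>R e | x t. x \<in> closure (C n) \<and> t \<in> {0..L}}"
      have B: "?B n \<in> sets lborel" for n
        using cylinder_compact[of "C n" e L] C by (auto simp: fine_covers_def borel_compact)
      have "S \<subseteq> (\<Union>n. ?B n)"
      proof
        fix y assume "y \<in> S"
        then obtain x t where "y = x + t *\<^sub>R e" "x \<in> A" "t \<in> {0..L}" using S by blast
        moreover then obtain n where "x \<in> C n" using C by (auto simp: fine_covers_def)
        ultimately show "y \<in> (\<Union>n. ?B n)" using closure_subset by blast
      qed
      then have "emeasure lborel S \<le> emeasure lborel (\<Union>n. ?B n)" using B by (intro emeasure_mono) auto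
      also have "\<dots> \<le> (\<Sum>n. emeasure lborel (?B n))"
        using B by (intro emeasure_subadditive_countably) auto
      also have "\<dots> \<le> (\<Sum>n. ennreal c * gauge_weight s (C n))"
        using C by (intro suminf_le cyl) (auto simp: fine_covers_def)
      finally have "ennreal (1/c) * emeasure lborel S \<le> ennreal (1/c) * (ennreal c * (\<Sum>n. gauge_weight s (C n)))"
        by (intro mult_left_mono) auto
      also have "\<dots> = (\<Sum>n. gauge_weight s (C n))"
        using c0 by (simp add: mult.assoc[symmetric] ennreal_mult'[symmetric])
      finally show "ennreal (1/c) * emeasure lborel S \<le> (\<Sum>n. gauge_weight s (C n))" .
    qed
    also have "\<dots> \<le> hausdorff_outer s A" by (rule hausdorff_pre_le_outer) simp
    finally have "ennreal c * (ennreal (1/c) * emeasure lborel S) \<le> ennreal c * hausdorff_outer s A"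
      by (intro mult_left_mono) auto
    then show "emeasure lborel S \<le> ennreal c * hausdorff_outer (real DIM('a) - 1) A"
      using c0 by (simp add: mult.assoc[symmetric] ennreal_mult'[symmetric] s_def)
  qed
qed

text \<open>A packing argument. A \<open>\<delta>\<close>-separated subset of \<open>A\<close> carries disjoint balls of radius \<open>\<delta>/2\<close> inside a
  set of measure at most \<open>M \<delta>\<close>, so it has at most a constant times \<open>\<delta>^(1-n)\<close> elements; the \<open>\<delta>\<close>-balls
  around a largest one cover \<open>A\<close>, with a total weight that does not depend on \<open>\<delta>\<close>.\<close>

lemma hausdorff_outer_finite_if_thin:
  fixes A :: "'a::euclidean_space set"
  assumes N: "DIM('a) \<ge> 2" and M: "M \<ge> 0"
    and thin: "\<And>\<delta>. 0 < \<delta> \<Longrightarrow> \<delta> \<le> 1 \<Longrightarrow> \<exists>S\<in>sets borel. (\<Union>a\<in>A. cball a \<delta>) \<subseteq> S \<and> emeasure lborel S \<le> ennreal (M * \<delta>)"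
  shows "hausdorff_outer (real DIM('a) - 1) A < top"
proof -
  let ?N = "DIM('a)"
  define s where "s = real ?N - 1"
  have s: "s > 0" "s = real (?N - 1)" using N by (auto simp: s_def)
  define V where "V = unit_ball_vol ?N / 2 ^ ?N"
  have V0: "V > 0" by (simp add: V_def unit_ball_vol_pos)
  define K where "K = M / V * unit_ball_vol s"
  have bound: "hausdorff_pre s (2 * \<delta>) A \<le> ennreal K" if \<delta>: "0 < \<delta>" "\<delta> \<le> 1" for \<delta>
  proof -
    obtain S where S: "S \<in> sets borel" "(\<Union>a\<in>A. cball a \<delta>) \<subseteq> S" "emeasure lborel S \<le> ennreal (M * \<delta>)"
      using thin[OF \<delta>] by blast
    define packing where "packing P \<longleftrightarrow> finite P \<and> P \<subseteq> A \<and> (\<forall>p\<in>P. \<forall>q\<in>P. p \<noteq> q \<longrightarrow> dist p q > \<delta>)" for P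
    have card: "real (card P) * (V * \<delta> ^ ?N) \<le> M * \<delta>" if P: "packing P" for P
    proof -
      have "ennreal (real (card P) * (V * \<delta> ^ ?N)) = (\<Sum>p\<in>P. ennreal (V * \<delta> ^ ?N))"
        using V0 \<delta> by (simp add: ennreal_mult' ennreal_of_nat_eq_real_of_nat)
      also have "\<dots> = (\<Sum>p\<in>P. emeasure lborel (ball p (\<delta>/2)))"
        using \<delta> by (simp add: emeasure_ball V_def power_divide)
      also have "\<dots> = emeasure lborel (\<Union>p\<in>P. ball p (\<delta>/2))"
      proof (rule sum_emeasure)
        show "disjoint_family_on (\<lambda>p. ball p (\<delta>/2)) P"
          unfolding disjoint_family_on_def
        proof (intro ballI impI, rule ccontr)
          fix p q assume pq: "p \<in> P" "q \<in> P" "p \<noteq> q" "ball p (\<delta>/2) \<inter> ball q (\<delta>/2) \<noteq> {}"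
          then obtain z where "dist p z < \<delta>/2" "dist q z < \<delta>/2" by auto
          then have "dist p q < \<delta>" using dist_triangle_half_l by (metis dist_commute)
          moreover have "dist p q > \<delta>" using P pq unfolding packing_def by blast
          ultimately show False by simp
        qed
      qed (use P in \<open>auto simp: packing_def\<close>)
      also have "\<dots> \<le> emeasure lborel S"
      proof (rule emeasure_mono)
        have "ball p (\<delta>/2) \<subseteq> cball p \<delta>" for p :: 'a using \<delta> by (intro subset_trans[OF ball_subset_cball] subset_cball) simp
        then show "(\<Union>p\<in>P. ball p (\<delta>/2)) \<subseteq> S" using S(2) P unfolding packing_def by blast
      qed (use S in simp)
      also have "\<dots> \<le> ennreal (M * \<delta>)" by (rule S(3))
      finally show ?thesis using M \<delta> by (subst (asm) ennreal_le_iff) auto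
    qed
    have vpos: "V * \<delta> ^ ?N > 0" using V0 \<delta> by simp
    have cardb: "card P \<le> nat \<lceil>M * \<delta> / (V * \<delta> ^ ?N)\<rceil>" if "packing P" for P
    proof -
      have "real (card P) \<le> M * \<delta> / (V * \<delta> ^ ?N)" using card[OF that] vpos by (simp add: le_divide_eq)
      also have "\<dots> \<le> real (nat \<lceil>M * \<delta> / (V * \<delta> ^ ?N)\<rceil>)" by (rule real_nat_ceiling_ge)
      finally show ?thesis by simp
    qed
    \<comment> \<open>a packing with the largest number of points is maximal, hence a net\<close>
    have "\<exists>P. packing P \<and> (\<forall>Q. packing Q \<longrightarrow> card Q \<le> card P)"
    proof (rule ex_has_greatest_nat)
      show "packing {}" by (simp add: packing_def)
      show "\<forall>Q. packing Q \<longrightarrow> card Q < Suc (nat \<lceil>M * \<delta> / (V * \<delta> ^ ?N)\<rceil>)"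
        using cardb by (simp add: less_Suc_eq_le)
    qed
    then obtain P where P: "packing P" "\<And>Q. packing Q \<Longrightarrow> card Q \<le> card P" by blast
    have finP: "finite P" using P(1) by (simp add: packing_def)
    have cov: "A \<subseteq> (\<Union>p\<in>P. cball p \<delta>)"
    proof
      fix a assume a: "a \<in> A"
      show "a \<in> (\<Union>p\<in>P. cball p \<delta>)"
      proof (rule ccontr)
        assume *: "a \<notin> (\<Union>p\<in>P. cball p \<delta>)"
        then have "packing (insert a P)" using P(1) a by (auto simp: packing_def dist_commute not_le)
        moreover have "a \<notin> P" using * \<delta> by auto
        ultimately show False using P(2)[of "insert a P"] finP by simp
      qed
    qed
    obtain h where h: "bij_betw h {..<card P} P" using ex_bij_betw_nat_finite[OF finP] by (auto simp: atLeast0LessThan)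
    define C where "C n = (if n < card P then cball (h n) \<delta> else {})" for n
    have "C \<in> fine_covers (2 * \<delta>) A"
      unfolding fine_covers_def
    proof (intro CollectI conjI allI)
      show "A \<subseteq> (\<Union>n. C n)"
      proof
        fix a assume "a \<in> A"
        then obtain p where "p \<in> P" "a \<in> cball p \<delta>" using cov by blast
        moreover then obtain n where "n < card P" "p = h n" using h by (auto simp: bij_betw_def)
        ultimately have "a \<in> C n" by (simp add: C_def)
        then show "a \<in> (\<Union>n. C n)" by blast
      qed
      show "bounded (C n)" "diameter (C n) \<le> 2 * \<delta>" for n using \<delta> by (auto simp: C_def diameter_def[of "{}"])
    qed
    then have "hausdorff_pre s (2 * \<delta>) A \<le> (\<Sum>n. gauge_weight s (C n))" by (rule hausdorff_pre_le)
    also have "\<dots> = (\<Sum>n<card P. gauge_weight s (C n))" by (rule suminf_finite) (auto simp: C_def)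
    also have "\<dots> = (\<Sum>n<card P. ennreal (unit_ball_vol s * \<delta> powr s))"
      using \<delta> by (intro sum.cong) (auto simp: C_def gauge_weight_def)
    also have "\<dots> = ennreal (real (card P) * (unit_ball_vol s * \<delta> powr s))"
      using s by (simp add: ennreal_mult' ennreal_of_nat_eq_real_of_nat)
    also have "\<dots> \<le> ennreal K"
    proof (rule ennreal_leI)
      have "\<delta> powr s = \<delta> ^ (?N - 1)" unfolding s(2) using \<delta> by (intro powr_realpow)
      moreover have "Suc (?N - 1) = ?N" using N by simp
      ultimately have "\<delta> ^ ?N = \<delta> * \<delta> powr s" by (metis power_Suc)
      then have "real (card P) * \<delta> powr s * (V * \<delta>) \<le> M * \<delta>" using card[OF P(1)] by (simp add: mult_ac)
      then have "real (card P) * \<delta> powr s \<le> M / V" using \<delta> V0 by (simp add: field_simps)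
      then have "real (card P) * \<delta> powr s * unit_ball_vol s \<le> M / V * unit_ball_vol s"
        using s by (intro mult_right_mono) auto
      then show "real (card P) * (unit_ball_vol s * \<delta> powr s) \<le> K" by (simp add: K_def mult_ac)
    qed
    finally show ?thesis .
  qed
  have "hausdorff_outer s A \<le> ennreal K"
    unfolding hausdorff_outer_eq
  proof (rule SUP_least)
    fix \<eta> :: real assume "\<eta> \<in> {0<..}"
    then have \<eta>: "0 < min 1 (\<eta>/2)" by auto
    have "hausdorff_pre s \<eta> A \<le> hausdorff_pre s (2 * min 1 (\<eta>/2)) A" by (rule hausdorff_pre_antimono) auto
    also have "\<dots> \<le> ennreal K" by (rule bound[OF \<eta>]) simp
    finally show "hausdorff_pre s \<eta> A \<le> ennreal K" .
  qed
  then show ?thesis by (simp add: s_def le_less_trans[OF _ ennreal_less_top])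
qed

section \<open>Graph charts of the boundary\<close>

text \<open>A defining function in the direction \<open>e\<close>: such \<open>H\<close> has the form \<open>h(\<pi> x) - x \<cdot> e\<close> with \<open>\<pi>\<close> the
  projection along \<open>e\<close>. It falls with slope 1 along \<open>e\<close>, and its gradient is constant along \<open>e\<close>.\<close>

definition graph_function :: "real^'n \<Rightarrow> (real^'n \<Rightarrow> real) \<Rightarrow> (real^'n \<Rightarrow> real^'n) \<Rightarrow> bool" where
  "graph_function e H H' \<longleftrightarrow> norm e = 1 \<and> has_C1_gradient H H' \<and>
     (\<forall>x t. H (x + t *\<^sub>R e) = H x - t) \<and> (\<forall>x t. H' (x + t *\<^sub>R e) = H' x)"

definition boundary_chart ::
  "(real^'n) set \<Rightarrow> real^'n \<Rightarrow> real \<Rightarrow> real^'n \<Rightarrow> (real^'n \<Rightarrow> real) \<Rightarrow> (real^'n \<Rightarrow> real^'n) \<Rightarrow> bool" where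
  "boundary_chart \<Omega> x0 r e H H' \<longleftrightarrow> 0 < r \<and> graph_function e H H' \<and>
     \<Omega> \<inter> ball x0 r = {x \<in> ball x0 r. H x < 0}"

lemma boundary_chart_exists:
  fixes \<Omega> :: "(real^'n) set"
  assumes "C2_holder_boundary \<gamma> \<Omega>" "x0 \<in> frontier \<Omega>"
  obtains r e H H' where "boundary_chart \<Omega> x0 r e H H'"
proof -
  obtain r e h where r: "r > 0" and e: "norm e = 1" and h: "C2_holder \<gamma> h"
    and \<Omega>: "\<Omega> \<inter> ball x0 r = {x \<in> ball x0 r. h (x - (x \<bullet> e) *\<^sub>R e) < x \<bullet> e}"
    using assms unfolding C2_holder_boundary_def by blast
  have ee: "e \<bullet> e = 1" using e by (simp add: dot_square_norm)
  define p where "p x = x - (x \<bullet> e) *\<^sub>R e" for x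
  define H where "H x = h (p x) - x \<bullet> e" for x
  have "Ck (Suc 1) h" using h by (simp add: C2_holder_def numeral_2_eq_2)
  from Ck_Suc_has_C1_gradient[OF this] obtain g where g: "has_C1_gradient h g" by blast
  define H' where "H' x = g (p x) - (g (p x) \<bullet> e) *\<^sub>R e - e" for x
  have pe: "p (x + t *\<^sub>R e) = p x" for x t by (simp add: p_def inner_add_left ee algebra_simps)
  have pc: "continuous_on UNIV p" unfolding p_def[abs_def] by (intro continuous_intros)
  have d: "GDERIV H x :> H' x" for x
  proof -
    have d1: "(p has_derivative (\<lambda>v. v - (v \<bullet> e) *\<^sub>R e)) (at x)"
      unfolding p_def[abs_def] by (auto intro!: derivative_eq_intros)
    have d2: "(h has_derivative (\<lambda>v. v \<bullet> g (p x))) (at (p x))"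
      using g by (simp add: has_C1_gradient_def gderiv_def)
    have "((\<lambda>x. h (p x)) has_derivative (\<lambda>v. (v - (v \<bullet> e) *\<^sub>R e) \<bullet> g (p x))) (at x)"
      by (rule has_derivative_compose[OF d1 d2])
    then have "(H has_derivative (\<lambda>v. (v - (v \<bullet> e) *\<^sub>R e) \<bullet> g (p x) - v \<bullet> e)) (at x)"
      unfolding H_def[abs_def] by (auto intro!: derivative_eq_intros)
    moreover have "(\<lambda>v. (v - (v \<bullet> e) *\<^sub>R e) \<bullet> g (p x) - v \<bullet> e) = (\<lambda>v. v \<bullet> H' x)"
      by (auto simp: H'_def inner_diff_left inner_diff_right inner_commute)
    ultimately show ?thesis unfolding gderiv_def by simp
  qed
  have gc: "continuous_on UNIV g" using g by (simp add: has_C1_gradient_def)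
  have "continuous_on UNIV H'"
    unfolding H'_def[abs_def] by (intro continuous_intros continuous_on_compose2[OF gc pc]) auto
  then have "graph_function e H H'"
    using d e unfolding graph_function_def has_C1_gradient_def
    by (simp add: H_def H'_def pe inner_add_left ee)
  moreover have "\<Omega> \<inter> ball x0 r = {x \<in> ball x0 r. H x < 0}" using \<Omega> by (simp add: H_def p_def)
  ultimately show thesis using that r unfolding boundary_chart_def by blast
qed

lemma graph_gradient_nonzero:
  assumes "graph_function e H H'"
  shows "e \<bullet> H' x = -1" "H' x \<noteq> 0"
proof -
  have "((\<lambda>t. H (x + t *\<^sub>R e)) has_real_derivative e \<bullet> H' (x + 0 *\<^sub>R e)) (at 0)"
    using assms by (intro has_C1_gradient_along_line) (simp add: graph_function_def)
  moreover have "((\<lambda>t. H (x + t *\<^sub>R e)) has_real_derivative -1) (at 0)"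
    using assms by (auto simp: graph_function_def intro!: derivative_eq_intros)
  ultimately show "e \<bullet> H' x = -1" using DERIV_unique by fastforce
  then show "H' x \<noteq> 0" by auto
qed

text \<open>The vector \<open>n' - n\<close> would enter the domain according to \<open>n\<close> and leave its closure according to \<open>n'\<close>.\<close>

lemma is_outer_normal_unique:
  assumes "is_outer_normal \<Omega> x n" "is_outer_normal \<Omega> x n'"
  shows "n = n'"
proof (rule ccontr)
  assume "n \<noteq> n'"
  have 1: "norm n = 1" "norm n' = 1" using assms by (auto simp: is_outer_normal_def)
  have "(norm (n' - n))\<^sup>2 > 0" using \<open>n \<noteq> n'\<close> by simp
  moreover have nn: "n \<bullet> n = 1" "n' \<bullet> n' = 1" using 1 by (simp_all add: dot_square_norm)
  ultimately have lt: "n \<bullet> n' < 1" unfolding power2_norm_eq_inner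
    by (simp add: inner_diff_left inner_diff_right inner_commute[of n' n])
  let ?v = "n' - n"
  have "?v \<bullet> n < 0" "?v \<bullet> n' > 0"
    using lt nn by (simp_all add: inner_diff_left inner_commute[of n' n])
  then have "\<forall>\<^sub>F t in at_right (0::real). x + t *\<^sub>R ?v \<in> \<Omega>" "\<forall>\<^sub>F t in at_right (0::real). x + t *\<^sub>R ?v \<notin> closure \<Omega>"
    using assms unfolding is_outer_normal_def by blast+
  then have "\<forall>\<^sub>F t in at_right (0::real). False"
    by eventually_elim (use closure_subset in blast)
  then show False by simp
qed

context
  fixes \<Omega> :: "(real^'n) set" and x0 r e H H'
  assumes chart: "boundary_chart \<Omega> x0 r e H H'" and "open \<Omega>"
begin

lemma chart_facts: "r > 0" "norm e = 1" "has_C1_gradient H H'" "H (x + t *\<^sub>R e) = H x - t"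
  "H' (x + t *\<^sub>R e) = H' x" "x \<in> ball x0 r \<Longrightarrow> x \<in> \<Omega> \<longleftrightarrow> H x < 0" "continuous_on UNIV H" "continuous_on UNIV H'"
  using chart has_C1_gradient_continuous[of H H']
  by (auto simp: boundary_chart_def graph_function_def has_C1_gradient_def)

lemma chart_closure: "x \<in> ball x0 r \<Longrightarrow> H x > 0 \<Longrightarrow> x \<notin> closure \<Omega>"
proof
  assume x: "x \<in> ball x0 r" "H x > 0" "x \<in> closure \<Omega>"
  have "open (ball x0 r \<inter> {y. H y > 0})"
    using chart_facts(7) by (intro open_Int open_ball open_Collect_less continuous_intros)
  moreover have "x \<in> ball x0 r \<inter> {y. H y > 0}" using x by simp
  ultimately have "(ball x0 r \<inter> {y. H y > 0}) \<inter> \<Omega> \<noteq> {}"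
    using x(3) unfolding closure_iff_nhds_not_empty by blast
  then show False using chart_facts(6) by fastforce
qed

lemma chart_frontier_iff: "x \<in> ball x0 r \<Longrightarrow> x \<in> frontier \<Omega> \<longleftrightarrow> H x = 0"
proof
  assume x: "x \<in> ball x0 r"
  show "H x = 0" if f: "x \<in> frontier \<Omega>"
  proof (rule ccontr)
    assume "H x \<noteq> 0"
    then consider "H x < 0" | "H x > 0" by linarith
    then show False
    proof cases
      case 1 then show ?thesis using x f chart_facts(6) \<open>open \<Omega>\<close> by (simp add: frontier_def interior_open)
    next
      case 2 then show ?thesis using x f chart_closure by (simp add: frontier_def)
    qed
  qed
  show "x \<in> frontier \<Omega>" if z: "H x = 0"
  proof -
    have "x \<notin> \<Omega>" using x z chart_facts(6) by simp
    moreover have "x \<in> closure \<Omega>"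
      unfolding closure_approachable
    proof (intro allI impI)
      fix \<eta> :: real assume "\<eta> > 0"
      obtain d where d: "d > 0" "ball x d \<subseteq> ball x0 r" using openE[OF open_ball x] by blast
      define t where "t = min (d/2) (\<eta>/2)"
      have t: "t > 0" "t < d" "t < \<eta>" using d \<open>\<eta> > 0\<close> by (auto simp: t_def)
      have "dist (x + t *\<^sub>R e) x = t" using t chart_facts(2) by (simp add: dist_norm)
      moreover have "x + t *\<^sub>R e \<in> \<Omega>"
      proof -
        have "x + t *\<^sub>R e \<in> ball x d" using \<open>dist (x + t *\<^sub>R e) x = t\<close> t by (simp add: dist_commute)
        then have "x + t *\<^sub>R e \<in> ball x0 r" using d by blast
        then show ?thesis using t z chart_facts(4)[of x t] chart_facts(6) by simp
      qed
      ultimately show "\<exists>y\<in>\<Omega>. dist y x < \<eta>" using t by metis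
    qed
    ultimately show ?thesis using \<open>open \<Omega>\<close> by (simp add: frontier_def interior_open)
  qed
qed

text \<open>Along a line through a boundary point, the sign of \<open>H\<close> is that of its directional derivative.\<close>

lemma chart_outer_normal:
  assumes x: "x \<in> ball x0 r" "x \<in> frontier \<Omega>"
  shows "H' x = norm (H' x) *\<^sub>R outer_normal \<Omega> x"
proof -
  have g: "graph_function e H H'" using chart by (simp add: boundary_chart_def)
  have nz: "norm (H' x) > 0" using graph_gradient_nonzero(2)[OF g] by simp
  let ?n = "(1 / norm (H' x)) *\<^sub>R H' x"
  have H0: "H x = 0" using chart_frontier_iff x by blast
  have ball: "\<forall>\<^sub>F t in at_right 0. x + t *\<^sub>R v \<in> ball x0 r" for v
  proof -
    have "((\<lambda>t. x + t *\<^sub>R v) \<longlongrightarrow> x + 0 *\<^sub>R v) (at_right 0)" by (intro tendsto_intros)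
    then show ?thesis using x(1) by (intro topological_tendstoD[of _ "x + 0 *\<^sub>R v"]) auto
  qed
  have der: "((\<lambda>t. H (x + t *\<^sub>R v)) has_real_derivative v \<bullet> H' x) (at 0)" for v
    using has_C1_gradient_along_line[OF chart_facts(3), of x v 0] by simp
  have "is_outer_normal \<Omega> x ?n"
    unfolding is_outer_normal_def
  proof (intro conjI allI impI)
    show "norm ?n = 1" using nz by simp
    show "\<forall>\<^sub>F t in at_right 0. x + t *\<^sub>R v \<in> \<Omega>" if v: "v \<bullet> ?n < 0" for v
    proof -
      have "v \<bullet> H' x < 0" using v nz by (simp add: divide_less_0_iff)
      then obtain d where d: "d > 0" "\<And>h. 0 < h \<Longrightarrow> h < d \<Longrightarrow> H (x + (0 + h) *\<^sub>R v) < H (x + 0 *\<^sub>R v)"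
        using DERIV_neg_dec_right[OF der[of v]] by auto
      then have "\<forall>\<^sub>F t in at_right 0. H (x + t *\<^sub>R v) < 0"
        unfolding eventually_at_right[OF d(1)] using H0 by auto
      with ball[of v] show ?thesis by eventually_elim (simp add: chart_facts(6))
    qed
    show "\<forall>\<^sub>F t in at_right 0. x + t *\<^sub>R v \<notin> closure \<Omega>" if v: "v \<bullet> ?n > 0" for v
    proof -
      have "v \<bullet> H' x > 0" using v nz by (simp add: zero_less_divide_iff)
      then obtain d where d: "d > 0" "\<And>h. 0 < h \<Longrightarrow> h < d \<Longrightarrow> H (x + 0 *\<^sub>R v) < H (x + (0 + h) *\<^sub>R v)"
        using DERIV_pos_inc_right[OF der[of v]] by auto
      then have "\<forall>\<^sub>F t in at_right 0. H (x + t *\<^sub>R v) > 0"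
        unfolding eventually_at_right[OF d(1)] using H0 by auto
      with ball[of v] show ?thesis by eventually_elim (rule chart_closure)
    qed
  qed
  then have "outer_normal \<Omega> x = ?n"
    unfolding outer_normal_def by (intro the_equality is_outer_normal_unique)
  then show ?thesis using nz by simp
qed

end

text \<open>The neighbourhood of the level set lies in \<open>{|H| \<le> K\<delta>}\<close>, where \<open>K\<close> bounds the gradient. As \<open>H\<close>
  falls with slope 1 along \<open>e\<close>, the translates of this set by multiples of \<open>2(K+1)\<delta>\<close> along \<open>e\<close> are
  disjoint; about \<open>1/\<delta>\<close> of them fit into a fixed ball, so each has measure of the order of \<open>\<delta>\<close>.\<close>

lemma graph_level_set_thin:
  fixes x0 :: "real^'n"
  assumes g: "graph_function e H H'" and R: "R > 0"
  obtains M where "M \<ge> 0" "\<And>\<delta>. 0 < \<delta> \<Longrightarrow> \<delta> \<le> 1 \<Longrightarrow> \<exists>S\<in>sets borel.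
    (\<Union>a\<in>{x \<in> cball x0 R. H x = 0}. cball a \<delta>) \<subseteq> S \<and> emeasure lborel S \<le> ennreal (M * \<delta>)"
proof -
  have H: "has_C1_gradient H H'" "norm e = 1" "\<And>x t. H (x + t *\<^sub>R e) = H x - t"
    using g by (auto simp: graph_function_def)
  have Hc: "continuous_on UNIV H" by (rule has_C1_gradient_continuous[OF H(1)])
  have "bounded (H' ` cball x0 (R + 1))"
    using H(1) by (intro compact_imp_bounded compact_continuous_image) (auto simp: has_C1_gradient_def intro: continuous_on_subset)
  then obtain K where K: "K > 0" "\<And>x. x \<in> cball x0 (R+1) \<Longrightarrow> norm (H' x) \<le> K"
    unfolding bounded_pos by auto
  have lip: "\<bar>H y - H x\<bar> \<le> K * norm (y - x)" if "x \<in> cball x0 (R+1)" "y \<in> cball x0 (R+1)" for x y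
  proof -
    have "norm (H y - H x) \<le> K * norm (y - x)"
    proof (rule differentiable_bound[OF convex_cball _ _ that(2,1)])
      fix z assume "z \<in> cball x0 (R+1)"
      show "(H has_derivative (\<lambda>h. h \<bullet> H' z)) (at z within cball x0 (R+1))"
        using H(1) by (auto simp: has_C1_gradient_def gderiv_def intro: has_derivative_at_withinI)
      show "onorm (\<lambda>h. h \<bullet> H' z) \<le> K"
      proof (rule onorm_le)
        fix h :: "real^'n"
        have "\<bar>h \<bullet> H' z\<bar> \<le> norm h * norm (H' z)" by (rule Cauchy_Schwarz_ineq2)
        also have "\<dots> \<le> norm h * K" using K(2)[OF \<open>z \<in> _\<close>] by (intro mult_left_mono) auto
        finally show "norm (h \<bullet> H' z) \<le> K * norm h" by (simp add: mult.commute)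
      qed
    qed
    then show ?thesis by simp
  qed
  define V where "V = measure lborel (cball x0 (R + 2))"
  have V: "emeasure lborel (cball x0 (R + 2)) = ennreal V"
    unfolding V_def by (rule emeasure_eq_ennreal_measure) (use emeasure_compact_finite[OF compact_cball[of x0 "R + 2"]] in auto)
  define M where "M = 2 * (K + 1) * V"
  show thesis
  proof (rule that[of M])
    show "M \<ge> 0" using K by (simp add: M_def V_def)
    fix \<delta> :: real assume \<delta>: "0 < \<delta>" "\<delta> \<le> 1"
    define S where "S = {y \<in> cball x0 (R+1). \<bar>H y\<bar> \<le> K * \<delta>}"
    have "closed {y. \<bar>H y\<bar> \<le> K * \<delta>}" by (intro closed_Collect_le continuous_intros Hc)
    moreover have "S = cball x0 (R+1) \<inter> {y. \<bar>H y\<bar> \<le> K * \<delta>}" by (auto simp: S_def)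
  ultimately have "closed S" by (simp add: closed_Int del: mem_cball)
    then have Sb: "S \<in> sets borel" by (rule borel_closed)
    have sub: "(\<Union>a\<in>{x \<in> cball x0 R. H x = 0}. cball a \<delta>) \<subseteq> S"
    proof
      fix y assume "y \<in> (\<Union>a\<in>{x \<in> cball x0 R. H x = 0}. cball a \<delta>)"
      then obtain a where a: "dist x0 a \<le> R" "H a = 0" "dist a y \<le> \<delta>" by auto
      then have y: "dist x0 y \<le> R + 1" using \<delta> dist_triangle[of x0 y a] by linarith
      have "\<bar>H y\<bar> \<le> K * norm (y - a)" using lip[of a y] a y by simp
      also have "\<dots> \<le> K * \<delta>" using a K by (simp add: dist_norm norm_minus_commute)
      finally show "y \<in> S" using y by (simp add: S_def)
    qed
    \<comment> \<open>slightly more than the width \<open>2K\<delta>\<close> of the layer, so that different translates are disjoint\<close>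
    define w where "w = 2 * (K + 1) * \<delta>"
    have w: "w > 0" using K \<delta> by (simp add: w_def)
    define m where "m = nat \<lfloor>1 / w\<rfloor>"
    have m: "real m * w \<le> 1" "1 < (real m + 1) * w"
    proof -
      have "1/w \<ge> 0" using w by simp
      then have "real m \<le> 1 / w" "1 / w < real m + 1" unfolding m_def by linarith+
      then show "real m * w \<le> 1" "1 < (real m + 1) * w" using w by (simp_all add: field_simps)
    qed
    define T where "T j = (\<lambda>x. (- (real j * w)) *\<^sub>R e + x) -` S" for j
    have Tb: "T j \<in> sets borel" for j
      unfolding T_def using Sb by (intro measurable_sets_borel[OF _ Sb]) auto
    have Tm: "emeasure lborel (T j) = emeasure lborel S" for j
    proof -
      have "emeasure lborel S = emeasure (distr lborel borel (\<lambda>x. (- (real j * w)) *\<^sub>R e + x)) S"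
        by (simp only: lborel_distr_shift)
      also have "\<dots> = emeasure lborel (T j)" using Sb by (subst emeasure_distr) (auto simp: T_def vimage_def)
      finally show ?thesis by simp
    qed
    have TH: "\<bar>H x + real j * w\<bar> \<le> K * \<delta>" if "x \<in> T j" for x j
      using that H(3)[of x "- (real j * w)"] by (simp add: T_def S_def add.commute)
    have "disjoint_family_on T {..m}"
      unfolding disjoint_family_on_def
    proof (intro ballI impI, rule ccontr)
      fix i j assume ij: "i \<noteq> j" "T i \<inter> T j \<noteq> {}"
      then obtain x where "x \<in> T i" "x \<in> T j" by blast
      then have "\<bar>(real i - real j) * w\<bar> \<le> 2 * (K * \<delta>)" using TH[of x i] TH[of x j] by (simp add: left_diff_distrib)
      moreover have "1 \<le> \<bar>real i - real j\<bar>" using ij(1) by linarith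
      then have "w \<le> \<bar>(real i - real j) * w\<bar>" using w by (simp add: abs_mult)
      ultimately show False using \<delta> by (simp add: w_def algebra_simps)
    qed
    then have "(\<Sum>j\<le>m. emeasure lborel (T j)) = emeasure lborel (\<Union>j\<le>m. T j)"
      using Tb by (intro sum_emeasure) auto
    also have "\<dots> \<le> emeasure lborel (cball x0 (R + 2))"
    proof (rule emeasure_mono)
      show "(\<Union>j\<le>m. T j) \<subseteq> cball x0 (R + 2)"
      proof
        fix x assume "x \<in> (\<Union>j\<le>m. T j)"
        then obtain j where j: "j \<le> m" "- (real j * w) *\<^sub>R e + x \<in> S" by (auto simp: T_def)
        have "norm (x0 - x) \<le> norm (x0 - (- (real j * w) *\<^sub>R e + x)) + norm (- (real j * w) *\<^sub>R e)"
          using norm_triangle_ineq[of "x0 - (- (real j * w) *\<^sub>R e + x)" "- (real j * w) *\<^sub>R e"] by simp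
        also have "\<dots> \<le> (R + 1) + 1"
        proof (rule add_mono)
          show "norm (x0 - (- (real j * w) *\<^sub>R e + x)) \<le> R + 1" using j(2) by (simp add: S_def dist_norm)
          have "real j * w \<le> real m * w" using j(1) w by (intro mult_right_mono) auto
          then have "real j * w \<le> 1" using m(1) by linarith
          then show "norm (- (real j * w) *\<^sub>R e) \<le> 1" using w H(2) by simp
        qed
        finally show "x \<in> cball x0 (R + 2)" by (simp add: dist_norm)
      qed
    qed simp
    finally have "of_nat (Suc m) * emeasure lborel S \<le> ennreal V"
      by (simp add: Tm V)
    moreover have "(of_nat (Suc m) :: ennreal) = ennreal (real m + 1)"
      by (subst ennreal_of_nat_eq_real_of_nat) (simp only: of_nat_Suc add.commute)
    ultimately have "ennreal (real m + 1) * emeasure lborel S \<le> ennreal V" by (simp only:)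
    then have "ennreal w * (ennreal (real m + 1) * emeasure lborel S) \<le> ennreal w * ennreal V"
      by (intro mult_left_mono) auto
    moreover have "ennreal ((real m + 1) * w) = ennreal w * ennreal (real m + 1)"
      using w by (subst ennreal_mult[symmetric]) (auto simp: mult.commute)
    moreover have "ennreal w * ennreal V = ennreal (M * \<delta>)"
      using w by (subst ennreal_mult[symmetric]) (auto simp: M_def w_def V_def mult_ac)
    ultimately have "ennreal ((real m + 1) * w) * emeasure lborel S \<le> ennreal (M * \<delta>)"
      by (simp only: mult.assoc)
    moreover have "emeasure lborel S \<le> ennreal ((real m + 1) * w) * emeasure lborel S"
    proof -
      have "(1::ennreal) \<le> ennreal ((real m + 1) * w)" using m(2) by (subst ennreal_1[symmetric], intro ennreal_leI) simp
      from mult_right_mono[OF this, of "emeasure lborel S"] show ?thesis by simp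
    qed
    ultimately have "emeasure lborel S \<le> ennreal (M * \<delta>)" by (rule order_trans[rotated])
    then show "\<exists>S\<in>sets borel. (\<Union>a\<in>{x \<in> cball x0 R. H x = 0}. cball a \<delta>) \<subseteq> S \<and> emeasure lborel S \<le> ennreal (M * \<delta>)"
      using sub Sb by blast
  qed
qed

lemma hausdorff_outer_UN_finite:
  assumes "finite I" "\<And>i. i \<in> I \<Longrightarrow> hausdorff_outer s (A i) < top"
  shows "hausdorff_outer s (\<Union>i\<in>I. A i) < top"
  using assms
proof (induction I rule: finite_induct)
  case (insert i I)
  then have "hausdorff_outer s (A i) + hausdorff_outer s (\<Union>i\<in>I. A i) < top" by simp
  then show ?case using hausdorff_outer_Un_le[of s "A i" "\<Union>i\<in>I. A i"] by (auto intro: le_less_trans)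
qed simp

text \<open>By compactness it suffices to consider the part of the boundary inside one chart, which is a level
  set of a defining function and hence thin.\<close>

lemma hausdorff_frontier_finite:
  fixes \<Omega> :: "(real^'n) set"
  assumes N: "CARD('n) \<ge> 2" and \<Omega>: "open \<Omega>" "bounded \<Omega>" "C2_holder_boundary \<gamma> \<Omega>"
  shows "hausdorff_outer (real CARD('n) - 1) (frontier \<Omega>) < top"
proof -
  have ex: "\<exists>r>0. hausdorff_outer (real CARD('n) - 1) (frontier \<Omega> \<inter> ball x0 r) < top" if x0: "x0 \<in> frontier \<Omega>" for x0
  proof -
    obtain r e H H' where c: "boundary_chart \<Omega> x0 r e H H'" using boundary_chart_exists[OF \<Omega>(3) x0] by blast
    have r: "r > 0" and g: "graph_function e H H'" using c by (auto simp: boundary_chart_def)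
    obtain M where M: "M \<ge> 0" "\<And>\<delta>. 0 < \<delta> \<Longrightarrow> \<delta> \<le> 1 \<Longrightarrow> \<exists>S\<in>sets borel.
      (\<Union>a\<in>{x \<in> cball x0 r. H x = 0}. cball a \<delta>) \<subseteq> S \<and> emeasure lborel S \<le> ennreal (M * \<delta>)"
      by (rule graph_level_set_thin[OF g r, of x0]) blast
    have "hausdorff_outer (real DIM(real^'n) - 1) {x \<in> cball x0 r. H x = 0} < top"
      by (rule hausdorff_outer_finite_if_thin[OF _ M(1)]) (use N M(2) in auto)
    moreover have "frontier \<Omega> \<inter> ball x0 r \<subseteq> {x \<in> cball x0 r. H x = 0}"
      using chart_frontier_iff[OF c \<Omega>(1)] by auto
    ultimately have "hausdorff_outer (real CARD('n) - 1) (frontier \<Omega> \<inter> ball x0 r) < top"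
      using hausdorff_outer_mono[of "frontier \<Omega> \<inter> ball x0 r" "{x \<in> cball x0 r. H x = 0}" "real CARD('n) - 1"]
      by (auto intro: le_less_trans)
    then show ?thesis using r by blast
  qed
  then obtain r where r: "\<And>x. x \<in> frontier \<Omega> \<Longrightarrow> r x > 0"
    "\<And>x. x \<in> frontier \<Omega> \<Longrightarrow> hausdorff_outer (real CARD('n) - 1) (frontier \<Omega> \<inter> ball x (r x)) < top"
    by metis
  have "compact (frontier \<Omega>)" using \<Omega>(2) by (simp add: compact_frontier_bounded)
  then obtain C where C: "C \<subseteq> frontier \<Omega>" "finite C" "frontier \<Omega> \<subseteq> (\<Union>x\<in>C. ball x (r x))"
  proof (rule compactE_image[of "frontier \<Omega>" "frontier \<Omega>" "\<lambda>x. ball x (r x)"])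
    show "frontier \<Omega> \<subseteq> (\<Union>x\<in>frontier \<Omega>. ball x (r x))" using r(1) by (meson UN_I centre_in_ball subsetI)
  qed auto
  have "hausdorff_outer (real CARD('n) - 1) (\<Union>x\<in>C. frontier \<Omega> \<inter> ball x (r x)) < top"
    using C r(2) by (intro hausdorff_outer_UN_finite) auto
  moreover have "frontier \<Omega> \<subseteq> (\<Union>x\<in>C. frontier \<Omega> \<inter> ball x (r x))" using C(3) by blast
  ultimately show ?thesis using hausdorff_outer_mono le_less_trans by blast
qed

section \<open>Surface measure and a Hardy estimate in a boundary strip\<close>

lemma surface_measure_facts:
  fixes \<Omega> :: "(real^'n) set"
  shows "(\<lambda>x. x) \<in> measurable (surface_measure \<Omega>) borel"
    "B \<in> sets borel \<Longrightarrow> emeasure (distr (surface_measure \<Omega>) borel (\<lambda>x. x)) B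
      = hausdorff_outer (real CARD('n) - 1) (B \<inter> frontier \<Omega>)"
    "space (surface_measure \<Omega>) = frontier \<Omega>"
    "emeasure (surface_measure \<Omega>) (space (surface_measure \<Omega>)) = hausdorff_outer (real CARD('n) - 1) (frontier \<Omega>)"
proof -
  let ?H = "hausdorff_measure (real CARD('n) - 1) :: (real^'n) measure"
  have F: "frontier \<Omega> \<in> sets ?H" by (intro borel_subset_hausdorff borel_closed frontier_closed)
  have "(\<lambda>x. x) \<in> measurable ?H borel" by (rule measurableI) (auto intro: borel_subset_hausdorff)
  then show m: "(\<lambda>x. x) \<in> measurable (surface_measure \<Omega>) borel"
    unfolding surface_measure_def by (rule measurable_restrict_space1)
  show sp: "space (surface_measure \<Omega>) = frontier \<Omega>" by (simp add: surface_measure_def space_restrict_space)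
  have em: "emeasure (surface_measure \<Omega>) (B \<inter> frontier \<Omega>) = hausdorff_outer (real CARD('n) - 1) (B \<inter> frontier \<Omega>)"
    if "B \<in> sets borel" for B
    unfolding surface_measure_def
    using F borel_subset_hausdorff[OF that]
    by (subst emeasure_restrict_space) (auto simp: emeasure_hausdorff_measure)
  show "emeasure (distr (surface_measure \<Omega>) borel (\<lambda>x. x)) B = hausdorff_outer (real CARD('n) - 1) (B \<inter> frontier \<Omega>)"
    if B: "B \<in> sets borel"
    using em[OF B] by (simp add: emeasure_distr[OF m B] sp)
  show "emeasure (surface_measure \<Omega>) (space (surface_measure \<Omega>)) = hausdorff_outer (real CARD('n) - 1) (frontier \<Omega>)"
    using em[of UNIV] by (simp add: sp)
qed

text \<open>The map \<open>x + H x e\<close> moves a point of the strip along \<open>e\<close> to the boundary. The preimage of a boundary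
  set lies in a cylinder over that set, so the image of Lebesgue measure is dominated by a
  multiple of the surface measure.\<close>

lemma nn_integral_graph_projection_le:
  fixes \<Omega> :: "(real^'n) set"
  assumes N: "CARD('n) \<ge> 2" and chart: "boundary_chart \<Omega> x0 r e H H'" and "open \<Omega>" and L: "L \<ge> 0"
  obtains c where "c \<ge> 0" "\<And>S f. S \<in> sets borel \<Longrightarrow>
    (\<And>x. x \<in> S \<Longrightarrow> 0 \<le> - H x \<and> - H x \<le> L \<and> x + H x *\<^sub>R e \<in> ball x0 r) \<Longrightarrow> f \<in> borel_measurable borel \<Longrightarrow>
    (\<integral>\<^sup>+x. f (x + H x *\<^sub>R e) * indicator S x \<partial>lborel) \<le> ennreal c * (\<integral>\<^sup>+y. f y \<partial>surface_measure \<Omega>)"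
proof -
  note cf = chart_facts[OF chart \<open>open \<Omega>\<close>]
  obtain c where c: "c \<ge> 0" "\<And>S A. S \<in> sets borel \<Longrightarrow> S \<subseteq> {x + t *\<^sub>R e | x t. x \<in> A \<and> t \<in> {0..L}} \<Longrightarrow>
    emeasure lborel S \<le> ennreal c * hausdorff_outer (real DIM(real^'n) - 1) A"
    by (rule content_le_hausdorff_outer[OF cf(2) L]) (use N in \<open>simp, blast\<close>)
  let ?P = "\<lambda>x. x + H x *\<^sub>R e"
  have Pm[measurable]: "?P \<in> borel_measurable borel"
    by (intro borel_measurable_continuous_onI continuous_intros cf(7))
  show thesis
  proof (rule that[OF c(1)])
    fix S :: "(real^'n) set" and f :: "real^'n \<Rightarrow> ennreal"
    assume S[measurable]: "S \<in> sets borel"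
      and SH: "\<And>x. x \<in> S \<Longrightarrow> 0 \<le> - H x \<and> - H x \<le> L \<and> ?P x \<in> ball x0 r"
      and f[measurable]: "f \<in> borel_measurable borel"
    let ?M1 = "distr (density lborel (indicator S)) borel ?P"
    let ?M2 = "scale_measure (ennreal c) (distr (surface_measure \<Omega>) borel (\<lambda>x. x))"
    \<comment> \<open>image of Lebesgue measure on the strip, against a multiple of the surface measure on Borel sets\<close>
    have "?M1 \<le> ?M2"
    proof (subst le_measure)
      show "\<forall>B\<in>sets ?M1. emeasure ?M1 B \<le> emeasure ?M2 B"
      proof
        fix B assume "B \<in> sets ?M1"
        then have B[measurable]: "B \<in> sets borel" by simp
        have SB: "S \<inter> ?P -` B \<in> sets borel"
          using measurable_sets_borel[OF Pm B] by (intro sets.Int S)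
        have "emeasure ?M1 B = emeasure (density lborel (indicator S)) (?P -` B)"
          by (subst emeasure_distr) auto
        also have "\<dots> = emeasure lborel (S \<inter> ?P -` B)"
          using measurable_sets_borel[OF Pm B] by (subst emeasure_density) (auto simp: nn_integral_indicator[symmetric] indicator_inter_arith SB intro!: nn_integral_cong)
        also have "\<dots> \<le> ennreal c * hausdorff_outer (real DIM(real^'n) - 1) (B \<inter> frontier \<Omega>)"
        proof (rule c(2)[OF SB], rule subsetI)
          fix x assume x: "x \<in> S \<inter> ?P -` B"
          have "H (?P x) = 0" using cf(4)[of x "H x"] by simp
          then have "?P x \<in> frontier \<Omega>" using SH[of x] x chart_frontier_iff[OF chart \<open>open \<Omega>\<close>] by blast
          moreover have "x = ?P x + (- H x) *\<^sub>R e" by simp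
          moreover have "- H x \<in> {0..L}" using SH[of x] x by simp
          ultimately show "x \<in> {x + t *\<^sub>R e | x t. x \<in> B \<inter> frontier \<Omega> \<and> t \<in> {0..L}}" using x by blast
        qed
        finally show "emeasure ?M1 B \<le> emeasure ?M2 B" using surface_measure_facts(2)[OF B, of \<Omega>] by simp
      qed
    qed simp
    then have "nn_integral ?M1 f \<le> nn_integral ?M2 f" by (intro nn_integral_mono_measure) simp_all
    moreover have "nn_integral ?M1 f = (\<integral>\<^sup>+x. f (?P x) * indicator S x \<partial>lborel)"
      by (subst nn_integral_distr) (auto simp: nn_integral_density mult.commute)
    moreover have "nn_integral ?M2 f = ennreal c * (\<integral>\<^sup>+y. f y \<partial>surface_measure \<Omega>)"
      using surface_measure_facts(1)[of \<Omega>] by (simp add: nn_integral_scale_measure nn_integral_distr)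
    ultimately show "(\<integral>\<^sup>+x. f (?P x) * indicator S x \<partial>lborel) \<le> ennreal c * (\<integral>\<^sup>+y. f y \<partial>surface_measure \<Omega>)" by simp
  qed
qed

text \<open>The Cauchy-Schwarz inequality for the derivative, in the form: the integral of \<open>(\<phi>' - m)\<^sup>2\<close> is
  nonnegative, where \<open>m\<close> is the mean value of \<open>\<phi>'\<close>.\<close>

lemma square_increment_le:
  fixes \<phi> :: "real \<Rightarrow> real"
  assumes t: "t > 0" and d: "\<And>s. (\<phi> has_real_derivative \<phi>' s) (at s)" and c: "continuous_on UNIV \<phi>'"
  shows "(\<phi> t - \<phi> 0)\<^sup>2 \<le> t * integral {0..t} (\<lambda>s. (\<phi>' s)\<^sup>2)"
proof -
  define m where "m = (\<phi> t - \<phi> 0) / t"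
  have c': "continuous_on {0..t} \<phi>'" using c continuous_on_subset by blast
  have 1: "(\<phi>' has_integral (\<phi> t - \<phi> 0)) {0..t}"
    using t d by (intro fundamental_theorem_of_calculus)
      (auto simp: has_real_derivative_iff_has_vector_derivative[symmetric] intro: has_field_derivative_at_within)
  have i2: "(\<lambda>s. (\<phi>' s)\<^sup>2) integrable_on {0..t}" by (intro integrable_continuous_interval continuous_intros c')
  have "((\<lambda>s. (\<phi>' s)\<^sup>2 - (2 * m) * \<phi>' s + m\<^sup>2) has_integral
      (integral {0..t} (\<lambda>s. (\<phi>' s)\<^sup>2) - (2 * m) * (\<phi> t - \<phi> 0) + t * m\<^sup>2)) {0..t}"
    using has_integral_const_real[of "m\<^sup>2" 0 t] t
    by (intro has_integral_add has_integral_diff has_integral_mult_right 1 integrable_integral i2) auto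
  then have "0 \<le> integral {0..t} (\<lambda>s. (\<phi>' s)\<^sup>2) - (2 * m) * (\<phi> t - \<phi> 0) + t * m\<^sup>2"
  proof (rule has_integral_nonneg)
    fix s
    have "(\<phi>' s)\<^sup>2 - (2 * m) * \<phi>' s + m\<^sup>2 = (\<phi>' s - m)\<^sup>2" by (simp add: power2_diff)
    then show "0 \<le> (\<phi>' s)\<^sup>2 - (2 * m) * \<phi>' s + m\<^sup>2" by simp
  qed
  moreover have "t * m = \<phi> t - \<phi> 0" using t by (simp add: m_def)
  ultimately have "0 \<le> t * (integral {0..t} (\<lambda>s. (\<phi>' s)\<^sup>2) - (2 * m) * (t * m) + t * m\<^sup>2)" using t by simp
  then have "(t * m)\<^sup>2 \<le> t * integral {0..t} (\<lambda>s. (\<phi>' s)\<^sup>2)" by (simp add: power2_eq_square algebra_simps)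
  then show ?thesis using \<open>t * m = \<phi> t - \<phi> 0\<close> by simp
qed

lemma norm_sq_vec: "(norm (x::real^'n))\<^sup>2 = (\<Sum>i\<in>UNIV. (x $ i)\<^sup>2)"
  unfolding power2_norm_eq_inner inner_vec_def by (simp add: power2_eq_square)

lemma norm_sq_matrix: "(norm (A::real^'n^'n))\<^sup>2 = (\<Sum>i\<in>UNIV. (norm (A $ i))\<^sup>2)"
  by (simp add: power2_norm_eq_inner inner_vec_def)

lemma abs_sum_inner_le:
  fixes A :: "real^'n^'n"
  shows "\<bar>\<Sum>i\<in>UNIV. w $ i * (v \<bullet> A $ i)\<bar> \<le> norm w * (norm v * norm A)"
proof -
  have "(\<Sum>i\<in>UNIV. w $ i * (v \<bullet> A $ i)) = w \<bullet> (\<chi> i. v \<bullet> A $ i)" by (simp add: inner_vec_def)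
  also have "\<bar>\<dots>\<bar> \<le> norm w * norm (\<chi> i. v \<bullet> A $ i)" by (rule Cauchy_Schwarz_ineq2)
  also have "norm (\<chi> i. v \<bullet> A $ i) \<le> norm v * norm A"
  proof (rule power2_le_imp_le)
    have "(norm (\<chi> i. v \<bullet> A $ i))\<^sup>2 = (\<Sum>i\<in>UNIV. (v \<bullet> A $ i)\<^sup>2)"
      by (simp add: norm_sq_vec)
    also have "\<dots> \<le> (\<Sum>i\<in>UNIV. (norm v)\<^sup>2 * (norm (A $ i))\<^sup>2)"
    proof (rule sum_mono)
      fix i show "(v \<bullet> A $ i)\<^sup>2 \<le> (norm v)\<^sup>2 * (norm (A $ i))\<^sup>2"
        using Cauchy_Schwarz_ineq2[of v "A $ i"] by (metis abs_le_square_iff abs_mult abs_norm_cancel power_mult_distrib)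
    qed
    also have "\<dots> = (norm v * norm A)\<^sup>2" by (simp add: power_mult_distrib norm_sq_matrix sum_distrib_left)
    finally show "(norm (\<chi> i. v \<bullet> A $ i))\<^sup>2 \<le> (norm v * norm A)\<^sup>2" .
  qed simp
  finally show ?thesis by (simp add: mult_left_mono)
qed

lemma square_le_twice: "(a::real)\<^sup>2 \<le> 2 * (b\<^sup>2 + (a - b)\<^sup>2)"
  using zero_le_power2[of "a - 2 * b"] by (simp add: power2_eq_square algebra_simps)

lemma nn_integral_shift:
  fixes g :: "real^'n \<Rightarrow> ennreal"
  assumes "g \<in> borel_measurable borel"
  shows "(\<integral>\<^sup>+x. g (x - v) \<partial>lborel) = (\<integral>\<^sup>+x. g x \<partial>lborel)"
proof -
  have "distr lborel borel (\<lambda>x. x - v) = lborel" using lborel_distr_shift[of "- v"] by simp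
  then show ?thesis using nn_integral_distr[of "\<lambda>x. x - v" lborel borel g] assms by simp
qed

text \<open>The Hardy estimate before the limit. On the segment from \<open>x\<close> in the strip down to the boundary
  the coefficient \<open>H'\<close> is constant, so only \<open>\<Psi>\<close> is differentiated; the increment of \<open>H' \<bullet> \<Psi>\<close> over
  the segment, whose length is at most \<open>L\<close>, is estimated by the integral of the derivative. After
  integration over \<open>x\<close> and a change of the order of integration each slice is a translate inside
  the larger strip, which gives the second factor \<open>L\<close>.\<close>

lemma strip_estimate_smooth:
  fixes \<Omega> :: "(real^'n) set" and \<Psi> :: "real^'n \<Rightarrow> real^'n" and D\<Psi> :: "real^'n \<Rightarrow> real^'n^'n"
  assumes chart: "boundary_chart \<Omega> x0 r e H H'" and "open \<Omega>"
    and \<Psi>: "\<And>i. has_C1_gradient (\<lambda>x. \<Psi> x $ i) (\<lambda>x. D\<Psi> x $ i)"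
    and L: "0 < L" "L < r / 4" and K: "K \<ge> 0" "\<And>x. x \<in> ball x0 r \<Longrightarrow> norm (H' x) \<le> K"
    and S: "S = {x \<in> ball x0 (r/4). 0 < - H x \<and> - H x < L}"
    and S': "S' = {x \<in> ball x0 (r/2). 0 < - H x \<and> - H x < L}"
  shows "(\<integral>\<^sup>+x. ennreal ((H' x \<bullet> \<Psi> x)\<^sup>2) * indicator S x \<partial>lborel)
    \<le> 2 * (\<integral>\<^sup>+x. ennreal ((H' (x + H x *\<^sub>R e) \<bullet> \<Psi> (x + H x *\<^sub>R e))\<^sup>2) * indicator S x \<partial>lborel)
      + ennreal (2 * K\<^sup>2 * L\<^sup>2) * (\<integral>\<^sup>+x. ennreal ((norm (D\<Psi> x))\<^sup>2) * indicator S' x \<partial>lborel)"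
proof -
  note cf = chart_facts[OF chart \<open>open \<Omega>\<close>]
  have \<Psi>c: "continuous_on UNIV \<Psi>"
    using has_C1_gradient_continuous[OF \<Psi>] continuous_on_vec_lambda[of UNIV "\<lambda>i x. \<Psi> x $ i"] by simp
  have "continuous_on UNIV (\<lambda>x. D\<Psi> x $ i)" for i using \<Psi>[of i] by (simp add: has_C1_gradient_def)
  then have D\<Psi>c: "continuous_on UNIV D\<Psi>"
    using continuous_on_vec_lambda[of UNIV "\<lambda>i x. D\<Psi> x $ i"] by simp
  have Hm[measurable]: "H \<in> borel_measurable borel" by (intro borel_measurable_continuous_onI cf)
  have H'm[measurable]: "H' \<in> borel_measurable borel" by (intro borel_measurable_continuous_onI cf)
  have \<Psi>m[measurable]: "\<Psi> \<in> borel_measurable borel" by (intro borel_measurable_continuous_onI \<Psi>c)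
  have D\<Psi>m[measurable]: "D\<Psi> \<in> borel_measurable borel" by (intro borel_measurable_continuous_onI D\<Psi>c)
  have Sm[measurable]: "S \<in> sets borel"
  proof -
    have "S = ball x0 (r/4) \<inter> {x. 0 < - H x} \<inter> {x. - H x < L}" unfolding S by auto
    also have "open \<dots>" by (intro open_Int open_ball open_Collect_less continuous_intros cf)
    finally show ?thesis by simp
  qed
  have S'm[measurable]: "S' \<in> sets borel"
  proof -
    have "S' = ball x0 (r/2) \<inter> {x. 0 < - H x} \<inter> {x. - H x < L}" unfolding S' by auto
    also have "open \<dots>" by (intro open_Int open_ball open_Collect_less continuous_intros cf)
    finally show ?thesis by simp
  qed
  define g where "g x = ennreal ((norm (D\<Psi> x))\<^sup>2)" for x
  have gm[measurable]: "g \<in> borel_measurable borel" unfolding g_def by measurable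
  define F where "F x s = (if x \<in> S \<and> 0 \<le> s \<and> s < - H x then g (x - s *\<^sub>R e) else 0)" for x and s :: real
  have Fm: "case_prod F \<in> borel_measurable (lborel \<Otimes>\<^sub>M lborel)"
    unfolding F_def by measurable
  have pt: "ennreal ((H' x \<bullet> \<Psi> x)\<^sup>2) * indicator S x
    \<le> 2 * (ennreal ((H' (x + H x *\<^sub>R e) \<bullet> \<Psi> (x + H x *\<^sub>R e))\<^sup>2) * indicator S x)
      + ennreal (2 * K\<^sup>2 * L) * (\<integral>\<^sup>+s. F x s \<partial>lborel)" for x
  proof (cases "x \<in> S")
    case True
    define t where "t = - H x"
    have t: "0 < t" "t < L" and xb: "x \<in> ball x0 r" using True cf(1) by (auto simp: S t_def)
    define \<phi> where "\<phi> s = H' x \<bullet> \<Psi> (x + s *\<^sub>R (- e))" for s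
    define \<phi>' where "\<phi>' s = (\<Sum>i\<in>UNIV. H' x $ i * ((- e) \<bullet> D\<Psi> (x + s *\<^sub>R (- e)) $ i))" for s
    have d: "(\<phi> has_real_derivative \<phi>' s) (at s)" for s
      unfolding \<phi>_def[abs_def] \<phi>'_def inner_vec_def[of "H' x"] inner_real_def
      by (intro DERIV_sum DERIV_cmult has_C1_gradient_along_line[OF \<Psi>])
    have lc: "continuous_on UNIV (\<lambda>s. D\<Psi> (x + s *\<^sub>R (- e)))"
      by (intro continuous_on_compose2[OF D\<Psi>c] continuous_intros) auto
    have c: "continuous_on UNIV \<phi>'"
      unfolding \<phi>'_def by (intro continuous_intros lc)
    let ?q = "\<lambda>s. K\<^sup>2 * (norm (D\<Psi> (x + s *\<^sub>R (- e))))\<^sup>2"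
    have qc: "continuous_on UNIV ?q" by (intro continuous_intros lc)
    have "(\<phi>' s)\<^sup>2 \<le> ?q s" for s
    proof -
      have "\<bar>\<phi>' s\<bar> \<le> norm (H' x) * (norm (- e) * norm (D\<Psi> (x + s *\<^sub>R (- e))))"
        unfolding \<phi>'_def by (rule abs_sum_inner_le)
      also have "\<dots> \<le> K * norm (D\<Psi> (x + s *\<^sub>R (- e)))" using K(2)[OF xb] cf(2) by (simp add: mult_right_mono)
      finally have "\<bar>\<phi>' s\<bar>\<^sup>2 \<le> (K * norm (D\<Psi> (x + s *\<^sub>R (- e))))\<^sup>2" by (intro power_mono) auto
      then show ?thesis by (simp add: power_mult_distrib)
    qed
    then have "integral {0..t} (\<lambda>s. (\<phi>' s)\<^sup>2) \<le> integral {0..t} ?q"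
      by (intro integral_le integrable_continuous_interval continuous_on_subset[OF qc] continuous_intros continuous_on_subset[OF c]) auto
    then have le: "(\<phi> 0 - \<phi> t)\<^sup>2 \<le> L * integral {0..t} ?q"
      using square_increment_le[OF t(1) d c] t
      by (smt (verit) integral_nonneg mult_right_mono mult_left_mono power2_commute qc continuous_on_subset integrable_continuous_interval subset_UNIV zero_le_mult_iff zero_le_power2)
    have "ennreal (integral {0..t} ?q) = (\<integral>\<^sup>+s. ennreal (?q s) * indicator {0..t} s \<partial>lborel)"
    proof -
      have "set_integrable lborel {0..t} ?q"
        by (rule borel_integrable_atLeastAtMost') (rule continuous_on_subset[OF qc], simp)
      note q = this
      have "integral {0..t} ?q = (\<integral>s. indicator {0..t} s * ?q s \<partial>lborel)"
        using set_borel_integral_eq_integral(2)[OF q] unfolding set_lebesgue_integral_def real_scaleR_def by (rule sym)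
      moreover have "(\<integral>\<^sup>+s. ennreal (indicator {0..t} s * ?q s) \<partial>lborel) = ennreal (\<integral>s. indicator {0..t} s * ?q s \<partial>lborel)"
        using q by (intro nn_integral_eq_integral) (auto simp: set_integrable_def)
      moreover have "(\<lambda>s. ennreal (indicator {0..t} s * ?q s)) = (\<lambda>s. ennreal (?q s) * indicator {0..t} s)"
        by (auto simp: indicator_def)
      ultimately show ?thesis by simp
    qed
    also have "\<dots> = (\<integral>\<^sup>+s. ennreal (K\<^sup>2) * F x s \<partial>lborel)"
    \<comment> \<open>the endpoint \<open>s = t\<close> lies on the boundary and is left out of \<open>F\<close>\<close>
    proof (rule nn_integral_cong_AE)
      show "AE s in lborel. ennreal (?q s) * indicator {0..t} s = ennreal (K\<^sup>2) * F x s"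
        using AE_lborel_singleton[of t]
        by eventually_elim (use True in \<open>auto simp: F_def g_def t_def indicator_def ennreal_mult'\<close>)
    qed
    also have "\<dots> = ennreal (K\<^sup>2) * (\<integral>\<^sup>+s. F x s \<partial>lborel)"
      by (rule nn_integral_cmult) (use Fm in measurable)
    finally have I: "ennreal (integral {0..t} ?q) = ennreal (K\<^sup>2) * (\<integral>\<^sup>+s. F x s \<partial>lborel)" .
    have "\<phi> 0 = H' x \<bullet> \<Psi> x" by (simp add: \<phi>_def)
    moreover have "\<phi> t = H' (x + H x *\<^sub>R e) \<bullet> \<Psi> (x + H x *\<^sub>R e)"
      using cf(5)[of x "H x"] by (simp add: \<phi>_def t_def)
    ultimately have "(H' x \<bullet> \<Psi> x)\<^sup>2 \<le> 2 * (H' (x + H x *\<^sub>R e) \<bullet> \<Psi> (x + H x *\<^sub>R e))\<^sup>2 + 2 * L * integral {0..t} ?q"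
      using square_le_twice[of "\<phi> 0" "\<phi> t"] le by simp
    then have "ennreal ((H' x \<bullet> \<Psi> x)\<^sup>2) \<le> ennreal (2 * (H' (x + H x *\<^sub>R e) \<bullet> \<Psi> (x + H x *\<^sub>R e))\<^sup>2 + 2 * L * integral {0..t} ?q)"
      by (rule ennreal_leI)
    also have "\<dots> = 2 * ennreal ((H' (x + H x *\<^sub>R e) \<bullet> \<Psi> (x + H x *\<^sub>R e))\<^sup>2) + ennreal (2 * L) * ennreal (integral {0..t} ?q)"
    proof -
      have "integral {0..t} ?q \<ge> 0"
        by (intro integral_nonneg integrable_continuous_interval continuous_on_subset[OF qc]) auto
      then show ?thesis using L(1) by (simp add: ennreal_plus ennreal_mult' )
    qed
    also have "ennreal (2 * L) * ennreal (integral {0..t} ?q) = ennreal (2 * K\<^sup>2 * L) * (\<integral>\<^sup>+s. F x s \<partial>lborel)"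
    proof -
      have "ennreal (2 * K\<^sup>2 * L) = ennreal (2 * L) * ennreal (K\<^sup>2)"
        using L(1) by (subst ennreal_mult[symmetric]) (auto simp: mult_ac)
      then show ?thesis by (simp only: I mult.assoc)
    qed
    finally show ?thesis using True by simp
  qed simp
  have inner: "(\<integral>\<^sup>+x. F x s \<partial>lborel) \<le> (\<integral>\<^sup>+x. g x * indicator S' x \<partial>lborel) * indicator {0..L} s" for s
  proof (cases "0 \<le> s \<and> s \<le> L")
    case True
    have "(\<integral>\<^sup>+x. F x s \<partial>lborel) \<le> (\<integral>\<^sup>+x. g (x - s *\<^sub>R e) * indicator S' (x - s *\<^sub>R e) \<partial>lborel)"
    proof (rule nn_integral_mono)
      fix x
      show "F x s \<le> g (x - s *\<^sub>R e) * indicator S' (x - s *\<^sub>R e)"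
      proof (cases "x \<in> S \<and> 0 \<le> s \<and> s < - H x")
        case h: True
        have "H (x - s *\<^sub>R e) = H x + s" using cf(4)[of x "- s"] by simp
        moreover have "dist x0 (x - s *\<^sub>R e) \<le> dist x0 x + s"
          using dist_triangle[of x0 "x - s *\<^sub>R e" x] h cf(2) by (simp add: dist_norm)
        then have "x - s *\<^sub>R e \<in> ball x0 (r/2)" using h L by (auto simp: S)
        ultimately have "x - s *\<^sub>R e \<in> S'" using h by (auto simp: S S')
        then show ?thesis by (simp add: F_def)
      qed (auto simp: F_def)
    qed
    also have "\<dots> = (\<integral>\<^sup>+x. g x * indicator S' x \<partial>lborel)"
      by (rule nn_integral_shift) measurable
    finally show ?thesis using True by simp
  next
    case False
    then have "F x s = 0" for x by (auto simp: F_def S)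
    then show ?thesis by simp
  qed
  have "(\<integral>\<^sup>+x. \<integral>\<^sup>+s. F x s \<partial>lborel \<partial>lborel) = (\<integral>\<^sup>+s. \<integral>\<^sup>+x. F x s \<partial>lborel \<partial>lborel)"
    using lborel_pair.Fubini'[OF Fm] by simp
  also have "\<dots> \<le> (\<integral>\<^sup>+s. (\<integral>\<^sup>+x. g x * indicator S' x \<partial>lborel) * indicator {0..L} s \<partial>lborel)"
    by (intro nn_integral_mono inner)
  also have "\<dots> = (\<integral>\<^sup>+x. g x * indicator S' x \<partial>lborel) * ennreal L"
    using L by (simp add: nn_integral_cmult_indicator)
  finally have dbl: "(\<integral>\<^sup>+x. \<integral>\<^sup>+s. F x s \<partial>lborel \<partial>lborel) \<le> ennreal L * (\<integral>\<^sup>+x. g x * indicator S' x \<partial>lborel)"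
    by (simp add: mult.commute)
  have "(\<integral>\<^sup>+x. ennreal ((H' x \<bullet> \<Psi> x)\<^sup>2) * indicator S x \<partial>lborel)
    \<le> (\<integral>\<^sup>+x. 2 * (ennreal ((H' (x + H x *\<^sub>R e) \<bullet> \<Psi> (x + H x *\<^sub>R e))\<^sup>2) * indicator S x)
      + ennreal (2 * K\<^sup>2 * L) * (\<integral>\<^sup>+s. F x s \<partial>lborel) \<partial>lborel)"
    by (intro nn_integral_mono pt)
  also have "\<dots> = 2 * (\<integral>\<^sup>+x. ennreal ((H' (x + H x *\<^sub>R e) \<bullet> \<Psi> (x + H x *\<^sub>R e))\<^sup>2) * indicator S x \<partial>lborel)
      + ennreal (2 * K\<^sup>2 * L) * (\<integral>\<^sup>+x. \<integral>\<^sup>+s. F x s \<partial>lborel \<partial>lborel)"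
  proof -
    have m2: "(\<lambda>x. \<integral>\<^sup>+s. F x s \<partial>lborel) \<in> borel_measurable lborel"
      using lborel.borel_measurable_nn_integral[OF Fm] by simp
    show ?thesis using m2 by (subst nn_integral_add) (auto simp: nn_integral_cmult)
  qed
  also have "ennreal (2 * K\<^sup>2 * L) * (\<integral>\<^sup>+x. \<integral>\<^sup>+s. F x s \<partial>lborel \<partial>lborel)
    \<le> ennreal (2 * K\<^sup>2 * L) * (ennreal L * (\<integral>\<^sup>+x. g x * indicator S' x \<partial>lborel))"
    by (intro mult_left_mono dbl) simp
  also have "\<dots> = ennreal (2 * K\<^sup>2 * L\<^sup>2) * (\<integral>\<^sup>+x. g x * indicator S' x \<partial>lborel)"
  proof -
    have "ennreal (2 * K\<^sup>2 * L\<^sup>2) = ennreal (2 * K\<^sup>2 * L) * ennreal L"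
      using L(1) by (subst ennreal_mult[symmetric]) (auto simp: power2_eq_square)
    then show ?thesis by (simp only: mult.assoc)
  qed
  finally show ?thesis by (simp add: g_def add_left_mono)
qed

section \<open>Square integrable functions\<close>

definition square_integrable :: "'a measure \<Rightarrow> ('a \<Rightarrow> 'b::euclidean_space) \<Rightarrow> bool" where
  "square_integrable M f \<longleftrightarrow> f \<in> borel_measurable M \<and> integrable M (\<lambda>x. (norm (f x))\<^sup>2)"

lemma square_integrable_measurable: "square_integrable M f \<Longrightarrow> f \<in> borel_measurable M"
  by (simp add: square_integrable_def)

lemma square_integrable_dominated:
  assumes "square_integrable M f" "g \<in> borel_measurable M" "\<And>x. x \<in> space M \<Longrightarrow> norm (g x) \<le> B * norm (f x)"
  shows "square_integrable M g"
  unfolding square_integrable_def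
proof
  have fi: "integrable M (\<lambda>x. (norm (f x))\<^sup>2)" using assms(1) by (simp add: square_integrable_def)
  show "integrable M (\<lambda>x. (norm (g x))\<^sup>2)"
  proof (rule Bochner_Integration.integrable_bound[OF integrable_mult_right[OF fi, of "B\<^sup>2"]])
    show "(\<lambda>x. (norm (g x))\<^sup>2) \<in> borel_measurable M" using assms(2) by measurable
    show "AE x in M. norm ((norm (g x))\<^sup>2) \<le> norm (B\<^sup>2 * (norm (f x))\<^sup>2)"
    proof (rule AE_I2)
      fix x assume "x \<in> space M"
      then have "(norm (g x))\<^sup>2 \<le> (B * norm (f x))\<^sup>2" using assms(3) by (intro power_mono) auto
      then show "norm ((norm (g x))\<^sup>2) \<le> norm (B\<^sup>2 * (norm (f x))\<^sup>2)" by (simp add: power_mult_distrib)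
    qed
  qed
qed (rule assms)

lemma square_integrable_mult_bounded:
  fixes f g :: "'a \<Rightarrow> real"
  assumes "square_integrable M f" "g \<in> borel_measurable M" "\<And>x. x \<in> space M \<Longrightarrow> \<bar>g x\<bar> \<le> B"
  shows "square_integrable M (\<lambda>x. f x * g x)"
proof (rule square_integrable_dominated[OF assms(1), where B=B])
  show "(\<lambda>x. f x * g x) \<in> borel_measurable M" using assms(2) square_integrable_measurable[OF assms(1)] by measurable
  fix x assume "x \<in> space M"
  then show "norm (f x * g x) \<le> B * norm (f x)" using mult_right_mono[OF assms(3), of x "\<bar>f x\<bar>"]
    by (simp add: abs_mult mult.commute)
qed

lemma square_integrable_component:
  fixes f :: "'a \<Rightarrow> real^'n"
  assumes "square_integrable M f" shows "square_integrable M (\<lambda>x. f x $ i)"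
proof (rule square_integrable_dominated[OF assms, where B=1])
  show "(\<lambda>x. f x $ i) \<in> borel_measurable M"
    by (rule measurable_compose[OF square_integrable_measurable[OF assms] borel_measurable_continuous_onI])
      (intro continuous_intros)
qed (simp add: component_le_norm_cart)

lemma square_integrable_row:
  fixes f :: "'a \<Rightarrow> real^'n^'m"
  assumes "square_integrable M f" shows "square_integrable M (\<lambda>x. f x $ i)"
proof (rule square_integrable_dominated[OF assms, where B=1])
  show "(\<lambda>x. f x $ i) \<in> borel_measurable M"
    by (rule measurable_compose[OF square_integrable_measurable[OF assms] borel_measurable_continuous_onI])
      (intro continuous_intros)
qed (simp add: Finite_Cartesian_Product.norm_nth_le)

lemma integrable_mult_square_integrable:
  fixes f g :: "'a \<Rightarrow> real"
  assumes "square_integrable M f" "square_integrable M g"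
  shows "integrable M (\<lambda>x. f x * g x)"
proof (rule Bochner_Integration.integrable_bound)
  show "integrable M (\<lambda>x. (f x)\<^sup>2 + (g x)\<^sup>2)" using assms by (simp add: square_integrable_def)
  show "(\<lambda>x. f x * g x) \<in> borel_measurable M"
    using assms[THEN square_integrable_measurable] by (rule borel_measurable_times)
  have "\<bar>f x * g x\<bar> \<le> (f x)\<^sup>2 + (g x)\<^sup>2" for x
  proof -
    have "0 \<le> (\<bar>f x\<bar> - \<bar>g x\<bar>)\<^sup>2" by simp
    then have "2 * (\<bar>f x\<bar> * \<bar>g x\<bar>) \<le> (f x)\<^sup>2 + (g x)\<^sup>2" by (simp add: power2_diff)
    then show ?thesis unfolding abs_mult by (smt (verit) mult_nonneg_nonneg abs_ge_zero)
  qed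
  then show "AE x in M. norm (f x * g x) \<le> norm ((f x)\<^sup>2 + (g x)\<^sup>2)" by (auto intro!: AE_I2)
qed

lemma square_integrable_diff:
  fixes f g :: "'a \<Rightarrow> 'b::euclidean_space"
  assumes "square_integrable M f" "square_integrable M g"
  shows "square_integrable M (\<lambda>x. f x - g x)"
  unfolding square_integrable_def
proof
  show m: "(\<lambda>x. f x - g x) \<in> borel_measurable M" using assms[THEN square_integrable_measurable] by (rule borel_measurable_diff)
  show "integrable M (\<lambda>x. (norm (f x - g x))\<^sup>2)"
  proof (rule Bochner_Integration.integrable_bound)
    show "integrable M (\<lambda>x. 2 * ((norm (f x))\<^sup>2 + (norm (g x))\<^sup>2))" using assms by (simp add: square_integrable_def)
    show "(\<lambda>x. (norm (f x - g x))\<^sup>2) \<in> borel_measurable M" using m by measurable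
    have "(norm (f x - g x))\<^sup>2 \<le> 2 * ((norm (f x))\<^sup>2 + (norm (g x))\<^sup>2)" for x
    proof -
      have "(norm (f x - g x))\<^sup>2 \<le> (norm (f x) + norm (g x))\<^sup>2" by (intro power_mono norm_triangle_ineq4) simp
      also have "\<dots> \<le> 2 * ((norm (f x))\<^sup>2 + (norm (g x))\<^sup>2)"
        using zero_le_power2[of "norm (f x) - norm (g x)"] by (simp add: power2_eq_square algebra_simps)
      finally show ?thesis .
    qed
    then show "AE x in M. norm ((norm (f x - g x))\<^sup>2) \<le> norm (2 * ((norm (f x))\<^sup>2 + (norm (g x))\<^sup>2))" by (auto intro!: AE_I2)
  qed
qed

lemma square_integrable_add:
  fixes f g :: "'a \<Rightarrow> 'b::euclidean_space"
  assumes "square_integrable M f" "square_integrable M g"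
  shows "square_integrable M (\<lambda>x. f x + g x)"
proof -
  have "square_integrable M (\<lambda>x. - g x)" using assms(2) by (simp add: square_integrable_def)
  from square_integrable_diff[OF assms(1) this] show ?thesis by simp
qed

text \<open>By Young's inequality with a parameter: \<open>2|w Y| \<le> \<theta> w\<^sup>2 + Y\<^sup>2/\<theta>\<close>, with \<open>\<theta>\<close> small and fixed.\<close>

lemma L2_pairing_tendsto_0:
  fixes w :: "'a \<Rightarrow> real" and Y :: "nat \<Rightarrow> 'a \<Rightarrow> real"
  assumes w: "square_integrable M w" and Y: "\<And>n. square_integrable M (Y n)"
    and l: "(\<lambda>n. \<integral>x. (Y n x)\<^sup>2 \<partial>M) \<longlonglongrightarrow> 0"
  shows "(\<lambda>n. \<integral>x. \<bar>w x * Y n x\<bar> \<partial>M) \<longlonglongrightarrow> 0"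
proof (rule LIMSEQ_I)
  fix e :: real assume e: "e > 0"
  define A where "A = (\<integral>x. (w x)\<^sup>2 \<partial>M)"
  have A: "A \<ge> 0" by (simp add: A_def)
  define \<theta> where "\<theta> = e / (A + 1)"
  have \<theta>: "\<theta> > 0" using e A by (simp add: \<theta>_def)
  obtain n0 where n0: "\<And>n. n \<ge> n0 \<Longrightarrow> norm ((\<integral>x. (Y n x)\<^sup>2 \<partial>M) - 0) < \<theta> * e"
    using LIMSEQ_D[OF l, of "\<theta> * e"] \<theta> e by auto
  have wi: "integrable M (\<lambda>x. (w x)\<^sup>2)" using w by (simp add: square_integrable_def)
  have Yi: "integrable M (\<lambda>x. (Y n x)\<^sup>2)" for n using Y by (simp add: square_integrable_def)
  show "\<exists>no. \<forall>n\<ge>no. norm ((\<integral>x. \<bar>w x * Y n x\<bar> \<partial>M) - 0) < e"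
  proof (intro exI[of _ n0] allI impI)
    fix n assume n: "n \<ge> n0"
    have "(\<integral>x. \<bar>w x * Y n x\<bar> \<partial>M) \<le> (\<integral>x. (\<theta> * (w x)\<^sup>2 + (Y n x)\<^sup>2 / \<theta>) / 2 \<partial>M)"
    proof (rule Bochner_Integration.integral_mono)
      show "integrable M (\<lambda>x. \<bar>w x * Y n x\<bar>)" by (intro integrable_abs integrable_mult_square_integrable w Y)
      show "integrable M (\<lambda>x. (\<theta> * (w x)\<^sup>2 + (Y n x)\<^sup>2 / \<theta>) / 2)" using wi Yi by simp
      fix x
      have "0 \<le> (\<theta> * \<bar>w x\<bar> - \<bar>Y n x\<bar>)\<^sup>2" by simp
      then have "2 * \<theta> * (\<bar>w x\<bar> * \<bar>Y n x\<bar>) \<le> \<theta>\<^sup>2 * (w x)\<^sup>2 + (Y n x)\<^sup>2" by (simp add: power2_diff power_mult_distrib)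
      then have "2 * \<theta> * \<bar>w x * Y n x\<bar> \<le> \<theta> * (\<theta> * (w x)\<^sup>2 + (Y n x)\<^sup>2 / \<theta>)"
        using \<theta> by (simp add: abs_mult power2_eq_square[of \<theta>] algebra_simps)
      then have "\<theta> * (2 * \<bar>w x * Y n x\<bar>) \<le> \<theta> * (\<theta> * (w x)\<^sup>2 + (Y n x)\<^sup>2 / \<theta>)" by (simp only: mult_ac)
      then have "2 * \<bar>w x * Y n x\<bar> \<le> \<theta> * (w x)\<^sup>2 + (Y n x)\<^sup>2 / \<theta>"
        using \<theta> by (simp only: mult_le_cancel_left_pos)
      then show "\<bar>w x * Y n x\<bar> \<le> (\<theta> * (w x)\<^sup>2 + (Y n x)\<^sup>2 / \<theta>) / 2" by simp
    qed
    also have "\<dots> = (\<theta> * A + (\<integral>x. (Y n x)\<^sup>2 \<partial>M) / \<theta>) / 2" using wi Yi by (simp add: A_def)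
    also have "\<dots> < (e + e) / 2"
    proof -
      have "(\<integral>x. (Y n x)\<^sup>2 \<partial>M) / \<theta> < e" using n0[OF n] \<theta> by (simp add: divide_less_eq mult.commute)
      moreover have "\<theta> * A \<le> e" using A e by (simp add: \<theta>_def field_simps)
      ultimately show ?thesis by (intro divide_strict_right_mono add_le_less_mono) auto
    qed
    finally show "norm ((\<integral>x. \<bar>w x * Y n x\<bar> \<partial>M) - 0) < e" by simp
  qed
qed

text \<open>Every term of the integration by parts has this form. The error splits into a part controlled by
  the convergence of \<open>X'\<close> in the square integral sense and a part to which dominated convergence
  applies.\<close>

lemma L2_pairing_tendsto:
  fixes w X :: "'a \<Rightarrow> real"
  assumes w: "square_integrable M w" and X: "square_integrable M X" "\<And>n. square_integrable M (X' n)"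
    and lX: "(\<lambda>n. \<integral>x. (X' n x - X x)\<^sup>2 \<partial>M) \<longlonglongrightarrow> 0"
    and c: "c \<in> borel_measurable M" "\<And>n. c' n \<in> borel_measurable M"
    and B: "\<And>n x. \<bar>c' n x\<bar> \<le> B"
    and lc: "AE x in M. (\<lambda>n. c' n x) \<longlonglongrightarrow> c x"
  shows "(\<lambda>n. \<integral>x. w x * c' n x * X' n x \<partial>M) \<longlonglongrightarrow> (\<integral>x. w x * c x * X x \<partial>M)"
    and "integrable M (\<lambda>x. w x * c' n x * X' n x)" and "integrable M (\<lambda>x. w x * c x * X x)"
proof -
  have wm: "w \<in> borel_measurable M" and Xm: "X \<in> borel_measurable M" using w X by (auto simp: square_integrable_def)
  have wc: "square_integrable M (\<lambda>x. w x * c' n x)" for n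
    by (rule square_integrable_mult_bounded[OF w c(2) B])
  show i1: "integrable M (\<lambda>x. w x * c' n x * X' n x)" for n
    by (intro integrable_mult_square_integrable wc X)
  have i2: "integrable M (\<lambda>x. w x * c' n x * X x)" for n
    by (intro integrable_mult_square_integrable wc X)
  have wX: "integrable M (\<lambda>x. B * \<bar>w x * X x\<bar>)"
    by (intro integrable_mult_right integrable_abs integrable_mult_square_integrable w X)
  have bound: "AE x in M. norm (w x * c' n x * X x) \<le> B * \<bar>w x * X x\<bar>" for n
  proof (rule AE_I2)
    fix x show "norm (w x * c' n x * X x) \<le> B * \<bar>w x * X x\<bar>"
      using mult_right_mono[OF B[of n x], of "\<bar>w x * X x\<bar>"] by (simp add: abs_mult mult_ac)
  qed
  have lim: "AE x in M. (\<lambda>n. w x * c' n x * X x) \<longlonglongrightarrow> w x * c x * X x"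
    using lc by eventually_elim (intro tendsto_intros)
  have l1: "(\<lambda>n. \<integral>x. w x * c' n x * X x \<partial>M) \<longlonglongrightarrow> (\<integral>x. w x * c x * X x \<partial>M)"
    by (rule integral_dominated_convergence[OF _ _ wX lim bound]) (use wm Xm c in measurable)
  show "integrable M (\<lambda>x. w x * c x * X x)"
    by (rule integrable_dominated_convergence[OF _ _ wX lim bound]) (use wm Xm c in measurable)
  have "(\<lambda>n. \<integral>x. w x * c' n x * (X' n x - X x) \<partial>M) \<longlonglongrightarrow> 0"
  proof (rule Lim_null_comparison)
    show "(\<lambda>n. B * (\<integral>x. \<bar>w x * (X' n x - X x)\<bar> \<partial>M)) \<longlonglongrightarrow> 0"
      using tendsto_mult_left[OF L2_pairing_tendsto_0[OF w square_integrable_diff[OF X(2) X(1)] lX], of B] by simp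
    show "\<forall>\<^sub>F n in sequentially. norm (\<integral>x. w x * c' n x * (X' n x - X x) \<partial>M) \<le> B * (\<integral>x. \<bar>w x * (X' n x - X x)\<bar> \<partial>M)"
    proof (intro always_eventually allI)
      fix n
      have i: "integrable M (\<lambda>x. w x * (X' n x - X x))"
        by (intro integrable_mult_square_integrable square_integrable_diff w X)
      have i': "integrable M (\<lambda>x. w x * c' n x * (X' n x - X x))"
        by (intro integrable_mult_square_integrable square_integrable_diff wc X)
      have "norm (\<integral>x. w x * c' n x * (X' n x - X x) \<partial>M) \<le> (\<integral>x. \<bar>w x * c' n x * (X' n x - X x)\<bar> \<partial>M)"
        unfolding real_norm_def by (rule integral_abs_bound)
      also have "\<dots> \<le> (\<integral>x. B * \<bar>w x * (X' n x - X x)\<bar> \<partial>M)"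
      proof (rule Bochner_Integration.integral_mono)
        fix x show "\<bar>w x * c' n x * (X' n x - X x)\<bar> \<le> B * \<bar>w x * (X' n x - X x)\<bar>"
          using mult_right_mono[OF B[of n x], of "\<bar>w x * (X' n x - X x)\<bar>"] by (simp add: abs_mult mult_ac)
      qed (use i i' in \<open>auto intro!: integrable_abs\<close>)
      finally show "norm (\<integral>x. w x * c' n x * (X' n x - X x) \<partial>M) \<le> B * (\<integral>x. \<bar>w x * (X' n x - X x)\<bar> \<partial>M)" by simp
    qed
  qed
  moreover have "(\<integral>x. w x * c' n x * (X' n x - X x) \<partial>M) = (\<integral>x. w x * c' n x * X' n x \<partial>M) - (\<integral>x. w x * c' n x * X x \<partial>M)" for n
    using i1 i2 by (simp add: right_diff_distrib)
  ultimately have "(\<lambda>n. (\<integral>x. w x * c' n x * X' n x \<partial>M) - (\<integral>x. w x * c' n x * X x \<partial>M)) \<longlonglongrightarrow> 0" by simp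
  from tendsto_add[OF this l1] show "(\<lambda>n. \<integral>x. w x * c' n x * X' n x \<partial>M) \<longlonglongrightarrow> (\<integral>x. w x * c x * X x \<partial>M)" by simp
qed

lemma has_C1_gradient_compose_vec:
  fixes \<Psi> :: "real^'n \<Rightarrow> real^'m" and D\<Psi> :: "real^'n \<Rightarrow> real^'n^'m"
  assumes \<mu>: "has_C1_gradient \<mu> \<mu>'" and \<Psi>: "\<And>i. has_C1_gradient (\<lambda>x. \<Psi> x $ i) (\<lambda>x. D\<Psi> x $ i)"
  shows "has_C1_gradient (\<lambda>x. \<mu> (\<Psi> x)) (\<lambda>x. \<Sum>j\<in>UNIV. (\<mu>' (\<Psi> x) $ j) *\<^sub>R (D\<Psi> x $ j))"
proof -
  have \<Psi>c: "continuous_on UNIV \<Psi>"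
    using has_C1_gradient_continuous[OF \<Psi>] continuous_on_vec_lambda[of UNIV "\<lambda>i x. \<Psi> x $ i"] by simp
  have \<mu>c: "continuous_on UNIV (\<lambda>x. \<mu>' (\<Psi> x))"
    using \<mu> by (intro continuous_on_compose2[OF _ \<Psi>c, of UNIV]) (auto simp: has_C1_gradient_def)
  have Dc: "continuous_on UNIV (\<lambda>x. D\<Psi> x $ j)" for j using \<Psi>[of j] by (simp add: has_C1_gradient_def)
  have "GDERIV (\<lambda>x. \<mu> (\<Psi> x)) x :> (\<Sum>j\<in>UNIV. (\<mu>' (\<Psi> x) $ j) *\<^sub>R (D\<Psi> x $ j))" for x
  proof -
    have d1: "(\<Psi> has_derivative (\<lambda>h. \<chi> i. h \<bullet> D\<Psi> x $ i)) (at x)"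
    proof (subst has_derivative_componentwise_within, rule ballI)
      fix b :: "real^'m" assume "b \<in> Basis"
      then obtain i where b: "b = axis i 1" by (auto simp: Basis_vec_def)
      show "((\<lambda>x. \<Psi> x \<bullet> b) has_derivative (\<lambda>h. (\<chi> i. h \<bullet> D\<Psi> x $ i) \<bullet> b)) (at x)"
        using \<Psi>[of i] by (simp add: b inner_axis has_C1_gradient_def gderiv_def)
    qed
    have d2: "(\<mu> has_derivative (\<lambda>h. h \<bullet> \<mu>' (\<Psi> x))) (at (\<Psi> x))"
      using \<mu> by (simp add: has_C1_gradient_def gderiv_def)
    have "((\<lambda>x. \<mu> (\<Psi> x)) has_derivative (\<lambda>h. (\<chi> i. h \<bullet> D\<Psi> x $ i) \<bullet> \<mu>' (\<Psi> x))) (at x)"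
      by (rule has_derivative_compose[OF d1 d2])
    moreover have "(\<lambda>h. (\<chi> i. h \<bullet> D\<Psi> x $ i) \<bullet> \<mu>' (\<Psi> x)) = (\<lambda>h. h \<bullet> (\<Sum>j\<in>UNIV. (\<mu>' (\<Psi> x) $ j) *\<^sub>R (D\<Psi> x $ j)))"
      by (rule ext) (simp add: inner_vec_def[of "\<chi> i. _ i"] inner_sum_right mult.commute)
    ultimately show ?thesis unfolding gderiv_def by simp
  qed
  moreover have "continuous_on UNIV (\<lambda>x. \<Sum>j\<in>UNIV. (\<mu>' (\<Psi> x) $ j) *\<^sub>R (D\<Psi> x $ j))"
    by (intro continuous_intros \<mu>c Dc)
  ultimately show ?thesis by (simp add: has_C1_gradient_def)
qed

section \<open>Integration by parts against fields with vanishing normal trace\<close>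

lemma finite_measure_lebesgue_on_bounded:
  assumes "bounded \<Omega>" "\<Omega> \<in> sets lebesgue"
  shows "finite_measure (lebesgue_on \<Omega>)"
proof
  have "\<Omega> \<in> lmeasurable" using assms bounded_set_imp_lmeasurable by blast
  then show "emeasure (lebesgue_on \<Omega>) (space (lebesgue_on \<Omega>)) \<noteq> \<infinity>"
    using assms(2) by (simp add: emeasure_restrict_space space_restrict_space fmeasurable_def less_top)
qed

lemma continuous_bounded_on_bounded:
  fixes f :: "'a::euclidean_space \<Rightarrow> 'b::euclidean_space"
  assumes "continuous_on UNIV f" "bounded \<Omega>"
  obtains B where "B \<ge> 0" "\<And>x. x \<in> \<Omega> \<Longrightarrow> norm (f x) \<le> B"
proof -
  have "bounded (f ` closure \<Omega>)"
    using assms by (intro compact_imp_bounded compact_continuous_image) (auto intro: continuous_on_subset simp: compact_closure)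
  then obtain B where "B > 0" "\<And>x. x \<in> closure \<Omega> \<Longrightarrow> norm (f x) \<le> B" unfolding bounded_pos by auto
  then show thesis using closure_subset by (intro that[of B]) auto
qed

lemma continuous_square_integrable:
  fixes f :: "'a::euclidean_space \<Rightarrow> 'b::euclidean_space"
  assumes f: "continuous_on UNIV f" and \<Omega>: "bounded \<Omega>" "\<Omega> \<in> sets lebesgue"
  shows "square_integrable (lebesgue_on \<Omega>) f"
proof -
  interpret finite_measure "lebesgue_on \<Omega>" by (rule finite_measure_lebesgue_on_bounded[OF \<Omega>])
  obtain B where B: "B \<ge> 0" "\<And>x. x \<in> \<Omega> \<Longrightarrow> norm (f x) \<le> B"
    using continuous_bounded_on_bounded[OF f \<Omega>(1)] by blast
  have fm: "f \<in> borel_measurable (lebesgue_on \<Omega>)" by (rule continuous_imp_measurable_lebesgue_on[OF f])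
  have "integrable (lebesgue_on \<Omega>) (\<lambda>x. (norm (f x))\<^sup>2)"
  proof (rule integrable_const_bound[of _ "B\<^sup>2"])
    show "AE x in lebesgue_on \<Omega>. norm ((norm (f x))\<^sup>2) \<le> B\<^sup>2"
      using B by (intro AE_I2) (auto simp: space_restrict_space intro!: power_mono)
    show "(\<lambda>x. (norm (f x))\<^sup>2) \<in> borel_measurable (lebesgue_on \<Omega>)" using fm by measurable
  qed
  then show ?thesis using fm by (simp add: square_integrable_def)
qed

lemma L2_tendsto_dominated:
  fixes X :: "nat \<Rightarrow> 'a \<Rightarrow> real" and Y :: "nat \<Rightarrow> 'a \<Rightarrow> 'b::euclidean_space"
  assumes Y: "\<And>n. square_integrable M (Y n)" "(\<lambda>n. \<integral>x. (norm (Y n x))\<^sup>2 \<partial>M) \<longlonglongrightarrow> 0"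
    and le: "\<And>n x. \<bar>X n x\<bar> \<le> norm (Y n x)"
  shows "(\<lambda>n. \<integral>x. (X n x)\<^sup>2 \<partial>M) \<longlonglongrightarrow> 0"
proof (rule Lim_null_comparison[OF _ Y(2)], intro always_eventually allI)
  fix n
  have "(\<integral>x. (X n x)\<^sup>2 \<partial>M) \<le> (\<integral>x. (norm (Y n x))\<^sup>2 \<partial>M)"
  proof (rule integral_mono')
    show "integrable M (\<lambda>x. (norm (Y n x))\<^sup>2)" using Y(1) by (simp add: square_integrable_def)
    show "(X n x)\<^sup>2 \<le> (norm (Y n x))\<^sup>2" for x using power_mono[OF le[of n x], of 2] by simp
  qed simp
  then show "norm (\<integral>x. (X n x)\<^sup>2 \<partial>M) \<le> (\<integral>x. (norm (Y n x))\<^sup>2 \<partial>M)" by simp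
qed

text \<open>A field \<open>G\<close> with derivative \<open>D\<close> (row \<open>i\<close> is the gradient of the \<open>i\<close>-th component), approximated by
  \<open>C\<^sup>1\<close> fields \<open>\<Psi> n\<close> in the square integral sense up to the first derivatives, whose boundary values
  converge to a field \<open>T\<close> without normal component. In the application \<open>G\<close> is the gradient of \<open>u\<close>. The
  approximating fields replace any density theorem for Sobolev functions.\<close>

locale neumann_field =
  fixes \<Omega> :: "(real^'n) set" and G :: "real^'n \<Rightarrow> real^'n" and D :: "real^'n \<Rightarrow> real^'n^'n"
    and \<Psi> :: "nat \<Rightarrow> real^'n \<Rightarrow> real^'n" and D\<Psi> :: "nat \<Rightarrow> real^'n \<Rightarrow> real^'n^'n"
    and T :: "real^'n \<Rightarrow> real^'n"
  assumes \<Omega>: "open \<Omega>" "bounded \<Omega>" "2 \<le> CARD('n)"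
    and charts: "\<And>x0. x0 \<in> frontier \<Omega> \<Longrightarrow> \<exists>r e H H'. boundary_chart \<Omega> x0 r e H H'"
    and G: "square_integrable (lebesgue_on \<Omega>) G" and D: "square_integrable (lebesgue_on \<Omega>) D"
    and \<Psi>: "\<And>n i. has_C1_gradient (\<lambda>x. \<Psi> n x $ i) (\<lambda>x. D\<Psi> n x $ i)"
    and conv: "(\<lambda>n. \<integral>x. (norm (\<Psi> n x - G x))\<^sup>2 \<partial>lebesgue_on \<Omega>) \<longlonglongrightarrow> 0"
      "(\<lambda>n. \<integral>x. (norm (D\<Psi> n x - D x))\<^sup>2 \<partial>lebesgue_on \<Omega>) \<longlonglongrightarrow> 0"
    and conv_AE: "AE x in lebesgue_on \<Omega>. (\<lambda>n. \<Psi> n x) \<longlonglongrightarrow> G x"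
    and T: "T \<in> borel_measurable (surface_measure \<Omega>)"
      "AE y in surface_measure \<Omega>. T y \<bullet> outer_normal \<Omega> y = 0"
      "(\<lambda>n. \<integral>\<^sup>+y. ennreal ((norm (\<Psi> n y - T y))\<^sup>2) \<partial>surface_measure \<Omega>) \<longlonglongrightarrow> 0"
begin

lemma \<Omega>_sets [simp]: "\<Omega> \<in> sets lebesgue" using \<Omega>(1) by simp

lemma \<Psi>_continuous: "continuous_on UNIV (\<Psi> n)"
  using has_C1_gradient_continuous[OF \<Psi>] continuous_on_vec_lambda[of UNIV "\<lambda>i x. \<Psi> n x $ i"] by simp

lemma D\<Psi>_continuous: "continuous_on UNIV (D\<Psi> n)"
proof -
  have "continuous_on UNIV (\<lambda>x. D\<Psi> n x $ i)" for i using \<Psi>[of n i] by (simp add: has_C1_gradient_def)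
  then show ?thesis using continuous_on_vec_lambda[of UNIV "\<lambda>i x. D\<Psi> n x $ i"] by simp
qed

lemma \<Psi>_L2: "square_integrable (lebesgue_on \<Omega>) (\<Psi> n)" "square_integrable (lebesgue_on \<Omega>) (D\<Psi> n)"
  using \<Omega> by (auto intro: continuous_square_integrable \<Psi>_continuous D\<Psi>_continuous)

lemma conv_components:
  "(\<lambda>n. \<integral>x. (\<Psi> n x $ i - G x $ i)\<^sup>2 \<partial>lebesgue_on \<Omega>) \<longlonglongrightarrow> 0"
  "(\<lambda>n. \<integral>x. (D\<Psi> n x $ i $ j - D x $ i $ j)\<^sup>2 \<partial>lebesgue_on \<Omega>) \<longlonglongrightarrow> 0"
proof -
  show "(\<lambda>n. \<integral>x. (\<Psi> n x $ i - G x $ i)\<^sup>2 \<partial>lebesgue_on \<Omega>) \<longlonglongrightarrow> 0"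
    by (rule L2_tendsto_dominated[OF square_integrable_diff[OF \<Psi>_L2(1) G] conv(1)])
      (metis component_le_norm_cart vector_minus_component)
  have "\<bar>A $ i $ j\<bar> \<le> norm A" for A :: "real^'n^'n"
    using component_le_norm_cart[of "A $ i" j] Finite_Cartesian_Product.norm_nth_le[of A i] by linarith
  then show "(\<lambda>n. \<integral>x. (D\<Psi> n x $ i $ j - D x $ i $ j)\<^sup>2 \<partial>lebesgue_on \<Omega>) \<longlonglongrightarrow> 0"
    by (intro L2_tendsto_dominated[OF square_integrable_diff[OF \<Psi>_L2(2) D] conv(2)])
      (metis vector_minus_component)
qed

end

text \<open>The data of the integration by parts: a function \<open>\<phi>\<close> in \<open>W^(1,2)\<close> and the field \<open>\<mu>(G) G\<close> with a scalar
  weight \<open>\<mu>\<close>. The bounds on \<open>\<mu>\<close> keep the field and its divergence square integrable.\<close>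

locale neumann_pairing = neumann_field \<Omega> G D \<Psi> D\<Psi> T
  for \<Omega> :: "(real^'n) set" and G D \<Psi> D\<Psi> T +
  fixes \<phi> :: "real^'n \<Rightarrow> real" and D\<phi> :: "real^'n \<Rightarrow> real^'n"
    and \<mu> :: "real^'n \<Rightarrow> real" and \<mu>' :: "real^'n \<Rightarrow> real^'n" and B :: real
  assumes \<phi>: "square_integrable (lebesgue_on \<Omega>) \<phi>" "\<And>i. square_integrable (lebesgue_on \<Omega>) (\<lambda>x. D\<phi> x $ i)"
      "\<And>i. weak_partial \<Omega> i \<phi> (\<lambda>x. D\<phi> x $ i)"
    and \<mu>: "has_C1_gradient \<mu> \<mu>'" "\<And>z. \<bar>\<mu> z\<bar> \<le> B" "\<And>z. norm z * norm (\<mu>' z) \<le> B"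
begin

abbreviation "M \<equiv> lebesgue_on \<Omega>"

definition flux :: "real^'n \<Rightarrow> real^'n" where
  "flux x = (\<phi> x * \<mu> (G x)) *\<^sub>R G x"

text \<open>The divergence of \<open>flux\<close> by the product and chain rules, applied formally.\<close>

definition flux_div :: "real^'n \<Rightarrow> real" where
  "flux_div x = \<phi> x * (\<mu> (G x) * (\<Sum>i\<in>UNIV. D x $ i $ i) + (\<Sum>i\<in>UNIV. \<Sum>j\<in>UNIV. G x $ i * \<mu>' (G x) $ j * D x $ j $ i))
     + \<mu> (G x) * (D\<phi> x \<bullet> G x)"

lemma \<mu>_continuous: "continuous_on UNIV \<mu>" "continuous_on UNIV \<mu>'"
  using \<mu>(1) has_C1_gradient_continuous by (auto simp: has_C1_gradient_def)

text \<open>Almost everywhere convergence of the coefficients \<open>q(\<Psi> n)\<close> follows from that of \<open>\<Psi> n\<close> by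
  continuity.\<close>

lemma coefficient_limit:
  assumes q: "continuous_on UNIV q" "\<And>z. \<bar>q z\<bar> \<le> B" and w: "square_integrable M w"
    and X: "square_integrable M X" "\<And>n. square_integrable M (X' n)" "(\<lambda>n. \<integral>x. (X' n x - X x)\<^sup>2 \<partial>M) \<longlonglongrightarrow> 0"
  shows "(\<lambda>n. \<integral>x. w x * q (\<Psi> n x) * X' n x \<partial>M) \<longlonglongrightarrow> (\<integral>x. w x * q (G x) * X x \<partial>M)"
    and "integrable M (\<lambda>x. w x * q (\<Psi> n x) * X' n x)" and "integrable M (\<lambda>x. w x * q (G x) * X x)"
proof -
  have qm[measurable]: "q \<in> borel_measurable borel" using q(1) by (rule borel_measurable_continuous_onI)
  have Gm[measurable]: "G \<in> borel_measurable M" and \<Psi>m[measurable]: "\<And>n. \<Psi> n \<in> borel_measurable M"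
    using G \<Psi>_L2 by (auto simp: square_integrable_def)
  have lim: "AE x in M. (\<lambda>n. q (\<Psi> n x)) \<longlonglongrightarrow> q (G x)"
    using conv_AE
  proof eventually_elim
    case (elim x)
    show ?case by (rule continuous_on_tendsto_compose[OF q(1) elim]) auto
  qed
  note * = L2_pairing_tendsto[OF w X, where c="\<lambda>x. q (G x)" and c'="\<lambda>n x. q (\<Psi> n x)" and B=B, OF _ _ q(2) lim]
  show "(\<lambda>n. \<integral>x. w x * q (\<Psi> n x) * X' n x \<partial>M) \<longlonglongrightarrow> (\<integral>x. w x * q (G x) * X x \<partial>M)"
    "integrable M (\<lambda>x. w x * q (\<Psi> n x) * X' n x)" "integrable M (\<lambda>x. w x * q (G x) * X x)"
    by (rule *; measurable)+
qed

lemmas limit\<Psi> = coefficient_limit[OF _ _ _ square_integrable_component[OF G] square_integrable_component[OF \<Psi>_L2(1)] conv_components(1)]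
lemmas limitD = coefficient_limit[OF _ _ _ square_integrable_component[OF square_integrable_row[OF D]]
   square_integrable_component[OF square_integrable_row[OF \<Psi>_L2(2)]] conv_components(2)]

lemma radial_coefficient: "continuous_on UNIV (\<lambda>z. z $ i * \<mu>' z $ j)" "\<bar>z $ i * \<mu>' z $ j\<bar> \<le> B"
proof -
  show "continuous_on UNIV (\<lambda>z. z $ i * \<mu>' z $ j)" by (intro continuous_intros \<mu>_continuous)
  have "\<bar>z $ i * \<mu>' z $ j\<bar> \<le> norm z * norm (\<mu>' z)"
    unfolding abs_mult by (intro mult_mono component_le_norm_cart) auto
  then show "\<bar>z $ i * \<mu>' z $ j\<bar> \<le> B" using \<mu>(3)[of z] by linarith
qed

lemma flux_integrable: "integrable M (\<lambda>x. flux x $ i)" "integrable M flux_div"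
proof -
  have "integrable M (\<lambda>x. \<phi> x * \<mu> (G x) * G x $ i)"
    by (rule limit\<Psi>(3)[OF \<mu>_continuous(1) \<mu>(2) \<phi>(1)])
  then show "integrable M (\<lambda>x. flux x $ i)" by (simp add: flux_def)
  have "integrable M (\<lambda>x. (\<Sum>i\<in>UNIV. \<phi> x * \<mu> (G x) * D x $ i $ i)
      + (\<Sum>i\<in>UNIV. \<Sum>j\<in>UNIV. \<phi> x * (G x $ i * \<mu>' (G x) $ j) * D x $ j $ i) + (\<Sum>i\<in>UNIV. D\<phi> x $ i * \<mu> (G x) * G x $ i))"
    by (intro Bochner_Integration.integrable_add Bochner_Integration.integrable_sum
        limitD(3)[OF \<mu>_continuous(1) \<mu>(2) \<phi>(1)] limitD(3)[OF radial_coefficient \<phi>(1)] limit\<Psi>(3)[OF \<mu>_continuous(1) \<mu>(2) \<phi>(2)])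
  also have "(\<lambda>x. (\<Sum>i\<in>UNIV. \<phi> x * \<mu> (G x) * D x $ i $ i)
      + (\<Sum>i\<in>UNIV. \<Sum>j\<in>UNIV. \<phi> x * (G x $ i * \<mu>' (G x) $ j) * D x $ j $ i) + (\<Sum>i\<in>UNIV. D\<phi> x $ i * \<mu> (G x) * G x $ i)) = flux_div"
    by (rule ext) (simp add: flux_div_def inner_vec_def sum_distrib_left distrib_left mult_ac)
  finally show "integrable M flux_div" .
qed

text \<open>Testing the weak derivatives of \<open>\<phi>\<close> with the components of \<open>\<psi> \<mu>(\<Psi> n) \<Psi> n\<close> gives the identity for
  \<open>\<Psi> n\<close>; each of its terms is a product to which \<open>L2_pairing_tendsto\<close> applies.\<close>

lemma interior_identity:
  assumes \<psi>: "has_C1_gradient \<psi> g" "compact K" "\<And>x. x \<notin> K \<Longrightarrow> \<psi> x = 0" and K: "K \<subseteq> \<Omega>"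
  shows "(\<integral>x. g x \<bullet> flux x + \<psi> x * flux_div x \<partial>M) = 0"
proof -
  have \<psi>c: "continuous_on UNIV \<psi>" by (rule has_C1_gradient_continuous[OF \<psi>(1)])
  have gc: "continuous_on UNIV (\<lambda>x. g x $ i)" for i using \<psi>(1) by (auto simp: has_C1_gradient_def intro!: continuous_intros)
  have g0: "x \<notin> K \<Longrightarrow> g x $ i = 0" for x i
    using has_C1_gradient_eq_0_outside[OF \<psi>(1) compact_imp_closed[OF \<psi>(2)] \<psi>(3)] by auto
  have L2w: "square_integrable M (\<lambda>x. w x * h x)"
    if w: "square_integrable M w" and h: "continuous_on UNIV h" "\<And>x. x \<notin> K \<Longrightarrow> h x = 0" for w h :: "real^'n \<Rightarrow> real"
  proof -
    obtain C where C: "C \<ge> 0" "\<And>x. \<bar>h x\<bar> \<le> C" using continuous_compact_support_bounded[OF h(1) \<psi>(2) h(2)] by blast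
    show ?thesis by (rule square_integrable_mult_bounded[OF w continuous_imp_measurable_lebesgue_on[OF h(1)] C(2)])
  qed
  note w1 = L2w[OF \<phi>(1) gc g0] and w2 = L2w[OF \<phi>(1) \<psi>c \<psi>(3)] and w4 = L2w[OF \<phi>(2) \<psi>c \<psi>(3)]
  note \<mu>q = \<mu>_continuous(1) \<mu>(2)
  have id_n: "(\<integral>x. \<phi> x * g x $ i * \<mu> (\<Psi> n x) * \<Psi> n x $ i \<partial>M) + (\<integral>x. \<phi> x * \<psi> x * \<mu> (\<Psi> n x) * D\<Psi> n x $ i $ i \<partial>M)
      + (\<Sum>j\<in>UNIV. \<integral>x. \<phi> x * \<psi> x * (\<Psi> n x $ i * \<mu>' (\<Psi> n x) $ j) * D\<Psi> n x $ j $ i \<partial>M)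
      = - (\<integral>x. D\<phi> x $ i * \<psi> x * \<mu> (\<Psi> n x) * \<Psi> n x $ i \<partial>M)" for i n
  proof -
    let ?t = "\<lambda>x. \<psi> x * (\<mu> (\<Psi> n x) * \<Psi> n x $ i)"
    let ?t' = "\<lambda>x. \<psi> x *\<^sub>R (\<mu> (\<Psi> n x) *\<^sub>R D\<Psi> n x $ i + (\<Psi> n x $ i) *\<^sub>R (\<Sum>j\<in>UNIV. (\<mu>' (\<Psi> n x) $ j) *\<^sub>R (D\<Psi> n x $ j))) + (\<mu> (\<Psi> n x) * \<Psi> n x $ i) *\<^sub>R g x"
    have t: "has_C1_gradient ?t ?t'"
      by (intro has_C1_gradient_mult \<psi>(1) has_C1_gradient_compose_vec[OF \<mu>(1) \<Psi>] \<Psi>)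
    have "(\<integral>x. \<phi> x * ?t' x $ i \<partial>M) = - (\<integral>x. D\<phi> x $ i * ?t x \<partial>M)"
      by (rule weak_partial_C1[OF \<phi>(3) t \<psi>(2) _ K \<Omega>(1)]) (simp add: \<psi>(3))
    moreover have "(\<lambda>x. \<phi> x * ?t' x $ i) = (\<lambda>x. \<phi> x * g x $ i * \<mu> (\<Psi> n x) * \<Psi> n x $ i + \<phi> x * \<psi> x * \<mu> (\<Psi> n x) * D\<Psi> n x $ i $ i
      + (\<Sum>j\<in>UNIV. \<phi> x * \<psi> x * (\<Psi> n x $ i * \<mu>' (\<Psi> n x) $ j) * D\<Psi> n x $ j $ i))"
      by (rule ext) (simp add: distrib_left sum_distrib_left mult_ac)
    moreover have "(\<lambda>x. D\<phi> x $ i * ?t x) = (\<lambda>x. D\<phi> x $ i * \<psi> x * \<mu> (\<Psi> n x) * \<Psi> n x $ i)"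
      by (simp add: mult_ac)
    ultimately show ?thesis
      using limit\<Psi>(2)[OF \<mu>q w1] limitD(2)[OF \<mu>q w2] limitD(2)[OF radial_coefficient w2] by simp
  qed
  have id: "(\<integral>x. \<phi> x * g x $ i * \<mu> (G x) * G x $ i \<partial>M) + (\<integral>x. \<phi> x * \<psi> x * \<mu> (G x) * D x $ i $ i \<partial>M)
      + (\<Sum>j\<in>UNIV. \<integral>x. \<phi> x * \<psi> x * (G x $ i * \<mu>' (G x) $ j) * D x $ j $ i \<partial>M)
      = - (\<integral>x. D\<phi> x $ i * \<psi> x * \<mu> (G x) * G x $ i \<partial>M)" for i
  proof (rule LIMSEQ_unique)
    show "(\<lambda>n. - (\<integral>x. D\<phi> x $ i * \<psi> x * \<mu> (\<Psi> n x) * \<Psi> n x $ i \<partial>M)) \<longlonglongrightarrow> - (\<integral>x. D\<phi> x $ i * \<psi> x * \<mu> (G x) * G x $ i \<partial>M)"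
      by (intro tendsto_minus limit\<Psi>(1)[OF \<mu>q w4])
    show "(\<lambda>n. - (\<integral>x. D\<phi> x $ i * \<psi> x * \<mu> (\<Psi> n x) * \<Psi> n x $ i \<partial>M)) \<longlonglongrightarrow>
      (\<integral>x. \<phi> x * g x $ i * \<mu> (G x) * G x $ i \<partial>M) + (\<integral>x. \<phi> x * \<psi> x * \<mu> (G x) * D x $ i $ i \<partial>M)
      + (\<Sum>j\<in>UNIV. \<integral>x. \<phi> x * \<psi> x * (G x $ i * \<mu>' (G x) $ j) * D x $ j $ i \<partial>M)"
      unfolding id_n[symmetric]
      by (intro tendsto_add tendsto_sum limit\<Psi>(1)[OF \<mu>q w1] limitD(1)[OF \<mu>q w2] limitD(1)[OF radial_coefficient w2])
  qed
  have eq: "(\<lambda>x. g x \<bullet> flux x + \<psi> x * flux_div x) = (\<lambda>x. \<Sum>i\<in>UNIV. \<phi> x * g x $ i * \<mu> (G x) * G x $ i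
      + \<phi> x * \<psi> x * \<mu> (G x) * D x $ i $ i + (\<Sum>j\<in>UNIV. \<phi> x * \<psi> x * (G x $ i * \<mu>' (G x) $ j) * D x $ j $ i)
      + D\<phi> x $ i * \<psi> x * \<mu> (G x) * G x $ i)"
    by (rule ext) (simp add: flux_def flux_div_def inner_vec_def sum_distrib_left distrib_left sum.distrib mult_ac)
  show ?thesis
    unfolding eq
    using limit\<Psi>(3)[OF \<mu>q w1] limitD(3)[OF \<mu>q w2] limitD(3)[OF radial_coefficient w2] limit\<Psi>(3)[OF \<mu>q w4] id
    by (simp add: eq_neg_iff_add_eq_0)
qed

end

subsection \<open>A step function of class \<open>C\<^sup>1\<close> and a partition argument\<close>

text \<open>The second primitive of the piecewise constant function \<open>1, -1\<close> on \<open>(0,1), (1,2)\<close>, written with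
  second differences of \<open>(max 0 s)\<^sup>2\<close>: it rises from 0 to 1 and its derivative is a tent.\<close>

definition smoothstep :: "real \<Rightarrow> real" where
  "smoothstep s = ((max 0 s)\<^sup>2 - 2 * (max 0 (s - 1))\<^sup>2 + (max 0 (s - 2))\<^sup>2) / 2"

definition tent :: "real \<Rightarrow> real" where
  "tent s = max 0 s - 2 * max 0 (s - 1) + max 0 (s - 2)"

lemma DERIV_max_0_square: "((\<lambda>s::real. (max 0 s)\<^sup>2) has_real_derivative 2 * max 0 s) (at s)"
proof -
  consider "s < 0" | "s = 0" | "s > 0" by linarith
  then show ?thesis
  proof cases
    case 1
    have "((\<lambda>_. 0) has_real_derivative 0) (at s)" by simp
    then have "((\<lambda>s::real. (max 0 s)\<^sup>2) has_real_derivative 0) (at s)"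
      by (rule has_field_derivative_transform_within_open[of _ _ _ "{..<0}"]) (use 1 in auto)
    then show ?thesis using 1 by simp
  next
    case 2
    have "((\<lambda>h::real. (max 0 h)\<^sup>2 / h) \<longlongrightarrow> 0) (at 0)"
    proof (rule Lim_null_comparison)
      show "\<forall>\<^sub>F h in at (0::real). norm ((max 0 h)\<^sup>2 / h) \<le> \<bar>h\<bar>"
        by (intro always_eventually allI) (auto simp: max_def power2_eq_square)
      show "((\<lambda>h::real. \<bar>h\<bar>) \<longlongrightarrow> 0) (at 0)" by (intro tendsto_rabs_zero tendsto_ident_at)
    qed
    then show ?thesis using 2 by (simp add: has_field_derivative_iff)
  next
    case 3
    have "((\<lambda>s. s\<^sup>2) has_real_derivative 2 * s) (at s)" by (auto intro!: derivative_eq_intros)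
    then have "((\<lambda>s::real. (max 0 s)\<^sup>2) has_real_derivative 2 * s) (at s)"
      by (rule has_field_derivative_transform_within_open[of _ _ _ "{0<..}"]) (use 3 in auto)
    then show ?thesis using 3 by simp
  qed
qed

lemma smoothstep_deriv: "(smoothstep has_real_derivative tent s) (at s)"
proof -
  have *: "((\<lambda>s::real. (max 0 (s - c))\<^sup>2) has_real_derivative 2 * max 0 (s - c)) (at s)" for c
  proof -
    have d: "((\<lambda>s. s - c) has_real_derivative 1) (at s)" by (auto intro!: derivative_eq_intros)
    show ?thesis using DERIV_chain2[where f="\<lambda>s. (max 0 s)\<^sup>2", OF DERIV_max_0_square d] by simp
  qed
  have "((\<lambda>s. ((max 0 s)\<^sup>2 - 2 * (max 0 (s - 1))\<^sup>2 + (max 0 (s - 2))\<^sup>2) / 2) has_real_derivative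
      (2 * max 0 s - 2 * (2 * max 0 (s - 1)) + 2 * max 0 (s - 2)) / 2) (at s)"
    by (intro DERIV_cdivide DERIV_add DERIV_diff DERIV_cmult DERIV_max_0_square *)
  moreover have "(2 * max 0 s - 2 * (2 * max 0 (s - 1)) + 2 * max 0 (s - 2)) / 2 = tent s"
    by (simp add: tent_def field_simps)
  ultimately show ?thesis unfolding smoothstep_def[abs_def] by (simp only:)
qed

lemma tent_continuous: "continuous_on UNIV tent"
  unfolding tent_def[abs_def] by (intro continuous_intros)

lemma smoothstep_facts: "s \<le> 0 \<Longrightarrow> smoothstep s = 0" "s \<ge> 2 \<Longrightarrow> smoothstep s = 1"
  "0 \<le> smoothstep s" "smoothstep s \<le> 1"
proof -
  show "s \<le> 0 \<Longrightarrow> smoothstep s = 0" by (simp add: smoothstep_def)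
  show "s \<ge> 2 \<Longrightarrow> smoothstep s = 1" by (simp add: smoothstep_def power2_eq_square algebra_simps)
  consider "s \<le> 0" | "0 \<le> s" "s \<le> 1" | "1 \<le> s" "s \<le> 2" | "s \<ge> 2" by linarith
  then have "0 \<le> smoothstep s \<and> smoothstep s \<le> 1"
  proof cases
    case 2
    then have "s\<^sup>2 \<le> 1" by (simp add: power_le_one)
    then show ?thesis using 2 by (simp add: smoothstep_def)
  next
    case 3
    then have eq: "smoothstep s = 1 - (2 - s)\<^sup>2 / 2" by (simp add: smoothstep_def power2_eq_square field_simps)
    have "(2 - s)\<^sup>2 \<le> 1" using 3 by (intro power_le_one) auto
    then show ?thesis unfolding eq by simp
  qed (simp_all add: smoothstep_def power2_eq_square algebra_simps)
  then show "0 \<le> smoothstep s" "smoothstep s \<le> 1" by auto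
qed

lemma tent_facts: "0 \<le> tent s" "tent s \<le> 1" "tent s \<noteq> 0 \<Longrightarrow> 0 < s \<and> s < 2"
  by (auto simp: tent_def max_def split: if_splits)

lemma has_C1_gradient_smoothstep:
  "has_C1_gradient f g \<Longrightarrow> has_C1_gradient (\<lambda>x. smoothstep (f x)) (\<lambda>x. tent (f x) *\<^sub>R g x)"
  by (rule has_C1_gradient_compose[OF _ smoothstep_deriv tent_continuous])

text \<open>Apply \<open>smoothstep\<close> to a multiple of \<open>\<rho>\<^sup>2 - |x - c|\<^sup>2\<close>, scaled so that the argument is at least 2 on
  the ball of half the radius.\<close>

lemma bump_exists:
  fixes c :: "real^'n"
  assumes "\<rho> > 0"
  obtains b b' where "has_C1_gradient b b'" "\<And>x. x \<notin> ball c \<rho> \<Longrightarrow> b x = 0" "\<And>x. x \<in> ball c (\<rho>/2) \<Longrightarrow> b x = 1"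
proof -
  define k where "k = 8 / (3 * \<rho>\<^sup>2)"
  have k: "k > 0" using assms by (simp add: k_def)
  have 1: "has_C1_gradient (\<lambda>x. k * (\<rho>\<^sup>2 - (norm (x - c))\<^sup>2)) (\<lambda>x. k *\<^sub>R (0 - 2 *\<^sub>R (x - c)) + (\<rho>\<^sup>2 - (norm (x - c))\<^sup>2) *\<^sub>R 0)"
    by (intro has_C1_gradient_mult has_C1_gradient_diff has_C1_gradient_const has_C1_gradient_norm_shift)
  show thesis
  proof (rule that[OF has_C1_gradient_smoothstep[OF 1]])
    fix x assume "x \<notin> ball c \<rho>"
    then have "\<rho> \<le> norm (x - c)" by (simp add: dist_norm norm_minus_commute)
    then have "\<rho>\<^sup>2 \<le> (norm (x - c))\<^sup>2" using assms by (intro power_mono) auto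
    then show "smoothstep (k * (\<rho>\<^sup>2 - (norm (x - c))\<^sup>2)) = 0"
      using k by (intro smoothstep_facts(1)) (simp add: mult_le_0_iff)
  next
    fix x assume "x \<in> ball c (\<rho>/2)"
    then have "norm (x - c) \<le> \<rho>/2" by (simp add: dist_norm norm_minus_commute)
    then have "(norm (x - c))\<^sup>2 \<le> (\<rho>/2)\<^sup>2" by (intro power_mono) auto
    then have "\<rho>\<^sup>2 - (norm (x - c))\<^sup>2 \<ge> 3/4 * \<rho>\<^sup>2" by (simp add: power_divide)
    then have "k * (\<rho>\<^sup>2 - (norm (x - c))\<^sup>2) \<ge> k * (3/4 * \<rho>\<^sup>2)" using k by (intro mult_left_mono) auto
    also have "k * (3/4 * \<rho>\<^sup>2) = 2" using assms by (simp add: k_def)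
    finally show "smoothstep (k * (\<rho>\<^sup>2 - (norm (x - c))\<^sup>2)) = 1" by (intro smoothstep_facts(2))
  qed
qed

lemma C1_weighted_integrable:
  fixes A :: "real^'n \<Rightarrow> real^'n" and C :: "real^'n \<Rightarrow> real"
  assumes \<Omega>: "bounded \<Omega>" and \<zeta>: "has_C1_gradient \<zeta> \<zeta>'"
    and A: "\<And>i. integrable (lebesgue_on \<Omega>) (\<lambda>x. A x $ i)" and C: "integrable (lebesgue_on \<Omega>) C"
  shows "integrable (lebesgue_on \<Omega>) (\<lambda>x. \<zeta>' x \<bullet> A x + \<zeta> x * C x)"
proof -
  have prod: "integrable (lebesgue_on \<Omega>) (\<lambda>x. h x * f x)"
    if h: "continuous_on UNIV h" and f: "integrable (lebesgue_on \<Omega>) f" for h f :: "real^'n \<Rightarrow> real"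
  proof -
    obtain B where B: "\<And>x. x \<in> \<Omega> \<Longrightarrow> norm (h x) \<le> B" using continuous_bounded_on_bounded[OF h \<Omega>] by blast
    show ?thesis
    proof (rule Bochner_Integration.integrable_bound[OF integrable_mult_right[OF f, of B]])
      show "(\<lambda>x. h x * f x) \<in> borel_measurable (lebesgue_on \<Omega>)"
        by (intro borel_measurable_times continuous_imp_measurable_lebesgue_on h borel_measurable_integrable f)
      show "AE x in lebesgue_on \<Omega>. norm (h x * f x) \<le> norm (B * f x)"
      proof (rule AE_I2)
        fix x assume "x \<in> space (lebesgue_on \<Omega>)"
        then have "norm (h x) \<le> \<bar>B\<bar>" using B[of x] by (simp add: space_restrict_space)
        then show "norm (h x * f x) \<le> norm (B * f x)" by (simp add: abs_mult mult_right_mono)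
      qed
    qed
  qed
  have "continuous_on UNIV (\<lambda>x. \<zeta>' x $ i)" for i using \<zeta> by (auto simp: has_C1_gradient_def intro!: continuous_intros)
  then show ?thesis unfolding inner_vec_def inner_real_def
    by (intro Bochner_Integration.integrable_add Bochner_Integration.integrable_sum prod A C has_C1_gradient_continuous[OF \<zeta>])
qed

text \<open>A partition of unity without division. For bumps \<open>b p\<close> equal to 1 on balls that cover the closure,
  the product of the functions \<open>1 - b p\<close> vanishes on \<open>\<Omega>\<close>; multiplying in one factor at a time changes
  the integral only by a term that is supported in one of the small balls, hence not at all. The
  integral for the empty product is the one in the claim.\<close>

lemma local_to_global_integral:
  fixes A :: "real^'n \<Rightarrow> real^'n" and C :: "real^'n \<Rightarrow> real"
  assumes \<Omega>: "open \<Omega>" "bounded \<Omega>"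
    and A: "\<And>i. integrable (lebesgue_on \<Omega>) (\<lambda>x. A x $ i)" and C: "integrable (lebesgue_on \<Omega>) C"
    and loc: "\<And>x0. x0 \<in> closure \<Omega> \<Longrightarrow> \<exists>\<rho>>0. \<forall>\<zeta> \<zeta>'. has_C1_gradient \<zeta> \<zeta>' \<longrightarrow> (\<forall>x. x \<notin> ball x0 \<rho> \<longrightarrow> \<zeta> x = 0)
      \<longrightarrow> (\<integral>x. \<zeta>' x \<bullet> A x + \<zeta> x * C x \<partial>lebesgue_on \<Omega>) = 0"
  shows "(\<integral>x. C x \<partial>lebesgue_on \<Omega>) = 0"
proof -
  note int = C1_weighted_integrable[OF \<Omega>(2) _ A C]
  define good where "good x0 \<rho> \<longleftrightarrow> \<rho> > 0 \<and> (\<forall>\<zeta> \<zeta>'. has_C1_gradient \<zeta> \<zeta>' \<longrightarrow> (\<forall>x. x \<notin> ball x0 \<rho> \<longrightarrow> \<zeta> x = 0)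
      \<longrightarrow> (\<integral>x. \<zeta>' x \<bullet> A x + \<zeta> x * C x \<partial>lebesgue_on \<Omega>) = 0)" for x0 \<rho>
  have "\<forall>x0\<in>closure \<Omega>. \<exists>\<rho>. good x0 \<rho>" unfolding good_def using loc by blast
  then obtain \<rho> where good: "\<forall>x0\<in>closure \<Omega>. good x0 (\<rho> x0)" unfolding bchoice_iff by blast
  have \<rho>: "\<And>x0. x0 \<in> closure \<Omega> \<Longrightarrow> \<rho> x0 > 0"
    "\<And>x0 \<zeta> \<zeta>'. x0 \<in> closure \<Omega> \<Longrightarrow> has_C1_gradient \<zeta> \<zeta>' \<Longrightarrow> (\<And>x. x \<notin> ball x0 (\<rho> x0) \<Longrightarrow> \<zeta> x = 0)
      \<Longrightarrow> (\<integral>x. \<zeta>' x \<bullet> A x + \<zeta> x * C x \<partial>lebesgue_on \<Omega>) = 0"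
    using good unfolding good_def by blast+
  have "compact (closure \<Omega>)" using \<Omega>(2) by (simp add: compact_closure)
  then obtain P where P: "P \<subseteq> closure \<Omega>" "finite P" "closure \<Omega> \<subseteq> (\<Union>x\<in>P. ball x (\<rho> x / 2))"
  proof (rule compactE_image[of "closure \<Omega>" "closure \<Omega>" "\<lambda>x. ball x (\<rho> x / 2)"])
    show "closure \<Omega> \<subseteq> (\<Union>x\<in>closure \<Omega>. ball x (\<rho> x / 2))" using \<rho>(1) by (meson UN_I centre_in_ball half_gt_zero subsetI)
  qed auto
  have step: "\<exists>\<xi> \<xi>'. has_C1_gradient \<xi> \<xi>' \<and> (\<forall>x\<in>(\<Union>p\<in>Q. ball p (\<rho> p / 2)). \<xi> x = 0) \<and>
      (\<integral>x. \<xi>' x \<bullet> A x + \<xi> x * C x \<partial>lebesgue_on \<Omega>) = (\<integral>x. C x \<partial>lebesgue_on \<Omega>)"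
    if "finite Q" "Q \<subseteq> closure \<Omega>" for Q
    using that
  proof (induction Q rule: finite_induct)
    case empty
    show ?case using has_C1_gradient_const[of 1] by (intro exI[of _ "\<lambda>_. 1"] exI[of _ "\<lambda>_. 0"]) auto
  next
    case (insert p Q)
    then obtain \<xi> \<xi>' where \<xi>: "has_C1_gradient \<xi> \<xi>'" "\<forall>x\<in>(\<Union>p\<in>Q. ball p (\<rho> p / 2)). \<xi> x = 0"
      "(\<integral>x. \<xi>' x \<bullet> A x + \<xi> x * C x \<partial>lebesgue_on \<Omega>) = (\<integral>x. C x \<partial>lebesgue_on \<Omega>)" by auto
    have p: "p \<in> closure \<Omega>" using insert.prems by simp
    obtain b b' where b: "has_C1_gradient b b'" "\<And>x. x \<notin> ball p (\<rho> p) \<Longrightarrow> b x = 0" "\<And>x. x \<in> ball p (\<rho> p / 2) \<Longrightarrow> b x = 1"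
      using bump_exists[OF \<rho>(1)[OF p]] by blast
    let ?z = "\<lambda>x. \<xi> x * b x" and ?z' = "\<lambda>x. \<xi> x *\<^sub>R b' x + b x *\<^sub>R \<xi>' x"
    have z: "has_C1_gradient ?z ?z'" by (rule has_C1_gradient_mult[OF \<xi>(1) b(1)])
    have z0: "(\<integral>x. ?z' x \<bullet> A x + ?z x * C x \<partial>lebesgue_on \<Omega>) = 0"
      by (rule \<rho>(2)[OF p z]) (simp add: b(2))
    have "(\<integral>x. (\<xi>' x - ?z' x) \<bullet> A x + (\<xi> x - ?z x) * C x \<partial>lebesgue_on \<Omega>)
      = (\<integral>x. (\<xi>' x \<bullet> A x + \<xi> x * C x) - (?z' x \<bullet> A x + ?z x * C x) \<partial>lebesgue_on \<Omega>)"
      by (intro Bochner_Integration.integral_cong) (simp_all add: inner_diff_left left_diff_distrib)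
    also have "\<dots> = (\<integral>x. C x \<partial>lebesgue_on \<Omega>)"
      using int[OF \<xi>(1)] int[OF z] \<xi>(3) z0 by simp
    finally have "(\<integral>x. (\<xi>' x - ?z' x) \<bullet> A x + (\<xi> x - ?z x) * C x \<partial>lebesgue_on \<Omega>) = (\<integral>x. C x \<partial>lebesgue_on \<Omega>)" .
    moreover have "\<forall>x\<in>(\<Union>p\<in>insert p Q. ball p (\<rho> p / 2)). \<xi> x - ?z x = 0" using \<xi>(2) b(3) by auto
    ultimately show ?case using has_C1_gradient_diff[OF \<xi>(1) z] by blast
  qed
  obtain \<xi> \<xi>' where \<xi>: "has_C1_gradient \<xi> \<xi>'" "\<forall>x\<in>(\<Union>p\<in>P. ball p (\<rho> p / 2)). \<xi> x = 0"
    "(\<integral>x. \<xi>' x \<bullet> A x + \<xi> x * C x \<partial>lebesgue_on \<Omega>) = (\<integral>x. C x \<partial>lebesgue_on \<Omega>)"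
    using step[OF P(2) P(1)] by auto
  have \<xi>0: "\<xi> x = 0" if "x \<in> \<Omega>" for x using \<xi>(2) P(3) closure_subset that by blast
  have "\<xi>' x = 0" if "x \<in> \<Omega>" for x
    using has_C1_gradient_eq_0_outside[OF \<xi>(1), of "- \<Omega>" x] \<xi>0 \<Omega>(1) that by (simp add: closed_Compl)
  then have "(\<integral>x. \<xi>' x \<bullet> A x + \<xi> x * C x \<partial>lebesgue_on \<Omega>) = (\<integral>x. 0 \<partial>lebesgue_on \<Omega>)"
    using \<xi>0 by (intro Bochner_Integration.integral_cong) (auto simp: space_restrict_space)
  then show ?thesis using \<xi>(3) by simp
qed

subsection \<open>The boundary strip does not contribute\<close>

definition strip :: "(real^'n \<Rightarrow> real) \<Rightarrow> real^'n \<Rightarrow> real \<Rightarrow> real \<Rightarrow> (real^'n) set" where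
  "strip H x0 \<rho> L = {x \<in> ball x0 \<rho>. 0 < - H x \<and> - H x < L}"

lemma strip_open: "continuous_on UNIV H \<Longrightarrow> open (strip H x0 \<rho> L)"
proof -
  assume "continuous_on UNIV H"
  then have "open (ball x0 \<rho> \<inter> {x. 0 < - H x} \<inter> {x. - H x < L})"
    by (intro open_Int open_ball open_Collect_less continuous_intros)
  moreover have "ball x0 \<rho> \<inter> {x. 0 < - H x} \<inter> {x. - H x < L} = strip H x0 \<rho> L" by (auto simp: strip_def)
  ultimately show ?thesis by (simp only:)
qed

lemma nn_integral_lebesgue_on_indicator:
  fixes f :: "'a::euclidean_space \<Rightarrow> ennreal"
  assumes "\<Omega> \<in> sets lebesgue" "S \<subseteq> \<Omega>"
  shows "(\<integral>\<^sup>+x. f x * indicator S x \<partial>lebesgue_on \<Omega>) = (\<integral>\<^sup>+x. f x * indicator S x \<partial>lborel)"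
proof -
  have "(\<integral>\<^sup>+x. f x * indicator S x \<partial>lebesgue_on \<Omega>) = (\<integral>\<^sup>+x. f x * indicator S x * indicator \<Omega> x \<partial>lebesgue)"
    using assms(1) by (intro nn_integral_restrict_space) simp
  also have "\<dots> = (\<integral>\<^sup>+x. f x * indicator S x \<partial>lebesgue)"
    using assms(2) by (intro nn_integral_cong) (auto simp: indicator_def)
  finally show ?thesis by (simp add: nn_integral_completion)
qed

context neumann_field
begin

text \<open>The estimate for \<open>\<Psi> n\<close> passes to the limit at fixed \<open>L\<close>. The boundary term tends to 0: on the
  boundary \<open>H'\<close> is a multiple of the normal, hence orthogonal to \<open>T\<close>, so \<open>H' \<bullet> \<Psi> n\<close> is \<open>H' \<bullet> (\<Psi> n - T)\<close>
  there.\<close>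

lemma strip_estimate_nn:
  assumes chart: "boundary_chart \<Omega> x0 r e H H'"
    and K: "K \<ge> 0" "\<And>x. x \<in> ball x0 r \<Longrightarrow> norm (H' x) \<le> K" and L: "0 < L" "L < r / 4"
  shows "(\<integral>\<^sup>+x. ennreal ((H' x \<bullet> G x)\<^sup>2) * indicator (strip H x0 (r/4) L) x \<partial>lebesgue_on \<Omega>)
    \<le> ennreal (8 * K\<^sup>2 * L\<^sup>2) * (\<integral>\<^sup>+x. ennreal ((norm (D x))\<^sup>2) * indicator (strip H x0 (r/2) L) x \<partial>lebesgue_on \<Omega>)"
proof -
  let ?M = "lebesgue_on \<Omega>"
  note cf = chart_facts[OF chart \<Omega>(1)]
  define S where "S = strip H x0 (r/4) L"
  define S' where "S' = strip H x0 (r/2) L"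
  have So: "open S" "open S'" unfolding S_def S'_def by (intro strip_open cf)+
  have S\<Omega>: "S \<subseteq> \<Omega>" "S' \<subseteq> \<Omega>" using cf(1,6) by (auto simp: S_def S'_def strip_def)
  have [measurable]: "S \<in> sets ?M" "S' \<in> sets ?M" using So S\<Omega> by (auto simp: sets_restrict_space_iff)
  have [measurable]: "G \<in> borel_measurable ?M" "D \<in> borel_measurable ?M" "\<And>n. \<Psi> n \<in> borel_measurable ?M" "\<And>n. D\<Psi> n \<in> borel_measurable ?M"
    "H' \<in> borel_measurable ?M"
    using G D \<Psi>_L2 continuous_imp_measurable_lebesgue_on[OF cf(8)] by (auto simp: square_integrable_def)
  define X where "X = (\<integral>\<^sup>+x. ennreal ((H' x \<bullet> G x)\<^sup>2) * indicator S x \<partial>?M)"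
  define Y where "Y = (\<integral>\<^sup>+x. ennreal ((norm (D x))\<^sup>2) * indicator S' x \<partial>?M)"
  define a where "a n = (\<integral>\<^sup>+x. ennreal ((norm (\<Psi> n x - G x))\<^sup>2) \<partial>?M)" for n
  define b where "b n = (\<integral>\<^sup>+x. ennreal ((norm (D\<Psi> n x - D x))\<^sup>2) \<partial>?M)" for n
  define t where "t n = (\<integral>\<^sup>+y. ennreal ((norm (\<Psi> n y - T y))\<^sup>2) \<partial>surface_measure \<Omega>)" for n
  define P where "P n = (\<integral>\<^sup>+x. ennreal ((H' x \<bullet> \<Psi> n x)\<^sup>2) * indicator S x \<partial>?M)" for n
  have an: "a n = ennreal (\<integral>x. (norm (\<Psi> n x - G x))\<^sup>2 \<partial>?M)" for n
    unfolding a_def using square_integrable_diff[OF \<Psi>_L2(1) G] by (intro nn_integral_eq_integral) (auto simp: square_integrable_def)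
  have a0: "a \<longlonglongrightarrow> 0" unfolding an[abs_def] using tendsto_ennrealI[OF conv(1)] by simp
  have bn: "b n = ennreal (\<integral>x. (norm (D\<Psi> n x - D x))\<^sup>2 \<partial>?M)" for n
    unfolding b_def using square_integrable_diff[OF \<Psi>_L2(2) D] by (intro nn_integral_eq_integral) (auto simp: square_integrable_def)
  have b0: "b \<longlonglongrightarrow> 0" unfolding bn[abs_def] using tendsto_ennrealI[OF conv(2)] by simp
  have t0: "t \<longlonglongrightarrow> 0" unfolding t_def[abs_def] by (rule T(3))
  have sq: "ennreal (p\<^sup>2) \<le> 2 * (ennreal (q\<^sup>2) + ennreal (s\<^sup>2))" if "\<bar>p\<bar> \<le> \<bar>q\<bar> + \<bar>s\<bar>" for p q s :: real
  proof -
    have "p\<^sup>2 \<le> (\<bar>q\<bar> + \<bar>s\<bar>)\<^sup>2" using power_mono[OF that, of 2] by simp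
    also have "\<dots> \<le> 2 * (q\<^sup>2 + s\<^sup>2)" using zero_le_power2[of "\<bar>q\<bar> - \<bar>s\<bar>"] by (simp add: power2_sum power2_diff)
    finally have "ennreal (p\<^sup>2) \<le> ennreal (2 * (q\<^sup>2 + s\<^sup>2))" by (rule ennreal_leI)
    also have "ennreal (2 * (q\<^sup>2 + s\<^sup>2)) = ennreal 2 * ennreal (q\<^sup>2 + s\<^sup>2)" by (rule ennreal_mult) auto
    also have "ennreal (q\<^sup>2 + s\<^sup>2) = ennreal (q\<^sup>2) + ennreal (s\<^sup>2)" by (rule ennreal_plus) auto
    also have "ennreal 2 = 2" by simp
    finally show ?thesis .
  qed
  have XP: "X \<le> 2 * (P n + ennreal (K\<^sup>2) * a n)" for n
  proof -
    have "X \<le> (\<integral>\<^sup>+x. 2 * (ennreal ((H' x \<bullet> \<Psi> n x)\<^sup>2) * indicator S x + ennreal (K\<^sup>2) * ennreal ((norm (\<Psi> n x - G x))\<^sup>2)) \<partial>?M)"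
      unfolding X_def
    proof (rule nn_integral_mono)
      fix x
      show "ennreal ((H' x \<bullet> G x)\<^sup>2) * indicator S x \<le> 2 * (ennreal ((H' x \<bullet> \<Psi> n x)\<^sup>2) * indicator S x + ennreal (K\<^sup>2) * ennreal ((norm (\<Psi> n x - G x))\<^sup>2))"
      proof (cases "x \<in> S")
        case True
        then have "x \<in> ball x0 r" using cf(1) by (auto simp: S_def strip_def)
        then have "\<bar>H' x \<bullet> (\<Psi> n x - G x)\<bar> \<le> K * norm (\<Psi> n x - G x)"
          using K(2) by (intro order_trans[OF Cauchy_Schwarz_ineq2] mult_right_mono) auto
        then have "\<bar>H' x \<bullet> G x\<bar> \<le> \<bar>H' x \<bullet> \<Psi> n x\<bar> + \<bar>K * norm (\<Psi> n x - G x)\<bar>"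
          by (simp add: inner_diff_right)
        from sq[OF this] show ?thesis using True by (simp add: power_mult_distrib ennreal_mult')
      qed simp
    qed
    also have "\<dots> = 2 * (P n + ennreal (K\<^sup>2) * a n)"
      unfolding P_def a_def by (simp add: nn_integral_cmult nn_integral_add)
    finally show ?thesis .
  qed
  obtain c where c: "c \<ge> 0" "\<And>S f. S \<in> sets borel \<Longrightarrow>
    (\<And>x. x \<in> S \<Longrightarrow> 0 \<le> - H x \<and> - H x \<le> L \<and> x + H x *\<^sub>R e \<in> ball x0 r) \<Longrightarrow> f \<in> borel_measurable borel \<Longrightarrow>
    (\<integral>\<^sup>+x. f (x + H x *\<^sub>R e) * indicator S x \<partial>lborel) \<le> ennreal c * (\<integral>\<^sup>+y. f y \<partial>surface_measure \<Omega>)"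
    by (rule nn_integral_graph_projection_le[OF \<Omega>(3) chart \<Omega>(1), of L]) (use L in \<open>simp, blast\<close>)
  have SP: "x + H x *\<^sub>R e \<in> ball x0 r" if "x \<in> S" for x
  proof -
    have "dist x0 (x + H x *\<^sub>R e) \<le> dist x0 x + \<bar>H x\<bar>"
      using dist_triangle[of x0 "x + H x *\<^sub>R e" x] cf(2) by (simp add: dist_norm)
    then show ?thesis using that L cf(1) by (simp add: S_def strip_def)
  qed
  have bdry: "(\<integral>\<^sup>+x. ennreal ((H' (x + H x *\<^sub>R e) \<bullet> \<Psi> n (x + H x *\<^sub>R e))\<^sup>2) * indicator S x \<partial>lborel)
      \<le> ennreal c * (ennreal (K\<^sup>2) * t n)" for n
  proof -
    define f where "f y = ennreal ((H' y \<bullet> \<Psi> n y)\<^sup>2) * indicator (ball x0 r) y" for y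
    have \<Psi>b: "\<Psi> n \<in> borel_measurable borel"
      using \<Psi>_continuous by (rule borel_measurable_continuous_onI)
    have "(\<lambda>y. (H' y \<bullet> \<Psi> n y)\<^sup>2) \<in> borel_measurable borel"
      by (intro borel_measurable_continuous_onI continuous_intros cf(8) \<Psi>_continuous)
    then have "(\<lambda>y. ennreal ((H' y \<bullet> \<Psi> n y)\<^sup>2)) \<in> borel_measurable borel"
      by (rule measurable_compose[OF _ measurable_ennreal])
    then have fm: "f \<in> borel_measurable borel" unfolding f_def
      by (intro borel_measurable_times_ennreal borel_measurable_indicator) auto
    have "(\<integral>\<^sup>+x. ennreal ((H' (x + H x *\<^sub>R e) \<bullet> \<Psi> n (x + H x *\<^sub>R e))\<^sup>2) * indicator S x \<partial>lborel)
        = (\<integral>\<^sup>+x. f (x + H x *\<^sub>R e) * indicator S x \<partial>lborel)"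
      using SP by (intro nn_integral_cong) (auto simp: f_def indicator_def)
    also have "\<dots> \<le> ennreal c * (\<integral>\<^sup>+y. f y \<partial>surface_measure \<Omega>)"
      using So SP by (intro c(2) fm) (auto simp: S_def strip_def)
    also have "(\<integral>\<^sup>+y. f y \<partial>surface_measure \<Omega>) \<le> (\<integral>\<^sup>+y. ennreal (K\<^sup>2) * ennreal ((norm (\<Psi> n y - T y))\<^sup>2) \<partial>surface_measure \<Omega>)"
    proof (rule nn_integral_mono_AE)
      show "AE y in surface_measure \<Omega>. f y \<le> ennreal (K\<^sup>2) * ennreal ((norm (\<Psi> n y - T y))\<^sup>2)"
        using T(2) AE_space
      proof eventually_elim
        case (elim y)
        show ?case
        proof (cases "y \<in> ball x0 r")
          case True
          have "y \<in> frontier \<Omega>" using elim surface_measure_facts(3)[of \<Omega>] by simp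
          from chart_outer_normal[OF chart \<Omega>(1) True this] elim(1)
          have "H' y \<bullet> T y = 0" by (metis inner_commute inner_scaleR_right mult_zero_right)
          then have "\<bar>H' y \<bullet> \<Psi> n y\<bar> = \<bar>H' y \<bullet> (\<Psi> n y - T y)\<bar>" by (simp add: inner_diff_right)
          also have "\<dots> \<le> K * norm (\<Psi> n y - T y)"
            using K(2)[OF True] by (intro order_trans[OF Cauchy_Schwarz_ineq2] mult_right_mono) auto
          finally have "\<bar>H' y \<bullet> \<Psi> n y\<bar>\<^sup>2 \<le> (K * norm (\<Psi> n y - T y))\<^sup>2" by (rule power_mono) simp
          then have "ennreal ((H' y \<bullet> \<Psi> n y)\<^sup>2) \<le> ennreal ((K * norm (\<Psi> n y - T y))\<^sup>2)" by (intro ennreal_leI) simp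
          then show ?thesis using True by (simp add: f_def power_mult_distrib ennreal_mult')
        qed (simp add: f_def)
      qed
    qed
    also have "\<dots> = ennreal (K\<^sup>2) * t n"
    proof -
      have m: "\<Psi> n \<in> borel_measurable (surface_measure \<Omega>)"
        using measurable_compose[OF surface_measure_facts(1) \<Psi>b] by simp
      show ?thesis unfolding t_def
        by (rule nn_integral_cmult) (use m T(1) in measurable)
    qed
    finally show ?thesis by (simp add: mult_left_mono)
  qed
  have D2: "(\<integral>\<^sup>+x. ennreal ((norm (D\<Psi> n x))\<^sup>2) * indicator S' x \<partial>?M) \<le> 2 * (Y + b n)" for n
  proof -
    have "(\<integral>\<^sup>+x. ennreal ((norm (D\<Psi> n x))\<^sup>2) * indicator S' x \<partial>?M)
        \<le> (\<integral>\<^sup>+x. 2 * (ennreal ((norm (D x))\<^sup>2) * indicator S' x + ennreal ((norm (D\<Psi> n x - D x))\<^sup>2)) \<partial>?M)"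
    proof (rule nn_integral_mono)
      fix x
      have "\<bar>norm (D\<Psi> n x)\<bar> \<le> \<bar>norm (D x)\<bar> + \<bar>norm (D\<Psi> n x - D x)\<bar>" using norm_triangle_sub[of "D\<Psi> n x" "D x"] by simp
      from sq[OF this] show "ennreal ((norm (D\<Psi> n x))\<^sup>2) * indicator S' x \<le> 2 * (ennreal ((norm (D x))\<^sup>2) * indicator S' x + ennreal ((norm (D\<Psi> n x - D x))\<^sup>2))"
        by (simp add: indicator_def)
    qed
    also have "\<dots> = 2 * (Y + b n)" unfolding Y_def b_def by (simp add: nn_integral_cmult nn_integral_add)
    finally show ?thesis .
  qed
  have Pn: "P n \<le> 2 * (ennreal c * (ennreal (K\<^sup>2) * t n)) + ennreal (2 * K\<^sup>2 * L\<^sup>2) * (2 * (Y + b n))" for n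
  proof -
    have "P n = (\<integral>\<^sup>+x. ennreal ((H' x \<bullet> \<Psi> n x)\<^sup>2) * indicator S x \<partial>lborel)"
      unfolding P_def by (rule nn_integral_lebesgue_on_indicator[OF \<Omega>_sets S\<Omega>(1)])
    also have "\<dots> \<le> 2 * (\<integral>\<^sup>+x. ennreal ((H' (x + H x *\<^sub>R e) \<bullet> \<Psi> n (x + H x *\<^sub>R e))\<^sup>2) * indicator S x \<partial>lborel)
      + ennreal (2 * K\<^sup>2 * L\<^sup>2) * (\<integral>\<^sup>+x. ennreal ((norm (D\<Psi> n x))\<^sup>2) * indicator S' x \<partial>lborel)"
      by (rule strip_estimate_smooth[OF chart \<Omega>(1) \<Psi> L K]) (simp_all add: S_def S'_def strip_def)
    also have "(\<integral>\<^sup>+x. ennreal ((norm (D\<Psi> n x))\<^sup>2) * indicator S' x \<partial>lborel) = (\<integral>\<^sup>+x. ennreal ((norm (D\<Psi> n x))\<^sup>2) * indicator S' x \<partial>?M)"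
      by (rule nn_integral_lebesgue_on_indicator[OF \<Omega>_sets S\<Omega>(2), symmetric])
    finally show ?thesis using bdry[of n] D2[of n]
      by (elim order_trans) (intro add_mono mult_left_mono; simp)
  qed
  have Xn: "X \<le> 2 * ((2 * (ennreal c * (ennreal (K\<^sup>2) * t n)) + ennreal (2 * K\<^sup>2 * L\<^sup>2) * (2 * (Y + b n))) + ennreal (K\<^sup>2) * a n)" for n
    by (rule order_trans[OF XP[of n]]) (intro mult_left_mono add_right_mono Pn; simp)
  have "(\<lambda>n. 2 * ((2 * (ennreal c * (ennreal (K\<^sup>2) * t n)) + ennreal (2 * K\<^sup>2 * L\<^sup>2) * (2 * (Y + b n))) + ennreal (K\<^sup>2) * a n))
      \<longlonglongrightarrow> 2 * ((2 * (ennreal c * (ennreal (K\<^sup>2) * 0)) + ennreal (2 * K\<^sup>2 * L\<^sup>2) * (2 * (Y + 0))) + ennreal (K\<^sup>2) * 0)"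
    by (intro ennreal_tendsto_cmult tendsto_add tendsto_const t0 b0 a0) auto
  from LIMSEQ_le_const[OF this, of X]
  have "X \<le> 2 * ((2 * (ennreal c * (ennreal (K\<^sup>2) * 0)) + ennreal (2 * K\<^sup>2 * L\<^sup>2) * (2 * (Y + 0))) + ennreal (K\<^sup>2) * 0)"
    using Xn by blast
  then have "X \<le> 2 * (ennreal (2 * K\<^sup>2 * L\<^sup>2) * (2 * Y))" by simp
  also have "\<dots> = ennreal (8 * K\<^sup>2 * L\<^sup>2) * Y"
  proof -
    have "ennreal (8 * K\<^sup>2 * L\<^sup>2) = 2 * (ennreal (2 * K\<^sup>2 * L\<^sup>2) * 2)"
      by (simp add: ennreal_numeral[symmetric] ennreal_mult[symmetric] del: ennreal_numeral)
    then show ?thesis by (simp only: mult.assoc)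
  qed
  finally show ?thesis unfolding X_def Y_def S_def S'_def .
qed

lemma strip_estimate:
  assumes chart: "boundary_chart \<Omega> x0 r e H H'"
    and K: "K \<ge> 0" "\<And>x. x \<in> ball x0 r \<Longrightarrow> norm (H' x) \<le> K" and L: "0 < L" "L < r / 4"
  shows "integrable (lebesgue_on \<Omega>) (\<lambda>x. (H' x \<bullet> G x)\<^sup>2 * indicator (strip H x0 (r/4) L) x)"
    "integrable (lebesgue_on \<Omega>) (\<lambda>x. (norm (D x))\<^sup>2 * indicator (strip H x0 (r/2) L) x)"
    "(\<integral>x. (H' x \<bullet> G x)\<^sup>2 * indicator (strip H x0 (r/4) L) x \<partial>lebesgue_on \<Omega>)
    \<le> 8 * K\<^sup>2 * L\<^sup>2 * (\<integral>x. (norm (D x))\<^sup>2 * indicator (strip H x0 (r/2) L) x \<partial>lebesgue_on \<Omega>)"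
proof -
  let ?M = "lebesgue_on \<Omega>"
  note cf = chart_facts[OF chart \<Omega>(1)]
  define S where "S = strip H x0 (r/4) L"
  define S' where "S' = strip H x0 (r/2) L"
  have So: "open S" "open S'" unfolding S_def S'_def by (intro strip_open cf)+
  have S\<Omega>: "S \<subseteq> \<Omega>" "S' \<subseteq> \<Omega>" using cf(1,6) by (auto simp: S_def S'_def strip_def)
  have [measurable]: "S \<in> sets ?M" "S' \<in> sets ?M" using So S\<Omega> by (auto simp: sets_restrict_space_iff)
  have [measurable]: "G \<in> borel_measurable ?M" "D \<in> borel_measurable ?M" "H' \<in> borel_measurable ?M"
    using G D continuous_imp_measurable_lebesgue_on[OF cf(8)] by (auto simp: square_integrable_def)
  have Gi: "integrable ?M (\<lambda>x. (norm (G x))\<^sup>2)" and Di: "integrable ?M (\<lambda>x. (norm (D x))\<^sup>2)"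
    using G D by (auto simp: square_integrable_def)
  have i1: "integrable ?M (\<lambda>x. (H' x \<bullet> G x)\<^sup>2 * indicator S x)"
  proof (rule Bochner_Integration.integrable_bound[OF integrable_mult_right[OF Gi, of "K\<^sup>2"]])
    show "AE x in ?M. norm ((H' x \<bullet> G x)\<^sup>2 * indicator S x) \<le> norm (K\<^sup>2 * (norm (G x))\<^sup>2)"
    proof (rule AE_I2)
      fix x
      show "norm ((H' x \<bullet> G x)\<^sup>2 * indicator S x) \<le> norm (K\<^sup>2 * (norm (G x))\<^sup>2)"
      proof (cases "x \<in> S")
        case True
        then have "x \<in> ball x0 r" using cf(1) by (auto simp: S_def strip_def)
        then have "\<bar>H' x \<bullet> G x\<bar> \<le> K * norm (G x)"
          using K(2) by (intro order_trans[OF Cauchy_Schwarz_ineq2] mult_right_mono) auto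
        then have "\<bar>H' x \<bullet> G x\<bar>\<^sup>2 \<le> (K * norm (G x))\<^sup>2" by (rule power_mono) simp
        then show ?thesis using True by (simp add: power_mult_distrib)
      qed simp
    qed
  qed measurable
  have i2: "integrable ?M (\<lambda>x. (norm (D x))\<^sup>2 * indicator S' x)"
    by (rule Bochner_Integration.integrable_bound[OF Di]) (auto intro!: AE_I2 simp: indicator_def)
  have "ennreal (\<integral>x. (H' x \<bullet> G x)\<^sup>2 * indicator S x \<partial>?M) = (\<integral>\<^sup>+x. ennreal ((H' x \<bullet> G x)\<^sup>2 * indicator S x) \<partial>?M)"
    by (rule nn_integral_eq_integral[symmetric, OF i1]) auto
  also have "\<dots> = (\<integral>\<^sup>+x. ennreal ((H' x \<bullet> G x)\<^sup>2) * indicator S x \<partial>?M)"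
    by (intro nn_integral_cong) (auto simp: indicator_def)
  also have "\<dots> \<le> ennreal (8 * K\<^sup>2 * L\<^sup>2) * (\<integral>\<^sup>+x. ennreal ((norm (D x))\<^sup>2) * indicator S' x \<partial>?M)"
    unfolding S_def S'_def by (rule strip_estimate_nn[OF chart K L])
  also have "(\<integral>\<^sup>+x. ennreal ((norm (D x))\<^sup>2) * indicator S' x \<partial>?M) = (\<integral>\<^sup>+x. ennreal ((norm (D x))\<^sup>2 * indicator S' x) \<partial>?M)"
    by (intro nn_integral_cong) (auto simp: indicator_def)
  also have "\<dots> = ennreal (\<integral>x. (norm (D x))\<^sup>2 * indicator S' x \<partial>?M)"
    by (rule nn_integral_eq_integral[OF i2]) auto
  finally have "ennreal (\<integral>x. (H' x \<bullet> G x)\<^sup>2 * indicator S x \<partial>?M) \<le> ennreal (8 * K\<^sup>2 * L\<^sup>2 * (\<integral>x. (norm (D x))\<^sup>2 * indicator S' x \<partial>?M))"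
    by (simp add: ennreal_mult'')
  moreover have "0 \<le> (\<integral>x. (norm (D x))\<^sup>2 * indicator S' x \<partial>?M)" by (intro Bochner_Integration.integral_nonneg) auto
  ultimately show "(\<integral>x. (H' x \<bullet> G x)\<^sup>2 * indicator (strip H x0 (r/4) L) x \<partial>lebesgue_on \<Omega>)
    \<le> 8 * K\<^sup>2 * L\<^sup>2 * (\<integral>x. (norm (D x))\<^sup>2 * indicator (strip H x0 (r/2) L) x \<partial>lebesgue_on \<Omega>)"
    unfolding S_def S'_def by (subst (asm) ennreal_le_iff) auto
  show "integrable ?M (\<lambda>x. (H' x \<bullet> G x)\<^sup>2 * indicator (strip H x0 (r/4) L) x)"
    "integrable ?M (\<lambda>x. (norm (D x))\<^sup>2 * indicator (strip H x0 (r/2) L) x)"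
    using i1 i2 by (simp_all add: S_def S'_def)
qed

end

context neumann_pairing
begin

text \<open>Near the boundary, the identity is tested with \<open>\<zeta>\<close> times a function of \<open>H\<close> that is 0 for
  \<open>-H \<le> \<epsilon>\<close> and 1 for \<open>-H \<ge> 3\<epsilon>\<close>. The term \<open>R\<close> in which this cutoff is differentiated is
  supported in a strip of width \<open>3\<epsilon>\<close>, has the factor \<open>1/\<epsilon>\<close> and contains the field only through
  \<open>H' \<bullet> G\<close>. Estimating the product of \<open>|\<phi>|\<close> and \<open>|H' \<bullet> G| / \<epsilon>\<close> by the sum of the squares leaves two
  integrals over shrinking strips, of \<open>\<phi>\<^sup>2\<close> and, by the Hardy estimate, of \<open>|D|\<^sup>2\<close>.\<close>

lemma boundary_identity:
  assumes x0: "x0 \<in> frontier \<Omega>"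
  shows "\<exists>\<rho>>0. \<forall>\<zeta> \<zeta>'. has_C1_gradient \<zeta> \<zeta>' \<longrightarrow> (\<forall>x. x \<notin> ball x0 \<rho> \<longrightarrow> \<zeta> x = 0)
      \<longrightarrow> (\<integral>x. \<zeta>' x \<bullet> flux x + \<zeta> x * flux_div x \<partial>M) = 0"
proof -
  obtain r e H H' where chart: "boundary_chart \<Omega> x0 r e H H'" using charts[OF x0] by blast
  note cf = chart_facts[OF chart \<Omega>(1)]
  have r: "r > 0" by (rule cf(1))
  obtain K where K: "K \<ge> 0" "\<And>x. x \<in> ball x0 r \<Longrightarrow> norm (H' x) \<le> K"
    using continuous_bounded_on_bounded[OF cf(8) bounded_ball] by blast
  have B0: "B \<ge> 0" using \<mu>(2) by (meson abs_ge_zero order_trans)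
  show ?thesis
  proof (intro exI[of _ "r/4"] conjI allI impI)
    show "r/4 > 0" using r by simp
    fix \<zeta> :: "real^'n \<Rightarrow> real" and \<zeta>'
    assume \<zeta>: "has_C1_gradient \<zeta> \<zeta>'" and \<zeta>0: "\<forall>x. x \<notin> ball x0 (r/4) \<longrightarrow> \<zeta> x = 0"
    have \<zeta>c: "continuous_on UNIV \<zeta>" by (rule has_C1_gradient_continuous[OF \<zeta>])
    have \<zeta>'0: "\<zeta>' x = 0" if "x \<notin> cball x0 (r/4)" for x
      by (rule has_C1_gradient_eq_0_outside[OF \<zeta> closed_cball _ that]) (use \<zeta>0 in auto)
    obtain Z where Z: "Z \<ge> 0" "\<And>x. \<bar>\<zeta> x\<bar> \<le> Z"
      using continuous_compact_support_bounded[OF \<zeta>c compact_cball[of x0 "r/4"]] \<zeta>0 by (metis ball_subset_cball subsetD)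
    \<comment> \<open>the factor 16 keeps the strip width \<open>3\<epsilon>\<close> below \<open>r/4\<close>, as the Hardy estimate requires\<close>
    define \<epsilon> where "\<epsilon> n = r / (16 * real (Suc n))" for n
    have \<epsilon>: "\<epsilon> n > 0" for n using r by (simp add: \<epsilon>_def)
    have \<epsilon>L: "3 * \<epsilon> n < r / 4" for n
    proof -
      have "\<epsilon> n \<le> r / 16" using r by (simp add: \<epsilon>_def field_simps)
      then show ?thesis using r by linarith
    qed
    have \<epsilon>0: "\<epsilon> \<longlonglongrightarrow> 0"
    proof -
      have "(\<lambda>n. (r/16) * inverse (real (Suc n))) \<longlonglongrightarrow> (r/16) * 0" by (intro tendsto_intros LIMSEQ_inverse_real_of_nat)
      moreover have "\<epsilon> = (\<lambda>n. (r/16) * inverse (real (Suc n)))" by (rule ext) (simp add: \<epsilon>_def divide_simps)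
      ultimately show ?thesis by simp
    qed
    define q where "q n s = smoothstep ((- s - \<epsilon> n) / \<epsilon> n)" for n s
    define q' where "q' n s = tent ((- s - \<epsilon> n) / \<epsilon> n) * (- 1 / \<epsilon> n)" for n s
    have qd: "(q n has_real_derivative q' n s) (at s)" for n s
    proof -
      have "((\<lambda>s. (- s - \<epsilon> n) / \<epsilon> n) has_real_derivative (- 1 / \<epsilon> n)) (at s)"
        using \<epsilon>[of n] by (auto intro!: derivative_eq_intros)
      from DERIV_chain2[OF smoothstep_deriv this] show ?thesis by (simp add: q_def[abs_def] q'_def)
    qed
    have q'c: "continuous_on UNIV (q' n)" for n
      unfolding q'_def[abs_def]
      using \<epsilon>[of n] by (intro continuous_intros continuous_on_compose2[OF tent_continuous]) auto
    have \<eta>: "has_C1_gradient (\<lambda>x. q n (H x)) (\<lambda>x. q' n (H x) *\<^sub>R H' x)" for n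
      by (rule has_C1_gradient_compose[OF cf(3) qd q'c])
    have \<eta>c: "continuous_on UNIV (\<lambda>x. q n (H x))" for n by (rule has_C1_gradient_continuous[OF \<eta>])
    \<comment> \<open>the test function is \<open>\<zeta>\<close> times the cutoff \<open>q n (H x)\<close>: \<open>F\<close> collects the terms in which the cutoff is not differentiated\<close>
    define F where "F x = \<zeta>' x \<bullet> flux x + \<zeta> x * flux_div x" for x
    define R where "R n x = \<zeta> x * q' n (H x) * (H' x \<bullet> flux x)" for n x
    have Fi: "integrable M F" unfolding F_def by (rule C1_weighted_integrable[OF \<Omega>(2) \<zeta> flux_integrable])
    have qF: "integrable M (\<lambda>x. q n (H x) * F x)" for n
    proof (rule Bochner_Integration.integrable_bound[OF Fi])
      show "(\<lambda>x. q n (H x) * F x) \<in> borel_measurable M"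
        by (intro borel_measurable_times continuous_imp_measurable_lebesgue_on \<eta>c borel_measurable_integrable Fi)
      show "AE x in M. norm (q n (H x) * F x) \<le> norm (F x)"
        using smoothstep_facts(3,4) by (auto intro!: AE_I2 simp: q_def abs_mult mult_left_le_one_le)
    qed
    have sum0: "(\<integral>x. q n (H x) * F x \<partial>M) + (\<integral>x. R n x \<partial>M) = 0 \<and> integrable M (R n)" for n
    proof -
      let ?\<psi> = "\<lambda>x. \<zeta> x * q n (H x)" and ?g = "\<lambda>x. \<zeta> x *\<^sub>R (q' n (H x) *\<^sub>R H' x) + q n (H x) *\<^sub>R \<zeta>' x"
      have \<psi>: "has_C1_gradient ?\<psi> ?g" by (rule has_C1_gradient_mult[OF \<zeta> \<eta>])
      define C where "C = cball x0 (r/4) \<inter> {x. H x \<le> - \<epsilon> n}"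
      have "compact C" unfolding C_def
        by (intro compact_Int_closed compact_cball closed_Collect_le continuous_intros cf(7))
      moreover have "?\<psi> x = 0" if "x \<notin> C" for x
      proof (cases "x \<in> cball x0 (r/4)")
        case True
        then have "(- H x - \<epsilon> n) / \<epsilon> n \<le> 0" using that \<epsilon>[of n] by (auto simp: C_def divide_le_0_iff)
        then show ?thesis by (simp add: q_def smoothstep_facts(1))
      qed (use \<zeta>0 in auto)
      moreover have "C \<subseteq> \<Omega>"
      proof
        fix x assume x: "x \<in> C"
        then have "x \<in> ball x0 r" using r by (auto simp: C_def)
        then show "x \<in> \<Omega>" using x cf(6) \<epsilon>[of n] by (auto simp: C_def)
      qed
      ultimately have "(\<integral>x. ?g x \<bullet> flux x + ?\<psi> x * flux_div x \<partial>M) = 0"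
        by (intro interior_identity[OF \<psi>])
      moreover have eq: "(\<lambda>x. ?g x \<bullet> flux x + ?\<psi> x * flux_div x) = (\<lambda>x. q n (H x) * F x + R n x)"
        by (rule ext) (simp add: F_def R_def inner_add_left algebra_simps)
      moreover have "integrable M (\<lambda>x. ?g x \<bullet> flux x + ?\<psi> x * flux_div x)"
        by (rule C1_weighted_integrable[OF \<Omega>(2) \<psi> flux_integrable])
      then have "integrable M (\<lambda>x. (q n (H x) * F x + R n x) - q n (H x) * F x)"
        unfolding eq by (intro Bochner_Integration.integrable_diff qF)
      then have "integrable M (R n)" by simp
      ultimately show ?thesis using qF[of n] by simp
    qed
    have lim1: "(\<lambda>n. \<integral>x. q n (H x) * F x \<partial>M) \<longlonglongrightarrow> (\<integral>x. F x \<partial>M)"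
    proof (rule integral_dominated_convergence[where w="\<lambda>x. \<bar>F x\<bar>"])
      show "F \<in> borel_measurable M" "(\<lambda>x. q n (H x) * F x) \<in> borel_measurable M" for n
        using Fi qF by (auto intro: borel_measurable_integrable)
      show "integrable M (\<lambda>x. \<bar>F x\<bar>)" using Fi by (rule integrable_abs)
      show "AE x in M. norm (q n (H x) * F x) \<le> \<bar>F x\<bar>" for n
        using smoothstep_facts(3,4) by (auto intro!: AE_I2 simp: q_def abs_mult mult_left_le_one_le)
      show "AE x in M. (\<lambda>n. q n (H x) * F x) \<longlonglongrightarrow> F x"
      proof (rule AE_I2)
        fix x assume "x \<in> space M"
        then have x: "x \<in> \<Omega>" by (simp add: space_restrict_space)
        show "(\<lambda>n. q n (H x) * F x) \<longlonglongrightarrow> F x"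
        proof (cases "x \<in> cball x0 (r/4)")
          case True
          then have "x \<in> ball x0 r" using r by auto
          then have Hx: "- H x > 0" using x cf(6) by auto
          have "\<forall>\<^sub>F n in sequentially. \<epsilon> n < - H x / 3" using \<epsilon>0 Hx by (intro order_tendstoD(2)) auto
          then have "\<forall>\<^sub>F n in sequentially. q n (H x) * F x = F x"
          proof eventually_elim
            case (elim n)
            then have "2 \<le> (- H x - \<epsilon> n) / \<epsilon> n" using \<epsilon>[of n] by (simp add: le_divide_eq)
            then show ?case by (simp add: q_def smoothstep_facts(2))
          qed
          then show ?thesis by (rule tendsto_eventually)
        next
          case False
          then have "F x = 0" using \<zeta>'0 \<zeta>0 by (auto simp: F_def)
          then show ?thesis by simp
        qed
      qed
    qed
    define s1 where "s1 n = (\<integral>x. (\<phi> x)\<^sup>2 * indicator (strip H x0 (r/4) (3 * \<epsilon> n)) x \<partial>M)" for n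
    define s2 where "s2 n = (\<integral>x. (norm (D x))\<^sup>2 * indicator (strip H x0 (r/2) (3 * \<epsilon> n)) x \<partial>M)" for n
    have strip0: "(\<lambda>n. \<integral>x. f x * indicator (strip H x0 \<rho> (3 * \<epsilon> n)) x \<partial>M) \<longlonglongrightarrow> 0 \<and>
        (\<forall>n. integrable M (\<lambda>x. f x * indicator (strip H x0 \<rho> (3 * \<epsilon> n)) x))"
      if f: "integrable M f" and \<rho>: "\<rho> \<le> r" for f :: "real^'n \<Rightarrow> real" and \<rho>
    proof -
      have sub: "strip H x0 \<rho> (3 * \<epsilon> n) \<in> sets M" for n
      proof -
        have "strip H x0 \<rho> (3 * \<epsilon> n) \<subseteq> \<Omega>" using cf(6) \<rho> by (auto simp: strip_def)
        then show ?thesis using strip_open[OF cf(7)] by (auto simp: sets_restrict_space_iff)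
      qed
      have m: "(\<lambda>x. f x * indicator (strip H x0 \<rho> (3 * \<epsilon> n)) x) \<in> borel_measurable M" for n
        using sub borel_measurable_integrable[OF f] by measurable
      have le: "AE x in M. norm (f x * indicator (strip H x0 \<rho> (3 * \<epsilon> n)) x) \<le> \<bar>f x\<bar>" for n
        by (auto intro!: AE_I2 simp: indicator_def)
      have "(\<lambda>n. \<integral>x. f x * indicator (strip H x0 \<rho> (3 * \<epsilon> n)) x \<partial>M) \<longlonglongrightarrow> (\<integral>x. 0 \<partial>M)"
      proof (rule integral_dominated_convergence[OF _ m _ _ le])
        show "integrable M (\<lambda>x. \<bar>f x\<bar>)" using f by (rule integrable_abs)
        show "AE x in M. (\<lambda>n. f x * indicator (strip H x0 \<rho> (3 * \<epsilon> n)) x) \<longlonglongrightarrow> 0"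
        proof (rule AE_I2)
          fix x
          have "\<forall>\<^sub>F n in sequentially. x \<notin> strip H x0 \<rho> (3 * \<epsilon> n)"
          proof (cases "- H x > 0")
            case True
            have "\<forall>\<^sub>F n in sequentially. \<epsilon> n < - H x / 3" using \<epsilon>0 True by (intro order_tendstoD(2)) auto
            then show ?thesis by eventually_elim (simp add: strip_def)
          qed (simp add: strip_def)
          then have "\<forall>\<^sub>F n in sequentially. f x * indicator (strip H x0 \<rho> (3 * \<epsilon> n)) x = 0"
            by eventually_elim simp
          then show "(\<lambda>n. f x * indicator (strip H x0 \<rho> (3 * \<epsilon> n)) x) \<longlonglongrightarrow> 0" by (rule tendsto_eventually)
        qed
      qed simp
      moreover have "integrable M (\<lambda>x. f x * indicator (strip H x0 \<rho> (3 * \<epsilon> n)) x)" for n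
        by (rule Bochner_Integration.integrable_bound[OF f m]) (auto intro!: AE_I2 simp: indicator_def)
      ultimately show ?thesis by simp
    qed
    have \<phi>i: "integrable M (\<lambda>x. (\<phi> x)\<^sup>2)" using \<phi>(1) by (simp add: square_integrable_def)
    have Di: "integrable M (\<lambda>x. (norm (D x))\<^sup>2)" using D by (simp add: square_integrable_def)
    have s1: "s1 \<longlonglongrightarrow> 0" "integrable M (\<lambda>x. (\<phi> x)\<^sup>2 * indicator (strip H x0 (r/4) (3 * \<epsilon> n)) x)" for n
      using strip0[OF \<phi>i, of "r/4"] r by (auto simp: s1_def[abs_def])
    have s2: "s2 \<longlonglongrightarrow> 0" using strip0[OF Di, of "r/2"] r by (auto simp: s2_def[abs_def])
    have lim2: "(\<lambda>n. \<integral>x. R n x \<partial>M) \<longlonglongrightarrow> 0"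
    proof (rule Lim_null_comparison)
      have "(\<lambda>n. Z * B * (s1 n + 72 * K\<^sup>2 * s2 n)) \<longlonglongrightarrow> Z * B * (0 + 72 * K\<^sup>2 * 0)"
        by (intro tendsto_intros s1 s2)
      then show "(\<lambda>n. Z * B * (s1 n + 72 * K\<^sup>2 * s2 n)) \<longlonglongrightarrow> 0" by simp
      show "\<forall>\<^sub>F n in sequentially. norm (\<integral>x. R n x \<partial>M) \<le> Z * B * (s1 n + 72 * K\<^sup>2 * s2 n)"
      proof (intro always_eventually allI)
        fix n
        let ?S = "strip H x0 (r/4) (3 * \<epsilon> n)"
        have L: "0 < 3 * \<epsilon> n" using \<epsilon>[of n] by simp
        note se = strip_estimate[OF chart K L \<epsilon>L]
        have "norm (\<integral>x. R n x \<partial>M) \<le> (\<integral>x. \<bar>R n x\<bar> \<partial>M)" unfolding real_norm_def by (rule integral_abs_bound)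
        also have "\<dots> \<le> (\<integral>x. Z * B * ((\<phi> x)\<^sup>2 * indicator ?S x + (1 / \<epsilon> n)\<^sup>2 * ((H' x \<bullet> G x)\<^sup>2 * indicator ?S x)) \<partial>M)"
        proof (rule Bochner_Integration.integral_mono)
          show "integrable M (\<lambda>x. \<bar>R n x\<bar>)" using sum0 by (intro integrable_abs) blast
          show "integrable M (\<lambda>x. Z * B * ((\<phi> x)\<^sup>2 * indicator ?S x + (1 / \<epsilon> n)\<^sup>2 * ((H' x \<bullet> G x)\<^sup>2 * indicator ?S x)))"
            by (intro integrable_mult_right Bochner_Integration.integrable_add s1(2) se(1))
          fix x
          show "\<bar>R n x\<bar> \<le> Z * B * ((\<phi> x)\<^sup>2 * indicator ?S x + (1 / \<epsilon> n)\<^sup>2 * ((H' x \<bullet> G x)\<^sup>2 * indicator ?S x))"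
          proof (cases "R n x = 0")
            case False
            then have nz: "\<zeta> x \<noteq> 0" "tent ((- H x - \<epsilon> n) / \<epsilon> n) \<noteq> 0" by (auto simp: R_def q'_def)
            from tent_facts(3)[OF nz(2)] have "0 < - H x" "- H x < 3 * \<epsilon> n" using \<epsilon>[of n]
              by (auto simp: divide_less_eq zero_less_divide_iff)
            moreover have "x \<in> ball x0 (r/4)" using nz(1) \<zeta>0 by blast
            ultimately have S: "x \<in> ?S" by (simp add: strip_def)
            have "\<bar>q' n (H x)\<bar> \<le> 1 / \<epsilon> n" using tent_facts(1,2) \<epsilon>[of n] by (simp add: q'_def abs_mult divide_right_mono)
            have "\<bar>R n x\<bar> = (\<bar>\<zeta> x\<bar> * \<bar>q' n (H x)\<bar>) * (\<bar>\<mu> (G x)\<bar> * (\<bar>\<phi> x\<bar> * \<bar>H' x \<bullet> G x\<bar>))"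
              by (simp add: R_def flux_def abs_mult mult_ac)
            also have "\<dots> \<le> Z * (1 / \<epsilon> n) * (B * (\<bar>\<phi> x\<bar> * \<bar>H' x \<bullet> G x\<bar>))"
              using Z \<mu>(2)[of "G x"] \<epsilon>[of n] B0 \<open>\<bar>q' n (H x)\<bar> \<le> 1 / \<epsilon> n\<close>
              by (intro mult_mono mult_nonneg_nonneg) auto
            also have "\<dots> = Z * B * (\<bar>\<phi> x\<bar> * (\<bar>H' x \<bullet> G x\<bar> / \<epsilon> n))" by simp
            also have "\<dots> \<le> Z * B * ((\<phi> x)\<^sup>2 + (1 / \<epsilon> n)\<^sup>2 * (H' x \<bullet> G x)\<^sup>2)"
            proof (intro mult_left_mono)
              have "p * t \<le> p\<^sup>2 + t\<^sup>2" for p t :: real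
              proof -
                have "2 * (p * t) \<le> p\<^sup>2 + t\<^sup>2" using zero_le_power2[of "p - t"] by (simp add: power2_diff mult.assoc)
                then show ?thesis using zero_le_power2[of p] zero_le_power2[of t] by linarith
              qed
              from this[of "\<bar>\<phi> x\<bar>" "\<bar>H' x \<bullet> G x\<bar> / \<epsilon> n"]
              show "\<bar>\<phi> x\<bar> * (\<bar>H' x \<bullet> G x\<bar> / \<epsilon> n) \<le> (\<phi> x)\<^sup>2 + (1 / \<epsilon> n)\<^sup>2 * (H' x \<bullet> G x)\<^sup>2"
                by (simp add: power_divide)
            qed (use Z B0 in simp)
            finally show ?thesis using S by simp
          qed (use Z B0 in simp)
        qed
        also have "\<dots> = Z * B * (s1 n + (1 / \<epsilon> n)\<^sup>2 * (\<integral>x. (H' x \<bullet> G x)\<^sup>2 * indicator ?S x \<partial>M))"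
          using s1(2) se(1) by (simp add: s1_def)
        also have "\<dots> \<le> Z * B * (s1 n + (1 / \<epsilon> n)\<^sup>2 * (8 * K\<^sup>2 * (3 * \<epsilon> n)\<^sup>2 * s2 n))"
          unfolding s2_def using Z B0 se(3) by (intro mult_left_mono add_left_mono) auto
        also have "(1 / \<epsilon> n)\<^sup>2 * (8 * K\<^sup>2 * (3 * \<epsilon> n)\<^sup>2 * s2 n) = 72 * K\<^sup>2 * s2 n"
          using \<epsilon>[of n] by (simp add: power_mult_distrib power_divide)
        finally show "norm (\<integral>x. R n x \<partial>M) \<le> Z * B * (s1 n + 72 * K\<^sup>2 * s2 n)" .
      qed
    qed
    have "(\<lambda>n. (\<integral>x. q n (H x) * F x \<partial>M) + (\<integral>x. R n x \<partial>M)) \<longlonglongrightarrow> (\<integral>x. F x \<partial>M) + 0"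
      by (intro tendsto_add lim1 lim2)
    then show "(\<integral>x. \<zeta>' x \<bullet> flux x + \<zeta> x * flux_div x \<partial>M) = 0"
      using sum0 by (simp add: F_def[abs_def] LIMSEQ_const_iff)
  qed
qed

lemma flux_div_integral_zero: "(\<integral>x. flux_div x \<partial>M) = 0"
proof (rule local_to_global_integral[OF \<Omega>(1,2) flux_integrable])
  fix x0 assume "x0 \<in> closure \<Omega>"
  then consider "x0 \<in> \<Omega>" | "x0 \<in> frontier \<Omega>" using \<Omega>(1) by (auto simp: frontier_def interior_open)
  then show "\<exists>\<rho>>0. \<forall>\<zeta> \<zeta>'. has_C1_gradient \<zeta> \<zeta>' \<longrightarrow> (\<forall>x. x \<notin> ball x0 \<rho> \<longrightarrow> \<zeta> x = 0)
      \<longrightarrow> (\<integral>x. \<zeta>' x \<bullet> flux x + \<zeta> x * flux_div x \<partial>M) = 0"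
  proof cases
    case 1
    then obtain \<rho> where \<rho>: "\<rho> > 0" "cball x0 \<rho> \<subseteq> \<Omega>" using \<Omega>(1) open_contains_cball by blast
    show ?thesis
    proof (intro exI[of _ \<rho>] conjI allI impI)
      fix \<zeta> \<zeta>' assume "has_C1_gradient \<zeta> \<zeta>'" "\<forall>x. x \<notin> ball x0 \<rho> \<longrightarrow> \<zeta> x = 0"
      then show "(\<integral>x. \<zeta>' x \<bullet> flux x + \<zeta> x * flux_div x \<partial>M) = 0"
        by (intro interior_identity[OF _ compact_cball _ \<rho>(2)]) auto
    qed (rule \<rho>)
  qed (rule boundary_identity)
qed

end

section \<open>Lebesgue and Sobolev spaces on bounded domains\<close>

lemma vec_measurable:
  fixes f :: "'a \<Rightarrow> 'v::euclidean_space^'n"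
  assumes "\<And>i. (\<lambda>x. f x $ i) \<in> borel_measurable M"
  shows "f \<in> borel_measurable M"
proof (subst borel_measurable_euclidean_space, rule ballI)
  fix b :: "'v^'n" assume "b \<in> Basis"
  then obtain i v where b: "b = axis i v" by (auto simp: Basis_vec_def)
  have "(\<lambda>x. f x $ i \<bullet> v) \<in> borel_measurable M" using assms by (intro borel_measurable_inner) auto
  then show "(\<lambda>x. f x \<bullet> b) \<in> borel_measurable M" by (simp add: b inner_axis)
qed

lemma norm_vec_le_component:
  fixes x :: "'v::euclidean_space^'n"
  shows "\<exists>i. norm x \<le> real CARD('n) * norm (x $ i)"
proof (rule ccontr)
  assume "\<not> ?thesis"
  then have *: "real CARD('n) * norm (x $ i) < norm x" for i by (simp add: not_le)
  have "norm x \<le> (\<Sum>i\<in>UNIV. norm (x $ i))"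
    unfolding norm_vec_def by (rule L2_set_le_sum) simp
  moreover have "(\<Sum>i\<in>UNIV. real CARD('n) * norm (x $ i)) < (\<Sum>i\<in>(UNIV::'n set). norm x)"
    by (intro sum_strict_mono *) auto
  ultimately show False by (simp add: sum_distrib_left[symmetric])
qed

lemma Lp_vec:
  fixes f :: "'a \<Rightarrow> 'v::euclidean_space^'n"
  assumes p: "p \<ge> 0" and f: "\<And>i. (\<lambda>x. f x $ i) \<in> Lp M p"
  shows "f \<in> Lp M p"
proof -
  have m: "f \<in> borel_measurable M" using f by (intro vec_measurable) (auto simp: Lp_def)
  let ?N = "real CARD('n)"
  have "integrable M (\<lambda>x. norm (f x) powr p)"
  proof (rule Bochner_Integration.integrable_bound)
    show "integrable M (\<lambda>x. \<Sum>i\<in>UNIV. ?N powr p * norm (f x $ i) powr p)"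
      using f by (intro Bochner_Integration.integrable_sum integrable_mult_right) (auto simp: Lp_def)
    show "(\<lambda>x. norm (f x) powr p) \<in> borel_measurable M" using m by measurable
    show "AE x in M. norm (norm (f x) powr p) \<le> norm (\<Sum>i\<in>UNIV. ?N powr p * norm (f x $ i) powr p)"
    proof (rule AE_I2)
      fix x
      obtain i where i: "norm (f x) \<le> ?N * norm (f x $ i)" using norm_vec_le_component by blast
      have "norm (f x) powr p \<le> (?N * norm (f x $ i)) powr p" using i p by (intro powr_mono2) auto
      also have "\<dots> = ?N powr p * norm (f x $ i) powr p" by (simp add: powr_mult)
      also have "\<dots> \<le> (\<Sum>i\<in>UNIV. ?N powr p * norm (f x $ i) powr p)" by (rule member_le_sum) auto
      finally show "norm (norm (f x) powr p) \<le> norm (\<Sum>i\<in>UNIV. ?N powr p * norm (f x $ i) powr p)" by simp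
    qed
  qed
  then show ?thesis using m by (simp add: Lp_def)
qed

lemma Lp_dominated:
  fixes f :: "'a \<Rightarrow> 'b::euclidean_space" and g :: "'a \<Rightarrow> 'c::euclidean_space"
  assumes "f \<in> Lp M p" "p \<ge> 0" "g \<in> borel_measurable M" "\<And>x. norm (g x) \<le> norm (f x)"
  shows "g \<in> Lp M p"
proof -
  have "integrable M (\<lambda>x. norm (g x) powr p)"
  proof (rule Bochner_Integration.integrable_bound[of M "\<lambda>x. norm (f x) powr p"])
    show "integrable M (\<lambda>x. norm (f x) powr p)" using assms(1) by (simp add: Lp_def)
    show "(\<lambda>x. norm (g x) powr p) \<in> borel_measurable M" using assms(3) by measurable
    show "AE x in M. norm (norm (g x) powr p) \<le> norm (norm (f x) powr p)"
      using assms by (intro AE_I2) (auto intro!: powr_mono2)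
  qed
  then show ?thesis using assms(3) by (simp add: Lp_def)
qed

lemma Lp_AE_cong:
  fixes f g :: "'a \<Rightarrow> 'b::euclidean_space"
  assumes "f \<in> Lp M p" "g \<in> borel_measurable M" "AE x in M. f x = g x"
  shows "g \<in> Lp M p"
proof -
  have "integrable M (\<lambda>x. norm (f x) powr p)" and [measurable]: "f \<in> borel_measurable M" "g \<in> borel_measurable M"
    using assms by (auto simp: Lp_def)
  moreover have "integrable M (\<lambda>x. norm (f x) powr p) = integrable M (\<lambda>x. norm (g x) powr p)"
  proof (rule integrable_cong_AE)
    show "AE x in M. norm (f x) powr p = norm (g x) powr p" using assms(3) by eventually_elim simp
  qed measurable
  ultimately show ?thesis using assms(2) by (simp add: Lp_def)
qed

lemma Lp_diff:
  fixes f g :: "'a \<Rightarrow> 'b::euclidean_space"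
  assumes f: "f \<in> Lp M p" and g: "g \<in> Lp M p" and p: "p \<ge> 0"
  shows "(\<lambda>x. f x - g x) \<in> Lp M p"
proof -
  have [measurable]: "f \<in> borel_measurable M" "g \<in> borel_measurable M" using f g by (auto simp: Lp_def)
  have "integrable M (\<lambda>x. norm (f x - g x) powr p)"
  proof (rule Bochner_Integration.integrable_bound)
    show "integrable M (\<lambda>x. 2 powr p * (norm (f x) powr p + norm (g x) powr p))"
      using f g by (auto simp: Lp_def)
    show "AE x in M. norm (norm (f x - g x) powr p) \<le> norm (2 powr p * (norm (f x) powr p + norm (g x) powr p))"
    proof (rule AE_I2)
      fix x
      let ?m = "max (norm (f x)) (norm (g x))"
      have "norm (f x - g x) \<le> 2 * ?m" using norm_triangle_ineq4[of "f x" "g x"] by linarith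
      then have "norm (f x - g x) powr p \<le> (2 * ?m) powr p" using p by (intro powr_mono2) auto
      also have "\<dots> = 2 powr p * ?m powr p" by (rule powr_mult)
      also have "\<dots> \<le> 2 powr p * (norm (f x) powr p + norm (g x) powr p)"
        by (intro mult_left_mono) (auto simp: max_def)
      finally show "norm (norm (f x - g x) powr p) \<le> norm (2 powr p * (norm (f x) powr p + norm (g x) powr p))" by simp
    qed
  qed measurable
  then show ?thesis by (simp add: Lp_def)
qed

lemma Lp_mono_exponent:
  fixes f :: "'a \<Rightarrow> 'b::euclidean_space"
  assumes "finite_measure M" "f \<in> Lp M p" "0 \<le> q" "q \<le> p"
  shows "f \<in> Lp M q"
proof -
  interpret finite_measure M by fact
  have [measurable]: "f \<in> borel_measurable M" using assms by (simp add: Lp_def)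
  have "integrable M (\<lambda>x. norm (f x) powr q)"
  proof (rule Bochner_Integration.integrable_bound)
    show "integrable M (\<lambda>x. 1 + norm (f x) powr p)" using assms by (simp add: Lp_def)
    show "AE x in M. norm (norm (f x) powr q) \<le> norm (1 + norm (f x) powr p)"
    proof (rule AE_I2)
      fix x
      show "norm (norm (f x) powr q) \<le> norm (1 + norm (f x) powr p)"
      proof (cases "norm (f x) \<le> 1")
        case True
        then have "norm (f x) powr q \<le> 1" using assms(3) by (intro powr_le1) auto
        then show ?thesis by (simp add: add_increasing2)
      next
        case False
        then have "norm (f x) powr q \<le> norm (f x) powr p" using assms(4) by (intro powr_mono) auto
        then show ?thesis by simp
      qed
    qed
  qed measurable
  then show ?thesis using assms by (simp add: Lp_def)
qed

lemma Lp_square_integrable: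
  fixes f :: "'a \<Rightarrow> 'b::euclidean_space"
  assumes "finite_measure M" "f \<in> Lp M p" "2 \<le> p"
  shows "square_integrable M f"
  using Lp_mono_exponent[OF assms(1,2), of 2] assms(3) by (simp add: Lp_def square_integrable_def)

lemma bounded_in_Lp:
  fixes f :: "'a \<Rightarrow> 'b::euclidean_space"
  assumes "finite_measure M" "f \<in> borel_measurable M" "\<And>x. x \<in> space M \<Longrightarrow> norm (f x) \<le> B" "p \<ge> 0"
  shows "f \<in> Lp M p"
proof -
  interpret finite_measure M by fact
  have "integrable M (\<lambda>x. norm (f x) powr p)"
  proof (rule integrable_const_bound[of _ "B powr p"])
    show "AE x in M. norm (norm (f x) powr p) \<le> B powr p"
      using assms(3,4) by (auto intro!: AE_I2 powr_mono2)
  qed (use assms(2) in measurable)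
  then show ?thesis using assms(2) by (simp add: Lp_def)
qed

lemma Lp_norm_nonneg: "Lp_norm M p f \<ge> 0"
  by (simp add: Lp_norm_def)

lemma Lp_norm_powr: "p > 0 \<Longrightarrow> Lp_norm M p f powr p = (\<integral>x. norm (f x) powr p \<partial>M)"
  by (simp add: Lp_norm_def powr_powr)

text \<open>On a finite measure space, via \<open>x\<^sup>2 \<le> \<theta>\<^sup>2 + \<theta>^(2-p) x^p\<close> for every \<open>\<theta> > 0\<close>.\<close>

lemma Lp_tendsto_imp_L2_tendsto:
  fixes f :: "nat \<Rightarrow> 'a \<Rightarrow> 'b::euclidean_space"
  assumes "finite_measure M" "p > 2" and f: "\<And>n. f n \<in> Lp M p" and l: "(\<lambda>n. Lp_norm M p (f n)) \<longlonglongrightarrow> 0"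
  shows "(\<lambda>n. \<integral>x. (norm (f n x))\<^sup>2 \<partial>M) \<longlonglongrightarrow> 0"
proof (rule LIMSEQ_I)
  fix e :: real assume e: "e > 0"
  interpret finite_measure M by fact
  define m where "m = measure M (space M)"
  have m: "m \<ge> 0" by (simp add: m_def)
  define \<theta> where "\<theta> = sqrt (e / (2 * (m + 1)))"
  have \<theta>: "\<theta> > 0" "\<theta>\<^sup>2 = e / (2 * (m + 1))" using e m by (auto simp: \<theta>_def)
  have fi: "integrable M (\<lambda>x. norm (f n x) powr p)" for n using f by (simp add: Lp_def)
  have "(\<lambda>n. Lp_norm M p (f n) powr p) \<longlonglongrightarrow> 0 powr p"
    by (rule tendsto_powr'[OF l tendsto_const]) (use assms(2) in \<open>auto simp: Lp_norm_nonneg\<close>)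
  then have I: "(\<lambda>n. \<integral>x. norm (f n x) powr p \<partial>M) \<longlonglongrightarrow> 0" using assms(2) by (simp add: Lp_norm_powr)
  from tendsto_mult_left[OF I, of "\<theta> powr (2 - p)"]
  have "(\<lambda>n. \<theta> powr (2 - p) * (\<integral>x. norm (f n x) powr p \<partial>M)) \<longlonglongrightarrow> 0" by simp
  from LIMSEQ_D[OF this, of "e/2"] e
  obtain n0 where n0: "\<And>n. n \<ge> n0 \<Longrightarrow> norm (\<theta> powr (2 - p) * (\<integral>x. norm (f n x) powr p \<partial>M) - 0) < e/2" by auto
  show "\<exists>no. \<forall>n\<ge>no. norm ((\<integral>x. (norm (f n x))\<^sup>2 \<partial>M) - 0) < e"
  proof (intro exI[of _ n0] allI impI)
    fix n assume n: "n \<ge> n0"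
    have "(\<integral>x. (norm (f n x))\<^sup>2 \<partial>M) \<le> (\<integral>x. \<theta>\<^sup>2 + \<theta> powr (2 - p) * norm (f n x) powr p \<partial>M)"
    proof (rule integral_mono')
      show "integrable M (\<lambda>x. \<theta>\<^sup>2 + \<theta> powr (2 - p) * norm (f n x) powr p)" using fi by simp
      fix x
      show "(norm (f n x))\<^sup>2 \<le> \<theta>\<^sup>2 + \<theta> powr (2 - p) * norm (f n x) powr p"
      proof (cases "norm (f n x) \<le> \<theta>")
        case True
        then have "(norm (f n x))\<^sup>2 \<le> \<theta>\<^sup>2" by (intro power_mono) auto
        then show ?thesis by (simp add: add_increasing2)
      next
        case False
        then have pos: "norm (f n x) > 0" "\<theta> \<le> norm (f n x)" using \<theta>(1) by linarith+
        have "(norm (f n x))\<^sup>2 = norm (f n x) powr (2 - p) * norm (f n x) powr p"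
          using pos(1) by (simp add: powr_add[symmetric])
        also have "\<dots> \<le> \<theta> powr (2 - p) * norm (f n x) powr p"
          using pos \<theta>(1) assms(2) by (intro mult_right_mono powr_mono2') auto
        finally show ?thesis by (simp add: add_increasing)
      qed
    qed (auto intro!: add_nonneg_nonneg mult_nonneg_nonneg)
    also have "\<dots> = m * \<theta>\<^sup>2 + \<theta> powr (2 - p) * (\<integral>x. norm (f n x) powr p \<partial>M)"
      using fi by (simp add: m_def)
    also have "\<dots> < e/2 + e/2"
    proof (rule add_le_less_mono)
      have "m * (e / (2 * (m + 1))) = (e/2) * (m / (m + 1))" by simp
      also have "\<dots> \<le> (e/2) * 1" using m e by (intro mult_left_mono) auto
      finally show "m * \<theta>\<^sup>2 \<le> e/2" using \<theta>(2) by simp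
      show "\<theta> powr (2 - p) * (\<integral>x. norm (f n x) powr p \<partial>M) < e/2" using n0[OF n] by simp
    qed
    finally show "norm ((\<integral>x. (norm (f n x))\<^sup>2 \<partial>M) - 0) < e" by simp
  qed
qed

text \<open>The chosen weak derivative agrees almost everywhere with the one that the definition of the space
  provides, and so inherits its integrability.\<close>

lemma sobolev_1_wpd:
  assumes \<Omega>: "open \<Omega>" and f: "f \<in> sobolev (Suc k) p \<Omega>"
  shows "weak_partial \<Omega> i f (wpd \<Omega> i f)" "f \<in> Lp (lebesgue_on \<Omega>) p"
    "\<exists>g\<in>sobolev k p \<Omega>. weak_partial \<Omega> i f g \<and> (AE x in lebesgue_on \<Omega>. g x = wpd \<Omega> i f x)"
    "wpd \<Omega> i f \<in> Lp (lebesgue_on \<Omega>) p"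
proof -
  obtain g where g: "g \<in> sobolev k p \<Omega>" "weak_partial \<Omega> i f g" using f by auto
  show w: "weak_partial \<Omega> i f (wpd \<Omega> i f)" by (rule weak_partial_wpd[OF g(2)])
  have ae: "AE x in lebesgue_on \<Omega>. g x = wpd \<Omega> i f x" by (rule weak_partial_AE_unique[OF g(2) w \<Omega>])
  then show "\<exists>g\<in>sobolev k p \<Omega>. weak_partial \<Omega> i f g \<and> (AE x in lebesgue_on \<Omega>. g x = wpd \<Omega> i f x)" using g by blast
  show "f \<in> Lp (lebesgue_on \<Omega>) p" using f by simp
  have "g \<in> Lp (lebesgue_on \<Omega>) p" using g(1) by (cases k) auto
  then show "wpd \<Omega> i f \<in> Lp (lebesgue_on \<Omega>) p"
    by (rule Lp_AE_cong[OF _ weak_partial_measurable(2)[OF w \<Omega>] ae])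
qed

lemma sobolev_1_mono_exponent:
  assumes \<Omega>: "open \<Omega>" "bounded \<Omega>" and f: "f \<in> sobolev 1 p \<Omega>" and q: "0 \<le> q" "q \<le> p"
  shows "f \<in> sobolev 1 q \<Omega>"
proof -
  have fin: "finite_measure (lebesgue_on \<Omega>)" using \<Omega> by (intro finite_measure_lebesgue_on_bounded) auto
  have f': "f \<in> sobolev (Suc 0) p \<Omega>" using f by simp
  show ?thesis
    using sobolev_1_wpd(1,2,4)[OF \<Omega>(1) f'] Lp_mono_exponent[OF fin _ q] by (auto intro!: bexI)
qed

lemma continuous_in_Lp:
  assumes \<Omega>: "open \<Omega>" "bounded \<Omega>" and "continuous_on UNIV f" "p \<ge> 0"
  shows "(f :: real^'n \<Rightarrow> real) \<in> Lp (lebesgue_on \<Omega>) p"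
proof -
  have fin: "finite_measure (lebesgue_on \<Omega>)" using \<Omega> by (intro finite_measure_lebesgue_on_bounded) auto
  obtain B where "\<And>x. x \<in> \<Omega> \<Longrightarrow> norm (f x) \<le> B" using continuous_bounded_on_bounded[OF assms(3) \<Omega>(2)] by blast
  then show ?thesis
    using assms(3,4) by (intro bounded_in_Lp[OF fin, of _ B] continuous_imp_measurable_lebesgue_on) (auto simp: space_restrict_space)
qed

lemma W1_tendsto_imp_L2_tendsto:
  fixes \<Omega> :: "(real^'n) set"
  assumes \<Omega>: "open \<Omega>" "bounded \<Omega>" and p: "p > 2" and f: "f \<in> sobolev 1 p \<Omega>"
    and \<phi>: "\<And>n. smooth (\<phi> n)" and l: "(\<lambda>n. W1_norm \<Omega> p (\<lambda>x. \<phi> n x - f x)) \<longlonglongrightarrow> 0"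
  shows "(\<lambda>n. \<integral>x. (\<phi> n x - f x)\<^sup>2 \<partial>lebesgue_on \<Omega>) \<longlonglongrightarrow> 0"
    "(\<lambda>n. \<integral>x. (pd j (\<phi> n) x - wpd \<Omega> j f x)\<^sup>2 \<partial>lebesgue_on \<Omega>) \<longlonglongrightarrow> 0"
proof -
  let ?M = "lebesgue_on \<Omega>"
  have fin: "finite_measure ?M" using \<Omega> by (intro finite_measure_lebesgue_on_bounded) auto
  have f': "f \<in> sobolev (Suc 0) p \<Omega>" using f by simp
  note sf = sobolev_1_wpd[OF \<Omega>(1) f']
  have \<phi>C: "has_C1_gradient (\<phi> n) (\<lambda>x. \<chi> i. pd i (\<phi> n) x)" for n using \<phi> smooth_has_C1_gradient by blast
  have pc: "continuous_on UNIV (pd i (\<phi> n))" for i n using \<phi>[of n] by (auto simp: smooth_def dest!: spec[of _ "Suc 0"])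
  have d0: "(\<lambda>x. \<phi> n x - f x) \<in> Lp ?M p" for n
    using p by (intro Lp_diff continuous_in_Lp \<Omega> has_C1_gradient_continuous[OF \<phi>C] sf) auto
  have w: "weak_partial \<Omega> i (\<lambda>x. \<phi> n x - f x) (\<lambda>x. pd i (\<phi> n) x - wpd \<Omega> i f x)" for i n
    using weak_partial_of_C1[OF \<phi>C \<Omega>(1), of i n] by (intro weak_partial_diff sf(1) \<Omega>(1)) simp
  have ae: "AE x in ?M. wpd \<Omega> i (\<lambda>x. \<phi> n x - f x) x = pd i (\<phi> n) x - wpd \<Omega> i f x" for i n
    by (rule weak_partial_AE_unique[OF weak_partial_wpd[OF w] w \<Omega>(1)])
  have dp: "(\<lambda>x. pd i (\<phi> n) x - wpd \<Omega> i f x) \<in> Lp ?M p" for i n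
    using p by (intro Lp_diff continuous_in_Lp \<Omega> pc sf(4)) auto
  have dw: "wpd \<Omega> i (\<lambda>x. \<phi> n x - f x) \<in> Lp ?M p" for i n
  proof (rule Lp_AE_cong[OF dp])
    show "wpd \<Omega> i (\<lambda>x. \<phi> n x - f x) \<in> borel_measurable ?M"
      by (rule weak_partial_measurable(2)[OF weak_partial_wpd[OF w] \<Omega>(1)])
    show "AE x in ?M. pd i (\<phi> n) x - wpd \<Omega> i f x = wpd \<Omega> i (\<lambda>x. \<phi> n x - f x) x"
      using ae[of i n] by eventually_elim simp
  qed
  have dg: "wgrad \<Omega> (\<lambda>x. \<phi> n x - f x) \<in> Lp ?M p" for n
    using p dw by (intro Lp_vec) (auto simp: wgrad_def)
  have l1: "(\<lambda>n. Lp_norm ?M p (wgrad \<Omega> (\<lambda>x. \<phi> n x - f x))) \<longlonglongrightarrow> 0"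
    by (rule Lim_null_comparison[OF _ l]) (auto simp: W1_norm_def Lp_norm_nonneg)
  have l2: "(\<lambda>n. Lp_norm ?M p (\<lambda>x. \<phi> n x - f x)) \<longlonglongrightarrow> 0"
    by (rule Lim_null_comparison[OF _ l]) (auto simp: W1_norm_def Lp_norm_nonneg)
  show "(\<lambda>n. \<integral>x. (\<phi> n x - f x)\<^sup>2 \<partial>?M) \<longlonglongrightarrow> 0"
    using Lp_tendsto_imp_L2_tendsto[OF fin p d0 l2] by simp
  have "square_integrable ?M (wgrad \<Omega> (\<lambda>x. \<phi> n x - f x))" for n
    using p by (intro Lp_square_integrable[OF fin dg]) simp
  then have "(\<lambda>n. \<integral>x. (wpd \<Omega> j (\<lambda>x. \<phi> n x - f x) x)\<^sup>2 \<partial>?M) \<longlonglongrightarrow> 0"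
    by (rule L2_tendsto_dominated[OF _ Lp_tendsto_imp_L2_tendsto[OF fin p dg l1]])
      (metis component_le_norm_cart vec_lambda_beta wgrad_def)
  moreover have "(\<integral>x. (wpd \<Omega> j (\<lambda>x. \<phi> n x - f x) x)\<^sup>2 \<partial>?M) = (\<integral>x. (pd j (\<phi> n) x - wpd \<Omega> j f x)\<^sup>2 \<partial>?M)" for n
  proof (rule integral_cong_AE)
    show "(\<lambda>x. (wpd \<Omega> j (\<lambda>x. \<phi> n x - f x) x)\<^sup>2) \<in> borel_measurable ?M" "(\<lambda>x. (pd j (\<phi> n) x - wpd \<Omega> j f x)\<^sup>2) \<in> borel_measurable ?M"
      using dw[of j n] dp[of j n] by (auto simp: Lp_def intro: borel_measurable_power)
    show "AE x in ?M. (wpd \<Omega> j (\<lambda>x. \<phi> n x - f x) x)\<^sup>2 = (pd j (\<phi> n) x - wpd \<Omega> j f x)\<^sup>2"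
      using ae[of j n] by eventually_elim simp
  qed
  ultimately show "(\<lambda>n. \<integral>x. (pd j (\<phi> n) x - wpd \<Omega> j f x)\<^sup>2 \<partial>?M) \<longlonglongrightarrow> 0" by simp
qed

lemma finite_measure_surface:
  fixes \<Omega> :: "(real^'n) set"
  assumes "CARD('n) \<ge> 2" "open \<Omega>" "bounded \<Omega>" "C2_holder_boundary \<gamma> \<Omega>"
  shows "finite_measure (surface_measure \<Omega>)"
proof
  show "emeasure (surface_measure \<Omega>) (space (surface_measure \<Omega>)) \<noteq> \<infinity>"
    using hausdorff_frontier_finite[OF assms] surface_measure_facts(4)[of \<Omega>] by auto
qed

text \<open>Finiteness of the surface measure makes \<open>\<phi> n - g\<close> integrable to the power \<open>p\<close>, so that its norm
  tending to 0 carries information.\<close>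

lemma trace_L2_tendsto:
  fixes \<Omega> :: "(real^'n) set"
  assumes fin: "finite_measure (surface_measure \<Omega>)" and "bounded \<Omega>" and p: "p > 2"
    and g: "g \<in> Lp (surface_measure \<Omega>) p" and \<phi>: "\<And>n. smooth (\<phi> n)"
    and l: "(\<lambda>n. Lp_norm (surface_measure \<Omega>) p (\<lambda>x. \<phi> n x - g x)) \<longlonglongrightarrow> 0"
  shows "(\<lambda>n. \<integral>\<^sup>+x. ennreal ((\<phi> n x - g x)\<^sup>2) \<partial>surface_measure \<Omega>) \<longlonglongrightarrow> 0"
proof -
  let ?S = "surface_measure \<Omega>"
  have c: "continuous_on UNIV (\<phi> n)" for n using \<phi> smooth_has_C1_gradient has_C1_gradient_continuous by blast
  have "\<phi> n \<in> Lp ?S p" for n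
  proof -
    have "bounded (frontier \<Omega>)" using \<open>bounded \<Omega>\<close> by (metis Diff_subset bounded_closure bounded_subset frontier_def)
    then obtain B where "\<And>x. x \<in> frontier \<Omega> \<Longrightarrow> norm (\<phi> n x) \<le> B" using continuous_bounded_on_bounded[OF c] by blast
    moreover have "\<phi> n \<in> borel_measurable ?S"
      using measurable_compose[OF surface_measure_facts(1) borel_measurable_continuous_onI[OF c]] by simp
    ultimately show ?thesis using p by (intro bounded_in_Lp[OF fin, of _ B]) (auto simp: surface_measure_facts(3))
  qed
  then have d: "(\<lambda>x. \<phi> n x - g x) \<in> Lp ?S p" for n using g p by (intro Lp_diff) auto
  have "(\<lambda>n. \<integral>x. (\<phi> n x - g x)\<^sup>2 \<partial>?S) \<longlonglongrightarrow> 0" using Lp_tendsto_imp_L2_tendsto[OF fin p d l] by simp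
  moreover have "(\<integral>\<^sup>+x. ennreal ((\<phi> n x - g x)\<^sup>2) \<partial>?S) = ennreal (\<integral>x. (\<phi> n x - g x)\<^sup>2 \<partial>?S)" for n
    using Lp_square_integrable[OF fin d, of n] p by (intro nn_integral_eq_integral) (auto simp: square_integrable_def)
  ultimately show ?thesis using tendsto_ennrealI by fastforce
qed

text \<open>The smooth functions in the definition of the trace, one sequence for each component of the
  gradient, approximate the gradient in the interior and on the boundary at the same time. A
  subsequence converges almost everywhere as well.\<close>

lemma neumann_field_exists:
  fixes \<Omega> :: "(real^'n) set"
  assumes N: "2 \<le> CARD('n)" and \<Omega>: "open \<Omega>" "bounded \<Omega>" "C2_holder_boundary \<gamma> \<Omega>" and p: "p > 2"
    and u: "u \<in> sobolev 2 p \<Omega>" and nc: "neumann_condition \<Omega> p u"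
  obtains \<Psi> D\<Psi> T where "neumann_field \<Omega> (wgrad \<Omega> u) (whess \<Omega> u) \<Psi> D\<Psi> T"
proof -
  let ?M = "lebesgue_on \<Omega>" and ?S = "surface_measure \<Omega>"
  have fin: "finite_measure ?M" using \<Omega> by (intro finite_measure_lebesgue_on_bounded) auto
  have finS: "finite_measure ?S" by (rule finite_measure_surface[OF N \<Omega>])
  obtain T :: "real^'n \<Rightarrow> real^'n" where T: "\<And>i. has_trace \<Omega> p (wpd \<Omega> i u) (\<lambda>x. T x $ i)"
    "AE x in ?S. T x \<bullet> outer_normal \<Omega> x = 0" using nc unfolding neumann_condition_def by blast
  have G1: "wpd \<Omega> i u \<in> sobolev 1 p \<Omega>" and TL: "(\<lambda>x. T x $ i) \<in> Lp ?S p" for i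
    using T(1)[of i] by (auto simp: has_trace_def)
  have "\<forall>i. \<exists>\<phi>. (\<forall>n. smooth (\<phi> n)) \<and> (\<lambda>n::nat. W1_norm \<Omega> p (\<lambda>x. \<phi> n x - wpd \<Omega> i u x)) \<longlonglongrightarrow> 0 \<and>
        (\<lambda>n::nat. Lp_norm ?S p (\<lambda>x. \<phi> n x - T x $ i)) \<longlonglongrightarrow> 0"
    using T(1) unfolding has_trace_def by blast
  then obtain \<Phi> where \<Phi>: "\<And>i n. smooth (\<Phi> i n)"
    "\<And>i. (\<lambda>n::nat. W1_norm \<Omega> p (\<lambda>x. \<Phi> i n x - wpd \<Omega> i u x)) \<longlonglongrightarrow> 0"
    "\<And>i. (\<lambda>n::nat. Lp_norm ?S p (\<lambda>x. \<Phi> i n x - T x $ i)) \<longlonglongrightarrow> 0"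
    unfolding choice_iff by blast
  let ?G = "wgrad \<Omega> u" and ?D = "whess \<Omega> u"
  define \<Psi>0 :: "nat \<Rightarrow> real^'n \<Rightarrow> real^'n" where "\<Psi>0 n x = (\<chi> i. \<Phi> i n x)" for n x
  define D0 :: "nat \<Rightarrow> real^'n \<Rightarrow> real^'n^'n" where "D0 n x = (\<chi> i j. pd j (\<Phi> i n) x)" for n x
  have GL: "wpd \<Omega> i u \<in> Lp ?M p" and DL: "wpd \<Omega> j (wpd \<Omega> i u) \<in> Lp ?M p" for i j
    using sobolev_1_wpd(2,4)[OF \<Omega>(1), of "wpd \<Omega> i u" 0 p] G1 by auto
  have "?G \<in> Lp ?M p" using p GL by (intro Lp_vec) (auto simp: wgrad_def)
  then have G: "square_integrable ?M ?G" using p by (intro Lp_square_integrable[OF fin, of _ p]) auto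
  have "?D \<in> Lp ?M p" using p DL by (intro Lp_vec) (auto simp: whess_def)
  then have D: "square_integrable ?M ?D" using p by (intro Lp_square_integrable[OF fin, of _ p]) auto
  have \<Phi>C: "has_C1_gradient (\<Phi> i n) (\<lambda>x. \<chi> j. pd j (\<Phi> i n) x)" for i n using \<Phi>(1) smooth_has_C1_gradient by blast
  have \<Psi>C: "has_C1_gradient (\<lambda>x. \<Psi>0 n x $ i) (\<lambda>x. D0 n x $ i)" for n i using \<Phi>C by (simp add: \<Psi>0_def D0_def)
  have \<Psi>c: "continuous_on UNIV (\<Psi>0 n)" for n
    using has_C1_gradient_continuous[OF \<Psi>C] continuous_on_vec_lambda[of UNIV "\<lambda>i x. \<Psi>0 n x $ i"] by simp
  have Dc: "continuous_on UNIV (D0 n)" for n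
  proof -
    have "continuous_on UNIV (\<lambda>x. D0 n x $ i)" for i using \<Psi>C[of n i] by (simp add: has_C1_gradient_def)
    then show ?thesis using continuous_on_vec_lambda[of UNIV "\<lambda>i x. D0 n x $ i"] by simp
  qed
  have \<Psi>L: "square_integrable ?M (\<Psi>0 n)" "square_integrable ?M (D0 n)" for n
    using \<Omega> by (auto intro: continuous_square_integrable \<Psi>c Dc)
  note dG = square_integrable_diff[OF \<Psi>L(1) G] and dD = square_integrable_diff[OF \<Psi>L(2) D]
  have conv1: "(\<lambda>n. \<integral>x. (norm (\<Psi>0 n x - ?G x))\<^sup>2 \<partial>?M) \<longlonglongrightarrow> 0"
  proof -
    have "(\<integral>x. (norm (\<Psi>0 n x - ?G x))\<^sup>2 \<partial>?M) = (\<Sum>i\<in>UNIV. \<integral>x. (\<Phi> i n x - wpd \<Omega> i u x)\<^sup>2 \<partial>?M)" for n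
    proof -
      have "integrable ?M (\<lambda>x. (\<Phi> i n x - wpd \<Omega> i u x)\<^sup>2)" for i
        using square_integrable_component[OF dG, of n i] by (simp add: square_integrable_def \<Psi>0_def wgrad_def)
      then show ?thesis unfolding norm_sq_vec by (simp add: \<Psi>0_def wgrad_def)
    qed
    moreover have "(\<lambda>n. \<Sum>i\<in>UNIV. \<integral>x. (\<Phi> i n x - wpd \<Omega> i u x)\<^sup>2 \<partial>?M) \<longlonglongrightarrow> (\<Sum>i\<in>(UNIV::'n set). 0)"
      by (intro tendsto_sum W1_tendsto_imp_L2_tendsto(1)[OF \<Omega>(1,2) p G1 \<Phi>(1,2)])
    ultimately show ?thesis by simp
  qed
  have conv2: "(\<lambda>n. \<integral>x. (norm (D0 n x - ?D x))\<^sup>2 \<partial>?M) \<longlonglongrightarrow> 0"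
  proof -
    have "(\<integral>x. (norm (D0 n x - ?D x))\<^sup>2 \<partial>?M) = (\<Sum>i\<in>UNIV. \<Sum>j\<in>UNIV. \<integral>x. (pd j (\<Phi> i n) x - wpd \<Omega> j (wpd \<Omega> i u) x)\<^sup>2 \<partial>?M)" for n
    proof -
      have "integrable ?M (\<lambda>x. (pd j (\<Phi> i n) x - wpd \<Omega> j (wpd \<Omega> i u) x)\<^sup>2)" for i j
        using square_integrable_component[OF square_integrable_row[OF dD], of n i j] by (simp add: square_integrable_def D0_def whess_def)
      then show ?thesis unfolding norm_sq_matrix norm_sq_vec by (simp add: D0_def whess_def)
    qed
    moreover have "(\<lambda>n. \<Sum>i\<in>UNIV. \<Sum>j\<in>UNIV. \<integral>x. (pd j (\<Phi> i n) x - wpd \<Omega> j (wpd \<Omega> i u) x)\<^sup>2 \<partial>?M) \<longlonglongrightarrow> (\<Sum>i\<in>(UNIV::'n set). \<Sum>j\<in>(UNIV::'n set). 0)"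
      by (intro tendsto_sum W1_tendsto_imp_L2_tendsto(2)[OF \<Omega>(1,2) p G1 \<Phi>(1,2)])
    ultimately show ?thesis by simp
  qed
  have Tm: "T \<in> borel_measurable ?S" using TL by (intro vec_measurable) (auto simp: Lp_def)
  have conv3: "(\<lambda>n. \<integral>\<^sup>+y. ennreal ((norm (\<Psi>0 n y - T y))\<^sup>2) \<partial>?S) \<longlonglongrightarrow> 0"
  proof -
    have "(\<integral>\<^sup>+y. ennreal ((norm (\<Psi>0 n y - T y))\<^sup>2) \<partial>?S) = (\<Sum>i\<in>UNIV. \<integral>\<^sup>+y. ennreal ((\<Phi> i n y - T y $ i)\<^sup>2) \<partial>?S)" for n
    proof -
      have "\<Phi> i n \<in> borel_measurable ?S" for i
        using measurable_compose[OF surface_measure_facts(1) borel_measurable_continuous_onI[OF has_C1_gradient_continuous[OF \<Phi>C]]] by simp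
      then have "(\<lambda>y. ennreal ((\<Phi> i n y - T y $ i)\<^sup>2)) \<in> borel_measurable ?S" for i
        using TL[of i] by (intro measurable_compose[OF _ measurable_ennreal] borel_measurable_power borel_measurable_diff) (auto simp: Lp_def)
      then have "(\<Sum>i\<in>UNIV. \<integral>\<^sup>+y. ennreal ((\<Phi> i n y - T y $ i)\<^sup>2) \<partial>?S) = (\<integral>\<^sup>+y. (\<Sum>i\<in>UNIV. ennreal ((\<Phi> i n y - T y $ i)\<^sup>2)) \<partial>?S)"
        by (intro nn_integral_sum[symmetric]) auto
      then show ?thesis unfolding norm_sq_vec by (simp add: \<Psi>0_def sum_ennreal)
    qed
    moreover have "(\<lambda>n. \<Sum>i\<in>UNIV. \<integral>\<^sup>+y. ennreal ((\<Phi> i n y - T y $ i)\<^sup>2) \<partial>?S) \<longlonglongrightarrow> (\<Sum>i\<in>(UNIV::'n set). 0)"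
      by (intro tendsto_sum trace_L2_tendsto[OF finS \<Omega>(2) p TL \<Phi>(1,3)])
    ultimately show ?thesis by simp
  qed
  have "\<exists>r::nat\<Rightarrow>nat. strict_mono r \<and> (AE x in ?M. (\<lambda>n. (norm (\<Psi>0 (r n) x - ?G x))\<^sup>2) \<longlonglongrightarrow> 0)"
    by (rule tendsto_L1_AE_subseq) (use dG conv1 in \<open>auto simp: square_integrable_def\<close>)
  then obtain r :: "nat \<Rightarrow> nat" where r: "strict_mono r" "AE x in ?M. (\<lambda>n. (norm (\<Psi>0 (r n) x - ?G x))\<^sup>2) \<longlonglongrightarrow> 0" by blast
  have "neumann_field \<Omega> ?G ?D (\<lambda>n. \<Psi>0 (r n)) (\<lambda>n. D0 (r n)) T"
  proof
    show "\<exists>r e H H'. boundary_chart \<Omega> x0 r e H H'" if "x0 \<in> frontier \<Omega>" for x0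
      using boundary_chart_exists[OF \<Omega>(3) that] by metis
    show "AE x in ?M. (\<lambda>n. \<Psi>0 (r n) x) \<longlonglongrightarrow> ?G x"
      using r(2)
    proof eventually_elim
      case (elim x)
      from tendsto_real_sqrt[OF elim] have "(\<lambda>n. norm (\<Psi>0 (r n) x - ?G x)) \<longlonglongrightarrow> 0" by simp
      from LIM_zero_cancel[OF tendsto_norm_zero_cancel[OF this]] show ?case .
    qed
    show "(\<lambda>n. \<integral>x. (norm (\<Psi>0 (r n) x - ?G x))\<^sup>2 \<partial>?M) \<longlonglongrightarrow> 0"
      using LIMSEQ_subseq_LIMSEQ[OF conv1 r(1)] by (simp add: comp_def)
    show "(\<lambda>n. \<integral>x. (norm (D0 (r n) x - ?D x))\<^sup>2 \<partial>?M) \<longlonglongrightarrow> 0"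
      using LIMSEQ_subseq_LIMSEQ[OF conv2 r(1)] by (simp add: comp_def)
    show "(\<lambda>n. \<integral>\<^sup>+y. ennreal ((norm (\<Psi>0 (r n) y - T y))\<^sup>2) \<partial>?S) \<longlonglongrightarrow> 0"
      using LIMSEQ_subseq_LIMSEQ[OF conv3 r(1)] by (simp add: comp_def)
  qed (fact \<Omega>(1) \<Omega>(2) N G D \<Psi>C Tm T(2))+
  then show thesis by (rule that)
qed

subsection \<open>Regularised powers of the norm\<close>

text \<open>A smooth, bounded and positive substitute for \<open>|z|^(2q)\<close>: the square of \<open>|z|\<close> is replaced by \<open>y / (1 + d y)\<close>
  with \<open>y = |z|\<^sup>2 + d\<close>, which bounds it away from both 0 and infinity.\<close>

definition reg_power :: "real \<Rightarrow> real \<Rightarrow> real^'n \<Rightarrow> real" where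
  "reg_power q d z = (1 / (z \<bullet> z + d) + d) powr (- q)"

definition reg_power_grad :: "real \<Rightarrow> real \<Rightarrow> real^'n \<Rightarrow> real^'n" where
  "reg_power_grad q d z = (q * (1 / (z \<bullet> z + d) + d) powr (- q - 1) / (z \<bullet> z + d)\<^sup>2) *\<^sub>R (2 *\<^sub>R z)"

context
  fixes q d :: real
  assumes q: "q \<ge> 0" and d: "d > 0"
begin

lemma reg_base_pos: "z \<bullet> z + d > 0" "1 / (z \<bullet> z + d) + d > 0" "1 / (z \<bullet> z + d) + d \<noteq> 0" for z :: "real^'n"
proof -
  show 1: "z \<bullet> z + d > 0" using d inner_ge_zero[of z] by linarith
  then have "1 / (z \<bullet> z + d) > 0" by simp
  then show "1 / (z \<bullet> z + d) + d > 0" using d by linarith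
  then show "1 / (z \<bullet> z + d) + d \<noteq> 0" by simp
qed

lemma reg_power_C1: "has_C1_gradient (reg_power q d :: real^'n \<Rightarrow> real) (reg_power_grad q d)"
  unfolding has_C1_gradient_def
proof (intro conjI allI)
  fix z :: "real^'n"
  have 1: "GDERIV (\<lambda>z::real^'n. z \<bullet> z) z :> 2 *\<^sub>R z" using has_C1_gradient_inner_self by (auto simp: has_C1_gradient_def)
  have 2: "DERIV (\<lambda>t. (1 / (t + d) + d) powr (- q)) (z \<bullet> z) :> q * (1 / (z \<bullet> z + d) + d) powr (- q - 1) / (z \<bullet> z + d)\<^sup>2"
    using reg_base_pos[of z] by (auto intro!: derivative_eq_intros simp: power2_eq_square)
  show "GDERIV (reg_power q d) z :> reg_power_grad q d z"
    using GDERIV_DERIV_compose[OF 1 2] by (simp add: reg_power_def[abs_def] reg_power_grad_def)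
next
  have nz: "z \<bullet> z + d \<noteq> 0" "1 / (z \<bullet> z + d) + d \<noteq> 0" for z :: "real^'n"
    using reg_base_pos[of z] by auto
  show "continuous_on UNIV (reg_power_grad q d :: real^'n \<Rightarrow> _)"
    unfolding reg_power_grad_def[abs_def] by (intro continuous_intros ballI) (auto simp: nz)
qed

lemma reg_power_nonneg: "reg_power q d z \<ge> 0" by (simp add: reg_power_def)

lemma reg_power_le: "reg_power q d z \<le> d powr (- q)"
  unfolding reg_power_def using q d reg_base_pos(1)[of z] by (intro powr_mono2') auto

lemma reg_power_le_powr: "d \<le> 1 \<Longrightarrow> reg_power q d z \<le> ((norm z)\<^sup>2 + 1) powr q"
proof -
  assume d1: "d \<le> 1"
  have y: "z \<bullet> z + d > 0" by (rule reg_base_pos)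
  have "reg_power q d z \<le> (1 / (z \<bullet> z + d)) powr (- q)"
    unfolding reg_power_def using q d y by (intro powr_mono2') auto
  also have "\<dots> = (z \<bullet> z + d) powr q" using y by (simp add: powr_divide powr_minus_divide)
  also have "\<dots> \<le> ((norm z)\<^sup>2 + 1) powr q"
    using q y d1 by (intro powr_mono2) (auto simp: power2_norm_eq_inner)
  finally show ?thesis .
qed

text \<open>The logarithmic derivative along \<open>z\<close> is at most that of \<open>|z|^(2q)\<close>. So the regularisation costs
  nothing in the constant \<open>s - 2\<close> of the main estimate.\<close>

lemma reg_power_grad_le: "norm z * norm (reg_power_grad q d z) \<le> 2 * q * reg_power q d z"
proof -
  let ?y = "z \<bullet> z + d" and ?b = "1 / (z \<bullet> z + d) + d"
  have y: "?y > 0" and b: "?b > 0" by (rule reg_base_pos)+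
  have e: "?b powr (- q - 1) = reg_power q d z / ?b"
    unfolding reg_power_def using b by (simp add: powr_diff)
  have "norm z * norm (reg_power_grad q d z) = 2 * q * reg_power q d z * ((z \<bullet> z) / (?b * ?y\<^sup>2))"
    using q b y reg_power_nonneg[of z] unfolding reg_power_grad_def e
    by (simp add: abs_mult power2_norm_eq_inner[symmetric] power2_eq_square)
  also have "(z \<bullet> z) / (?b * ?y\<^sup>2) \<le> 1"
  proof -
    have "?b * ?y\<^sup>2 = ?y + d * ?y\<^sup>2" using y by (simp add: field_simps power2_eq_square)
    moreover have "d * ?y\<^sup>2 \<ge> 0" using d by simp
    ultimately have "z \<bullet> z \<le> ?b * ?y\<^sup>2" using d by linarith
    moreover have "?b * ?y\<^sup>2 > 0" using b y by simp
    ultimately show ?thesis by simp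
  qed
  then have "2 * q * reg_power q d z * ((z \<bullet> z) / (?b * ?y\<^sup>2)) \<le> 2 * q * reg_power q d z * 1"
    using q reg_power_nonneg[of z] by (intro mult_left_mono mult_nonneg_nonneg) auto
  finally show ?thesis by simp
qed

end

text \<open>For \<open>q = 0\<close> the regularised power is identically 1, in agreement with \<open>rpow x 0 = 1\<close>.\<close>

lemma reg_power_tendsto:
  fixes z :: "real^'n"
  assumes q: "q \<ge> 0" and d: "\<And>n. d n > 0" "d \<longlonglongrightarrow> 0"
  shows "(\<lambda>n::nat. reg_power q (d n) z) \<longlonglongrightarrow> rpow (norm z) (2 * q)"
proof (cases "q = 0")
  case True
  have "reg_power 0 (d n) z = 1" for n
    using reg_base_pos(2)[OF order_refl d(1)[of n], of z] by (simp add: reg_power_def)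
  then show ?thesis using True by (simp add: rpow_def)
next
  case False
  then have q0: "q > 0" using q by simp
  have eq: "reg_power q (d n) z = ((z \<bullet> z + d n) / (1 + d n * (z \<bullet> z + d n))) powr q" for n
  proof -
    have y: "z \<bullet> z + d n > 0" and b: "1 / (z \<bullet> z + d n) + d n > 0" by (rule reg_base_pos[OF q d(1)])+
    have "reg_power q (d n) z = (1 / (1 / (z \<bullet> z + d n) + d n)) powr q"
      unfolding reg_power_def using b by (simp add: powr_divide powr_minus_divide)
    also have "1 / (1 / (z \<bullet> z + d n) + d n) = (z \<bullet> z + d n) / (1 + d n * (z \<bullet> z + d n))"
      using y by (simp add: field_simps)
    finally show ?thesis .
  qed
  have "(\<lambda>n. ((z \<bullet> z + d n) / (1 + d n * (z \<bullet> z + d n))) powr q) \<longlonglongrightarrow> ((z \<bullet> z + 0) / (1 + 0 * (z \<bullet> z + 0))) powr q"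
  proof (rule tendsto_powr')
    show "(\<lambda>n. (z \<bullet> z + d n) / (1 + d n * (z \<bullet> z + d n))) \<longlonglongrightarrow> (z \<bullet> z + 0) / (1 + 0 * (z \<bullet> z + 0))"
      by (intro tendsto_intros d) auto
    have "0 \<le> (z \<bullet> z + d n) / (1 + d n * (z \<bullet> z + d n))" for n
      using d(1)[of n] by (intro divide_nonneg_nonneg add_nonneg_nonneg mult_nonneg_nonneg) auto
    then show "(z \<bullet> z + 0) / (1 + 0 * (z \<bullet> z + 0)) \<noteq> 0 \<or> 0 < q \<and> (\<forall>\<^sub>F n in sequentially. 0 \<le> (z \<bullet> z + d n) / (1 + d n * (z \<bullet> z + d n)))"
      using q0 by simp
  qed simp
  moreover have "(z \<bullet> z) powr q = rpow (norm z) (2 * q)"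
  proof -
    have "z \<bullet> z = norm z powr 2" by (simp add: power2_norm_eq_inner)
    then have "(z \<bullet> z) powr q = norm z powr (2 * q)" by (simp only: powr_powr)
    then show ?thesis using q0 by (simp add: rpow_def)
  qed
  ultimately show ?thesis by (simp add: eq)
qed

subsection \<open>Hoelder's inequality for three factors\<close>

text \<open>Young's inequality for \<open>ab\<close> and \<open>c\<close> with exponents \<open>p/2\<close> and \<open>r\<close>, and then for the two factors of
  \<open>(ab)^(p/2)\<close>.\<close>

lemma Young_three:
  fixes a b c p r :: real
  assumes abc: "a \<ge> 0" "b \<ge> 0" "c \<ge> 0" and pr: "p > 2" "r > 1" "2 / p + 1 / r = 1"
  shows "a * b * c \<le> a powr p / p + b powr p / p + c powr r / r"
proof -
  have "(a * b) * c \<le> (a * b) powr (p/2) / (p/2) + c powr r / r"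
    using abc pr by (intro Youngs_inequality) (auto simp: field_simps)
  also have "(a * b) powr (p/2) \<le> (a powr p + b powr p) / 2"
  proof -
    have "(a * b) powr (p/2) = a powr (p/2) * b powr (p/2)" using abc by (simp add: powr_mult)
    also have "\<dots> \<le> ((a powr (p/2))\<^sup>2 + (b powr (p/2))\<^sup>2) / 2"
      using zero_le_power2[of "a powr (p/2) - b powr (p/2)"] by (simp add: power2_diff)
    also have "\<dots> = (a powr p + b powr p) / 2" by (simp add: power2_eq_square powr_add[symmetric])
    finally show ?thesis .
  qed
  then have "(a * b) powr (p/2) / (p/2) \<le> (a powr p + b powr p) / 2 / (p/2)" using pr by (intro divide_right_mono) auto
  also have "(a powr p + b powr p) / 2 / (p/2) = a powr p / p + b powr p / p" by (simp add: add_divide_distrib)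
  finally show ?thesis by simp
qed

text \<open>The factors are divided by their norms plus \<open>e > 0\<close>, so that vanishing norms need no separate
  treatment; at the end \<open>e\<close> tends to 0.\<close>

lemma Hoelder_three:
  fixes f g h :: "'a \<Rightarrow> real"
  assumes f: "f \<in> Lp M p" and g: "g \<in> Lp M p" and h: "h \<in> borel_measurable M" "\<And>x. 0 \<le> h x" "integrable M (\<lambda>x. h x powr r)"
    and pr: "p > 2" "r > 1" "2 / p + 1 / r = 1"
  shows "integrable M (\<lambda>x. \<bar>f x\<bar> * \<bar>g x\<bar> * h x)"
    "(\<integral>x. \<bar>f x\<bar> * \<bar>g x\<bar> * h x \<partial>M) \<le> Lp_norm M p f * Lp_norm M p g * (\<integral>x. h x powr r \<partial>M) powr (1 / r)"
proof -
  have fi: "integrable M (\<lambda>x. \<bar>f x\<bar> powr p)" and gi: "integrable M (\<lambda>x. \<bar>g x\<bar> powr p)"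
    and [measurable]: "f \<in> borel_measurable M" "g \<in> borel_measurable M" "h \<in> borel_measurable M"
    using f g h by (auto simp: Lp_def)
  show int: "integrable M (\<lambda>x. \<bar>f x\<bar> * \<bar>g x\<bar> * h x)"
  proof (rule Bochner_Integration.integrable_bound)
    show "integrable M (\<lambda>x. \<bar>f x\<bar> powr p / p + \<bar>g x\<bar> powr p / p + h x powr r / r)" using fi gi h by simp
    show "AE x in M. norm (\<bar>f x\<bar> * \<bar>g x\<bar> * h x) \<le> norm (\<bar>f x\<bar> powr p / p + \<bar>g x\<bar> powr p / p + h x powr r / r)"
    proof (rule AE_I2)
      fix x
      have "\<bar>f x\<bar> * \<bar>g x\<bar> * h x \<le> \<bar>f x\<bar> powr p / p + \<bar>g x\<bar> powr p / p + h x powr r / r"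
        by (rule Young_three) (use h pr in auto)
      moreover have "0 \<le> \<bar>f x\<bar> * \<bar>g x\<bar> * h x" using h by simp
      ultimately show "norm (\<bar>f x\<bar> * \<bar>g x\<bar> * h x) \<le> norm (\<bar>f x\<bar> powr p / p + \<bar>g x\<bar> powr p / p + h x powr r / r)" by simp
    qed
  qed measurable
  let ?A = "Lp_norm M p f" and ?B = "Lp_norm M p g" and ?C = "(\<integral>x. h x powr r \<partial>M) powr (1 / r)"
  let ?I = "\<integral>x. \<bar>f x\<bar> * \<bar>g x\<bar> * h x \<partial>M"
  have le: "?I \<le> (?A + e) * (?B + e) * (?C + e)" if e: "e > 0" for e
  proof -
    define A B C where "A = ?A + e" and "B = ?B + e" and "C = ?C + e"
    have pos: "A > 0" "B > 0" "C > 0" using e Lp_norm_nonneg[of M p f] Lp_norm_nonneg[of M p g] by (auto simp: A_def B_def C_def add_nonneg_pos)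
    have 1: "(\<integral>x. \<bar>k x\<bar> powr p \<partial>M) / K powr p \<le> 1" if "K = Lp_norm M p k + e" for k K
    proof -
      have "(\<integral>x. \<bar>k x\<bar> powr p \<partial>M) = Lp_norm M p k powr p" using pr by (simp add: Lp_norm_powr)
      also have "\<dots> \<le> K powr p" using that e pr Lp_norm_nonneg[of M p k] by (intro powr_mono2) auto
      finally show ?thesis using that e Lp_norm_nonneg[of M p k] by (simp add: divide_le_eq)
    qed
    have 2: "(\<integral>x. h x powr r \<partial>M) / C powr r \<le> 1"
    proof -
      have "(\<integral>x. h x powr r \<partial>M) = ?C powr r" using pr by (simp add: powr_powr Bochner_Integration.integral_nonneg)
      also have "\<dots> \<le> C powr r" using e pr by (intro powr_mono2) (auto simp: C_def)
      finally show ?thesis using pos by (simp add: divide_le_eq)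
    qed
    have "?I / (A * B * C) = (\<integral>x. (\<bar>f x\<bar> / A) * (\<bar>g x\<bar> / B) * (h x / C) \<partial>M)"
      by (simp add: field_simps)
    also have "\<dots> \<le> (\<integral>x. (\<bar>f x\<bar> powr p / A powr p) / p + (\<bar>g x\<bar> powr p / B powr p) / p + (h x powr r / C powr r) / r \<partial>M)"
    proof (rule Bochner_Integration.integral_mono)
      have "integrable M (\<lambda>x. (\<bar>f x\<bar> * \<bar>g x\<bar> * h x) / (A * B * C))" using int by simp
      then show "integrable M (\<lambda>x. (\<bar>f x\<bar> / A) * (\<bar>g x\<bar> / B) * (h x / C))" by simp
      show "integrable M (\<lambda>x. (\<bar>f x\<bar> powr p / A powr p) / p + (\<bar>g x\<bar> powr p / B powr p) / p + (h x powr r / C powr r) / r)"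
        using fi gi h by simp
      fix x
      have "(\<bar>f x\<bar> / A) * (\<bar>g x\<bar> / B) * (h x / C) \<le> (\<bar>f x\<bar> / A) powr p / p + (\<bar>g x\<bar> / B) powr p / p + (h x / C) powr r / r"
        by (rule Young_three) (use h pr pos in auto)
      then show "(\<bar>f x\<bar> / A) * (\<bar>g x\<bar> / B) * (h x / C) \<le> (\<bar>f x\<bar> powr p / A powr p) / p + (\<bar>g x\<bar> powr p / B powr p) / p + (h x powr r / C powr r) / r"
        using pos h by (simp add: powr_divide)
    qed
    also have "\<dots> = (\<integral>x. \<bar>f x\<bar> powr p \<partial>M) / A powr p / p + (\<integral>x. \<bar>g x\<bar> powr p \<partial>M) / B powr p / p + (\<integral>x. h x powr r \<partial>M) / C powr r / r"
      using fi gi h by simp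
    also have "\<dots> \<le> 1 / p + 1 / p + 1 / r"
      using 1[OF A_def] 1[OF B_def] 2 pr by (intro add_mono divide_right_mono) auto
    also have "\<dots> = 1" using pr by simp
    finally show ?thesis using pos by (simp add: divide_le_eq A_def B_def C_def)
  qed
  have "((\<lambda>e. (?A + e) * (?B + e) * (?C + e)) \<longlongrightarrow> (?A + 0) * (?B + 0) * (?C + 0)) (at_right 0)"
    by (intro tendsto_intros)
  then have "?I \<le> (?A + 0) * (?B + 0) * (?C + 0)"
    by (rule tendsto_lowerbound) (use le in \<open>auto simp: eventually_at_filter\<close>)
  then show "?I \<le> ?A * ?B * ?C" by simp
qed

section \<open>The estimate\<close>

lemma wpd_shift: "open \<Omega> \<Longrightarrow> wpd \<Omega> i (\<lambda>x. u x - c) = wpd \<Omega> i u"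
  unfolding wpd_def using weak_partial_shift_iff by metis

lemma wgrad_shift: "open \<Omega> \<Longrightarrow> wgrad \<Omega> (\<lambda>x. u x - c) = wgrad \<Omega> u"
  by (rule ext) (simp add: wgrad_def wpd_shift)

lemma whess_shift: "open \<Omega> \<Longrightarrow> whess \<Omega> (\<lambda>x. u x - c) = whess \<Omega> u"
  by (rule ext) (simp add: whess_def wpd_shift)

lemma rpow_nonneg: "rpow x a \<ge> 0" by (simp add: rpow_def)

lemma rpow_powr: "rpow x a powr r = rpow x (a * r)" if "r \<noteq> 0"
  using that by (simp add: rpow_def powr_powr)

lemma integrable_shifted_power:
  fixes G :: "'a \<Rightarrow> 'b::euclidean_space"
  assumes fin: "finite_measure M" and G: "G \<in> Lp M p" and t: "0 \<le> t" "2 * t \<le> p"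
  shows "integrable M (\<lambda>x. ((norm (G x))\<^sup>2 + 1) powr t)"
proof -
  interpret finite_measure M by fact
  have [measurable]: "G \<in> borel_measurable M" using G by (simp add: Lp_def)
  have Gt: "integrable M (\<lambda>x. norm (G x) powr (2 * t))"
    using Lp_mono_exponent[OF fin G, of "2 * t"] t by (simp add: Lp_def)
  show ?thesis
  proof (rule Bochner_Integration.integrable_bound)
    show "integrable M (\<lambda>x. 2 powr t * (1 + norm (G x) powr (2 * t)))" using Gt by simp
    show "AE x in M. norm (((norm (G x))\<^sup>2 + 1) powr t) \<le> norm (2 powr t * (1 + norm (G x) powr (2 * t)))"
    proof (rule AE_I2)
      fix x
      let ?g = "norm (G x)"
      have "(?g\<^sup>2 + 1) powr t \<le> (2 * max 1 (?g\<^sup>2)) powr t" using t by (intro powr_mono2) (auto simp: max_def)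
      also have "\<dots> = 2 powr t * max 1 (?g\<^sup>2) powr t" by (rule powr_mult)
      also have "max 1 (?g\<^sup>2) powr t \<le> 1 + ?g powr (2 * t)"
      proof -
        have "(?g\<^sup>2) powr t = ?g powr (2 * t)"
        proof -
          have "?g\<^sup>2 = ?g powr 2" by simp
          then show ?thesis by (simp only: powr_powr)
        qed
        then show ?thesis by (auto simp: max_def)
      qed
      finally show "norm ((?g\<^sup>2 + 1) powr t) \<le> norm (2 powr t * (1 + ?g powr (2 * t)))" by simp
    qed
  qed measurable
qed

lemma Lp_matrix_trace:
  fixes D :: "'a \<Rightarrow> real^'n^'n"
  assumes D: "D \<in> Lp M p" and p: "p \<ge> 0"
  shows "(\<lambda>x. \<Sum>i\<in>UNIV. D x $ i $ i) \<in> Lp M p"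
proof -
  have m: "(\<lambda>x. D x $ i $ i) \<in> borel_measurable M" for i
    using D by (intro measurable_compose[of D M borel "\<lambda>A. A $ i $ i"] borel_measurable_continuous_onI continuous_intros)
      (simp add: Lp_def)
  have "(\<lambda>x. \<Sum>i\<in>I. D x $ i $ i) \<in> Lp M p" if "finite I" for I
    using that
  proof (induction I rule: finite_induct)
    case empty
    show ?case by (simp add: Lp_def)
  next
    case (insert i I)
    have "(\<lambda>x. - D x $ i $ i) \<in> Lp M p"
    proof (rule Lp_dominated[OF D p])
      show "(\<lambda>x. - D x $ i $ i) \<in> borel_measurable M" using m by (intro borel_measurable_uminus)
      show "norm (- D x $ i $ i) \<le> norm (D x)" for x
        using component_le_norm_cart[of "D x $ i" i] Finite_Cartesian_Product.norm_nth_le[of "D x" i] by simp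
    qed
    from Lp_diff[OF insert.IH this p] insert.hyps show ?case by (simp add: add.commute)
  qed
  then show ?thesis by simp
qed

text \<open>The integration by parts with weight 1: the gradient of \<open>u\<close> satisfies the weak form of the
  Neumann problem with right-hand side \<open>-\<Delta>u\<close>.\<close>

lemma (in neumann_field) green_identity:
  assumes \<phi>: "\<phi> \<in> sobolev 1 2 \<Omega>"
  shows "(\<integral>x. G x \<bullet> wgrad \<Omega> \<phi> x \<partial>lebesgue_on \<Omega>) = - (\<integral>x. \<phi> x * (\<Sum>i\<in>UNIV. D x $ i $ i) \<partial>lebesgue_on \<Omega>)"
proof -
  have fin: "finite_measure (lebesgue_on \<Omega>)" using \<Omega> by (intro finite_measure_lebesgue_on_bounded) auto
  have \<phi>': "\<phi> \<in> sobolev (Suc 0) 2 \<Omega>" using \<phi> by simp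
  note s = sobolev_1_wpd[OF \<Omega>(1) \<phi>']
  interpret neumann_pairing \<Omega> G D \<Psi> D\<Psi> T \<phi> "wgrad \<Omega> \<phi>" "\<lambda>_. 1" "\<lambda>_. 0" 1
  proof
    show "square_integrable (lebesgue_on \<Omega>) \<phi>" by (rule Lp_square_integrable[OF fin s(2)]) simp
    show "square_integrable (lebesgue_on \<Omega>) (\<lambda>x. wgrad \<Omega> \<phi> x $ i)" for i
      using Lp_square_integrable[OF fin s(4)] by (simp add: wgrad_def)
    show "weak_partial \<Omega> i \<phi> (\<lambda>x. wgrad \<Omega> \<phi> x $ i)" for i using s(1) by (simp add: wgrad_def)
  qed (auto intro: has_C1_gradient_const)
  have i1: "integrable (lebesgue_on \<Omega>) (\<lambda>x. \<phi> x * (\<Sum>i\<in>UNIV. D x $ i $ i))"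
    unfolding sum_distrib_left
    by (intro Bochner_Integration.integrable_sum integrable_mult_square_integrable \<phi>(1)
        square_integrable_component square_integrable_row D)
  have i2: "integrable (lebesgue_on \<Omega>) (\<lambda>x. wgrad \<Omega> \<phi> x \<bullet> G x)"
    using Bochner_Integration.integrable_diff[OF flux_integrable(2) i1] by (simp add: flux_div_def)
  have "(\<integral>x. \<phi> x * (\<Sum>i\<in>UNIV. D x $ i $ i) + wgrad \<Omega> \<phi> x \<bullet> G x \<partial>lebesgue_on \<Omega>) = 0"
    using flux_div_integral_zero by (simp add: flux_div_def)
  then show ?thesis using i1 i2 by (simp add: inner_commute)
qed

text \<open>The integration by parts with \<open>\<phi> = v\<close> and a regularised power as weight. In the divergence of the
  field, the derivative of the weight is contracted with \<open>D\<close> and the field, hence at most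
  \<open>|G| |\<mu>'(G)| |D|\<close>.\<close>

lemma (in neumann_field) weighted_gradient_bound:
  assumes v: "v \<in> sobolev 1 2 \<Omega>" and gv: "wgrad \<Omega> v = G" and q: "q \<ge> 0" and d: "d > 0"
  shows "(\<integral>x. reg_power q d (G x) * (norm (G x))\<^sup>2 \<partial>lebesgue_on \<Omega>)
    \<le> 2 * q * (\<integral>x. \<bar>v x\<bar> * norm (D x) * reg_power q d (G x) \<partial>lebesgue_on \<Omega>)
      + (\<integral>x. \<bar>v x\<bar> * \<bar>\<Sum>i\<in>UNIV. D x $ i $ i\<bar> * reg_power q d (G x) \<partial>lebesgue_on \<Omega>)"
proof -
  let ?M = "lebesgue_on \<Omega>"
  let ?m = "reg_power q d :: real^'n \<Rightarrow> real" and ?m' = "reg_power_grad q d :: real^'n \<Rightarrow> real^'n"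
  define L where "L x = (\<Sum>i\<in>UNIV. D x $ i $ i)" for x
  have fin: "finite_measure ?M" using \<Omega> by (intro finite_measure_lebesgue_on_bounded) auto
  have v': "v \<in> sobolev (Suc 0) 2 \<Omega>" using v by simp
  note s = sobolev_1_wpd[OF \<Omega>(1) v']
  have v2: "square_integrable ?M v" by (rule Lp_square_integrable[OF fin s(2)]) simp
  have m0: "?m z \<ge> 0" for z by (rule reg_power_nonneg[OF q d])
  define B where "B = (1 + 2 * q) * d powr (- q)"
  have mB: "\<bar>?m z\<bar> \<le> B" "norm z * norm (?m' z) \<le> B" for z
  proof -
    have le: "?m z \<le> d powr (- q)" by (rule reg_power_le[OF q d])
    also have "\<dots> \<le> B" using q by (simp add: B_def distrib_right)
    finally show "\<bar>?m z\<bar> \<le> B" using m0 by simp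
    have "norm z * norm (?m' z) \<le> 2 * q * ?m z" by (rule reg_power_grad_le[OF q d])
    also have "\<dots> \<le> 2 * q * d powr (- q)" using le q by (intro mult_left_mono) auto
    also have "\<dots> \<le> B" by (simp add: B_def distrib_right)
    finally show "norm z * norm (?m' z) \<le> B" .
  qed
  interpret neumann_pairing \<Omega> G D \<Psi> D\<Psi> T v G ?m ?m' B
  proof
    show "square_integrable ?M v" by (rule v2)
    show "square_integrable ?M (\<lambda>x. G x $ i)" for i by (rule square_integrable_component[OF G])
    show "weak_partial \<Omega> i v (\<lambda>x. G x $ i)" for i using s(1) unfolding gv[symmetric] by (simp add: wgrad_def)
    show "has_C1_gradient ?m ?m'" by (rule reg_power_C1[OF q d])
  qed (rule mB)+
  have mm: "(\<lambda>x. ?m (G x)) \<in> borel_measurable ?M"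
    using G by (intro measurable_compose[OF _ borel_measurable_continuous_onI[OF \<mu>_continuous(1)]]) (simp add: square_integrable_def)
  have L2: "square_integrable ?M L"
  proof -
    have "square_integrable ?M (\<lambda>x. \<Sum>i\<in>I. D x $ i $ i)" if "finite I" for I
      using that
    proof (induction I rule: finite_induct)
      case (insert i I)
      then show ?case using square_integrable_add[OF square_integrable_component[OF square_integrable_row[OF D]]] by simp
    qed (simp add: square_integrable_def)
    then show ?thesis unfolding L_def by simp
  qed
  have n2: "square_integrable ?M (\<lambda>x. norm (f x))" if "square_integrable ?M f" for f :: "real^'n \<Rightarrow> 'z::euclidean_space"
    using that by (auto simp: square_integrable_def intro: borel_measurable_norm)
  have iD: "integrable ?M (\<lambda>x. \<bar>v x\<bar> * norm (D x) * ?m (G x))"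
    using integrable_mult_square_integrable[OF square_integrable_mult_bounded[OF n2[OF v2] mm mB(1)] n2[OF D]]
    by (simp add: mult_ac)
  have iL: "integrable ?M (\<lambda>x. \<bar>v x\<bar> * \<bar>L x\<bar> * ?m (G x))"
    using integrable_mult_square_integrable[OF square_integrable_mult_bounded[OF n2[OF v2] mm mB(1)] n2[OF L2]]
    by (simp add: mult_ac)
  have iG: "integrable ?M (\<lambda>x. ?m (G x) * (norm (G x))\<^sup>2)"
    using integrable_mult_square_integrable[OF square_integrable_mult_bounded[OF n2[OF G] mm mB(1)] n2[OF G]]
    by (simp add: mult_ac power2_eq_square)
  define R where "R x = v x * (?m (G x) * L x + (\<Sum>i\<in>UNIV. \<Sum>j\<in>UNIV. G x $ i * ?m' (G x) $ j * D x $ j $ i))" for x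
  have fd: "flux_div x = R x + ?m (G x) * (norm (G x))\<^sup>2" for x
    unfolding flux_div_def R_def L_def power2_norm_eq_inner by (simp add: inner_commute)
  have iR: "integrable ?M R"
    using Bochner_Integration.integrable_diff[OF flux_integrable(2) iG] by (simp add: fd)
  have "(\<integral>x. ?m (G x) * (norm (G x))\<^sup>2 \<partial>?M) = - (\<integral>x. R x \<partial>?M)"
    using flux_div_integral_zero iR iG by (simp add: fd)
  also have "\<dots> \<le> (\<integral>x. \<bar>R x\<bar> \<partial>?M)" using integral_abs_bound[of ?M R] by linarith
  also have "\<dots> \<le> (\<integral>x. 2 * q * (\<bar>v x\<bar> * norm (D x) * ?m (G x)) + \<bar>v x\<bar> * \<bar>L x\<bar> * ?m (G x) \<partial>?M)"
  proof (rule Bochner_Integration.integral_mono)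
    show "integrable ?M (\<lambda>x. \<bar>R x\<bar>)" using iR by (rule integrable_abs)
    show "integrable ?M (\<lambda>x. 2 * q * (\<bar>v x\<bar> * norm (D x) * ?m (G x)) + \<bar>v x\<bar> * \<bar>L x\<bar> * ?m (G x))"
      using iD iL by simp
    fix x
    let ?S = "\<Sum>i\<in>UNIV. \<Sum>j\<in>UNIV. G x $ i * ?m' (G x) $ j * D x $ j $ i"
    have "?S = (\<Sum>j\<in>UNIV. ?m' (G x) $ j * (G x \<bullet> D x $ j))"
      by (subst sum.swap) (simp add: inner_vec_def sum_distrib_left mult_ac)
    also have "\<bar>\<dots>\<bar> \<le> norm (?m' (G x)) * (norm (G x) * norm (D x))" by (rule abs_sum_inner_le)
    also have "\<dots> = (norm (G x) * norm (?m' (G x))) * norm (D x)" by simp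
    also have "\<dots> \<le> (2 * q * ?m (G x)) * norm (D x)"
      using reg_power_grad_le[OF q d, of "G x"] by (intro mult_right_mono) auto
    finally have S: "\<bar>?S\<bar> \<le> 2 * q * ?m (G x) * norm (D x)" .
    have "\<bar>R x\<bar> \<le> \<bar>v x\<bar> * (\<bar>?m (G x) * L x\<bar> + \<bar>?S\<bar>)"
      unfolding R_def abs_mult[of "v x"] by (intro mult_left_mono abs_triangle_ineq) simp
    also have "\<dots> \<le> \<bar>v x\<bar> * (\<bar>?m (G x) * L x\<bar> + 2 * q * ?m (G x) * norm (D x))"
      using S by (intro mult_left_mono add_left_mono) auto
    also have "\<dots> = 2 * q * (\<bar>v x\<bar> * norm (D x) * ?m (G x)) + \<bar>v x\<bar> * \<bar>L x\<bar> * ?m (G x)"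
      using m0[of "G x"] by (simp add: abs_mult algebra_simps)
    finally show "\<bar>R x\<bar> \<le> 2 * q * (\<bar>v x\<bar> * norm (D x) * ?m (G x)) + \<bar>v x\<bar> * \<bar>L x\<bar> * ?m (G x)" .
  qed
  finally show ?thesis using iD iL by (simp add: L_def)
qed

text \<open>Hoelder's inequality is applied while the weight is still regularised, so that only two limits
  remain, both by dominated convergence: the integrand on the left is dominated by a multiple of
  \<open>1 + |G|^s\<close> and the one on the right by a multiple of \<open>1 + |G|^((s-2)r)\<close>.\<close>

lemma (in neumann_field) gradient_power_bound:
  assumes v: "v \<in> sobolev 1 2 \<Omega>" "wgrad \<Omega> v = G"
    and p: "p > 2" "r > 1" "2 / p + 1 / r = 1"
    and Lp: "v \<in> Lp (lebesgue_on \<Omega>) p" "G \<in> Lp (lebesgue_on \<Omega>) p" "D \<in> Lp (lebesgue_on \<Omega>) p"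
    and s: "2 \<le> s" "s \<le> p" "(s - 2) * r \<le> p"
  shows "(\<integral>x. rpow (norm (G x)) s \<partial>lebesgue_on \<Omega>)
    \<le> ((s - 2) * Lp_norm (lebesgue_on \<Omega>) p D + Lp_norm (lebesgue_on \<Omega>) p (\<lambda>x. \<Sum>i\<in>UNIV. D x $ i $ i))
      * Lp_norm (lebesgue_on \<Omega>) p v * (\<integral>x. rpow (norm (G x)) ((s - 2) * r) \<partial>lebesgue_on \<Omega>) powr (1 / r)"
proof -
  let ?M = "lebesgue_on \<Omega>"
  have fin: "finite_measure ?M" using \<Omega> by (intro finite_measure_lebesgue_on_bounded) auto
  define q where "q = (s - 2) / 2"
  have q: "q \<ge> 0" "2 * q = s - 2" using s by (auto simp: q_def)
  define L where "L x = (\<Sum>i\<in>UNIV. D x $ i $ i)" for x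
  define d where "d n = 1 / real (Suc n)" for n
  have d: "d n > 0" "d n \<le> 1" for n by (auto simp: d_def)
  have d0: "d \<longlonglongrightarrow> 0" using LIMSEQ_inverse_real_of_nat by (simp add: d_def[abs_def] divide_inverse)
  let ?m = "\<lambda>n. reg_power q (d n) :: real^'n \<Rightarrow> real"
  have Gm: "G \<in> borel_measurable ?M" using G by (simp add: square_integrable_def)
  have mm: "(\<lambda>x. ?m n (G x)) \<in> borel_measurable ?M" for n
    by (rule measurable_compose[OF Gm borel_measurable_continuous_onI[OF has_C1_gradient_continuous[OF reg_power_C1[OF q(1) d(1)]]]])
  have m0: "?m n z \<ge> 0" for n z by (rule reg_power_nonneg[OF q(1) d(1)])
  have mle: "?m n z \<le> ((norm z)\<^sup>2 + 1) powr q" for n z by (rule reg_power_le_powr[OF q(1) d])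
  have mlim: "(\<lambda>n. ?m n z) \<longlonglongrightarrow> rpow (norm z) (s - 2)" for z
    using reg_power_tendsto[OF q(1) d(1) d0, of z] by (simp add: q(2))
  have Ii: "integrable ?M (\<lambda>x. ((norm (G x))\<^sup>2 + 1) powr (q * r))"
  proof (rule integrable_shifted_power[OF fin Lp(2)])
    show "0 \<le> q * r" using q(1) p by simp
    have "2 * (q * r) = (s - 2) * r" using q(2) by (simp only: mult.assoc[symmetric])
    then show "2 * (q * r) \<le> p" using s(3) by (simp only:)
  qed
  have le_r: "?m n z powr r \<le> ((norm z)\<^sup>2 + 1) powr (q * r)" for n z
    using powr_mono2[OF _ m0 mle, of r n z] p by (simp add: powr_powr)
  have mri: "integrable ?M (\<lambda>x. ?m n (G x) powr r)" for n
  proof (rule Bochner_Integration.integrable_bound[OF Ii])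
    show "(\<lambda>x. ?m n (G x) powr r) \<in> borel_measurable ?M" using mm[of n] by measurable
    show "AE x in ?M. norm (?m n (G x) powr r) \<le> norm (((norm (G x))\<^sup>2 + 1) powr (q * r))"
      using le_r by (auto intro!: AE_I2)
  qed
  define J where "J n = (\<integral>x. ?m n (G x) powr r \<partial>?M)" for n
  define A where "A = (s - 2) * Lp_norm ?M p D + Lp_norm ?M p L"
  have LLp: "L \<in> Lp ?M p" unfolding L_def using p by (intro Lp_matrix_trace[OF Lp(3)]) simp
  have nD: "(\<lambda>x. norm (D x)) \<in> Lp ?M p" "Lp_norm ?M p (\<lambda>x. norm (D x)) = Lp_norm ?M p D"
    using Lp(3) by (auto simp: Lp_def Lp_norm_def intro: borel_measurable_norm)
  have bound: "(\<integral>x. ?m n (G x) * (norm (G x))\<^sup>2 \<partial>?M) \<le> A * Lp_norm ?M p v * J n powr (1 / r)" for n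
  proof -
    have "(\<integral>x. ?m n (G x) * (norm (G x))\<^sup>2 \<partial>?M)
      \<le> 2 * q * (\<integral>x. \<bar>v x\<bar> * norm (D x) * ?m n (G x) \<partial>?M) + (\<integral>x. \<bar>v x\<bar> * \<bar>L x\<bar> * ?m n (G x) \<partial>?M)"
      unfolding L_def by (rule weighted_gradient_bound[OF v q(1) d(1)])
    also have "\<dots> \<le> (s - 2) * (Lp_norm ?M p v * Lp_norm ?M p D * J n powr (1 / r)) + Lp_norm ?M p v * Lp_norm ?M p L * J n powr (1 / r)"
    proof (intro add_mono)
      have "(\<integral>x. \<bar>v x\<bar> * norm (D x) * ?m n (G x) \<partial>?M) \<le> Lp_norm ?M p v * Lp_norm ?M p D * J n powr (1 / r)"
        using Hoelder_three(2)[OF Lp(1) nD(1) mm m0 mri p] by (simp add: J_def nD(2))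
      then show "2 * q * (\<integral>x. \<bar>v x\<bar> * norm (D x) * ?m n (G x) \<partial>?M) \<le> (s - 2) * (Lp_norm ?M p v * Lp_norm ?M p D * J n powr (1 / r))"
        unfolding q(2) using s by (intro mult_left_mono) auto
      show "(\<integral>x. \<bar>v x\<bar> * \<bar>L x\<bar> * ?m n (G x) \<partial>?M) \<le> Lp_norm ?M p v * Lp_norm ?M p L * J n powr (1 / r)"
        using Hoelder_three(2)[OF Lp(1) LLp mm m0 mri p] by (simp add: J_def)
    qed
    also have "\<dots> = A * Lp_norm ?M p v * J n powr (1 / r)" by (simp add: A_def algebra_simps)
    finally show ?thesis .
  qed
  have Jlim: "J \<longlonglongrightarrow> (\<integral>x. rpow (norm (G x)) ((s - 2) * r) \<partial>?M)"
    unfolding J_def[abs_def]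
  proof (rule integral_dominated_convergence[OF _ _ Ii])
    show "(\<lambda>x. ?m n (G x) powr r) \<in> borel_measurable ?M" for n using mm[of n] by measurable
    show "(\<lambda>x. rpow (norm (G x)) ((s - 2) * r)) \<in> borel_measurable ?M" unfolding rpow_def using Gm by measurable
    show "AE x in ?M. norm (?m n (G x) powr r) \<le> ((norm (G x))\<^sup>2 + 1) powr (q * r)" for n using le_r by (auto intro!: AE_I2)
    show "AE x in ?M. (\<lambda>n. ?m n (G x) powr r) \<longlonglongrightarrow> rpow (norm (G x)) ((s - 2) * r)"
    proof (rule AE_I2)
      fix x
      have "(\<lambda>n. ?m n (G x) powr r) \<longlonglongrightarrow> rpow (norm (G x)) (s - 2) powr r"
        by (rule tendsto_powr'[OF mlim tendsto_const]) (use p m0 in auto)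
      then show "(\<lambda>n. ?m n (G x) powr r) \<longlonglongrightarrow> rpow (norm (G x)) ((s - 2) * r)" using p by (simp add: rpow_powr)
    qed
  qed
  have Llim: "(\<lambda>n. \<integral>x. ?m n (G x) * (norm (G x))\<^sup>2 \<partial>?M) \<longlonglongrightarrow> (\<integral>x. rpow (norm (G x)) s \<partial>?M)"
  proof (rule integral_dominated_convergence)
    show "integrable ?M (\<lambda>x. ((norm (G x))\<^sup>2 + 1) powr (q + 1))"
      by (rule integrable_shifted_power[OF fin Lp(2)]) (use q s in auto)
    show "(\<lambda>x. ?m n (G x) * (norm (G x))\<^sup>2) \<in> borel_measurable ?M" for n using mm[of n] Gm by measurable
    show "(\<lambda>x. rpow (norm (G x)) s) \<in> borel_measurable ?M" unfolding rpow_def using Gm by measurable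
    show "AE x in ?M. norm (?m n (G x) * (norm (G x))\<^sup>2) \<le> ((norm (G x))\<^sup>2 + 1) powr (q + 1)" for n
    proof (rule AE_I2)
      fix x
      let ?y = "(norm (G x))\<^sup>2 + 1"
      have "?m n (G x) * (norm (G x))\<^sup>2 \<le> ?y powr q * ?y" by (intro mult_mono mle) auto
      also have "\<dots> = ?y powr (q + 1)" by (simp add: powr_add add_nonneg_pos)
      finally show "norm (?m n (G x) * (norm (G x))\<^sup>2) \<le> ?y powr (q + 1)" using m0[of n "G x"] by (simp add: abs_mult)
    qed
    show "AE x in ?M. (\<lambda>n. ?m n (G x) * (norm (G x))\<^sup>2) \<longlonglongrightarrow> rpow (norm (G x)) s"
    proof (rule AE_I2)
      fix x
      have "rpow (norm (G x)) (s - 2) * (norm (G x))\<^sup>2 = rpow (norm (G x)) s"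
      proof (cases "G x = 0")
        case False
        then have "norm (G x) powr s = norm (G x) powr (s - 2) * (norm (G x))\<^sup>2" by (simp add: powr_diff)
        then show ?thesis using s False by (simp add: rpow_def)
      qed (use s in \<open>simp add: rpow_def\<close>)
      then show "(\<lambda>n. ?m n (G x) * (norm (G x))\<^sup>2) \<longlonglongrightarrow> rpow (norm (G x)) s"
        using tendsto_mult[OF mlim[of "G x"] tendsto_const[of "(norm (G x))\<^sup>2"]] by simp
    qed
  qed
  have "(\<lambda>n. J n powr (1 / r)) \<longlonglongrightarrow> (\<integral>x. rpow (norm (G x)) ((s - 2) * r) \<partial>?M) powr (1 / r)"
    by (rule tendsto_powr'[OF Jlim tendsto_const]) (use p in \<open>auto simp: J_def intro!: always_eventually Bochner_Integration.integral_nonneg\<close>)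
  then have "(\<lambda>n. A * Lp_norm ?M p v * J n powr (1 / r)) \<longlonglongrightarrow> A * Lp_norm ?M p v * (\<integral>x. rpow (norm (G x)) ((s - 2) * r) \<partial>?M) powr (1 / r)"
    by (rule tendsto_mult_left)
  from LIMSEQ_le[OF Llim this] bound show ?thesis unfolding A_def L_def[abs_def] by blast
qed

lemma Lp_shift:
  fixes u :: "real^'n \<Rightarrow> real"
  assumes \<Omega>: "open \<Omega>" "bounded \<Omega>" and u: "u \<in> Lp (lebesgue_on \<Omega>) q" and q: "q \<ge> 0"
  shows "(\<lambda>x. u x - c) \<in> Lp (lebesgue_on \<Omega>) q"
  by (rule Lp_diff[OF u continuous_in_Lp[OF \<Omega> continuous_on_const q] q])

lemma sobolev_1_shift:
  assumes \<Omega>: "open \<Omega>" "bounded \<Omega>" and u: "u \<in> sobolev 1 q \<Omega>" and q: "q \<ge> 0"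
  shows "(\<lambda>x. u x - c) \<in> sobolev 1 q \<Omega>"
proof -
  have "(\<lambda>x. u x - c) \<in> Lp (lebesgue_on \<Omega>) q"
    using u q by (intro Lp_shift \<Omega>) auto
  then show ?thesis using u by (simp add: weak_partial_shift_iff[OF \<Omega>(1)])
qed

lemma average_shift_eq_0:
  assumes \<Omega>: "open \<Omega>" "bounded \<Omega>" "\<Omega> \<noteq> {}" and u: "integrable (lebesgue_on \<Omega>) u"
  shows "average \<Omega> (\<lambda>x. u x - average \<Omega> u) = 0"
proof -
  have lm: "\<Omega> \<in> lmeasurable" using \<Omega> by (intro bounded_set_imp_lmeasurable) auto
  have pos: "measure lebesgue \<Omega> \<noteq> 0"
    using \<Omega>(1,3) lm open_not_negligible negligible_iff_measure by blast
  interpret finite_measure "lebesgue_on \<Omega>" using \<Omega> by (intro finite_measure_lebesgue_on_bounded) auto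
  have "measure (lebesgue_on \<Omega>) (space (lebesgue_on \<Omega>)) = measure lebesgue \<Omega>"
    using \<Omega>(1) by (simp add: measure_restrict_space space_restrict_space)
  then have "(\<integral>x. u x - average \<Omega> u \<partial>lebesgue_on \<Omega>) = (\<integral>x. u x \<partial>lebesgue_on \<Omega>) - average \<Omega> u * measure lebesgue \<Omega>"
    using u by simp
  also have "\<dots> = 0" using pos by (simp add: average_def)
  finally show ?thesis by (simp add: average_def[of \<Omega> "\<lambda>x. u x - average \<Omega> u"])
qed

lemma rpow_mult: "x \<ge> 0 \<Longrightarrow> y \<ge> 0 \<Longrightarrow> rpow (x * y) b = rpow x b * rpow y b"
  by (simp add: rpow_def powr_mult)

text \<open>The hypothesis concerns solutions with mean value 0, so it is applied to \<open>u\<close> minus its mean value,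
  which has the same derivatives.\<close>

lemma calderon_zygmund_hessian_bound:
  fixes \<Omega> :: "(real^'n) set"
  assumes dom: "open \<Omega>" "bounded \<Omega>" "\<Omega> \<noteq> {}" and F: "neumann_field \<Omega> (wgrad \<Omega> u) (whess \<Omega> u) \<Psi> D\<Psi> T"
    and p: "p > 2" and cz: "calderon_zygmund_constant \<Omega> p c"
    and u: "u \<in> sobolev 1 2 \<Omega>" and whess_Lp: "whess \<Omega> u \<in> Lp (lebesgue_on \<Omega>) p"
  shows "Lp_norm (lebesgue_on \<Omega>) p (whess \<Omega> u) \<le> c * Lp_norm (lebesgue_on \<Omega>) p (wlap \<Omega> u)"
proof -
  let ?M = "lebesgue_on \<Omega>"
  interpret neumann_field \<Omega> "wgrad \<Omega> u" "whess \<Omega> u" \<Psi> D\<Psi> T by (rule F)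
  have fin: "finite_measure ?M" using \<Omega> by (intro finite_measure_lebesgue_on_bounded) auto
  define v where "v x = u x - average \<Omega> u" for x
  have v1: "v \<in> sobolev 1 2 \<Omega>" unfolding v_def using u by (intro sobolev_1_shift \<Omega>) auto
  have wl: "wlap \<Omega> u = (\<lambda>x. \<Sum>i\<in>UNIV. whess \<Omega> u x $ i $ i)" by (rule ext) (simp add: wlap_def whess_def)
  have LL: "wlap \<Omega> u \<in> Lp ?M p" unfolding wl using p by (intro Lp_matrix_trace[OF whess_Lp]) simp
  have "u \<in> Lp ?M 2" using u by simp
  then have "u \<in> Lp ?M 1" by (rule Lp_mono_exponent[OF fin]) auto
  then have um: "u \<in> borel_measurable ?M" and "integrable ?M (\<lambda>x. norm (u x))" by (auto simp: Lp_def)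
  then have "integrable ?M u" using integrable_norm_cancel by blast
  then have av: "average \<Omega> v = 0" unfolding v_def by (rule average_shift_eq_0[OF dom])
  have "weak_neumann_solution \<Omega> (\<lambda>x. - wlap \<Omega> u x) v"
    unfolding weak_neumann_solution_def
  proof (intro conjI ballI v1)
    fix \<phi> assume "\<phi> \<in> sobolev 1 2 \<Omega>"
    from green_identity[OF this]
    show "(\<integral>x. wgrad \<Omega> v x \<bullet> wgrad \<Omega> \<phi> x \<partial>?M) = (\<integral>x. - wlap \<Omega> u x * \<phi> x \<partial>?M)"
      unfolding v_def wgrad_shift[OF \<Omega>(1)] wl by (simp add: mult.commute)
  qed
  moreover have "(\<lambda>x. - wlap \<Omega> u x) \<in> Lp ?M p" using LL by (simp add: Lp_def)
  ultimately have "W2_norm \<Omega> p v \<le> c * Lp_norm ?M p (\<lambda>x. - wlap \<Omega> u x)"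
    using cz av unfolding calderon_zygmund_constant_def by blast
  moreover have "Lp_norm ?M p (whess \<Omega> u) \<le> W2_norm \<Omega> p v"
    unfolding W2_norm_def v_def whess_shift[OF \<Omega>(1)] by (simp add: Lp_norm_nonneg)
  ultimately show ?thesis by (simp add: Lp_norm_def)
qed

theorem proposition3p1:
  fixes \<Omega> :: "(real^'n) set"
    and N \<alpha> \<gamma> two_star c c_\<Omega> :: real
    and a b :: "nat \<Rightarrow> real"
    and k :: nat and u :: "real^'n \<Rightarrow> real"
  defines "N \<equiv> real CARD('n)"
    and "two_star \<equiv> 2 * N / (N - 2)"
    and "a \<equiv> \<lambda>k. 2 * N / (N - 2) - 2 * (N / (N - 2) - \<alpha>) * (N / 2) ^ k"
    and "b \<equiv> \<lambda>k. (1 - (2 / N) ^ k) / (1 - 2 / N)"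
  assumes "CARD('n) > 2"
    and "open \<Omega>" "connected \<Omega>" "\<Omega> \<noteq> {}" "bounded \<Omega>"
    and "0 < \<gamma>" "\<gamma> < 1" "C2_holder_boundary \<gamma> \<Omega>"
    and "1 < \<alpha>" "\<alpha> < N / (N - 2)"
    and "calderon_zygmund_constant \<Omega> two_star c"
    and "sobolev_constant \<Omega> two_star c_\<Omega>"
    and "a k \<ge> 0"
    and "u \<in> sobolev 2 two_star \<Omega>" "neumann_condition \<Omega> two_star u"
  shows "(\<integral>x. rpow (norm (wgrad \<Omega> u x)) (2 * \<alpha>) \<partial>lebesgue_on \<Omega>)
    \<le> rpow (((2 * \<alpha> - 2) * c + 1) * c_\<Omega>) (b k)
      * rpow (Lp_norm (lebesgue_on \<Omega>) two_star (wlap \<Omega> u)) (b k)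
      * rpow (Lp_norm (lebesgue_on \<Omega>) 2 (wgrad \<Omega> u)) (b k)
      * rpow (\<integral>x. rpow (norm (wgrad \<Omega> u x)) (a k) \<partial>lebesgue_on \<Omega>) ((2 / N) ^ k)"
proof -
  let ?M = "lebesgue_on \<Omega>"
  have N: "N > 2" using assms(5) by (simp add: N_def)
  define r where "r = N / 2"
  define \<rho> where "\<rho> = 2 / N"
  have r: "r > 1" "1 / r = \<rho>" and \<rho>: "0 < \<rho>" "\<rho> < 1" using N by (auto simp: r_def \<rho>_def)
  have p: "two_star > 2" "2 / two_star + 1 / r = 1" using N by (auto simp: two_star_def r_def field_simps)
  have fin: "finite_measure ?M" using assms by (intro finite_measure_lebesgue_on_bounded) auto
  have G1: "wpd \<Omega> i u \<in> sobolev 1 two_star \<Omega>" for i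
    using \<open>neumann_condition \<Omega> two_star u\<close> by (auto simp: neumann_condition_def has_trace_def)
  have u1: "u \<in> sobolev 1 two_star \<Omega>" using \<open>u \<in> sobolev 2 two_star \<Omega>\<close> by (auto simp: numeral_2_eq_2)
  have u12: "u \<in> sobolev 1 2 \<Omega>"
    using p by (intro sobolev_1_mono_exponent[OF \<open>open \<Omega>\<close> \<open>bounded \<Omega>\<close> u1]) auto
  have GL: "wgrad \<Omega> u \<in> Lp ?M two_star"
    using p sobolev_1_wpd(2)[OF \<open>open \<Omega>\<close>, of _ 0] G1 by (intro Lp_vec) (auto simp: wgrad_def)
  have DL: "whess \<Omega> u \<in> Lp ?M two_star"
    using p sobolev_1_wpd(4)[OF \<open>open \<Omega>\<close>, of _ 0] G1 by (intro Lp_vec) (auto simp: whess_def)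
  define v where "v x = u x - average \<Omega> u" for x
  have v1: "v \<in> sobolev 1 2 \<Omega>" unfolding v_def using u12 assms by (intro sobolev_1_shift) auto
  have vL: "v \<in> Lp ?M two_star"
    unfolding v_def using u1 p by (intro Lp_shift[OF \<open>open \<Omega>\<close> \<open>bounded \<Omega>\<close>]) auto
  have gv: "wgrad \<Omega> v = wgrad \<Omega> u" unfolding v_def by (rule wgrad_shift[OF \<open>open \<Omega>\<close>])
  obtain \<Psi> D\<Psi> T where F: "neumann_field \<Omega> (wgrad \<Omega> u) (whess \<Omega> u) \<Psi> D\<Psi> T"
    by (rule neumann_field_exists[of \<Omega> \<gamma> two_star u]) (use assms p in auto)
  interpret neumann_field \<Omega> "wgrad \<Omega> u" "whess \<Omega> u" \<Psi> D\<Psi> T by (rule F)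
  define Lap where "Lap = Lp_norm ?M two_star (wlap \<Omega> u)"
  define Gr where "Gr = Lp_norm ?M 2 (wgrad \<Omega> u)"
  define K where "K = ((2 * \<alpha> - 2) * c + 1) * c_\<Omega>"
  define I where "I s = (\<integral>x. rpow (norm (wgrad \<Omega> u x)) s \<partial>?M)" for s
  have nn: "Lap \<ge> 0" "Gr \<ge> 0" "I s \<ge> 0" for s
    by (auto simp: Lap_def Gr_def Lp_norm_nonneg I_def rpow_nonneg intro!: Bochner_Integration.integral_nonneg)
  have c: "c > 0" using assms by (simp add: calderon_zygmund_constant_def)
  have hess: "Lp_norm ?M two_star (whess \<Omega> u) \<le> c * Lap"
    unfolding Lap_def by (rule calderon_zygmund_hessian_bound[OF _ _ _ F]) (use assms p u12 DL in auto)
  have sob: "Lp_norm ?M two_star v \<le> c_\<Omega> * Gr"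
    using assms u12 unfolding sobolev_constant_def v_def Gr_def by blast
  \<comment> \<open>if the gradient vanishes, the sign of \<open>c_\<Omega>\<close> is unknown, but both sides are trivial; otherwise the Sobolev inequality forces \<open>c_\<Omega> \<ge> 0\<close>\<close>
  have goal: "I (2 * \<alpha>) \<le> rpow K (b k) * rpow Lap (b k) * rpow Gr (b k) * rpow (I (a k)) (\<rho> ^ k)"
  proof (cases "Gr = 0")
    case True
    have "(\<integral>x. norm (wgrad \<Omega> u x) powr 2 \<partial>?M) = 0"
      using True Lp_norm_powr[of 2 ?M "wgrad \<Omega> u"] by (simp add: Gr_def)
    moreover have "integrable ?M (\<lambda>x. norm (wgrad \<Omega> u x) powr 2)"
      using G by (simp add: square_integrable_def)
    ultimately have "AE x in ?M. norm (wgrad \<Omega> u x) powr 2 = 0"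
      by (subst (asm) integral_nonneg_eq_0_iff_AE) auto
    then have "AE x in ?M. rpow (norm (wgrad \<Omega> u x)) (2 * \<alpha>) = 0"
      by eventually_elim (use \<open>1 < \<alpha>\<close> in \<open>simp add: rpow_def\<close>)
    then have "I (2 * \<alpha>) = 0" unfolding I_def by (rule integral_eq_zero_AE)
    then show ?thesis by (simp add: rpow_nonneg)
  next
    case False
    then have Gr: "Gr > 0" using nn by simp
    have "0 \<le> c_\<Omega> * Gr" using sob Lp_norm_nonneg[of ?M two_star v] by linarith
    then have c0: "c_\<Omega> \<ge> 0" using Gr by (simp add: zero_le_mult_iff)
    have "(2 * \<alpha> - 2) * c \<ge> 0" using c \<open>1 < \<alpha>\<close> by simp
    then have K0: "K \<ge> 0" unfolding K_def using c0 by (intro mult_nonneg_nonneg) auto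
    define X where "X = K * Lap * Gr"
    have X0: "X \<ge> 0" unfolding X_def using K0 nn by simp
    have wl: "(\<lambda>x. \<Sum>i\<in>UNIV. whess \<Omega> u x $ i $ i) = wlap \<Omega> u" by (rule ext) (simp add: wlap_def whess_def)
    have one_step: "I s \<le> X * I ((s - 2) * r) powr \<rho>"
      if s: "2 \<le> s" "s \<le> 2 * \<alpha>" "s \<le> two_star" "(s - 2) * r \<le> two_star" for s
    proof -
      have "I s \<le> ((s - 2) * Lp_norm ?M two_star (whess \<Omega> u) + Lap) * Lp_norm ?M two_star v * I ((s - 2) * r) powr (1 / r)"
        using gradient_power_bound[OF v1 gv p(1) r(1) p(2) vL GL DL s(1,3,4)] unfolding wl by (simp add: I_def Lap_def)
      also have "\<dots> \<le> (((2 * \<alpha> - 2) * c + 1) * Lap) * (c_\<Omega> * Gr) * I ((s - 2) * r) powr (1 / r)"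
      proof (intro mult_right_mono mult_mono)
        have "(s - 2) * Lp_norm ?M two_star (whess \<Omega> u) \<le> (2 * \<alpha> - 2) * (c * Lap)"
          using s hess Lp_norm_nonneg by (intro mult_mono) auto
        then show "(s - 2) * Lp_norm ?M two_star (whess \<Omega> u) + Lap \<le> ((2 * \<alpha> - 2) * c + 1) * Lap"
          by (simp add: algebra_simps)
        show "Lp_norm ?M two_star v \<le> c_\<Omega> * Gr" by (rule sob)
        show "0 \<le> ((2 * \<alpha> - 2) * c + 1) * Lap" using nn c \<open>1 < \<alpha>\<close> by (intro mult_nonneg_nonneg add_nonneg_nonneg) auto
      qed (auto simp: Lp_norm_nonneg)
      also have "\<dots> = X * I ((s - 2) * r) powr \<rho>" by (simp add: X_def K_def r(2))
      finally show ?thesis .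
    qed
    define e where "e = N / (N - 2) - \<alpha>"
    have e: "e > 0" using assms by (simp add: e_def)
    have a_eq: "a j = two_star - 2 * e * r ^ j" for j by (simp add: a_def two_star_def e_def r_def)
    have a0: "a 0 = 2 * \<alpha>" by (simp add: a_eq e_def two_star_def)
    have a_anti: "a j \<le> a i" if "i \<le> j" for i j
    proof -
      have "r ^ i \<le> r ^ j" using r that by (intro power_increasing) auto
      then show ?thesis using e by (simp add: a_eq)
    qed
    have a_Suc: "(a j - 2) * r = a (Suc j)" for j
    proof -
      have "(two_star - 2) * r = two_star" using N by (simp add: two_star_def r_def field_simps)
      then show ?thesis by (simp add: a_eq algebra_simps)
    qed
    have a_le: "a j \<le> two_star" for j using e r by (simp add: a_eq)
    have b_Suc: "b (Suc j) = b j + \<rho> ^ j" for j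
      using \<rho> by (simp add: b_def \<rho>_def[symmetric] field_simps)
    have b_pos: "b j > 0" if "j > 0" for j
      using \<rho> that by (simp add: b_def \<rho>_def[symmetric] power_less_one_iff)
    have "I (2 * \<alpha>) \<le> rpow X (b j) * I (a j) powr (\<rho> ^ j)" if "j \<le> k" for j
      using that
    proof (induction j)
      case 0
      have "b 0 = 0" by (simp add: b_def)
      then show ?case using nn(3)[of "2 * \<alpha>"] by (simp add: rpow_def a0)
    next
      case (Suc j)
      have "0 \<le> a (Suc j)" using a_anti[OF Suc.prems] assms(17) by simp
      then have "0 \<le> (a j - 2) * r" by (simp add: a_Suc)
      then have aj: "2 \<le> a j" using r by (simp add: zero_le_mult_iff)
      have st: "I (a j) \<le> X * I (a (Suc j)) powr \<rho>"
        using one_step[of "a j"] aj a_anti[of 0 j] a_le[of j] a_le[of "Suc j"] by (simp add: a0 a_Suc)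
      have "I (2 * \<alpha>) \<le> rpow X (b j) * I (a j) powr (\<rho> ^ j)" using Suc by simp
      also have "\<dots> \<le> rpow X (b j) * (X * I (a (Suc j)) powr \<rho>) powr (\<rho> ^ j)"
        using st nn(3) \<rho> by (intro mult_left_mono powr_mono2) (auto simp: rpow_nonneg)
      also have "\<dots> = (rpow X (b j) * X powr (\<rho> ^ j)) * I (a (Suc j)) powr (\<rho> ^ Suc j)"
        using X0 by (simp add: powr_mult powr_powr)
      also have "rpow X (b j) * X powr (\<rho> ^ j) = rpow X (b (Suc j))"
      \<comment> \<open>for \<open>j = 0\<close> the convention \<open>rpow 0 0 = 1\<close> matters, as \<open>X\<close> may vanish\<close>
      proof (cases j)
        case 0
        have "b 0 = 0" "b (Suc 0) = 1" using b_Suc[of 0] by (simp_all add: b_def)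
        then show ?thesis using 0 by (simp add: rpow_def)
      next
        case (Suc i)
        then have "b j > 0" "b (Suc j) > 0" using b_pos by auto
        then have "rpow X (b j) = X powr b j" "rpow X (b (Suc j)) = X powr b (Suc j)" by (simp_all add: rpow_def)
        then show ?thesis by (simp add: b_Suc powr_add)
      qed
      finally show ?case .
    qed
    then have "I (2 * \<alpha>) \<le> rpow X (b k) * I (a k) powr (\<rho> ^ k)" by simp
    moreover have "rpow X (b k) = rpow K (b k) * rpow Lap (b k) * rpow Gr (b k)"
      unfolding X_def using K0 nn by (simp add: rpow_mult)
    moreover have "I (a k) powr (\<rho> ^ k) = rpow (I (a k)) (\<rho> ^ k)" using \<rho> by (simp add: rpow_def)
    ultimately show ?thesis by simp
  qed
  then show ?thesis by (simp add: I_def K_def Lap_def Gr_def \<rho>_def)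
qed

end
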